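(* Let $q$ be a prime power, let $V$ be an $n$-dimensional vector space over the finite field $\mathbb{F}_q$, and let $1 \leq k \leq n-1$. Let $\mathcal{D}^k(V)=\tilde{H}_{n-k-1}(X_V;\wedge^k \mathfrak{g})$. Then $$\dim_{\mathbb{F}_q} \mathcal{D}^k(V)=\sum_{1 \leq \alpha_1<\cdots <\alpha_{n-k} \leq n-1}\ \prod_{j=1}^{n-k}(q^{\alpha_j}-1).$$
   Context: Local systems. Let $X$ be a finite simplicial complex (containing the empty simplex $\emptyset$, of dimension $-1$) with a fixed linear order on its vertices; $X(p)$ is the set of $p$-dimensional simplices. For $\sigma=[s_1,\ldots,s_{p+1}]\in X(p)$ written in increasing order, $\sigma_i$ denotes the face obtained by deleting $s_i$. A local system $\mathcal{F}$ on $X$ assigns an abelian group $\mathcal{F}(\sigma)$ to each simplex $\sigma\in X$ (including $\emptyset$), together with homomorphisms $\rho_\sigma^\tau:\mathcal{F}(\tau)\to\mathcal{F}(\sigma)$ for $\sigma\subset\tau$, with $\rho_\sigma^\sigma=\mathrm{id}$ and $\rho_\eta^\sigma\rho_\sigma^\tau=\rho_\eta^\tau$ for $\eta\subset\sigma\subset\tau$. The group $C_p(X;\mathcal{F})$ consists of formal sums $\sum_{\sigma\in X(p)}c(\sigma)\sigma$ with $c(\sigma)\in\mathcal{F}(\sigma)$ (so $C_{-1}(X;\mathcal{F})=\mathcal{F}(\emptyset)$), and $\partial_p\big(\sum_\sigma c(\sigma)\sigma\big)=\sum_{\sigma\in X(p)}\sum_{i=1}^{p+1}(-1)^{i+1}\rho_{\sigma_i}^\sigma(c(\sigma))\,\sigma_i$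 for $p\ge 0$. The reduced homology $\tilde{H}_*(X;\mathcal{F})$ is the homology of $\bigoplus_{p\ge -1}C_p(X;\mathcal{F})$. The complex $X_V$. Its vertices are the linear subspaces $0\ne U\subsetneq V$, and its $p$-simplices are the flags $\{U_0\subsetneq\cdots\subsetneq U_p\}$ of such subspaces. The vertices are linearly ordered so that $U$ precedes $U'$ whenever $\dim U<\dim U'$. The local system $\wedge^k\mathfrak{g}$ on $X_V$ is given by $(\wedge^k\mathfrak{g})([U_0\subsetneq\cdots\subsetneq U_p])=\wedge^k U_0$ and $(\wedge^k\mathfrak{g})(\emptyset)=\wedge^k V$, with connecting maps induced by the inclusions of subspaces. Its chain groups and homology groups are $\mathbb{F}_q$-vector spaces. *)

theory Defs
  imports
    "Jordan_Normal_Form.Missing_VectorSpace"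
    "HOL-Algebra.AbelCoset"
    "HOL-Number_Theory.Prime_Powers"
begin

text \<open>Scalars and vector spaces are records with carriers. The fields
  \<open>mult\<close> and \<open>one\<close> of a module record play no role and are left unspecified.\<close>

subsection \<open>Quotient modules\<close>

definition quotient_module ::
    "('k, 'm, 'z) module_scheme \<Rightarrow> 'm set \<Rightarrow> ('k, 'm set) module" where
  "quotient_module M N =
     \<lparr>carrier = a_rcosets\<^bsub>M\<^esub> N, monoid.mult = undefined, one = undefined,
      zero = N, add = (\<lambda>A B. A <+>\<^bsub>M\<^esub> B),
      smult = (\<lambda>a A. \<Union>x\<in>A. N +>\<^bsub>M\<^esub> (a \<odot>\<^bsub>M\<^esub> x))\<rparr>"

subsection \<open>Exterior powers\<close>

definition free_module :: "('k, 'z) ring_scheme \<Rightarrow> 'b set \<Rightarrow> ('k, 'b \<Rightarrow> 'k) module" where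
  "free_module K S =
     \<lparr>carrier = {c. range c \<subseteq> carrier K \<and> finite {x. c x \<noteq> \<zero>\<^bsub>K\<^esub>} \<and> {x. c x \<noteq> \<zero>\<^bsub>K\<^esub>} \<subseteq> S},
      monoid.mult = undefined, one = undefined,
      zero = (\<lambda>_. \<zero>\<^bsub>K\<^esub>), add = (\<lambda>c d x. c x \<oplus>\<^bsub>K\<^esub> d x),
      smult = (\<lambda>a c x. a \<otimes>\<^bsub>K\<^esub> c x)\<rparr>"

definition free_gen :: "('k, 'z) ring_scheme \<Rightarrow> 'b \<Rightarrow> 'b \<Rightarrow> 'k" where
  "free_gen K x = (\<lambda>y. if y = x then \<one>\<^bsub>K\<^esub> else \<zero>\<^bsub>K\<^esub>)"

definition tuples :: "nat \<Rightarrow> 'm set \<Rightarrow> 'm list set" where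
  "tuples k U = {xs. length xs = k \<and> set xs \<subseteq> U}"

text \<open>\<open>\<and>\<^sup>k M\<close> is presented by the generators \<open>x\<^sub>1 \<and> \<dots> \<and> x\<^sub>k\<close> for all \<open>k\<close>-tuples
  of elements of \<open>M\<close>, subject to additivity and homogeneity in each argument and to the vanishing of
  tuples with a repeated entry (not merely antisymmetry, which would be too weak in characteristic 2).\<close>

definition wedge_relators ::
    "('k, 'z) ring_scheme \<Rightarrow> nat \<Rightarrow> ('k, 'm, 'y) module_scheme \<Rightarrow> ('m list \<Rightarrow> 'k) set" where
  "wedge_relators K k M = (let T = tuples k (carrier M); L = free_module K T in
     {free_gen K (xs[i := x \<oplus>\<^bsub>M\<^esub> y]) \<ominus>\<^bsub>L\<^esub>
        (free_gen K (xs[i := x]) \<oplus>\<^bsub>L\<^esub> free_gen K (xs[i := y])) | xs i x y.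
        xs \<in> T \<and> i < k \<and> x \<in> carrier M \<and> y \<in> carrier M} \<union>
     {free_gen K (xs[i := a \<odot>\<^bsub>M\<^esub> x]) \<ominus>\<^bsub>L\<^esub> a \<odot>\<^bsub>L\<^esub> free_gen K (xs[i := x]) | xs i a x.
        xs \<in> T \<and> i < k \<and> a \<in> carrier K \<and> x \<in> carrier M} \<union>
     {free_gen K xs | xs. xs \<in> T \<and> (\<exists>i j. i < j \<and> j < k \<and> xs ! i = xs ! j)})"

definition wedge_kernel ::
    "('k, 'z) ring_scheme \<Rightarrow> nat \<Rightarrow> ('k, 'm, 'y) module_scheme \<Rightarrow> ('m list \<Rightarrow> 'k) set" where
  "wedge_kernel K k M =
     LinearCombinations.module.span K (free_module K (tuples k (carrier M))) (wedge_relators K k M)"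

definition exterior_power ::
    "('k, 'z) ring_scheme \<Rightarrow> nat \<Rightarrow> ('k, 'm, 'y) module_scheme \<Rightarrow> ('k, ('m list \<Rightarrow> 'k) set) module"
    where
  "exterior_power K k M =
     quotient_module (free_module K (tuples k (carrier M))) (wedge_kernel K k M)"

text \<open>The map \<open>\<and>\<^sup>k M \<rightarrow> \<and>\<^sup>k N\<close> induced by the inclusion of a submodule \<open>M\<close> of
  \<open>N\<close>. Elements of a free module vanish outside the generating set, so the free module on the
  tuples of \<open>M\<close> is literally contained in the one on the tuples of \<open>N\<close>, and the class of
  \<open>c\<close> is sent to the class of the same \<open>c\<close>.\<close>

definition exterior_inclusion ::
    "('k, 'z) ring_scheme \<Rightarrow> nat \<Rightarrow> ('k, 'm, 'y) module_scheme \<Rightarrow>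
     ('m list \<Rightarrow> 'k) set \<Rightarrow> ('m list \<Rightarrow> 'k) set" where
  "exterior_inclusion K k N A =
     (\<Union>c\<in>A. wedge_kernel K k N +>\<^bsub>free_module K (tuples k (carrier N))\<^esub> c)"

subsection \<open>Simplicial homology with coefficients in a local system\<close>

text \<open>A simplicial complex is given by its set of simplices, including the empty one.\<close>

locale simplicial_complex =
  fixes X :: "'a set set"
  assumes finite_complex: "finite X"
    and finite_simplex: "\<sigma> \<in> X \<Longrightarrow> finite \<sigma>"
    and empty_simplex: "{} \<in> X"
    and face_closed: "\<sigma> \<in> X \<Longrightarrow> \<tau> \<subseteq> \<sigma> \<Longrightarrow> \<tau> \<in> X"

text \<open>Local systems of modules over a commutative ring \<open>K\<close>. The map
  \<open>\<rho> \<sigma> \<tau>\<close>, for \<open>\<sigma> \<subseteq> \<tau>\<close>, goes from \<open>F \<tau>\<close> to \<open>F \<sigma>\<close>.\<close>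

locale local_system = simplicial_complex X
  for X :: "'a set set" +
  fixes K :: "('k, 'z) ring_scheme"
    and F :: "'a set \<Rightarrow> ('k, 'm) module"
    and \<rho> :: "'a set \<Rightarrow> 'a set \<Rightarrow> 'm \<Rightarrow> 'm"
  assumes module_coeff: "\<sigma> \<in> X \<Longrightarrow> Module.module K (F \<sigma>)"
    and hom_coeff: "\<tau> \<in> X \<Longrightarrow> \<sigma> \<subseteq> \<tau> \<Longrightarrow> \<rho> \<sigma> \<tau> \<in> LinearCombinations.module_hom K (F \<tau>) (F \<sigma>)"
    and id_coeff: "\<sigma> \<in> X \<Longrightarrow> x \<in> carrier (F \<sigma>) \<Longrightarrow> \<rho> \<sigma> \<sigma> x = x"
    and comp_coeff: "\<tau> \<in> X \<Longrightarrow> \<eta> \<subseteq> \<sigma> \<Longrightarrow> \<sigma> \<subseteq> \<tau> \<Longrightarrow> x \<in> carrier (F \<tau>) \<Longrightarrow>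
      \<rho> \<eta> \<sigma> (\<rho> \<sigma> \<tau> x) = \<rho> \<eta> \<tau> x"

definition simplices :: "'a set set \<Rightarrow> int \<Rightarrow> 'a set set" where
  "simplices X p = {\<sigma> \<in> X. int (card \<sigma>) = p + 1}"

text \<open>A chain \<open>\<Sum>\<^sub>\<sigma> c(\<sigma>) \<sigma>\<close> is encoded by its coefficient function \<open>c\<close>.\<close>

definition chain_module :: "'a set set \<Rightarrow> ('a set \<Rightarrow> ('k, 'm) module) \<Rightarrow> int \<Rightarrow> ('k, 'a set \<Rightarrow> 'm) module"
    where
  "chain_module X F p =
     \<lparr>carrier = (\<Pi>\<^sub>E \<sigma>\<in>simplices X p. carrier (F \<sigma>)), monoid.mult = undefined, one = undefined,
      zero = (\<lambda>\<sigma>\<in>simplices X p. \<zero>\<^bsub>F \<sigma>\<^esub>),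
      add = (\<lambda>c d. \<lambda>\<sigma>\<in>simplices X p. c \<sigma> \<oplus>\<^bsub>F \<sigma>\<^esub> d \<sigma>),
      smult = (\<lambda>a c. \<lambda>\<sigma>\<in>simplices X p. a \<odot>\<^bsub>F \<sigma>\<^esub> c \<sigma>)\<rparr>"

text \<open>For a reflexive linear order \<open>r\<close>, this is the index \<open>i\<close> (counted from 1) with \<open>s = s\<^sub>i\<close>
  when \<open>\<sigma> = [s\<^sub>1, \<dots>, s\<^sub>p\<^sub>+\<^sub>1]\<close> is listed in increasing order.\<close>

definition vertex_index :: "'a rel \<Rightarrow> 'a set \<Rightarrow> 'a \<Rightarrow> nat" where
  "vertex_index r \<sigma> s = card {t \<in> \<sigma>. (t, s) \<in> r}"

text \<open>The coefficient of \<open>\<partial>\<^sub>p c\<close> at \<open>\<tau>\<close> collects the terms of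
  \<open>\<Sum>\<^sub>\<sigma> \<Sum>\<^sub>i (-1)\<^sup>i\<^sup>+\<^sup>1 \<rho>(c(\<sigma>)) \<sigma>\<^sub>i\<close> with \<open>\<sigma>\<^sub>i = \<tau>\<close>. For
  \<open>p = -1\<close> this is the zero map into \<open>C\<^sub>-\<^sub>2 = 0\<close>.\<close>

definition boundary ::
    "'a rel \<Rightarrow> 'a set set \<Rightarrow> ('a set \<Rightarrow> ('k, 'm) module) \<Rightarrow> ('a set \<Rightarrow> 'a set \<Rightarrow> 'm \<Rightarrow> 'm) \<Rightarrow> int \<Rightarrow>
     ('a set \<Rightarrow> 'm) \<Rightarrow> 'a set \<Rightarrow> 'm" where
  "boundary r X F \<rho> p c =
     (\<lambda>\<tau>\<in>simplices X (p - 1).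
        finsum (F \<tau>)
          (\<lambda>(\<sigma>, s). add_pow (F \<tau>) ((-1 :: int) ^ (vertex_index r \<sigma> s + 1)) (\<rho> \<tau> \<sigma> (c \<sigma>)))
          {(\<sigma>, s). \<sigma> \<in> simplices X p \<and> s \<in> \<sigma> \<and> \<sigma> - {s} = \<tau>})"

definition cycles ::
    "'a rel \<Rightarrow> 'a set set \<Rightarrow> ('a set \<Rightarrow> ('k, 'm) module) \<Rightarrow> ('a set \<Rightarrow> 'a set \<Rightarrow> 'm \<Rightarrow> 'm) \<Rightarrow> int \<Rightarrow>
     ('a set \<Rightarrow> 'm) set" where
  "cycles r X F \<rho> p =
     {c \<in> carrier (chain_module X F p). boundary r X F \<rho> p c = \<zero>\<^bsub>chain_module X F (p - 1)\<^esub>}"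

definition boundaries ::
    "'a rel \<Rightarrow> 'a set set \<Rightarrow> ('a set \<Rightarrow> ('k, 'm) module) \<Rightarrow> ('a set \<Rightarrow> 'a set \<Rightarrow> 'm \<Rightarrow> 'm) \<Rightarrow> int \<Rightarrow>
     ('a set \<Rightarrow> 'm) set" where
  "boundaries r X F \<rho> p = boundary r X F \<rho> (p + 1) ` carrier (chain_module X F (p + 1))"

definition reduced_homology ::
    "'a rel \<Rightarrow> 'a set set \<Rightarrow> ('a set \<Rightarrow> ('k, 'm) module) \<Rightarrow> ('a set \<Rightarrow> 'a set \<Rightarrow> 'm \<Rightarrow> 'm) \<Rightarrow> int \<Rightarrow>
     ('k, ('a set \<Rightarrow> 'm) set) module" where
  "reduced_homology r X F \<rho> p =
     quotient_module ((chain_module X F p)\<lparr>carrier := cycles r X F \<rho> p\<rparr>) (boundaries r X F \<rho> p)"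

subsection \<open>The complex of flags and the local system of exterior powers\<close>

definition proper_subspaces :: "('k, 'z) ring_scheme \<Rightarrow> ('k, 'v, 'y) module_scheme \<Rightarrow> 'v set set" where
  "proper_subspaces K V = {U. VectorSpace.subspace K U V \<and> U \<noteq> {\<zero>\<^bsub>V\<^esub>} \<and> U \<noteq> carrier V}"

definition flag_complex :: "('k, 'z) ring_scheme \<Rightarrow> ('k, 'v, 'y) module_scheme \<Rightarrow> 'v set set set" where
  "flag_complex K V = {\<sigma>. finite \<sigma> \<and> \<sigma> \<subseteq> proper_subspaces K V \<and> chain\<^sub>\<subseteq> \<sigma>}"

definition dimension_order ::
    "('k, 'z) ring_scheme \<Rightarrow> ('k, 'v, 'y) module_scheme \<Rightarrow> 'v set rel \<Rightarrow> bool" where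
  "dimension_order K V r \<longleftrightarrow>
     linear_order_on (proper_subspaces K V) r \<and>
     (\<forall>U\<in>proper_subspaces K V. \<forall>U'\<in>proper_subspaces K V.
        vectorspace.dim K (V\<lparr>carrier := U\<rparr>) < vectorspace.dim K (V\<lparr>carrier := U'\<rparr>) \<longrightarrow> (U, U') \<in> r)"

text \<open>The intersection of a nonempty flag \<open>U\<^sub>0 \<subset> \<dots> \<subset> U\<^sub>p\<close> is \<open>U\<^sub>0\<close>.\<close>

definition flag_bottom :: "('k, 'v, 'y) module_scheme \<Rightarrow> 'v set set \<Rightarrow> 'v set" where
  "flag_bottom V \<sigma> = (if \<sigma> = {} then carrier V else \<Inter>\<sigma>)"

definition wedge_system ::
    "('k, 'z) ring_scheme \<Rightarrow> ('k, 'v, 'y) module_scheme \<Rightarrow> nat \<Rightarrow> 'v set set \<Rightarrow>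
     ('k, ('v list \<Rightarrow> 'k) set) module" where
  "wedge_system K V k \<sigma> = exterior_power K k (V\<lparr>carrier := flag_bottom V \<sigma>\<rparr>)"

definition wedge_map ::
    "('k, 'z) ring_scheme \<Rightarrow> ('k, 'v, 'y) module_scheme \<Rightarrow> nat \<Rightarrow> 'v set set \<Rightarrow> 'v set set \<Rightarrow>
     ('v list \<Rightarrow> 'k) set \<Rightarrow> ('v list \<Rightarrow> 'k) set" where
  "wedge_map K V k \<sigma> \<tau> = exterior_inclusion K k (V\<lparr>carrier := flag_bottom V \<sigma>\<rparr>)"

definition D_space ::
    "('k, 'z) ring_scheme \<Rightarrow> ('k, 'v, 'y) module_scheme \<Rightarrow> 'v set rel \<Rightarrow> nat \<Rightarrow>
     ('k, ('v set set \<Rightarrow> ('v list \<Rightarrow> 'k) set) set) module" where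
  "D_space K V r k =
     reduced_homology r (flag_complex K V) (wedge_system K V k) (wedge_map K V k)
       (int (vectorspace.dim K V) - int k - 1)"

subsection \<open>Exterior powers over the flag complex form a local system\<close>

lemma submodule_abelian_subgroup:
  assumes "submodule R N M" shows "abelian_subgroup N M"
proof -
  interpret submodule R N M by fact
  interpret Module.module R M by (rule module)
  have inv: "\<ominus>\<^bsub>M\<^esub> x \<in> N" if "x \<in> N" for x
  proof -
    have "\<ominus>\<^bsub>M\<^esub> x = (\<ominus>\<^bsub>R\<^esub> \<one>\<^bsub>R\<^esub>) \<odot>\<^bsub>M\<^esub> x"
      using that subset by (simp add: smult_l_minus subset_iff)
    then show ?thesis using that by simp
  qed
  have "subgroup N (add_monoid M)"
    by unfold_locales (use subset inv in \<open>auto simp: a_inv_def[symmetric]\<close>)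
  then show ?thesis
    by (intro abelian_subgroupI3 additive_subgroup.intro abelian_group_axioms)
qed

lemma quotient_smult:
  assumes "submodule R N M" "a \<in> carrier R" "x \<in> carrier M"
  shows "a \<odot>\<^bsub>quotient_module M N\<^esub> (N +>\<^bsub>M\<^esub> x) = N +>\<^bsub>M\<^esub> (a \<odot>\<^bsub>M\<^esub> x)"
proof -
  interpret submodule R N M by fact
  interpret Module.module R M by (rule module)
  interpret abelian_subgroup N M by (rule submodule_abelian_subgroup) fact
  have "N +>\<^bsub>M\<^esub> (a \<odot>\<^bsub>M\<^esub> y) = N +>\<^bsub>M\<^esub> (a \<odot>\<^bsub>M\<^esub> x)" if y: "y \<in> N +>\<^bsub>M\<^esub> x" for y
  proof -
    obtain h where h: "h \<in> N" "y = h \<oplus>\<^bsub>M\<^esub> x" using y by (auto simp: a_r_coset_def')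
    have "a \<odot>\<^bsub>M\<^esub> y = a \<odot>\<^bsub>M\<^esub> h \<oplus>\<^bsub>M\<^esub> a \<odot>\<^bsub>M\<^esub> x"
      using h assms subset by (auto simp: smult_r_distr)
    then have "a \<odot>\<^bsub>M\<^esub> y \<in> N +>\<^bsub>M\<^esub> (a \<odot>\<^bsub>M\<^esub> x)"
      using h assms by (auto simp: a_r_coset_def')
    moreover have "a \<odot>\<^bsub>M\<^esub> x \<in> carrier M" using assms by simp
    ultimately show ?thesis by (rule a_repr_independence'[symmetric])
  qed
  moreover have "x \<in> N +>\<^bsub>M\<^esub> x" using assms by (simp add: a_rcos_self)
  ultimately have "(\<Union>y\<in>N +>\<^bsub>M\<^esub> x. N +>\<^bsub>M\<^esub> (a \<odot>\<^bsub>M\<^esub> y)) = N +>\<^bsub>M\<^esub> (a \<odot>\<^bsub>M\<^esub> x)" by blast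
  then show ?thesis by (simp add: quotient_module_def)
qed

lemma quotient_add:
  assumes "submodule R N M" "x \<in> carrier M" "y \<in> carrier M"
  shows "(N +>\<^bsub>M\<^esub> x) \<oplus>\<^bsub>quotient_module M N\<^esub> (N +>\<^bsub>M\<^esub> y) = N +>\<^bsub>M\<^esub> (x \<oplus>\<^bsub>M\<^esub> y)"
proof -
  interpret abelian_subgroup N M by (rule submodule_abelian_subgroup) fact
  show ?thesis using assms by (simp add: quotient_module_def a_rcos_sum)
qed

lemma quotient_carrier: "carrier (quotient_module M N) = (\<lambda>x. N +>\<^bsub>M\<^esub> x) ` carrier M"
  by (auto simp: quotient_module_def A_RCOSETS_def')

lemma quotient_module_module:
  assumes "submodule R N M" shows "Module.module R (quotient_module M N)"
proof -
  interpret submodule R N M by fact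
  interpret Module.module R M by (rule module)
  interpret abelian_subgroup N M by (rule submodule_abelian_subgroup) fact
  have zero: "\<zero>\<^bsub>quotient_module M N\<^esub> = N +>\<^bsub>M\<^esub> \<zero>\<^bsub>M\<^esub>"
    using subset by (auto simp: quotient_module_def a_r_coset_def')
  note simps = quotient_carrier zero quotient_smult[OF assms] quotient_add[OF assms]
  show ?thesis
  proof (intro moduleI abelian_groupI R.is_cring)
    fix A assume "A \<in> carrier (quotient_module M N)"
    then obtain x where x: "x \<in> carrier M" "A = N +>\<^bsub>M\<^esub> x" by (auto simp: quotient_carrier)
    then show "\<exists>B\<in>carrier (quotient_module M N). B \<oplus>\<^bsub>quotient_module M N\<^esub> A = \<zero>\<^bsub>quotient_module M N\<^esub>"
      by (intro bexI[of _ "N +>\<^bsub>M\<^esub> (\<ominus>\<^bsub>M\<^esub> x)"]) (auto simp: simps M.l_neg)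
    fix B assume "B \<in> carrier (quotient_module M N)"
    then obtain y where y: "y \<in> carrier M" "B = N +>\<^bsub>M\<^esub> y" by (auto simp: quotient_carrier)
    show "A \<oplus>\<^bsub>quotient_module M N\<^esub> B = B \<oplus>\<^bsub>quotient_module M N\<^esub> A"
      using x y by (simp add: simps M.a_comm)
  qed (auto simp: simps smult_l_distr smult_r_distr smult_assoc1 M.a_assoc)
qed

lemma free_module_module:
  fixes K :: "('k, 'z) ring_scheme" and S :: "'b set"
  assumes "cring K" shows "Module.module K (free_module K S)"
proof -
  interpret cring K by fact
  let ?L = "free_module K S"
  have val: "c x \<in> carrier K" if "c \<in> carrier ?L" for c x
    using that by (auto simp: free_module_def)
  have add: "c \<oplus>\<^bsub>?L\<^esub> d = (\<lambda>x. c x \<oplus>\<^bsub>K\<^esub> d x)" and smult: "a \<odot>\<^bsub>?L\<^esub> c = (\<lambda>x. a \<otimes>\<^bsub>K\<^esub> c x)"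
    and zero: "\<zero>\<^bsub>?L\<^esub> = (\<lambda>_. \<zero>\<^bsub>K\<^esub>)" for a c d
    by (simp_all add: free_module_def)
  have memI: "c \<in> carrier ?L"
    if "\<And>x. c x \<in> carrier K" "{x. c x \<noteq> \<zero>\<^bsub>K\<^esub>} \<subseteq> {x. d x \<noteq> \<zero>\<^bsub>K\<^esub>} \<union> {x. e x \<noteq> \<zero>\<^bsub>K\<^esub>}"
      "d \<in> carrier ?L" "e \<in> carrier ?L" for c d e
  proof -
    have "finite ({x. d x \<noteq> \<zero>\<^bsub>K\<^esub>} \<union> {x. e x \<noteq> \<zero>\<^bsub>K\<^esub>})"
      and sub: "{x. d x \<noteq> \<zero>\<^bsub>K\<^esub>} \<union> {x. e x \<noteq> \<zero>\<^bsub>K\<^esub>} \<subseteq> S"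
      using that(3,4) by (auto simp: free_module_def)
    then have "finite {x. c x \<noteq> \<zero>\<^bsub>K\<^esub>}" using that(2) by (rule_tac finite_subset)
    moreover have "{x. c x \<noteq> \<zero>\<^bsub>K\<^esub>} \<subseteq> S" using that(2) sub by (rule order_trans)
    ultimately show ?thesis using that(1) by (simp add: free_module_def image_subset_iff)
  qed
  show ?thesis
  proof (intro moduleI abelian_groupI assms)
    show "c \<oplus>\<^bsub>?L\<^esub> d \<in> carrier ?L" if "c \<in> carrier ?L" "d \<in> carrier ?L" for c d
      by (rule memI[OF _ _ that]) (auto simp: add val that)
    show "a \<odot>\<^bsub>?L\<^esub> c \<in> carrier ?L" if "a \<in> carrier K" "c \<in> carrier ?L" for a c
      by (rule memI[OF _ _ that(2,2)]) (auto simp: smult val that)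
    show "\<exists>d\<in>carrier ?L. d \<oplus>\<^bsub>?L\<^esub> c = \<zero>\<^bsub>?L\<^esub>" if c: "c \<in> carrier ?L" for c
    proof
      show "(\<lambda>x. \<ominus>\<^bsub>K\<^esub> c x) \<in> carrier ?L"
        by (rule memI[OF _ _ c c]) (auto simp: val[OF c])
      show "(\<lambda>x. \<ominus>\<^bsub>K\<^esub> c x) \<oplus>\<^bsub>?L\<^esub> c = \<zero>\<^bsub>?L\<^esub>"
        by (simp add: add zero l_neg val[OF c])
    qed
    show "\<zero>\<^bsub>?L\<^esub> \<in> carrier ?L" by (simp add: free_module_def image_subset_iff)
    show "c \<oplus>\<^bsub>?L\<^esub> d = d \<oplus>\<^bsub>?L\<^esub> c" if "c \<in> carrier ?L" "d \<in> carrier ?L" for c d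
      unfolding add by (intro ext a_comm val that)
  qed (simp_all add: add smult zero val a_assoc m_assoc l_distr r_distr)
qed

lemma free_gen_carrier: "cring K \<Longrightarrow> x \<in> S \<Longrightarrow> free_gen K x \<in> carrier (free_module K S)"
  by (auto simp: free_module_def free_gen_def cring.cring_simprules)

lemma wedge_relators_carrier:
  assumes "Module.module K M"
  shows "wedge_relators K k M \<subseteq> carrier (free_module K (tuples k (carrier M)))"
proof -
  interpret Module.module K M by fact
  interpret L: Module.module K "free_module K (tuples k (carrier M))"
    by (rule free_module_module[OF R.is_cring])
  have [simp]: "xs[i := x] \<in> tuples k (carrier M)" if "xs \<in> tuples k (carrier M)" "x \<in> carrier M" for xs i x
    using that set_update_subset_insert[of xs i x] by (auto simp: tuples_def)
  show ?thesis
    by (auto simp: wedge_relators_def Let_def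
        intro!: L.minus_closed L.a_closed L.smult_closed free_gen_carrier[OF R.is_cring])
qed

lemma wedge_kernel_submodule:
  assumes "Module.module K M"
  shows "submodule K (wedge_kernel K k M) (free_module K (tuples k (carrier M)))"
proof -
  interpret Module.module K M by fact
  interpret L: Module.module K "free_module K (tuples k (carrier M))"
    by (rule free_module_module[OF R.is_cring])
  show ?thesis unfolding wedge_kernel_def
    by (rule L.span_is_submodule[OF wedge_relators_carrier[OF assms]])
qed

lemma exterior_power_module:
  "Module.module K M \<Longrightarrow> Module.module K (exterior_power K k M)"
  unfolding exterior_power_def by (rule quotient_module_module[OF wedge_kernel_submodule])


lemma free_module_uminus:
  assumes "cring K" "c \<in> carrier (free_module K S)"
  shows "\<ominus>\<^bsub>free_module K S\<^esub> c = (\<lambda>x. \<ominus>\<^bsub>K\<^esub> c x)"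
proof -
  interpret cring K by fact
  interpret L: Module.module K "free_module K S" by (rule free_module_module) fact
  have c: "c x \<in> carrier K" for x using assms by (auto simp: free_module_def)
  have "{x. \<ominus>\<^bsub>K\<^esub> c x \<noteq> \<zero>\<^bsub>K\<^esub>} = {x. c x \<noteq> \<zero>\<^bsub>K\<^esub>}"
    using c by (metis minus_minus minus_zero)
  then have "(\<lambda>x. \<ominus>\<^bsub>K\<^esub> c x) \<in> carrier (free_module K S)"
    using assms(2) c by (simp add: free_module_def image_subset_iff)
  moreover have "(\<lambda>x. \<ominus>\<^bsub>K\<^esub> c x) \<oplus>\<^bsub>free_module K S\<^esub> c = \<zero>\<^bsub>free_module K S\<^esub>"
    using c by (auto simp: free_module_def l_neg)
  ultimately show ?thesis using assms(2) L.minus_equality by blast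
qed

lemma free_module_mono: "S \<subseteq> T \<Longrightarrow> carrier (free_module K S) \<subseteq> carrier (free_module K T)"
  by (auto simp: free_module_def)

lemma free_module_minus:
  assumes "cring K" "d \<in> carrier (free_module K S)"
  shows "c \<ominus>\<^bsub>free_module K S\<^esub> d = (\<lambda>x. c x \<ominus>\<^bsub>K\<^esub> d x)"
  by (simp add: a_minus_def free_module_uminus[OF assms]) (simp add: free_module_def)

lemma wedge_relators_mono:
  assumes "Module.module K (V\<lparr>carrier := U\<rparr>)" "Module.module K (V\<lparr>carrier := W\<rparr>)" "U \<subseteq> W"
  shows "wedge_relators K k (V\<lparr>carrier := U\<rparr>) \<subseteq> wedge_relators K k (V\<lparr>carrier := W\<rparr>)"
proof -
  interpret U: Module.module K "V\<lparr>carrier := U\<rparr>" by fact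
  interpret W: Module.module K "V\<lparr>carrier := W\<rparr>" by fact
  have cr: "cring K" by (rule U.R.is_cring)
  interpret LU: Module.module K "free_module K (tuples k U)" by (rule free_module_module[OF cr])
  interpret LW: Module.module K "free_module K (tuples k W)" by (rule free_module_module[OF cr])
  have TUW: "tuples k U \<subseteq> tuples k W" using assms(3) by (auto simp: tuples_def)
  have tup: "xs[i := x] \<in> tuples k Z" if "xs \<in> tuples k Z" "x \<in> Z" for xs i x and Z :: "'c set"
    using that set_update_subset_insert[of xs i x] by (auto simp: tuples_def)
  have fg: "free_gen K xs \<in> carrier (free_module K (tuples k Z))" if "xs \<in> tuples k Z" for xs and Z :: "'c set"
    by (rule free_gen_carrier[OF cr that])
  have mono: "c \<in> carrier (free_module K (tuples k W))" if "c \<in> carrier (free_module K (tuples k U))" for c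
    using that free_module_mono[OF TUW] by blast
  have addeq: "c \<oplus>\<^bsub>free_module K (tuples k U)\<^esub> d = c \<oplus>\<^bsub>free_module K (tuples k W)\<^esub> d"
    and smulteq: "a \<odot>\<^bsub>free_module K (tuples k U)\<^esub> d = a \<odot>\<^bsub>free_module K (tuples k W)\<^esub> d" for a c d
    by (simp_all add: free_module_def)
  have mineq: "c \<ominus>\<^bsub>free_module K (tuples k U)\<^esub> d = c \<ominus>\<^bsub>free_module K (tuples k W)\<^esub> d"
    if "d \<in> carrier (free_module K (tuples k U))" for c d
    by (simp add: free_module_minus[OF cr that] free_module_minus[OF cr mono[OF that]])
  show ?thesis (is "?A \<subseteq> ?B")
  proof
    fix g assume "g \<in> ?A"
    then consider
      (add) xs i x y where "xs \<in> tuples k U" "i < k" "x \<in> U" "y \<in> U"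
        "g = free_gen K (xs[i := x \<oplus>\<^bsub>V\<^esub> y]) \<ominus>\<^bsub>free_module K (tuples k U)\<^esub>
           (free_gen K (xs[i := x]) \<oplus>\<^bsub>free_module K (tuples k U)\<^esub> free_gen K (xs[i := y]))"
    | (smult) xs i a x where "xs \<in> tuples k U" "i < k" "a \<in> carrier K" "x \<in> U"
        "g = free_gen K (xs[i := a \<odot>\<^bsub>V\<^esub> x]) \<ominus>\<^bsub>free_module K (tuples k U)\<^esub>
           a \<odot>\<^bsub>free_module K (tuples k U)\<^esub> free_gen K (xs[i := x])"
    | (alt) xs i j where "xs \<in> tuples k U" "i < j" "j < k" "xs ! i = xs ! j" "g = free_gen K xs"
      by (auto simp: wedge_relators_def Let_def)
    then show "g \<in> ?B"
    proof cases
      case add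
      have "free_gen K (xs[i := x]) \<oplus>\<^bsub>free_module K (tuples k U)\<^esub> free_gen K (xs[i := y])
          \<in> carrier (free_module K (tuples k U))"
        using add by (intro LU.M.a_closed fg tup)
      then have "g = free_gen K (xs[i := x \<oplus>\<^bsub>V\<^esub> y]) \<ominus>\<^bsub>free_module K (tuples k W)\<^esub>
           (free_gen K (xs[i := x]) \<oplus>\<^bsub>free_module K (tuples k W)\<^esub> free_gen K (xs[i := y]))"
        using add(5) by (simp add: mineq addeq)
      moreover have "xs \<in> tuples k W" "x \<in> W" "y \<in> W" using add TUW assms(3) by auto
      ultimately show ?thesis using add(2) unfolding wedge_relators_def Let_def
        by (intro UnI1) (simp, blast)
    next
      case smult
      have "a \<odot>\<^bsub>free_module K (tuples k U)\<^esub> free_gen K (xs[i := x])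
          \<in> carrier (free_module K (tuples k U))"
        using smult by (intro LU.smult_closed fg tup)
      then have "g = free_gen K (xs[i := a \<odot>\<^bsub>V\<^esub> x]) \<ominus>\<^bsub>free_module K (tuples k W)\<^esub>
           a \<odot>\<^bsub>free_module K (tuples k W)\<^esub> free_gen K (xs[i := x])"
        using smult(5) by (simp add: mineq smulteq)
      moreover have "xs \<in> tuples k W" "x \<in> W" using smult TUW assms(3) by auto
      ultimately show ?thesis using smult(2,3) unfolding wedge_relators_def Let_def
        by (rule_tac UnI1, rule_tac UnI2) (simp, blast)
    next
      case alt
      then show ?thesis using TUW unfolding wedge_relators_def Let_def
        by (intro UnI2) (simp, blast)
    qed
  qed
qed

lemma wedge_kernel_mono:
  assumes "Module.module K (V\<lparr>carrier := U\<rparr>)" "Module.module K (V\<lparr>carrier := W\<rparr>)" "U \<subseteq> W"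
  shows "wedge_kernel K k (V\<lparr>carrier := U\<rparr>) \<subseteq> wedge_kernel K k (V\<lparr>carrier := W\<rparr>)"
proof -
  interpret U: Module.module K "V\<lparr>carrier := U\<rparr>" by fact
  have cr: "cring K" by (rule U.R.is_cring)
  interpret LU: Module.module K "free_module K (tuples k U)" by (rule free_module_module[OF cr])
  interpret LW: Module.module K "free_module K (tuples k W)" by (rule free_module_module[OF cr])
  interpret S: submodule K "wedge_kernel K k (V\<lparr>carrier := W\<rparr>)" "free_module K (tuples k W)"
    using wedge_kernel_submodule[OF assms(2)] by simp
  let ?N = "wedge_kernel K k (V\<lparr>carrier := W\<rparr>) \<inter> carrier (free_module K (tuples k U))"
  have addeq: "c \<oplus>\<^bsub>free_module K (tuples k U)\<^esub> d = c \<oplus>\<^bsub>free_module K (tuples k W)\<^esub> d"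
    and smulteq: "a \<odot>\<^bsub>free_module K (tuples k U)\<^esub> d = a \<odot>\<^bsub>free_module K (tuples k W)\<^esub> d"
    and zeroeq: "\<zero>\<^bsub>free_module K (tuples k U)\<^esub> = \<zero>\<^bsub>free_module K (tuples k W)\<^esub>" for a c d
    by (simp_all add: free_module_def)
  have sub: "submodule K ?N (free_module K (tuples k U))"
  proof
    show "\<zero>\<^bsub>free_module K (tuples k U)\<^esub> \<in> ?N" using S.zero_closed zeroeq LU.M.zero_closed by simp
    show "v \<oplus>\<^bsub>free_module K (tuples k U)\<^esub> w \<in> ?N" if "v \<in> ?N" "w \<in> ?N" for v w
      using that S.m_closed LU.M.a_closed by (simp add: addeq)
    show "c \<odot>\<^bsub>free_module K (tuples k U)\<^esub> v \<in> ?N" if "c \<in> carrier K" "v \<in> ?N" for c v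
      using that S.smult_closed LU.smult_closed by (simp add: smulteq)
  qed auto
  have "wedge_relators K k (V\<lparr>carrier := W\<rparr>) \<subseteq> wedge_kernel K k (V\<lparr>carrier := W\<rparr>)"
    unfolding wedge_kernel_def using LW.in_own_span[OF wedge_relators_carrier[OF assms(2), simplified]] by simp
  then have "wedge_relators K k (V\<lparr>carrier := U\<rparr>) \<subseteq> ?N"
    using wedge_relators_mono[OF assms, of k] wedge_relators_carrier[OF assms(1), of k] by auto
  then have "LU.span (wedge_relators K k (V\<lparr>carrier := U\<rparr>)) \<subseteq> ?N"
    by (rule LU.span_is_subset[OF _ sub])
  then show ?thesis by (simp add: wedge_kernel_def)
qed


lemma exterior_inclusion_class:
  assumes "Module.module K (V\<lparr>carrier := U\<rparr>)" "Module.module K (V\<lparr>carrier := W\<rparr>)" "U \<subseteq> W"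
    and c: "c \<in> carrier (free_module K (tuples k U))"
  shows "exterior_inclusion K k (V\<lparr>carrier := W\<rparr>)
      (wedge_kernel K k (V\<lparr>carrier := U\<rparr>) +>\<^bsub>free_module K (tuples k U)\<^esub> c) =
    wedge_kernel K k (V\<lparr>carrier := W\<rparr>) +>\<^bsub>free_module K (tuples k W)\<^esub> c"
proof -
  interpret U: Module.module K "V\<lparr>carrier := U\<rparr>" by fact
  have "tuples k U \<subseteq> tuples k W" using assms(3) by (auto simp: tuples_def)
  then have cW: "c \<in> carrier (free_module K (tuples k W))" using c free_module_mono by blast
  interpret NU: abelian_subgroup "wedge_kernel K k (V\<lparr>carrier := U\<rparr>)" "free_module K (tuples k U)"
    using submodule_abelian_subgroup[OF wedge_kernel_submodule[OF assms(1)]] by simp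
  interpret NW: abelian_subgroup "wedge_kernel K k (V\<lparr>carrier := W\<rparr>)" "free_module K (tuples k W)"
    using submodule_abelian_subgroup[OF wedge_kernel_submodule[OF assms(2)]] by simp
  have "wedge_kernel K k (V\<lparr>carrier := W\<rparr>) +>\<^bsub>free_module K (tuples k W)\<^esub> d =
      wedge_kernel K k (V\<lparr>carrier := W\<rparr>) +>\<^bsub>free_module K (tuples k W)\<^esub> c"
    if d: "d \<in> wedge_kernel K k (V\<lparr>carrier := U\<rparr>) +>\<^bsub>free_module K (tuples k U)\<^esub> c" for d
  proof -
    obtain h where h: "h \<in> wedge_kernel K k (V\<lparr>carrier := U\<rparr>)"
      "d = h \<oplus>\<^bsub>free_module K (tuples k U)\<^esub> c"
      using d by (auto simp: a_r_coset_def')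
    have "h \<in> wedge_kernel K k (V\<lparr>carrier := W\<rparr>)"
      using h(1) wedge_kernel_mono[OF assms(1-3)] by (rule rev_subsetD)
    moreover have "d = h \<oplus>\<^bsub>free_module K (tuples k W)\<^esub> c"
      using h(2) by (simp add: free_module_def)
    ultimately have "d \<in> wedge_kernel K k (V\<lparr>carrier := W\<rparr>) +>\<^bsub>free_module K (tuples k W)\<^esub> c"
      by (auto simp: a_r_coset_def')
    then show ?thesis using cW by (rule NW.a_repr_independence'[symmetric])
  qed
  moreover have "c \<in> wedge_kernel K k (V\<lparr>carrier := U\<rparr>) +>\<^bsub>free_module K (tuples k U)\<^esub> c"
    using c by (rule NU.a_rcos_self)
  ultimately have "(\<Union>d\<in>wedge_kernel K k (V\<lparr>carrier := U\<rparr>) +>\<^bsub>free_module K (tuples k U)\<^esub> c.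
      wedge_kernel K k (V\<lparr>carrier := W\<rparr>) +>\<^bsub>free_module K (tuples k W)\<^esub> d) =
    wedge_kernel K k (V\<lparr>carrier := W\<rparr>) +>\<^bsub>free_module K (tuples k W)\<^esub> c" by blast
  then show ?thesis by (simp add: exterior_inclusion_def)
qed

lemma exterior_inclusion_hom:
  assumes "Module.module K (V\<lparr>carrier := U\<rparr>)" "Module.module K (V\<lparr>carrier := W\<rparr>)" "U \<subseteq> W"
  shows "exterior_inclusion K k (V\<lparr>carrier := W\<rparr>) \<in> LinearCombinations.module_hom K
    (exterior_power K k (V\<lparr>carrier := U\<rparr>)) (exterior_power K k (V\<lparr>carrier := W\<rparr>))"
proof -
  interpret U: Module.module K "V\<lparr>carrier := U\<rparr>" by fact
  interpret LU: Module.module K "free_module K (tuples k U)"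
    by (rule free_module_module[OF U.R.is_cring])
  have TUW: "tuples k U \<subseteq> tuples k W" using assms(3) by (auto simp: tuples_def)
  note mono = subsetD[OF free_module_mono[OF TUW]]
  note subU = wedge_kernel_submodule[OF assms(1), of k, simplified]
  note subW = wedge_kernel_submodule[OF assms(2), of k, simplified]
  have eq: "c \<oplus>\<^bsub>free_module K (tuples k W)\<^esub> d = c \<oplus>\<^bsub>free_module K (tuples k U)\<^esub> d"
    "a \<odot>\<^bsub>free_module K (tuples k W)\<^esub> d = a \<odot>\<^bsub>free_module K (tuples k U)\<^esub> d" for a c d
    by (simp_all add: free_module_def)
  show ?thesis
    by (auto simp: LinearCombinations.module_hom_def exterior_power_def quotient_carrier mono
        quotient_add[OF subU] quotient_smult[OF subU] quotient_add[OF subW] quotient_smult[OF subW]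
        exterior_inclusion_class[OF assms] eq)
qed

lemma finite_vectorspace:
  assumes "vectorspace K V" "finite (carrier K)" "vectorspace.fin_dim K V"
  shows "finite (carrier V)"
proof -
  interpret vectorspace K V by fact
  obtain A where A: "finite A" "A \<subseteq> carrier V" "gen_set A" using assms(3) unfolding fin_dim_def by blast
  have "carrier V \<subseteq> (\<lambda>a. lincomb a A) ` (A \<rightarrow>\<^sub>E carrier K)"
  proof
    fix v assume "v \<in> carrier V"
    then obtain a where a: "a \<in> A \<rightarrow> carrier K" "v = lincomb a A"
      using A finite_span[of A] by blast
    have "lincomb (restrict a A) A = lincomb a A"
      unfolding lincomb_def using a A by (intro M.finsum_cong') auto
    then show "v \<in> (\<lambda>a. lincomb a A) ` (A \<rightarrow>\<^sub>E carrier K)"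
      using a by (intro image_eqI[of _ _ "restrict a A"]) auto
  qed
  then show ?thesis
    using A assms(2) by (meson finite_PiE finite_imageI finite_subset)
qed

lemma flag_complex_simplicial:
  assumes "vectorspace K V" "finite (carrier K)" "vectorspace.fin_dim K V"
  shows "simplicial_complex (flag_complex K V)"
proof
  have "proper_subspaces K V \<subseteq> Pow (carrier V)"
    by (auto simp: proper_subspaces_def VectorSpace.subspace_def submodule_def)
  then have "flag_complex K V \<subseteq> Pow (Pow (carrier V))"
    by (auto simp: flag_complex_def)
  then show "finite (flag_complex K V)"
    using finite_vectorspace[OF assms] by (meson finite_Pow_iff finite_subset)
qed (unfold flag_complex_def chain_subset_def mem_Collect_eq; blast intro: finite_subset)+

lemma flag_bottom_submodule:
  assumes "vectorspace K V" "\<sigma> \<in> flag_complex K V"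
  shows "submodule K (flag_bottom V \<sigma>) V"
proof -
  interpret vectorspace K V by fact
  show ?thesis
  proof (cases "\<sigma> = {}")
    case True
    then show ?thesis by (simp add: flag_bottom_def) (unfold_locales; auto)
  next
    case False
    have sub: "submodule K U V" if "U \<in> \<sigma>" for U
      using assms(2) that by (auto simp: flag_complex_def proper_subspaces_def VectorSpace.subspace_def)
    have "\<Inter>\<sigma> \<subseteq> carrier V" using False submodule.subset[OF sub] by blast
    moreover have "submodule K (\<Inter>\<sigma>) V"
      by (rule submodule.intro)
        (use calculation in \<open>auto simp: submodule.m_closed[OF sub] submodule.smult_closed[OF sub] submodule.zero_closed[OF sub] module_axioms\<close>)
    ultimately show ?thesis using False by (simp add: flag_bottom_def)
  qed
qed

lemma flag_bottom_antimono:
  assumes "vectorspace K V" "\<tau> \<in> flag_complex K V" "\<sigma> \<subseteq> \<tau>"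
  shows "flag_bottom V \<tau> \<subseteq> flag_bottom V \<sigma>"
  using submodule.subset[OF flag_bottom_submodule[OF assms(1,2)]] assms(3)
  by (auto simp: flag_bottom_def split: if_splits)

lemma wedge_local_system:
  assumes "vectorspace K V" "finite (carrier K)" "vectorspace.fin_dim K V"
  shows "local_system (flag_complex K V) K (wedge_system K V k) (wedge_map K V k)"
proof -
  interpret vectorspace K V by fact
  interpret simplicial_complex "flag_complex K V" by (rule flag_complex_simplicial) fact+
  have mod: "Module.module K (V\<lparr>carrier := flag_bottom V \<sigma>\<rparr>)" if "\<sigma> \<in> flag_complex K V" for \<sigma>
    by (rule submodule_is_module[OF flag_bottom_submodule[OF assms(1) that]])
  note anti = flag_bottom_antimono[OF assms(1)]
  have tup: "tuples k (flag_bottom V \<tau>) \<subseteq> tuples k (flag_bottom V \<sigma>)"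
    if "\<tau> \<in> flag_complex K V" "\<sigma> \<subseteq> \<tau>" for \<sigma> \<tau>
    using anti[OF that] by (auto simp: tuples_def)
  show ?thesis
  proof (intro local_system.intro local_system_axioms.intro simplicial_complex_axioms)
    fix \<sigma> assume s: "\<sigma> \<in> flag_complex K V"
    show "Module.module K (wedge_system K V k \<sigma>)"
      unfolding wedge_system_def by (rule exterior_power_module[OF mod[OF s]])
    show "wedge_map K V k \<sigma> \<sigma> x = x" if "x \<in> carrier (wedge_system K V k \<sigma>)" for x
      using that exterior_inclusion_class[OF mod[OF s] mod[OF s] order_refl]
      by (auto simp: wedge_system_def wedge_map_def exterior_power_def quotient_carrier)
  next
    fix \<tau> \<sigma> assume t: "\<tau> \<in> flag_complex K V" and st: "\<sigma> \<subseteq> \<tau>"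
    have s: "\<sigma> \<in> flag_complex K V" by (rule face_closed[OF t st])
    show "wedge_map K V k \<sigma> \<tau> \<in> LinearCombinations.module_hom K (wedge_system K V k \<tau>) (wedge_system K V k \<sigma>)"
      unfolding wedge_map_def wedge_system_def
      by (rule exterior_inclusion_hom[OF mod[OF t] mod[OF s] anti[OF t st]])
    fix \<eta> x assume es: "\<eta> \<subseteq> \<sigma>" and x: "x \<in> carrier (wedge_system K V k \<tau>)"
    have e: "\<eta> \<in> flag_complex K V" by (rule face_closed[OF s es])
    have et: "\<eta> \<subseteq> \<tau>" using es st by blast
    show "wedge_map K V k \<eta> \<sigma> (wedge_map K V k \<sigma> \<tau> x) = wedge_map K V k \<eta> \<tau> x"
      using x
      by (auto simp: wedge_system_def wedge_map_def exterior_power_def quotient_carrier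
          exterior_inclusion_class[OF mod[OF t] mod[OF s] anti[OF t st]]
          exterior_inclusion_class[OF mod[OF s] mod[OF e] anti[OF s es]]
          exterior_inclusion_class[OF mod[OF t] mod[OF e] anti[OF t et]]
          subsetD[OF free_module_mono[OF tup[OF t st]]])
  qed
qed

end

theory Submission
  imports Defs
begin

text \<open>
  Fix coordinates $V = K^{n+1}$, the line $L$ spanned by the first basis vector and the hyperplane $H$ of
  vectors with first coordinate $0$; let $\pi$ be the projection $V \to V/L = K^n$. Writing a form as
  $\omega_0 + e_1 \wedge \omega_1$ splits the chains on flags of $V$ into three pieces:
  for each of the $q^n - 1$ complements $U \neq H$ of $L$, the parts $\omega_0$ on the flags with top $U$,
  a copy of the degree $k$ chains on $K^n$; the parts $\omega_1$ on the flags all of whose members contain $L$,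
  a copy of the degree $k-1$ chains on $K^n$; and the parts $\omega_0$ on the flags that avoid all complements
  of $L$ except $H$. The last piece is acyclic: an acyclic matching on these flags adds or removes
  $x + L$, $y \cap H$ or $H$, and this does not change $\pi$ of the smallest member of the flag.
  By induction on $n$ there are subsets $M_j$ of the chain groups on which $\partial$ is injective and whose
  sizes account for all of $C_j$ except a factor $q^{f(n,k)}$ in the degree under consideration, where
  $f(n+1,k) = f(n,k-1) + (q^n-1) f(n,k)$. Together with $\partial\partial = 0$ the sizes
  force all the ranks, so the homology has dimension $f(n,k)$. This recursion is also that of
  the elementary symmetric polynomials in $q - 1, \ldots, q^{n-1} - 1$.
\<close>

section \<open>The exterior algebra of $K^n$\<close>

text \<open>Dimensions are read off from cardinalities: a surjection between finite sets whose
  source is not larger than its target is injective, and this takes the place of most arguments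
  about linear independence. For exterior powers, the presentation yields the upper bound and the
  coordinate model the lower one.

  The three pieces are not a direct sum of complexes, since the boundary mixes them. It is
  triangular, however: a complement of $L$ is a maximal proper subspace, so the boundary at a flag
  with top $U$ involves only flags with top $U$; at a flag containing $L$, the additional cofaces do
  not contain $L$ and are settled before. Injectivity of the boundary on a set of chains survives
  such a triangular shape, which is why it is the property carried through the induction.

  One of the $q^n$ complements has to be withheld from the first piece, because the matching needs a
  fixed $H$ to intersect with; this is the origin of $q^n - 1$.\<close>

locale finite_field = field K for K :: "('k, 'z) ring_scheme" (structure) +
  assumes finite_scalars: "finite (carrier K)"
begin

text \<open>Vectors are functions on all of \<open>nat\<close>, zero from \<open>n\<close> on. Every
  $K^n$ then lives in one type, \<open>vtl\<close> passes between them, and equality is equality of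
  functions.\<close>

definition vecs :: "nat \<Rightarrow> (nat \<Rightarrow> 'k) set" where
  "vecs n = {v. range v \<subseteq> carrier K \<and> (\<forall>i\<ge>n. v i = \<zero>)}"

definition vtl :: "(nat \<Rightarrow> 'k) \<Rightarrow> nat \<Rightarrow> 'k" where
  "vtl v = (\<lambda>i. v (Suc i))"

text \<open>
  The exterior algebra of $K^n$ is modelled by functions on boolean lists of length $n$ (indicator lists of
  the subsets of the basis): \<open>part False\<close> and \<open>part True\<close> extract $\omega_0$ and $\omega_1$ from
  $\omega = \omega_0 + e_1 \wedge \omega_1$. Then \<open>wed\<close> is left multiplication by a vector, via
  $(a e_1 + v) \wedge (\omega_0 + e_1 \wedge \omega_1) = v \wedge \omega_0 + e_1 \wedge (a \omega_0 - v \wedge \omega_1)$.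
\<close>

definition part :: "bool \<Rightarrow> (bool list \<Rightarrow> 'k) \<Rightarrow> bool list \<Rightarrow> 'k" where
  "part b \<omega> = (\<lambda>l. \<omega> (b # l))"

definition glue :: "(bool list \<Rightarrow> 'k) \<Rightarrow> (bool list \<Rightarrow> 'k) \<Rightarrow> bool list \<Rightarrow> 'k" where
  "glue \<alpha> \<beta> = (\<lambda>l. case l of [] \<Rightarrow> \<zero> | b # l' \<Rightarrow> if b then \<beta> l' else \<alpha> l')"

definition ext_alg :: "nat \<Rightarrow> (bool list \<Rightarrow> 'k) set" where
  "ext_alg n = {\<omega>. range \<omega> \<subseteq> carrier K \<and> (\<forall>l. length l \<noteq> n \<longrightarrow> \<omega> l = \<zero>)}"

primrec wed :: "nat \<Rightarrow> (nat \<Rightarrow> 'k) \<Rightarrow> (bool list \<Rightarrow> 'k) \<Rightarrow> bool list \<Rightarrow> 'k" where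
  "wed 0 v \<omega> = (\<lambda>_. \<zero>)"
| "wed (Suc n) v \<omega> = glue (wed n (vtl v) (part False \<omega>))
     (\<lambda>l. v 0 \<otimes> part False \<omega> l \<ominus> wed n (vtl v) (part True \<omega>) l)"

definition ext_one :: "nat \<Rightarrow> bool list \<Rightarrow> 'k" where
  "ext_one n = (\<lambda>l. if l = replicate n False then \<one> else \<zero>)"

definition wedge :: "nat \<Rightarrow> (nat \<Rightarrow> 'k) list \<Rightarrow> bool list \<Rightarrow> 'k" where
  "wedge n xs = foldr (wed n) xs (ext_one n)"

text \<open>
  The degree is an integer so that degree $k - 1$ needs no case distinction; in negative degrees only $0$ remains.
\<close>

inductive_set ext_power :: "nat \<Rightarrow> int \<Rightarrow> (nat \<Rightarrow> 'k) set \<Rightarrow> (bool list \<Rightarrow> 'k) set"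
  for n k U where
  zero: "(\<lambda>_. \<zero>) \<in> ext_power n k U"
| step: "\<lbrakk>a \<in> carrier K; int (length xs) = k; set xs \<subseteq> U; \<omega> \<in> ext_power n k U\<rbrakk> \<Longrightarrow>
    (\<lambda>l. a \<otimes> wedge n xs l \<oplus> \<omega> l) \<in> ext_power n k U"

lemma part_glue [simp]: "part False (glue \<alpha> \<beta>) = \<alpha>" "part True (glue \<alpha> \<beta>) = \<beta>"
  by (auto simp: part_def glue_def)

lemma glue_part: "\<omega> \<in> ext_alg (Suc n) \<Longrightarrow> glue (part False \<omega>) (part True \<omega>) = \<omega>"
  by (rule ext) (auto simp: part_def glue_def ext_alg_def split: list.splits)

lemma ext_part: "\<omega> \<in> ext_alg (Suc n) \<Longrightarrow> part b \<omega> \<in> ext_alg n"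
  by (auto simp: part_def ext_alg_def)

lemma ext_glue: "\<alpha> \<in> ext_alg n \<Longrightarrow> \<beta> \<in> ext_alg n \<Longrightarrow> glue \<alpha> \<beta> \<in> ext_alg (Suc n)"
  by (auto simp: glue_def ext_alg_def image_subset_iff split: list.splits)

lemma ext_eqI:
  assumes "\<omega> \<in> ext_alg (Suc n)" "\<omega>' \<in> ext_alg (Suc n)" "part False \<omega> = part False \<omega>'" "part True \<omega> = part True \<omega>'"
  shows "\<omega> = \<omega>'"
  using glue_part[OF assms(1)] glue_part[OF assms(2)] assms(3,4) by metis

lemma ext_val [simp]: "\<omega> \<in> ext_alg n \<Longrightarrow> \<omega> l \<in> carrier K"
  by (auto simp: ext_alg_def)

lemma vecs_val [simp]: "v \<in> vecs n \<Longrightarrow> v i \<in> carrier K"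
  by (auto simp: vecs_def)

lemma vtl_vecs: "v \<in> vecs (Suc n) \<Longrightarrow> vtl v \<in> vecs n"
  by (auto simp: vtl_def vecs_def)

lemma vecs_cons: "a \<in> carrier K \<Longrightarrow> v \<in> vecs n \<Longrightarrow> case_nat a v \<in> vecs (Suc n)"
proof -
  assume a: "a \<in> carrier K" "v \<in> vecs n"
  have "case_nat a v i \<in> carrier K" for i using a by (cases i) auto
  moreover have "case_nat a v i = \<zero>" if "Suc n \<le> i" for i
    using a that by (cases i) (auto simp: vecs_def)
  ultimately show ?thesis by (auto simp: vecs_def)
qed

lemma vtl_cons [simp]: "vtl (case_nat a v) = v"
  by (simp add: vtl_def)

lemma cons_vtl: "case_nat (v 0) (vtl v) = v"
  by (rule ext) (simp add: vtl_def split: nat.splits)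

lemma zero_ext [simp]: "(\<lambda>_. \<zero>) \<in> ext_alg n"
  by (auto simp: ext_alg_def)

lemma add_ext: "\<alpha> \<in> ext_alg n \<Longrightarrow> \<beta> \<in> ext_alg n \<Longrightarrow> (\<lambda>l. \<alpha> l \<oplus> \<beta> l) \<in> ext_alg n"
  by (auto simp: ext_alg_def)

lemma smult_ext: "a \<in> carrier K \<Longrightarrow> \<beta> \<in> ext_alg n \<Longrightarrow> (\<lambda>l. a \<otimes> \<beta> l) \<in> ext_alg n"
  by (auto simp: ext_alg_def)

lemma minus_ext: "\<alpha> \<in> ext_alg n \<Longrightarrow> \<beta> \<in> ext_alg n \<Longrightarrow> (\<lambda>l. \<alpha> l \<ominus> \<beta> l) \<in> ext_alg n"
  by (auto simp: ext_alg_def a_minus_def)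

lemma zero_vecs [simp]: "(\<lambda>_. \<zero>) \<in> vecs n"
  by (auto simp: vecs_def)

lemma add_vecs: "v \<in> vecs n \<Longrightarrow> w \<in> vecs n \<Longrightarrow> (\<lambda>i. v i \<oplus> w i) \<in> vecs n"
  by (auto simp: vecs_def)

lemma smult_vecs: "a \<in> carrier K \<Longrightarrow> v \<in> vecs n \<Longrightarrow> (\<lambda>i. a \<otimes> v i) \<in> vecs n"
  by (auto simp: vecs_def)

lemma part_add: "part b (\<lambda>l. \<alpha> l \<oplus> \<beta> l) = (\<lambda>l. part b \<alpha> l \<oplus> part b \<beta> l)"
  and part_smult: "part b (\<lambda>l. a \<otimes> \<beta> l) = (\<lambda>l. a \<otimes> part b \<beta> l)"
  and part_zero: "part b (\<lambda>l. \<zero>) = (\<lambda>l. \<zero>)"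
  by (simp_all add: part_def)

lemma vtl_add: "vtl (\<lambda>l. v l \<oplus> w l) = (\<lambda>l. vtl v l \<oplus> vtl w l)"
  and vtl_smult: "vtl (\<lambda>l. a \<otimes> v l) = (\<lambda>l. a \<otimes> vtl v l)"
  and vtl_zero: "vtl (\<lambda>l. \<zero>) = (\<lambda>l. \<zero>)"
  by (simp_all add: vtl_def)

lemma wed_ext: "v \<in> vecs n \<Longrightarrow> \<omega> \<in> ext_alg n \<Longrightarrow> wed n v \<omega> \<in> ext_alg n"
proof (induction n arbitrary: v \<omega>)
  case (Suc n)
  then show ?case
    by (simp add: ext_glue minus_ext smult_ext ext_part vtl_vecs)
qed simp

lemma glue_eqI: "\<alpha> = \<alpha>' \<Longrightarrow> \<beta> = \<beta>' \<Longrightarrow> glue \<alpha> \<beta> = glue \<alpha>' \<beta>'"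
  by simp

lemma glue_add: "glue (\<lambda>l. \<alpha> l \<oplus> \<alpha>' l) (\<lambda>l. \<beta> l \<oplus> \<beta>' l) = (\<lambda>l. glue \<alpha> \<beta> l \<oplus> glue \<alpha>' \<beta>' l)"
  by (rule ext) (auto simp: glue_def split: list.splits)

lemma glue_smult: "a \<in> carrier K \<Longrightarrow> glue (\<lambda>l. a \<otimes> \<alpha>' l) (\<lambda>l. a \<otimes> \<beta>' l) = (\<lambda>l. a \<otimes> glue \<alpha>' \<beta>' l)"
  by (rule ext) (auto simp: glue_def split: list.splits)

lemma glue_zero: "glue (\<lambda>_. \<zero>) (\<lambda>_. \<zero>) = (\<lambda>_. \<zero>)"
  by (rule ext) (auto simp: glue_def split: list.splits)

lemma wed_add_right:
  "v \<in> vecs n \<Longrightarrow> \<alpha> \<in> ext_alg n \<Longrightarrow> \<beta> \<in> ext_alg n \<Longrightarrow>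
    wed n v (\<lambda>l. \<alpha> l \<oplus> \<beta> l) = (\<lambda>l. wed n v \<alpha> l \<oplus> wed n v \<beta> l)"
proof (induction n arbitrary: v \<alpha> \<beta>)
  case (Suc n)
  note c = ext_val[OF ext_part[OF Suc.prems(2)]] ext_val[OF ext_part[OF Suc.prems(3)]]
    ext_val[OF wed_ext[OF vtl_vecs[OF Suc.prems(1)] ext_part[OF Suc.prems(2)]]]
    ext_val[OF wed_ext[OF vtl_vecs[OF Suc.prems(1)] ext_part[OF Suc.prems(3)]]]
    vecs_val[OF Suc.prems(1)]
  have "wed (Suc n) v (\<lambda>l. \<alpha> l \<oplus> \<beta> l) =
      glue (\<lambda>l. wed n (vtl v) (part False \<alpha>) l \<oplus> wed n (vtl v) (part False \<beta>) l)
       (\<lambda>l. (v 0 \<otimes> part False \<alpha> l \<ominus> wed n (vtl v) (part True \<alpha>) l) \<oplus>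
            (v 0 \<otimes> part False \<beta> l \<ominus> wed n (vtl v) (part True \<beta>) l))"
    using Suc.prems c
    by (auto simp: part_add Suc.IH ext_part vtl_vecs a_minus_def r_distr minus_add a_ac intro!: glue_eqI)
  then show ?case by (simp add: glue_add)
qed (simp add: fun_eq_iff)

lemma wed_smult_right:
  "v \<in> vecs n \<Longrightarrow> a \<in> carrier K \<Longrightarrow> \<beta> \<in> ext_alg n \<Longrightarrow>
    wed n v (\<lambda>l. a \<otimes> \<beta> l) = (\<lambda>l. a \<otimes> wed n v \<beta> l)"
proof (induction n arbitrary: v \<beta>)
  case (Suc n)
  note c = ext_val[OF ext_part[OF Suc.prems(3)]]
    ext_val[OF wed_ext[OF vtl_vecs[OF Suc.prems(1)] ext_part[OF Suc.prems(3)]]]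
    vecs_val[OF Suc.prems(1)]
  have "wed (Suc n) v (\<lambda>l. a \<otimes> \<beta> l) =
      glue (\<lambda>l. a \<otimes> wed n (vtl v) (part False \<beta>) l)
       (\<lambda>l. a \<otimes> (v 0 \<otimes> part False \<beta> l \<ominus> wed n (vtl v) (part True \<beta>) l))"
    using Suc.prems c
    by (auto simp: part_smult Suc.IH ext_part vtl_vecs a_minus_def r_distr r_minus m_lcomm intro!: glue_eqI)
  then show ?case using Suc.prems by (simp add: glue_smult)
qed (simp add: fun_eq_iff)

lemma wed_add_left:
  "v \<in> vecs n \<Longrightarrow> w \<in> vecs n \<Longrightarrow> \<beta> \<in> ext_alg n \<Longrightarrow>
    wed n (\<lambda>i. v i \<oplus> w i) \<beta> = (\<lambda>l. wed n v \<beta> l \<oplus> wed n w \<beta> l)"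
proof (induction n arbitrary: v w \<beta>)
  case (Suc n)
  note c = ext_val[OF ext_part[OF Suc.prems(3)]]
    ext_val[OF wed_ext[OF vtl_vecs[OF Suc.prems(1)] ext_part[OF Suc.prems(3)]]]
    ext_val[OF wed_ext[OF vtl_vecs[OF Suc.prems(2)] ext_part[OF Suc.prems(3)]]]
    vecs_val[OF Suc.prems(1)] vecs_val[OF Suc.prems(2)]
  have "wed (Suc n) (\<lambda>i. v i \<oplus> w i) \<beta> =
      glue (\<lambda>l. wed n (vtl v) (part False \<beta>) l \<oplus> wed n (vtl w) (part False \<beta>) l)
       (\<lambda>l. (v 0 \<otimes> part False \<beta> l \<ominus> wed n (vtl v) (part True \<beta>) l) \<oplus>
            (w 0 \<otimes> part False \<beta> l \<ominus> wed n (vtl w) (part True \<beta>) l))"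
    using Suc.prems c
    by (auto simp: vtl_add Suc.IH ext_part vtl_vecs a_minus_def l_distr minus_add a_ac intro!: glue_eqI)
  then show ?case by (simp add: glue_add)
qed (simp add: fun_eq_iff)

lemma wed_smult_left:
  "v \<in> vecs n \<Longrightarrow> a \<in> carrier K \<Longrightarrow> \<beta> \<in> ext_alg n \<Longrightarrow>
    wed n (\<lambda>i. a \<otimes> v i) \<beta> = (\<lambda>l. a \<otimes> wed n v \<beta> l)"
proof (induction n arbitrary: v \<beta>)
  case (Suc n)
  note c = ext_val[OF ext_part[OF Suc.prems(3)]]
    ext_val[OF wed_ext[OF vtl_vecs[OF Suc.prems(1)] ext_part[OF Suc.prems(3)]]]
    vecs_val[OF Suc.prems(1)]
  have "wed (Suc n) (\<lambda>i. a \<otimes> v i) \<beta> =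
      glue (\<lambda>l. a \<otimes> wed n (vtl v) (part False \<beta>) l)
       (\<lambda>l. a \<otimes> (v 0 \<otimes> part False \<beta> l \<ominus> wed n (vtl v) (part True \<beta>) l))"
    using Suc.prems c
    by (auto simp: vtl_smult Suc.IH ext_part vtl_vecs a_minus_def r_distr r_minus m_assoc intro!: glue_eqI)
  then show ?case using Suc.prems by (simp add: glue_smult)
qed (simp add: fun_eq_iff)

lemma wed_zero_right: "v \<in> vecs n \<Longrightarrow> wed n v (\<lambda>_. \<zero>) = (\<lambda>_. \<zero>)"
  using wed_smult_right[of v n \<zero> "\<lambda>_. \<zero>"] ext_val[OF wed_ext[of v n "\<lambda>_. \<zero>"]] by simp

lemma wed_zero_left: "\<omega> \<in> ext_alg n \<Longrightarrow> wed n (\<lambda>_. \<zero>) \<omega> = (\<lambda>_. \<zero>)"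
  using wed_smult_left[of "\<lambda>_. \<zero>" n \<zero> \<omega>] ext_val[OF wed_ext[of "\<lambda>_. \<zero>" n \<omega>]] by simp

lemma wed_minus_right:
  assumes "v \<in> vecs n" "\<alpha> \<in> ext_alg n" "\<beta> \<in> ext_alg n"
  shows "wed n v (\<lambda>l. \<alpha> l \<ominus> \<beta> l) = (\<lambda>l. wed n v \<alpha> l \<ominus> wed n v \<beta> l)"
proof -
  have *: "(\<lambda>l. \<alpha> l \<ominus> \<beta> l) = (\<lambda>l. \<alpha> l \<oplus> (\<ominus> \<one>) \<otimes> \<beta> l)"
    using assms by (simp add: a_minus_def l_minus)
  have "wed n v (\<lambda>l. \<alpha> l \<ominus> \<beta> l) = (\<lambda>l. wed n v \<alpha> l \<oplus> (\<ominus> \<one>) \<otimes> wed n v \<beta> l)"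
    unfolding * by (subst wed_add_right[OF assms(1,2) smult_ext[OF _ assms(3)]])
      (use assms in \<open>simp_all only: wed_smult_right a_inv_closed one_closed\<close>)
  then show ?thesis using ext_val[OF wed_ext[OF assms(1,3)]] by (simp add: a_minus_def l_minus)
qed

text \<open>With $v$ split as $a e_1 + v'$, the component along $e_1$ of the double product is $a
  (v' \<and> \<omega>_0) - v' \<and> (a \<omega>_0 - v' \<and> \<omega>_1)$: the terms in $a$ cancel
  because of the sign in \<open>wed\<close>, and the rest is the induction hypothesis.\<close>

lemma wed_same: "v \<in> vecs n \<Longrightarrow> \<omega> \<in> ext_alg n \<Longrightarrow> wed n v (wed n v \<omega>) = (\<lambda>_. \<zero>)"
proof (induction n arbitrary: v \<omega>)
  case (Suc n)
  note v = vtl_vecs[OF Suc.prems(1)] and p = ext_part[OF Suc.prems(2)]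
  have "wed n (vtl v) (\<lambda>l. v 0 \<otimes> part False \<omega> l \<ominus> wed n (vtl v) (part True \<omega>) l) =
      (\<lambda>l. v 0 \<otimes> wed n (vtl v) (part False \<omega>) l \<ominus> \<zero>)"
    using Suc.prems v p
    by (simp only: wed_minus_right[OF v smult_ext[OF vecs_val p] wed_ext[OF v p]] wed_smult_right vecs_val Suc.IH)
  then show ?case
    using Suc.prems v p ext_val[OF wed_ext[OF v p]] by (simp add: Suc.IH a_minus_def r_neg glue_zero)
qed simp

text \<open>Polarisation of \<open>wed_same\<close> at the sum of \<open>v\<close> and
  \<open>w\<close>, where only the mixed products survive.\<close>

lemma wed_anticomm:
  assumes "v \<in> vecs n" "w \<in> vecs n" "\<omega> \<in> ext_alg n"
  shows "wed n v (wed n w \<omega>) = (\<lambda>l. \<ominus> wed n w (wed n v \<omega>) l)"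
proof -
  have c: "wed n x (wed n y \<omega>) l \<in> carrier K" if "x \<in> vecs n" "y \<in> vecs n" for x y l
    using that assms by (intro ext_val[of _ n] wed_ext)
  have "wed n (\<lambda>i. v i \<oplus> w i) (wed n (\<lambda>i. v i \<oplus> w i) \<omega>) = (\<lambda>_. \<zero>)"
    using assms by (simp add: wed_same add_vecs)
  then have "(\<lambda>l. wed n v (wed n w \<omega>) l \<oplus> wed n w (wed n v \<omega>) l) = (\<lambda>_. \<zero>)"
    using assms c by (simp add: wed_add_left wed_add_right wed_ext add_ext wed_same)
  then have "wed n v (wed n w \<omega>) l \<oplus> wed n w (wed n v \<omega>) l = \<zero>" for l
    by (rule fun_cong)
  then show ?thesis using c assms by (intro HOL.ext minus_equality[symmetric]) simp_all
qed

lemma ext_one_ext [simp]: "ext_one n \<in> ext_alg n"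
  by (auto simp: ext_one_def ext_alg_def)

lemma wedge_Nil [simp]: "wedge n [] = ext_one n"
  and wedge_Cons [simp]: "wedge n (x # xs) = wed n x (wedge n xs)"
  by (simp_all add: wedge_def)

lemma wedge_ext: "set xs \<subseteq> vecs n \<Longrightarrow> wedge n xs \<in> ext_alg n"
  by (induction xs) (auto simp: wed_ext)

lemma wed_wedge_mem:
  "set xs \<subseteq> vecs n \<Longrightarrow> x \<in> set xs \<Longrightarrow> wed n x (wedge n xs) = (\<lambda>_. \<zero>)"
proof (induction xs)
  case (Cons y xs)
  show ?case
  proof (cases "y = x")
    case True
    then show ?thesis using Cons.prems by (simp add: wed_same wedge_ext)
  next
    case False
    then have "wed n x (wedge n xs) = (\<lambda>_. \<zero>)" using Cons by auto
    then show ?thesis using Cons.prems wed_anticomm[of x n y "wedge n xs"]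
      by (auto simp: wedge_ext wed_zero_right)
  qed
qed simp

lemma wedge_not_distinct: "set xs \<subseteq> vecs n \<Longrightarrow> \<not> distinct xs \<Longrightarrow> wedge n xs = (\<lambda>_. \<zero>)"
proof (induction xs)
  case (Cons y xs)
  then show ?case by (cases "y \<in> set xs") (auto simp: wed_wedge_mem wed_zero_right)
qed simp

lemma ext_power_ext: "U \<subseteq> vecs n \<Longrightarrow> \<omega> \<in> ext_power n k U \<Longrightarrow> \<omega> \<in> ext_alg n"
  by (rotate_tac, induction rule: ext_power.induct) (auto intro!: add_ext smult_ext wedge_ext)

lemma ext_power_mono: "U \<subseteq> U' \<Longrightarrow> ext_power n k U \<subseteq> ext_power n k U'"
proof
  fix \<omega> assume "\<omega> \<in> ext_power n k U" "U \<subseteq> U'"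
  then show "\<omega> \<in> ext_power n k U'"
    by (induction rule: ext_power.induct) (auto intro!: ext_power.intros)
qed

lemma ext_power_add:
  assumes "U \<subseteq> vecs n" "\<alpha> \<in> ext_power n k U" "\<beta> \<in> ext_power n k U"
  shows "(\<lambda>l. \<alpha> l \<oplus> \<beta> l) \<in> ext_power n k U"
  using assms(2)
proof (induction rule: ext_power.induct)
  case zero
  have "(\<lambda>l. \<zero> \<oplus> \<beta> l) = \<beta>" using ext_power_ext[OF assms(1,3)] by simp
  then show ?case using assms(3) by simp
next
  case (step a xs \<omega>)
  have "(\<lambda>l. a \<otimes> wedge n xs l \<oplus> \<omega> l \<oplus> \<beta> l) = (\<lambda>l. a \<otimes> wedge n xs l \<oplus> (\<omega> l \<oplus> \<beta> l))"
    using step(1) ext_power_ext[OF assms(1) step(4)] ext_power_ext[OF assms(1,3)]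
      wedge_ext[OF subset_trans[OF step(3) assms(1)]]
    by (simp add: a_assoc)
  then show ?case using ext_power.step[OF step(1-3,5)] by simp
qed

lemma ext_power_smult:
  assumes "U \<subseteq> vecs n" "b \<in> carrier K" "\<alpha> \<in> ext_power n k U"
  shows "(\<lambda>l. b \<otimes> \<alpha> l) \<in> ext_power n k U"
  using assms(3)
proof (induction rule: ext_power.induct)
  case zero
  then show ?case using assms(2) by (simp add: ext_power.zero)
next
  case (step a xs \<omega>)
  have "(\<lambda>l. b \<otimes> (a \<otimes> wedge n xs l \<oplus> \<omega> l)) = (\<lambda>l. (b \<otimes> a) \<otimes> wedge n xs l \<oplus> b \<otimes> \<omega> l)"
    using step(1) assms(2) ext_power_ext[OF assms(1) step(4)]
      wedge_ext[OF subset_trans[OF step(3) assms(1)]]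
    by (simp add: m_assoc r_distr)
  then show ?case using ext_power.step[OF _ step(2,3,5)] assms(2) step(1) by simp
qed

lemma ext_power_neg:
  assumes "U \<subseteq> vecs n" "\<alpha> \<in> ext_power n k U"
  shows "(\<lambda>l. \<ominus> \<alpha> l) \<in> ext_power n k U"
  using ext_power_smult[OF assms(1) _ assms(2), of "\<ominus> \<one>"] ext_power_ext[OF assms]
  by (simp add: l_minus)

lemma ext_power_minus:
  assumes "U \<subseteq> vecs n" "\<alpha> \<in> ext_power n k U" "\<beta> \<in> ext_power n k U"
  shows "(\<lambda>l. \<alpha> l \<ominus> \<beta> l) \<in> ext_power n k U"
  using ext_power_add[OF assms(1,2) ext_power_neg[OF assms(1,3)]] by (simp add: a_minus_def)

lemma wedge_ext_power:
  assumes "U \<subseteq> vecs n" "set xs \<subseteq> U" shows "wedge n xs \<in> ext_power n (int (length xs)) U"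
proof -
  have "(\<lambda>l. \<one> \<otimes> wedge n xs l \<oplus> \<zero>) \<in> ext_power n (int (length xs)) U"
    using assms by (intro ext_power.intros) auto
  then show ?thesis using wedge_ext[OF subset_trans[OF assms(2,1)]] by simp
qed

lemma wed_ext_power:
  assumes U: "U \<subseteq> vecs n" and u: "u \<in> U" and "\<omega> \<in> ext_power n k U"
  shows "wed n u \<omega> \<in> ext_power n (k + 1) U"
  using assms(3)
proof (induction rule: ext_power.induct)
  case zero
  then show ?case using U u wed_zero_right[of u n] by (auto simp: ext_power.zero)
next
  case (step a xs \<omega>)
  have xs: "wedge n xs \<in> ext_alg n" using step(3) U by (intro wedge_ext) auto
  have "wed n u (\<lambda>l. a \<otimes> wedge n xs l \<oplus> \<omega> l) = (\<lambda>l. a \<otimes> wedge n (u # xs) l \<oplus> wed n u \<omega> l)"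
    using step(1) U u xs ext_power_ext[OF U step(4)]
    by (subst wed_add_right) (auto simp: wed_smult_right smult_ext)
  then show ?case using ext_power.step[OF step(1) _ _ step(5), of "u # xs"] step u by simp
qed

lemma vecs_0: "vecs 0 = {\<lambda>_. \<zero>}"
  by (auto simp: vecs_def)

lemma vecs_Suc: "vecs (Suc n) = (\<lambda>(a, v). case_nat a v) ` (carrier K \<times> vecs n)"
proof (intro equalityI subsetI)
  fix v assume "v \<in> vecs (Suc n)"
  then show "v \<in> (\<lambda>(a, v). case_nat a v) ` (carrier K \<times> vecs n)"
    using vtl_vecs[of v n] cons_vtl[of v] by (intro image_eqI[of _ _ "(v 0, vtl v)"]) auto
qed (auto intro: vecs_cons)

lemma finite_vecs: "finite (vecs n)"
  by (induction n) (auto simp: vecs_0 vecs_Suc finite_scalars)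

lemma card_vecs: "card (vecs n) = card (carrier K) ^ n"
proof (induction n)
  case (Suc n)
  have "inj_on (\<lambda>(a, v). case_nat a v) (carrier K \<times> vecs n)"
  proof (rule inj_onI, clarify)
    fix a a' :: 'k and v v' assume eq: "case_nat a v = case_nat a' v'"
    show "a = a' \<and> v = v'"
      using fun_cong[OF eq, of 0] arg_cong[OF eq, of vtl] by simp
  qed
  then show ?case by (simp add: vecs_Suc card_image card_cartesian_product Suc.IH)
qed (simp add: vecs_0)

lemma finite_ext: "finite (ext_alg n)"
proof -
  have fin: "finite {l :: bool list. length l = n}"
    using finite_lists_length_eq[of "UNIV :: bool set" n] by simp
  have "inj_on (\<lambda>\<omega>. restrict \<omega> {l. length l = n}) (ext_alg n)"
  proof (rule inj_onI, rule HOL.ext)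
    fix \<omega> \<omega>' l
    assume "\<omega> \<in> ext_alg n" "\<omega>' \<in> ext_alg n"
      and "restrict \<omega> {l. length l = n} = restrict \<omega>' {l. length l = n}"
    then show "\<omega> l = \<omega>' l"
      by (cases "length l = n") (auto simp: ext_alg_def dest: fun_cong[of _ _ l])
  qed
  moreover have "(\<lambda>\<omega>. restrict \<omega> {l. length l = n}) ` ext_alg n \<subseteq> {l. length l = n} \<rightarrow>\<^sub>E carrier K"
    by (intro image_subsetI) (auto simp: PiE_iff)
  ultimately show ?thesis
    using finite_PiE[OF fin finite_scalars] by (meson finite_imageD finite_subset)
qed

lemma finite_ext_power: "U \<subseteq> vecs n \<Longrightarrow> finite (ext_power n k U)"
  by (rule finite_subset[OF _ finite_ext]) (auto dest: ext_power_ext)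

end

section \<open>The size of an exterior power\<close>

lemma free_module_simps:
  "\<zero>\<^bsub>free_module K T\<^esub> = (\<lambda>_. \<zero>\<^bsub>K\<^esub>)"
  "c \<oplus>\<^bsub>free_module K T\<^esub> d = (\<lambda>x. c x \<oplus>\<^bsub>K\<^esub> d x)"
  "a \<odot>\<^bsub>free_module K T\<^esub> c = (\<lambda>x. a \<otimes>\<^bsub>K\<^esub> c x)"
  by (simp_all add: free_module_def)

lemma free_module_val: "c \<in> carrier (free_module K T) \<Longrightarrow> c x \<in> carrier K"
  by (auto simp: free_module_def)

context cring
begin

lemma free_module_closed:
  shows "(\<lambda>_. \<zero>) \<in> carrier (free_module R T)"
    and "c \<in> carrier (free_module R T) \<Longrightarrow> d \<in> carrier (free_module R T) \<Longrightarrow>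
      (\<lambda>x. c x \<oplus> d x) \<in> carrier (free_module R T)"
    and "a \<in> carrier R \<Longrightarrow> c \<in> carrier (free_module R T) \<Longrightarrow>
      (\<lambda>x. a \<otimes> c x) \<in> carrier (free_module R T)"
proof -
  interpret L: Module.module R "free_module R T" by (rule free_module_module[OF is_cring])
  show "(\<lambda>_. \<zero>) \<in> carrier (free_module R T)"
    using L.M.zero_closed by (simp add: free_module_simps)
  show "c \<in> carrier (free_module R T) \<Longrightarrow> d \<in> carrier (free_module R T) \<Longrightarrow>
      (\<lambda>x. c x \<oplus> d x) \<in> carrier (free_module R T)"
    using L.M.a_closed[of c d] by (simp add: free_module_simps)
  show "a \<in> carrier R \<Longrightarrow> c \<in> carrier (free_module R T) \<Longrightarrow>
      (\<lambda>x. a \<otimes> c x) \<in> carrier (free_module R T)"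
    using L.smult_closed[of a c] by (simp add: free_module_simps)
qed

lemma free_module_induct [consumes 1, case_names zero gen smult add]:
  assumes "c \<in> carrier (free_module R T)"
    and "P (\<lambda>_. \<zero>)" and gen: "\<And>x. x \<in> T \<Longrightarrow> P (free_gen R x)"
    and smult: "\<And>a c. a \<in> carrier R \<Longrightarrow> c \<in> carrier (free_module R T) \<Longrightarrow> P c \<Longrightarrow> P (\<lambda>x. a \<otimes> c x)"
    and add: "\<And>c d. c \<in> carrier (free_module R T) \<Longrightarrow> d \<in> carrier (free_module R T) \<Longrightarrow>
      P c \<Longrightarrow> P d \<Longrightarrow> P (\<lambda>x. c x \<oplus> d x)"
  shows "P c"
proof -
  have "P c" if "finite A" "{x. c x \<noteq> \<zero>} \<subseteq> A" "A \<subseteq> T" "range c \<subseteq> carrier R" for A c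
    using that
  proof (induction A arbitrary: c rule: finite_induct)
    case empty
    then have "c = (\<lambda>_. \<zero>)" by auto
    then show ?case using assms(2) by simp
  next
    case (insert y A)
    let ?d = "c(y := \<zero>)"
    have c: "c x \<in> carrier R" for x using insert.prems by auto
    have d: "P ?d" using insert.prems insert.hyps by (intro insert.IH) auto
    have dT: "?d \<in> carrier (free_module R T)"
      using insert.prems insert.hyps by (auto simp: free_module_def intro: finite_subset[of _ "insert y A"])
    have yT: "free_gen R y \<in> carrier (free_module R T)"
      using insert.prems by (intro free_gen_carrier is_cring) auto
    have "P (\<lambda>x. (c y \<otimes> free_gen R y x) \<oplus> ?d x)"
      using insert.prems c by (intro add smult gen free_module_closed yT d dT) auto
    moreover have "(\<lambda>x. (c y \<otimes> free_gen R y x) \<oplus> ?d x) = c"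
      using c by (auto simp: free_gen_def fun_eq_iff)
    ultimately show ?case by simp
  qed
  then show ?thesis using assms(1) by (auto simp: free_module_def)
qed

end

lemma card_free_module:
  assumes "finite T" "cring K" "finite (carrier K)"
  shows "card (carrier (free_module K T)) = card (carrier K) ^ card T"
    and "finite (carrier (free_module K T))"
proof -
  interpret cring K by fact
  let ?L = "carrier (free_module K T)" and ?ext = "\<lambda>f x. if x \<in> T then f x else \<zero>\<^bsub>K\<^esub>"
  have out: "c x = \<zero>\<^bsub>K\<^esub>" if "c \<in> ?L" "x \<notin> T" for c x
    using that by (auto simp: free_module_def)
  have mem: "?ext f \<in> ?L" if f: "f \<in> T \<rightarrow>\<^sub>E carrier K" for f
  proof -
    have "{x. ?ext f x \<noteq> \<zero>\<^bsub>K\<^esub>} \<subseteq> T" by auto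
    moreover from this have "finite {x. ?ext f x \<noteq> \<zero>\<^bsub>K\<^esub>}" using assms(1) by (rule finite_subset)
    moreover have "range (?ext f) \<subseteq> carrier K" using PiE_mem[OF f] by auto
    ultimately show ?thesis by (simp add: free_module_def)
  qed
  have bij: "bij_betw (\<lambda>c. restrict c T) ?L (T \<rightarrow>\<^sub>E carrier K)"
  proof (rule bij_betw_byWitness[where f' = ?ext])
    show "\<forall>c\<in>?L. ?ext (restrict c T) = c" using out by (intro ballI HOL.ext) simp
    show "\<forall>f\<in>T \<rightarrow>\<^sub>E carrier K. restrict (?ext f) T = f"
    proof (intro ballI HOL.ext)
      fix f x assume f: "f \<in> T \<rightarrow>\<^sub>E carrier K"
      show "restrict (?ext f) T x = f x" using PiE_arb[OF f, of x] by (cases "x \<in> T") auto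
    qed
    show "(\<lambda>c. restrict c T) ` ?L \<subseteq> T \<rightarrow>\<^sub>E carrier K"
    proof (rule image_subsetI)
      fix c assume "c \<in> ?L"
      then have "c x \<in> carrier K" for x by (rule free_module_val)
      then show "restrict c T \<in> T \<rightarrow>\<^sub>E carrier K" by simp
    qed
    show "?ext ` (T \<rightarrow>\<^sub>E carrier K) \<subseteq> ?L" using mem by blast
  qed
  show "card ?L = card (carrier K) ^ card T"
    using bij_betw_same_card[OF bij] assms(1) by (simp add: card_PiE)
  show "finite ?L"
    using bij_betw_finite[OF bij] finite_PiE[of T "\<lambda>_. carrier K"] assms by simp
qed

section \<open>Generators of the presented exterior power\<close>

locale exterior_module = Module.module K M
  for K :: "('k, 'z) ring_scheme" (structure) and M :: "('k, 'm, 'y) module_scheme"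
begin

abbreviation tensors :: "nat \<Rightarrow> ('m list \<Rightarrow> 'k) set" where
  "tensors k \<equiv> carrier (free_module K (tuples k (carrier M)))"

abbreviation wker :: "nat \<Rightarrow> ('m list \<Rightarrow> 'k) set" where
  "wker k \<equiv> wedge_kernel K k M"

text \<open>
  \<open>cons x c\<close> represents $x \otimes c$, and \<open>weq\<close> says that two tensors represent the same
  element of the exterior power.
\<close>

definition cons :: "'m \<Rightarrow> ('m list \<Rightarrow> 'k) \<Rightarrow> 'm list \<Rightarrow> 'k" where
  "cons x c = (\<lambda>xs. case xs of [] \<Rightarrow> \<zero> | y # ys \<Rightarrow> if y = x then c ys else \<zero>)"

definition weq :: "nat \<Rightarrow> ('m list \<Rightarrow> 'k) \<Rightarrow> ('m list \<Rightarrow> 'k) \<Rightarrow> bool" where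
  "weq k c d \<longleftrightarrow> c \<in> tensors k \<and> d \<in> tensors k \<and> (\<lambda>xs. c xs \<ominus> d xs) \<in> wker k"

lemma wker_sub: "c \<in> wker k \<Longrightarrow> c \<in> tensors k"
  using submodule.subset[OF wedge_kernel_submodule[OF module_axioms]] by blast

lemma wker_zero: "(\<lambda>_. \<zero>) \<in> wker k"
  and wker_add: "c \<in> wker k \<Longrightarrow> d \<in> wker k \<Longrightarrow> (\<lambda>x. c x \<oplus> d x) \<in> wker k"
  and wker_smult: "a \<in> carrier K \<Longrightarrow> d \<in> wker k \<Longrightarrow> (\<lambda>x. a \<otimes> d x) \<in> wker k"
  using submodule.zero_closed[OF wedge_kernel_submodule[OF module_axioms]]
    submodule.m_closed[OF wedge_kernel_submodule[OF module_axioms]]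
    submodule.smult_closed[OF wedge_kernel_submodule[OF module_axioms]]
  by (simp_all add: free_module_simps)

lemma wker_induct [consumes 1, case_names rel zero smult add]:
  assumes c: "c \<in> wker k" and rel: "\<And>c. c \<in> wedge_relators K k M \<Longrightarrow> P c"
    and zero: "P (\<lambda>_. \<zero>)"
    and smult: "\<And>a c. a \<in> carrier K \<Longrightarrow> c \<in> tensors k \<Longrightarrow> P c \<Longrightarrow> P (\<lambda>x. a \<otimes> c x)"
    and add: "\<And>c d. c \<in> tensors k \<Longrightarrow> d \<in> tensors k \<Longrightarrow> P c \<Longrightarrow> P d \<Longrightarrow> P (\<lambda>x. c x \<oplus> d x)"
  shows "P c"
proof -
  interpret L: Module.module K "free_module K (tuples k (carrier M))"
    by (rule free_module_module[OF R.is_cring])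
  have "submodule K {c \<in> tensors k. P c} (free_module K (tuples k (carrier M)))"
    by (rule submodule.intro)
      (auto simp: free_module_simps R.free_module_closed zero smult add L.module_axioms)
  moreover have "wedge_relators K k M \<subseteq> {c \<in> tensors k. P c}"
    using wedge_relators_carrier[OF module_axioms] rel by auto
  ultimately have "wker k \<subseteq> {c \<in> tensors k. P c}"
    unfolding wedge_kernel_def by (intro L.span_is_subset)
  then show ?thesis using c by auto
qed

lemma rel_mem: "c \<in> wedge_relators K k M \<Longrightarrow> c \<in> wker k"
proof -
  interpret L: Module.module K "free_module K (tuples k (carrier M))"
    by (rule free_module_module[OF R.is_cring])
  show "c \<in> wedge_relators K k M \<Longrightarrow> c \<in> wker k"
    unfolding wedge_kernel_def using L.in_own_span[OF wedge_relators_carrier[OF module_axioms]] by auto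
qed

lemma gen_tensors: "xs \<in> tuples k (carrier M) \<Longrightarrow> free_gen K xs \<in> tensors k"
  by (rule free_gen_carrier[OF R.is_cring])

lemma tuples_update: "xs \<in> tuples k (carrier M) \<Longrightarrow> x \<in> carrier M \<Longrightarrow> xs[i := x] \<in> tuples k (carrier M)"
  using set_update_subset_insert[of xs i x] by (auto simp: tuples_def)

lemma wedge_relators_cases [consumes 1, case_names add smult alt]:
  assumes "c \<in> wedge_relators K k M"
  obtains (add) xs i x y where "xs \<in> tuples k (carrier M)" "i < k" "x \<in> carrier M" "y \<in> carrier M"
      "c = (\<lambda>l. free_gen K (xs[i := x \<oplus>\<^bsub>M\<^esub> y]) l \<ominus> (free_gen K (xs[i := x]) l \<oplus> free_gen K (xs[i := y]) l))"
    | (smult) xs i a x where "xs \<in> tuples k (carrier M)" "i < k" "a \<in> carrier K" "x \<in> carrier M"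
      "c = (\<lambda>l. free_gen K (xs[i := a \<odot>\<^bsub>M\<^esub> x]) l \<ominus> a \<otimes> free_gen K (xs[i := x]) l)"
    | (alt) xs i j where "xs \<in> tuples k (carrier M)" "i < j" "j < k" "xs ! i = xs ! j" "c = free_gen K xs"
  using assms
  by (auto simp: wedge_relators_def Let_def free_module_simps tuples_update gen_tensors R.free_module_closed
      free_module_minus[OF R.is_cring])

lemma relator_add:
  assumes "xs \<in> tuples k (carrier M)" "i < k" "x \<in> carrier M" "y \<in> carrier M"
  shows "(\<lambda>l. free_gen K (xs[i := x \<oplus>\<^bsub>M\<^esub> y]) l \<ominus> (free_gen K (xs[i := x]) l \<oplus> free_gen K (xs[i := y]) l)) \<in> wker k"
proof (rule rel_mem)
  have "free_gen K (xs[i := x \<oplus>\<^bsub>M\<^esub> y]) \<ominus>\<^bsub>free_module K (tuples k (carrier M))\<^esub>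
        (free_gen K (xs[i := x]) \<oplus>\<^bsub>free_module K (tuples k (carrier M))\<^esub> free_gen K (xs[i := y]))
     \<in> wedge_relators K k M"
    unfolding wedge_relators_def Let_def using assms by blast
  then show "(\<lambda>l. free_gen K (xs[i := x \<oplus>\<^bsub>M\<^esub> y]) l \<ominus> (free_gen K (xs[i := x]) l \<oplus> free_gen K (xs[i := y]) l))
     \<in> wedge_relators K k M"
    using assms by (simp add: free_module_simps tuples_update gen_tensors R.free_module_closed
      free_module_minus[OF R.is_cring])
qed

lemma relator_smult:
  assumes "xs \<in> tuples k (carrier M)" "i < k" "a \<in> carrier K" "x \<in> carrier M"
  shows "(\<lambda>l. free_gen K (xs[i := a \<odot>\<^bsub>M\<^esub> x]) l \<ominus> a \<otimes> free_gen K (xs[i := x]) l) \<in> wker k"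
proof (rule rel_mem)
  have "free_gen K (xs[i := a \<odot>\<^bsub>M\<^esub> x]) \<ominus>\<^bsub>free_module K (tuples k (carrier M))\<^esub>
        a \<odot>\<^bsub>free_module K (tuples k (carrier M))\<^esub> free_gen K (xs[i := x])
     \<in> wedge_relators K k M"
    unfolding wedge_relators_def Let_def using assms by blast
  then show "(\<lambda>l. free_gen K (xs[i := a \<odot>\<^bsub>M\<^esub> x]) l \<ominus> a \<otimes> free_gen K (xs[i := x]) l)
     \<in> wedge_relators K k M"
    using assms by (simp add: free_module_simps tuples_update gen_tensors R.free_module_closed
      free_module_minus[OF R.is_cring])
qed

lemma relator_alt:
  assumes "xs \<in> tuples k (carrier M)" "i < j" "j < k" "xs ! i = xs ! j"
  shows "free_gen K xs \<in> wker k"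
  by (rule rel_mem) (use assms in \<open>unfold wedge_relators_def Let_def, blast\<close>)

lemma cons_gen: "cons x (free_gen K xs) = free_gen K (x # xs)"
  by (auto simp: cons_def free_gen_def fun_eq_iff split: list.splits)

lemma cons_zero: "cons x (\<lambda>_. \<zero>) = (\<lambda>_. \<zero>)"
  by (auto simp: cons_def fun_eq_iff split: list.splits)

lemma cons_add: "cons x (\<lambda>l. c l \<oplus> d l) = (\<lambda>l. cons x c l \<oplus> cons x d l)"
  by (auto simp: cons_def fun_eq_iff split: list.splits)

lemma cons_smult: "a \<in> carrier K \<Longrightarrow> cons x (\<lambda>l. a \<otimes> d l) = (\<lambda>l. a \<otimes> cons x d l)"
  by (auto simp: cons_def fun_eq_iff split: list.splits)

lemma cons_minus: "cons x (\<lambda>l. c l \<ominus> d l) = (\<lambda>l. cons x c l \<ominus> cons x d l)"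
  by (auto simp: cons_def fun_eq_iff a_minus_def split: list.splits)

lemma cons_free:
  assumes "c \<in> carrier (free_module K T)" shows "cons x c \<in> carrier (free_module K ((#) x ` T))"
proof -
  have "{l. cons x c l \<noteq> \<zero>} \<subseteq> (#) x ` {l. c l \<noteq> \<zero>}"
  proof
    fix l assume "l \<in> {l. cons x c l \<noteq> \<zero>}"
    then show "l \<in> (#) x ` {l. c l \<noteq> \<zero>}" by (cases l) (auto simp: cons_def split: if_splits)
  qed
  moreover have "range (cons x c) \<subseteq> carrier K"
    using assms by (auto simp: cons_def free_module_val split: list.splits if_splits)
  moreover have "finite {l. c l \<noteq> \<zero>}" "{l. c l \<noteq> \<zero>} \<subseteq> T" using assms by (auto simp: free_module_def)
  ultimately show ?thesis
    unfolding free_module_def by (simp, meson finite_imageI finite_subset image_mono order_trans)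
qed

lemma cons_tensors: "x \<in> carrier M \<Longrightarrow> c \<in> tensors k \<Longrightarrow> cons x c \<in> tensors (Suc k)"
  by (rule subsetD[OF free_module_mono cons_free]) (auto simp: tuples_def)

text \<open>Prefixing \<open>x\<close> turns a relator into the relator of the same kind with its
  positions moved up by one, so $x \<otimes> -$ descends to exterior powers.\<close>

lemma cons_wker:
  assumes x: "x \<in> carrier M" and "c \<in> wker k"
  shows "cons x c \<in> wker (Suc k)"
  using assms(2)
proof (induction rule: wker_induct)
  case (rel c)
  have T: "x # xs \<in> tuples (Suc k) (carrier M)" if "xs \<in> tuples k (carrier M)" for xs
    using that x by (auto simp: tuples_def)
  from rel show ?case
  proof (cases rule: wedge_relators_cases)
    case (add xs i y z)
    then show ?thesis using relator_add[OF T[OF add(1)], of "Suc i" y z]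
      by (simp add: cons_minus cons_add cons_gen)
  next
    case (smult xs i a y)
    then show ?thesis using relator_smult[OF T[OF smult(1)], of "Suc i" a y]
      by (simp add: cons_minus cons_smult cons_gen)
  next
    case (alt xs i j)
    then show ?thesis using relator_alt[OF T[OF alt(1)], of "Suc i" "Suc j"] by (simp add: cons_gen)
  qed
qed (auto simp: cons_zero cons_smult cons_add wker_zero wker_smult wker_add)

lemma weq_refl: "c \<in> tensors k \<Longrightarrow> weq k c c"
  by (simp add: weq_def free_module_val R.minus_eq R.r_neg wker_zero)

lemma weq_trans:
  assumes "weq k c d" "weq k d e" shows "weq k c e"
proof -
  have "(\<lambda>x. (c x \<ominus> d x) \<oplus> (d x \<ominus> e x)) \<in> wker k"
    using assms by (intro wker_add) (auto simp: weq_def)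
  moreover have "(c x \<ominus> d x) \<oplus> (d x \<ominus> e x) = c x \<ominus> e x" for x
  proof -
    have "c x \<in> carrier K" "d x \<in> carrier K" "e x \<in> carrier K"
      using assms by (auto simp: weq_def free_module_val)
    then show ?thesis by algebra
  qed
  ultimately show ?thesis using assms by (simp add: weq_def)
qed

lemma weq_add:
  assumes "weq k c c'" "weq k d d'" shows "weq k (\<lambda>x. c x \<oplus> d x) (\<lambda>x. c' x \<oplus> d' x)"
proof -
  have "(\<lambda>x. (c x \<ominus> c' x) \<oplus> (d x \<ominus> d' x)) \<in> wker k"
    using assms by (intro wker_add) (auto simp: weq_def)
  moreover have "(c x \<ominus> c' x) \<oplus> (d x \<ominus> d' x) = (c x \<oplus> d x) \<ominus> (c' x \<oplus> d' x)" for x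
  proof -
    have "c x \<in> carrier K" "d x \<in> carrier K" "c' x \<in> carrier K" "d' x \<in> carrier K"
      using assms by (auto simp: weq_def free_module_val)
    then show ?thesis by algebra
  qed
  ultimately show ?thesis using assms by (simp add: weq_def R.free_module_closed)
qed

lemma weq_smult:
  assumes "a \<in> carrier K" "weq k c c'" shows "weq k (\<lambda>x. a \<otimes> c x) (\<lambda>x. a \<otimes> c' x)"
proof -
  have "(\<lambda>x. a \<otimes> (c x \<ominus> c' x)) \<in> wker k"
    using assms by (intro wker_smult) (auto simp: weq_def)
  moreover have "a \<otimes> (c x \<ominus> c' x) = a \<otimes> c x \<ominus> a \<otimes> c' x" for x
  proof -
    have "c x \<in> carrier K" "c' x \<in> carrier K"
      using assms by (auto simp: weq_def free_module_val)
    then show ?thesis using assms(1) by algebra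
  qed
  ultimately show ?thesis using assms by (simp add: weq_def R.free_module_closed)
qed

lemma weq_cons:
  assumes "x \<in> carrier M" "weq k c c'" shows "weq (Suc k) (cons x c) (cons x c')"
  using assms cons_wker[of x "\<lambda>l. c l \<ominus> c' l" k] by (simp add: weq_def cons_tensors cons_minus)

lemma weq_zero: "weq k c (\<lambda>_. \<zero>) \<longleftrightarrow> c \<in> wker k"
proof -
  have "(\<lambda>x. c x \<ominus> \<zero>) = c" if "c \<in> tensors k"
    using that by (simp add: free_module_val R.minus_eq)
  then show ?thesis using wker_sub by (auto simp: weq_def R.free_module_closed)
qed

lemma Cons_tuples: "x \<in> carrier M \<Longrightarrow> xs \<in> tuples k (carrier M) \<Longrightarrow> x # xs \<in> tuples (Suc k) (carrier M)"
  by (auto simp: tuples_def)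

lemma cons_add_left:
  assumes "x \<in> carrier M" "y \<in> carrier M" "c \<in> tensors k"
  shows "weq (Suc k) (cons (x \<oplus>\<^bsub>M\<^esub> y) c) (\<lambda>l. cons x c l \<oplus> cons y c l)"
  using assms(3)
proof (induction rule: R.free_module_induct)
  case zero
  then show ?case by (simp add: cons_zero weq_zero wker_zero)
next
  case (gen xs)
  then show ?case
    using assms relator_add[OF Cons_tuples[OF assms(1) gen], of 0 x y]
    by (simp add: weq_def cons_gen R.free_module_closed gen_tensors Cons_tuples)
next
  case (smult a c)
  then show ?case using weq_smult[OF smult(1,3)] assms
    by (simp add: cons_smult R.r_distr free_module_val[OF cons_tensors])
next
  case (add c d)
  have "(\<lambda>l. (cons x c l \<oplus> cons y c l) \<oplus> (cons x d l \<oplus> cons y d l)) =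
    (\<lambda>l. (cons x c l \<oplus> cons x d l) \<oplus> (cons y c l \<oplus> cons y d l))"
    using assms add(1,2) free_module_val[OF cons_tensors]
    by (intro HOL.ext) (simp add: R.add.m_ac)
  then show ?case using weq_add[OF add(3,4)] by (simp add: cons_add)
qed

lemma cons_smult_left:
  assumes "x \<in> carrier M" "b \<in> carrier K" "c \<in> tensors k"
  shows "weq (Suc k) (cons (b \<odot>\<^bsub>M\<^esub> x) c) (\<lambda>l. b \<otimes> cons x c l)"
  using assms(3)
proof (induction rule: R.free_module_induct)
  case zero
  then show ?case using assms by (simp add: cons_zero weq_zero wker_zero)
next
  case (gen xs)
  then show ?case
    using assms relator_smult[OF Cons_tuples[OF assms(1) gen], of 0 b x]
    by (simp add: weq_def cons_gen R.free_module_closed gen_tensors Cons_tuples)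
next
  case (smult a c)
  then show ?case using weq_smult[OF smult(1,3)] assms
    by (simp add: cons_smult R.m_lcomm free_module_val[OF cons_tensors])
next
  case (add c d)
  then show ?case using weq_add[OF add(3,4)] assms
    by (simp add: cons_add R.r_distr free_module_val[OF cons_tensors])
qed

lemma cons_same:
  assumes "x \<in> carrier M" "c \<in> tensors k"
  shows "cons x (cons x c) \<in> wker (Suc (Suc k))"
  using assms(2)
proof (induction rule: R.free_module_induct)
  case (gen xs)
  then show ?case
    using assms relator_alt[OF Cons_tuples[OF assms(1) Cons_tuples[OF assms(1) gen]], of 0 1] by (simp add: cons_gen)
qed (auto simp: cons_zero cons_smult cons_add wker_zero wker_smult wker_add)

text \<open>Polarisation in the presentation, where the square of a sum has to be expanded by means
  of relators.\<close>

lemma cons_swap: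
  assumes x: "x \<in> carrier M" and y: "y \<in> carrier M" and c: "c \<in> tensors k"
  shows "weq (Suc (Suc k)) (cons x (cons y c)) (\<lambda>l. (\<ominus> \<one>) \<otimes> cons y (cons x c) l)"
proof -
  let ?s = "x \<oplus>\<^bsub>M\<^esub> y" and ?k = "Suc (Suc k)"
  have val: "cons z (cons w c) l \<in> carrier K" if "z \<in> carrier M" "w \<in> carrier M" for z w l
    using that c by (intro free_module_val[OF cons_tensors[OF _ cons_tensors]])
  have s: "?s \<in> carrier M" using x y by simp
  have "(\<lambda>l. (cons x (cons y c) l \<oplus> cons y (cons x c) l)) \<in> wker ?k"
  proof -
    have 1: "weq ?k (cons ?s (cons ?s c)) (\<lambda>l. cons ?s (cons x c) l \<oplus> cons ?s (cons y c) l)"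
      using weq_cons[OF s cons_add_left[OF x y c]] by (simp add: cons_add)
    have 2: "weq ?k (cons ?s (cons z c)) (\<lambda>l. cons x (cons z c) l \<oplus> cons y (cons z c) l)"
      if "z \<in> carrier M" for z
      using that x y c by (intro cons_add_left cons_tensors)
    have "weq ?k (cons ?s (cons ?s c)) (\<lambda>l. (cons x (cons x c) l \<oplus> cons y (cons x c) l) \<oplus>
       (cons x (cons y c) l \<oplus> cons y (cons y c) l))"
      by (rule weq_trans[OF 1 weq_add[OF 2 2]]) fact+
    then have "(\<lambda>l. cons ?s (cons ?s c) l \<ominus> ((cons x (cons x c) l \<oplus> cons y (cons x c) l) \<oplus>
       (cons x (cons y c) l \<oplus> cons y (cons y c) l))) \<in> wker ?k" by (simp add: weq_def)
    \<comment> \<open>The summands lie in the kernel: the square of \<open>?s\<close>, the negative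
      of the difference just obtained, and the negative of the squares of \<open>x\<close> and
      \<open>y\<close>. What is left of the sum are the two mixed products.\<close>
    then have "(\<lambda>l. (cons ?s (cons ?s c) l \<oplus> (\<ominus> \<one>) \<otimes> (cons ?s (cons ?s c) l \<ominus> ((cons x (cons x c) l \<oplus> cons y (cons x c) l) \<oplus>
       (cons x (cons y c) l \<oplus> cons y (cons y c) l)))) \<oplus> (\<ominus> \<one>) \<otimes> (cons x (cons x c) l \<oplus> cons y (cons y c) l)) \<in> wker ?k"
      using x y s c by (intro wker_add wker_smult cons_same) auto
    moreover have "(cons ?s (cons ?s c) l \<oplus> (\<ominus> \<one>) \<otimes> (cons ?s (cons ?s c) l \<ominus> ((cons x (cons x c) l \<oplus> cons y (cons x c) l) \<oplus>
       (cons x (cons y c) l \<oplus> cons y (cons y c) l)))) \<oplus> (\<ominus> \<one>) \<otimes> (cons x (cons x c) l \<oplus> cons y (cons y c) l)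
       = (cons x (cons y c) l \<oplus> cons y (cons x c) l)" for l
    proof -
      have "p \<oplus> (\<ominus> \<one>) \<otimes> (p \<ominus> ((x \<oplus> y) \<oplus> (z \<oplus> w))) \<oplus> (\<ominus> \<one>) \<otimes> (x \<oplus> w) = z \<oplus> y"
        if "p \<in> carrier K" "x \<in> carrier K" "y \<in> carrier K" "z \<in> carrier K" "w \<in> carrier K" for p x y z w
        using that by algebra
      then show ?thesis using x y s by (simp add: val)
    qed
    ultimately show ?thesis by simp
  qed
  moreover have "(\<lambda>l. cons x (cons y c) l \<ominus> (\<ominus> \<one>) \<otimes> cons y (cons x c) l) = (\<lambda>l. cons x (cons y c) l \<oplus> cons y (cons x c) l)"
    using x y by (simp add: val R.minus_eq R.l_minus)
  ultimately show ?thesis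
    using x y c by (auto simp: weq_def intro!: cons_tensors R.free_module_closed)
qed

text \<open>Subsequences of \<open>us\<close>, the index set of the standard generators. Repetitions
  in \<open>us\<close> may identify some of them, so \<open>card_subtuples\<close> is an inequality,
  which suffices for an upper bound.\<close>

fun subtuples :: "nat \<Rightarrow> 'm list \<Rightarrow> 'm list set" where
  "subtuples 0 us = {[]}"
| "subtuples (Suc k) [] = {}"
| "subtuples (Suc k) (u # us) = subtuples (Suc k) us \<union> (#) u ` subtuples k us"

text \<open>The span built along the list, so that detaching one generator, the basic move in
  \<open>weq_subtuples\<close>, is an unfolding.\<close>

primrec lspan :: "'m list \<Rightarrow> 'm set" where
  "lspan [] = {\<zero>\<^bsub>M\<^esub>}"
| "lspan (u # us) = {a \<odot>\<^bsub>M\<^esub> u \<oplus>\<^bsub>M\<^esub> w | a w. a \<in> carrier K \<and> w \<in> lspan us}"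

lemma finite_subtuples: "finite (subtuples k us)"
  by (induction k us rule: subtuples.induct) auto

lemma card_subtuples: "card (subtuples k us) \<le> length us choose k"
proof (induction k us rule: subtuples.induct)
  case (3 k u us)
  have "card (subtuples (Suc k) (u # us)) \<le> card (subtuples (Suc k) us) + card (subtuples k us)"
    by (simp add: order_trans[OF card_Un_le] card_image_le finite_subtuples)
  then show ?case using 3 by simp
qed auto

lemma lspan_carrier: "set us \<subseteq> carrier M \<Longrightarrow> lspan us \<subseteq> carrier M"
  by (induction us) auto

lemma lspan_Cons_mono:
  assumes "u \<in> carrier M" "set us \<subseteq> carrier M" shows "lspan us \<subseteq> lspan (u # us)"
proof
  fix w assume "w \<in> lspan us"
  then show "w \<in> lspan (u # us)" using assms lspan_carrier[OF assms(2)]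
    by (auto intro!: exI[of _ \<zero>] exI[of _ w])
qed

lemma zero_lspan: "set us \<subseteq> carrier M \<Longrightarrow> \<zero>\<^bsub>M\<^esub> \<in> lspan us"
proof (induction us)
  case (Cons u us)
  then show ?case using lspan_Cons_mono[of u us] by auto
qed simp

lemma set_lspan: "set us \<subseteq> carrier M \<Longrightarrow> set us \<subseteq> lspan us"
proof (induction us)
  case (Cons u us)
  have "u = \<one> \<odot>\<^bsub>M\<^esub> u \<oplus>\<^bsub>M\<^esub> \<zero>\<^bsub>M\<^esub>" using Cons.prems by simp
  then have "\<exists>a w. u = a \<odot>\<^bsub>M\<^esub> u \<oplus>\<^bsub>M\<^esub> w \<and> a \<in> carrier K \<and> w \<in> lspan us"
    using zero_lspan[of us] Cons.prems R.one_closed by (metis list.set_intros(2) subset_code(1))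
  then have "u \<in> lspan (u # us)" by simp
  then show ?case using Cons lspan_Cons_mono[of u us] by auto
qed simp

lemma subtuples_tuples: "set us \<subseteq> U \<Longrightarrow> subtuples k us \<subseteq> tuples k U"
proof (induction k us rule: subtuples.induct)
  case (3 k u us)
  then show ?case by (fastforce simp: tuples_def)
qed (auto simp: tuples_def)

lemma free_module_split:
  assumes "d \<in> carrier (free_module K (A \<union> (#) u ` B))"
  shows "\<exists>d1\<in>carrier (free_module K A). \<exists>d2\<in>carrier (free_module K B). d = (\<lambda>l. d1 l \<oplus> cons u d2 l)"
  using assms
proof (induction rule: R.free_module_induct)
  case zero
  then show ?case
    by (intro bexI[of _ "\<lambda>_. \<zero>"] R.free_module_closed) (simp add: cons_zero)
next
  case (gen x)
  then consider "x \<in> A" | y where "y \<in> B" "x = u # y" by blast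
  then show ?case
  proof cases
    case 1
    then show ?thesis
      by (intro bexI[of _ "free_gen K x"] bexI[of _ "\<lambda>_. \<zero>"] R.free_module_closed free_gen_carrier R.is_cring)
        (auto simp: cons_zero free_gen_def)
  next
    case 2
    then show ?thesis
      by (intro bexI[of _ "free_gen K y"] bexI[of _ "\<lambda>_. \<zero>"] R.free_module_closed free_gen_carrier R.is_cring)
        (auto simp: cons_gen, auto simp: free_gen_def)
  qed
next
  case (smult a c)
  then obtain d1 d2 where d: "d1 \<in> carrier (free_module K A)" "d2 \<in> carrier (free_module K B)"
    "c = (\<lambda>l. d1 l \<oplus> cons u d2 l)" by blast
  show ?case
    using smult(1) d
    by (intro bexI[of _ "\<lambda>l. a \<otimes> d1 l"] bexI[of _ "\<lambda>l. a \<otimes> d2 l"] R.free_module_closed)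
      (auto simp: cons_smult R.r_distr free_module_val[OF d(1)] free_module_val[OF cons_free[OF d(2)]])
next
  case (add c c')
  then obtain d1 d2 d1' d2' where d: "d1 \<in> carrier (free_module K A)" "d2 \<in> carrier (free_module K B)"
    "c = (\<lambda>l. d1 l \<oplus> cons u d2 l)" "d1' \<in> carrier (free_module K A)" "d2' \<in> carrier (free_module K B)"
    "c' = (\<lambda>l. d1' l \<oplus> cons u d2' l)" by blast
  show ?case
    using d
    by (intro bexI[of _ "\<lambda>l. d1 l \<oplus> d1' l"] bexI[of _ "\<lambda>l. d2 l \<oplus> d2' l"] R.free_module_closed)
      (auto simp: cons_add free_module_val[OF d(1)] free_module_val[OF cons_free[OF d(2)]]
         free_module_val[OF d(4)] free_module_val[OF cons_free[OF d(5)]] R.add.m_ac)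
qed

text \<open>Induction on \<open>us\<close>, then on \<open>k\<close>. The leading factor is $a u +
  w$ with $w$ in the span of \<open>us\<close>; the remaining factors are reduced to $d_1 + u \<and>
  d_2$ with $d_1$ and $d_2$ over \<open>us\<close>. Now $u \<and> d_1$ is reduced already, $w \<and>
  d_1$ is reduced by the hypothesis for \<open>us\<close>, $u \<and> u \<and> d_2$ vanishes, and $w
  \<and> u \<and> d_2 = - u \<and> (w \<and> d_2)$ with $w \<and> d_2$ again over
  \<open>us\<close>.\<close>

lemma weq_subtuples:
  assumes "set us \<subseteq> carrier M" "c \<in> carrier (free_module K (tuples k (lspan us)))"
  shows "\<exists>d\<in>carrier (free_module K (subtuples k us)). weq k c d"
  using assms
proof (induction us arbitrary: k c)
  case Nil
  show ?case
  proof (cases k)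
    case 0
    then have "c \<in> carrier (free_module K (subtuples 0 []))" using Nil by (simp add: tuples_def conj_commute cong: conj_cong)
    moreover have "tuples 0 (lspan []) = tuples 0 (carrier M)" by (auto simp: tuples_def)
    then have "c \<in> tensors 0" using Nil 0 by simp
    ultimately show ?thesis using weq_refl 0 by blast
  next
    case (Suc k')
    \<comment> \<open>A tuple over \<open>lspan []\<close> consists of zero vectors; its leading
      entry is zero times zero, and \<open>cons_smult_left\<close> extracts the zero scalar.\<close>
    have "weq k c (\<lambda>_. \<zero>)" using Nil(2)
    proof (induction rule: R.free_module_induct)
      case (gen xs)
      then obtain ys where ys: "xs = \<zero>\<^bsub>M\<^esub> # ys" "ys \<in> tuples k' (carrier M)"
        using Suc by (cases xs) (auto simp: tuples_def)
      then show ?case using cons_smult_left[of "\<zero>\<^bsub>M\<^esub>" \<zero> "free_gen K ys" k'] gen_tensors[OF ys(2)] Suc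
        by (simp add: cons_gen free_module_val[OF gen_tensors[OF Cons_tuples]])
    next
      case (smult a c)
      then show ?case using weq_smult[OF smult(1,3)] by simp
    next
      case (add c d)
      then show ?case using weq_add[OF add(3,4)] by simp
    qed (simp add: weq_zero wker_zero)
    then show ?thesis using R.free_module_closed(1) by blast
  qed
next
  case (Cons u us)
  have u: "u \<in> carrier M" and us: "set us \<subseteq> carrier M" using Cons.prems by auto
  note sub = lspan_carrier[OF us]
  have st: "d \<in> carrier (free_module K (tuples k (lspan us)))" "d \<in> tensors k"
    if "d \<in> carrier (free_module K (subtuples k us))" for d k
    using that free_module_mono[OF subtuples_tuples[OF set_lspan[OF us]]]
      free_module_mono[OF subtuples_tuples[OF us]] by blast+
  have cw: "cons w d \<in> carrier (free_module K (tuples (Suc k) (lspan us)))"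
    if "w \<in> lspan us" "d \<in> carrier (free_module K (tuples k (lspan us)))" for w d k
    by (rule subsetD[OF free_module_mono cons_free[OF that(2)]]) (use that(1) in \<open>auto simp: tuples_def\<close>)
  have U1: "d \<in> carrier (free_module K (subtuples (Suc k) (u # us)))"
    if "d \<in> carrier (free_module K (subtuples (Suc k) us))" for d k
    using that free_module_mono[of "subtuples (Suc k) us" "subtuples (Suc k) (u # us)" K] by auto
  have U2: "cons u d \<in> carrier (free_module K (subtuples (Suc k) (u # us)))"
    if "d \<in> carrier (free_module K (subtuples k us))" for d k
    using cons_free[OF that, of u] free_module_mono[of "(#) u ` subtuples k us" "subtuples (Suc k) (u # us)" K] by auto
  show ?case using Cons.prems(2)
  proof (induction k arbitrary: c)
    case 0
    then have "c \<in> carrier (free_module K (subtuples 0 (u # us)))" by (simp add: tuples_def cong: conj_cong)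
    moreover have "tuples 0 (lspan (u # us)) = tuples 0 (carrier M)" by (auto simp: tuples_def)
    then have "c \<in> tensors 0" using 0 by simp
    ultimately show ?case using weq_refl by blast
  next
    case (Suc k)
    from Suc.prems show ?case
    proof (induction rule: R.free_module_induct)
      case zero
      then show ?case using weq_refl[OF R.free_module_closed(1)] R.free_module_closed(1) by blast
    next
      case (smult a c)
      then show ?case using weq_smult[OF smult(1)] R.free_module_closed(3)[OF smult(1)] by blast
    next
      case (add c d)
      then show ?case using weq_add R.free_module_closed(2) by blast
    next
      case (gen xs)
      then obtain x ys where xs: "xs = x # ys" "x \<in> lspan (u # us)" "ys \<in> tuples k (lspan (u # us))"
        by (cases xs) (auto simp: tuples_def)
      then obtain a w where x: "a \<in> carrier K" "w \<in> lspan us" "x = a \<odot>\<^bsub>M\<^esub> u \<oplus>\<^bsub>M\<^esub> w" by auto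
      have w: "w \<in> carrier M" and xM: "x \<in> carrier M" using x sub u by auto
      have split: "weq (Suc m) (cons x d) (\<lambda>l. a \<otimes> cons u d l \<oplus> cons w d l)" if d: "d \<in> tensors m" for d m
      proof -
        have "weq (Suc m) (cons x d) (\<lambda>l. cons (a \<odot>\<^bsub>M\<^esub> u) d l \<oplus> cons w d l)"
          unfolding x(3) using x(1) u w d by (intro cons_add_left) auto
        also have "weq (Suc m) \<dots> (\<lambda>l. a \<otimes> cons u d l \<oplus> cons w d l)"
          using u x(1) w d by (intro weq_add cons_smult_left weq_refl cons_tensors)
        finally (weq_trans) show ?thesis .
      qed
      have A: "\<exists>d'\<in>carrier (free_module K (subtuples (Suc k) (u # us))). weq (Suc k) (cons x d1) d'"
        if d1: "d1 \<in> carrier (free_module K (subtuples k us))" for d1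
      proof -
        obtain e where e: "e \<in> carrier (free_module K (subtuples (Suc k) us))" "weq (Suc k) (cons w d1) e"
          using Cons.IH[OF us cw[OF x(2) st(1)[OF d1]]] by blast
        have "weq (Suc k) (cons x d1) (\<lambda>l. a \<otimes> cons u d1 l \<oplus> e l)"
          by (rule weq_trans[OF split[OF st(2)[OF d1]] weq_add[OF weq_smult[OF x(1) weq_refl] e(2)]])
            (intro cons_tensors u st(2) d1)
        then show ?thesis
          by (intro bexI[of _ "\<lambda>l. a \<otimes> cons u d1 l \<oplus> e l"] R.free_module_closed x(1) U1 U2 d1 e(1))
      qed
      have B: "\<exists>d'\<in>carrier (free_module K (subtuples (Suc k) (u # us))). weq (Suc k) (cons x (cons u d2)) d'"
        if k: "k = Suc k'" and d2: "d2 \<in> carrier (free_module K (subtuples k' us))" for d2 k'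
      proof -
        obtain e where e: "e \<in> carrier (free_module K (subtuples k us))" "weq k (cons w d2) e"
          using Cons.IH[OF us cw[OF x(2) st(1)[OF d2]]] k by blast
        have "weq (Suc k) (cons x (cons u d2)) (\<lambda>l. a \<otimes> cons u (cons u d2) l \<oplus> cons w (cons u d2) l)"
          unfolding k by (intro split cons_tensors u st(2) d2)
        \<comment> \<open>The literal \<open>a \<otimes> \<zero>\<close> is what remains of $a u
          \<and> u \<and> d_2$; left unsimplified, it keeps the shape that \<open>weq_add\<close>
          and \<open>weq_smult\<close> match.\<close>
        also have "weq (Suc k) \<dots> (\<lambda>l. a \<otimes> \<zero> \<oplus> (\<ominus> \<one>) \<otimes> cons u (cons w d2) l)"
          unfolding k using weq_zero[of "Suc (Suc k')"] cons_same[OF u st(2)[OF d2]]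
          by (intro weq_add weq_smult cons_swap x(1) w u st(2) d2) simp
        also (weq_trans) have "weq (Suc k) \<dots> (\<lambda>l. a \<otimes> \<zero> \<oplus> (\<ominus> \<one>) \<otimes> cons u e l)"
          by (intro weq_add weq_smult weq_cons e(2) x(1) u weq_refl R.free_module_closed) simp
        finally (weq_trans) show ?thesis
          by (intro bexI[of _ "\<lambda>l. a \<otimes> \<zero> \<oplus> (\<ominus> \<one>) \<otimes> cons u e l"] R.free_module_closed x(1) U2 e(1)) simp_all
      qed
      obtain d where d: "d \<in> carrier (free_module K (subtuples k (u # us)))" "weq k (free_gen K ys) d"
        using Suc.IH[OF free_gen_carrier[OF R.is_cring xs(3)]] by blast
      have 1: "weq (Suc k) (free_gen K xs) (cons x d)"
        using weq_cons[OF xM d(2)] xs(1) by (simp add: cons_gen)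
      show ?case
      proof (cases k)
        case 0
        then have "d \<in> carrier (free_module K (subtuples k us))" using d by simp
        then show ?thesis using A weq_trans[OF 1] by blast
      next
        case (Suc k')
        obtain d1 d2 where d12: "d1 \<in> carrier (free_module K (subtuples k us))"
          "d2 \<in> carrier (free_module K (subtuples k' us))" "d = (\<lambda>l. d1 l \<oplus> cons u d2 l)"
          using free_module_split[of d "subtuples k us" u "subtuples k' us"] d(1) Suc by auto
        obtain e1 e2 where e: "e1 \<in> carrier (free_module K (subtuples (Suc k) (u # us)))"
          "weq (Suc k) (cons x d1) e1" "e2 \<in> carrier (free_module K (subtuples (Suc k) (u # us)))"
          "weq (Suc k) (cons x (cons u d2)) e2"
          using A[OF d12(1)] B[OF Suc d12(2)] by blast
        have "weq (Suc k) (free_gen K xs) (\<lambda>l. e1 l \<oplus> e2 l)"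
          using weq_trans[OF 1] weq_add[OF e(2,4)] by (simp add: d12(3) cons_add)
        then show ?thesis using R.free_module_closed(2)[OF e(1,3)] by blast
      qed
    qed
  qed
qed

text \<open>The upper bound is what the presentation shows directly. The matching lower bound comes
  from the model, through \<open>card_ext_power_ge\<close>.\<close>

lemma card_exterior_power_le:
  assumes "finite (carrier K)" "set us \<subseteq> carrier M" "lspan us = carrier M"
  shows "card (carrier (exterior_power K k M)) \<le> card (carrier K) ^ (length us choose k)"
    and "finite (carrier (exterior_power K k M))"
proof -
  let ?N = "wker k" and ?L = "free_module K (tuples k (carrier M))"
  let ?S = "carrier (free_module K (subtuples k us))"
  interpret N: abelian_subgroup ?N ?L
    by (rule submodule_abelian_subgroup[OF wedge_kernel_submodule[OF module_axioms]])
  have sub: "carrier (exterior_power K k M) \<subseteq> (\<lambda>c. ?N +>\<^bsub>?L\<^esub> c) ` ?S"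
  proof
    fix A assume "A \<in> carrier (exterior_power K k M)"
    then obtain c where c: "c \<in> carrier ?L" "A = ?N +>\<^bsub>?L\<^esub> c"
      by (auto simp: exterior_power_def quotient_carrier)
    obtain d where d: "d \<in> ?S" "weq k c d" using weq_subtuples[OF assms(2), of c k] c(1) assms(3) by auto
    have "c = (\<lambda>x. c x \<ominus> d x) \<oplus>\<^bsub>?L\<^esub> d"
      using d c by (simp add: free_module_simps weq_def free_module_val R.minus_eq R.a_assoc R.l_neg)
    then have "c \<in> ?N +>\<^bsub>?L\<^esub> d" using d(2) by (auto simp: a_r_coset_def' weq_def)
    moreover have "d \<in> carrier ?L" using d by (simp add: weq_def)
    ultimately have "A = ?N +>\<^bsub>?L\<^esub> d" using c N.a_repr_independence' by metis
    then show "A \<in> (\<lambda>c. ?N +>\<^bsub>?L\<^esub> c) ` ?S" using d by blast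
  qed
  have fin: "finite ?S" and card: "card ?S = card (carrier K) ^ card (subtuples k us)"
    using card_free_module[OF finite_subtuples R.is_cring assms(1)] by auto
  show "finite (carrier (exterior_power K k M))"
    by (rule finite_subset[OF sub finite_imageI[OF fin]])
  have "card (carrier (exterior_power K k M)) \<le> card ?S"
    using card_mono[OF finite_imageI[OF fin] sub] card_image_le[OF fin] by (rule order_trans)
  also have "\<dots> \<le> card (carrier K) ^ (length us choose k)"
  proof -
    have "1 \<le> card (carrier K)" using assms(1) R.zero_closed by (metis One_nat_def Suc_leI card_gt_0_iff empty_iff)
    then show ?thesis unfolding card by (rule power_increasing[OF card_subtuples])
  qed
  finally show "card (carrier (exterior_power K k M)) \<le> card (carrier K) ^ (length us choose k)" .
qed

end

text \<open>The substitute for linear independence: once the sizes on both sides are known,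
  surjections become bijections.\<close>

lemma card_bij_inj: "finite A \<Longrightarrow> f ` A = B \<Longrightarrow> card A \<le> card B \<Longrightarrow> inj_on f A"
  by (metis card_image_le eq_card_imp_inj_on le_antisym)

lemma (in abelian_monoid) finsum_subset_diff:
  assumes "finite B" "A \<subseteq> B" "f \<in> B \<rightarrow> carrier G"
  shows "finsum G f B = finsum G f A \<oplus> finsum G f (B - A)"
proof -
  have "finsum G f (A \<union> (B - A)) = finsum G f A \<oplus> finsum G f (B - A)"
    using assms by (intro finsum_Un_disjoint) (auto intro: finite_subset)
  moreover have "A \<union> (B - A) = B" using assms by blast
  ultimately show ?thesis by simp
qed

lemma (in abelian_monoid) finsum_mono_neutral:
  assumes "finite B" "A \<subseteq> B" "f \<in> A \<rightarrow> carrier G" "\<And>x. x \<in> B - A \<Longrightarrow> f x = \<zero>"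
  shows "finsum G f A = finsum G f B"
proof -
  have "f \<in> B \<rightarrow> carrier G" using assms by fastforce
  moreover have "finsum G f (B - A) = finsum G (\<lambda>_. \<zero>) (B - A)"
    using assms(4) by (intro finsum_cong') auto
  ultimately show ?thesis using finsum_subset_diff[OF assms(1,2)] assms(3) by simp
qed

section \<open>Generating lists of a finite module\<close>

locale finite_exterior = exterior_module K M + finite_field K
  for K :: "('k, 'z) ring_scheme" (structure) and M :: "('k, 'm, 'y) module_scheme"
begin

lemma card_scalars: "card (carrier K) \<ge> 2"
proof -
  have "card {\<zero>, \<one>} \<le> card (carrier K)" using finite_scalars by (intro card_mono) auto
  then show ?thesis by simp
qed

lemma lspan_add:
  "set us \<subseteq> carrier M \<Longrightarrow> x \<in> lspan us \<Longrightarrow> y \<in> lspan us \<Longrightarrow> x \<oplus>\<^bsub>M\<^esub> y \<in> lspan us"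
proof (induction us arbitrary: x y)
  case (Cons u us)
  obtain a w where x: "a \<in> carrier K" "w \<in> lspan us" "x = a \<odot>\<^bsub>M\<^esub> u \<oplus>\<^bsub>M\<^esub> w" using Cons.prems by auto
  obtain b v where y: "b \<in> carrier K" "v \<in> lspan us" "y = b \<odot>\<^bsub>M\<^esub> u \<oplus>\<^bsub>M\<^esub> v" using Cons.prems by auto
  have wv: "w \<in> carrier M" "v \<in> carrier M" "u \<in> carrier M" using x y Cons.prems lspan_carrier[of us] by auto
  have "x \<oplus>\<^bsub>M\<^esub> y = (a \<oplus> b) \<odot>\<^bsub>M\<^esub> u \<oplus>\<^bsub>M\<^esub> (w \<oplus>\<^bsub>M\<^esub> v)"
    using x y wv by (simp add: smult_l_distr M.add.m_ac)
  moreover have "w \<oplus>\<^bsub>M\<^esub> v \<in> lspan us" using Cons x y by auto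
  ultimately show ?case using x y by auto
qed simp

lemma lspan_smult:
  "set us \<subseteq> carrier M \<Longrightarrow> b \<in> carrier K \<Longrightarrow> x \<in> lspan us \<Longrightarrow> b \<odot>\<^bsub>M\<^esub> x \<in> lspan us"
proof (induction us arbitrary: x)
  case (Cons u us)
  obtain a w where x: "a \<in> carrier K" "w \<in> lspan us" "x = a \<odot>\<^bsub>M\<^esub> u \<oplus>\<^bsub>M\<^esub> w" using Cons.prems by auto
  have wv: "w \<in> carrier M" "u \<in> carrier M" using x Cons.prems lspan_carrier[of us] by auto
  have "b \<odot>\<^bsub>M\<^esub> x = (b \<otimes> a) \<odot>\<^bsub>M\<^esub> u \<oplus>\<^bsub>M\<^esub> (b \<odot>\<^bsub>M\<^esub> w)"
    using x wv Cons.prems by (simp add: smult_r_distr smult_assoc1)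
  moreover have "b \<odot>\<^bsub>M\<^esub> w \<in> lspan us" using Cons x by auto
  ultimately show ?case using x Cons.prems by auto
qed simp

lemma card_lspan_Cons:
  assumes us: "set us \<subseteq> carrier M" and u: "u \<in> carrier M" "u \<notin> lspan us"
  shows "card (lspan (u # us)) = card (carrier K) * card (lspan us)"
proof -
  let ?f = "\<lambda>(a, w). a \<odot>\<^bsub>M\<^esub> u \<oplus>\<^bsub>M\<^esub> w"
  have "inj_on ?f (carrier K \<times> lspan us)"
  proof (rule inj_onI, clarify)
    fix a w b v assume a: "a \<in> carrier K" "b \<in> carrier K" and w: "w \<in> lspan us" "v \<in> lspan us"
      and eq: "a \<odot>\<^bsub>M\<^esub> u \<oplus>\<^bsub>M\<^esub> w = b \<odot>\<^bsub>M\<^esub> u \<oplus>\<^bsub>M\<^esub> v"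
    have wv: "w \<in> carrier M" "v \<in> carrier M" using w lspan_carrier[OF us] by auto
    have "(a \<ominus> b) \<odot>\<^bsub>M\<^esub> u = (a \<odot>\<^bsub>M\<^esub> u \<oplus>\<^bsub>M\<^esub> w) \<oplus>\<^bsub>M\<^esub> (\<ominus>\<^bsub>M\<^esub> w \<oplus>\<^bsub>M\<^esub> \<ominus>\<^bsub>M\<^esub> (b \<odot>\<^bsub>M\<^esub> u))"
      using a u wv by (simp add: a_minus_def smult_l_distr smult_l_minus M.add.m_assoc M.r_neg2)
    also have "\<dots> = v \<oplus>\<^bsub>M\<^esub> \<ominus>\<^bsub>M\<^esub> w"
      unfolding eq using a u wv by (simp add: M.add.m_ac M.r_neg2 M.r_neg1 M.r_neg)
    finally have e: "(a \<ominus> b) \<odot>\<^bsub>M\<^esub> u = v \<oplus>\<^bsub>M\<^esub> (\<ominus> \<one>) \<odot>\<^bsub>M\<^esub> w" using wv by (simp add: smult_l_minus)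
    have "a = b"
    proof (rule ccontr)
      assume "a \<noteq> b"
      then have ab: "a \<ominus> b \<in> Units K" using a by (simp add: field_Units)
      have "v \<oplus>\<^bsub>M\<^esub> (\<ominus> \<one>) \<odot>\<^bsub>M\<^esub> w \<in> lspan us" using w us by (intro lspan_add lspan_smult) auto
      then have "inv (a \<ominus> b) \<odot>\<^bsub>M\<^esub> ((a \<ominus> b) \<odot>\<^bsub>M\<^esub> u) \<in> lspan us"
        unfolding e using ab us by (intro lspan_smult) auto
      moreover have "inv (a \<ominus> b) \<odot>\<^bsub>M\<^esub> ((a \<ominus> b) \<odot>\<^bsub>M\<^esub> u) = u"
        using ab a u by (simp add: smult_assoc1[symmetric])
      ultimately show False using u by simp
    qed
    then show "a = b \<and> w = v" using eq a u wv by simp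
  qed
  moreover have "lspan (u # us) = ?f ` (carrier K \<times> lspan us)" by auto
  ultimately show ?thesis by (simp add: card_image card_cartesian_product)
qed

text \<open>Take a list of maximal length among those whose span is as large as a free module: a
  vector outside the span would lengthen it, by \<open>card_lspan_Cons\<close>. Lengths are bounded
  because $m < q^m$.\<close>

lemma exists_lspan:
  assumes "finite (carrier M)"
  obtains us where "set us \<subseteq> carrier M" "lspan us = carrier M" "card (carrier M) = card (carrier K) ^ length us"
proof -
  let ?P = "\<lambda>us. set us \<subseteq> carrier M \<and> card (lspan us) = card (carrier K) ^ length us"
  have "length us < card (carrier M)" if "?P us" for us
  proof -
    have "length us < card (carrier K) ^ length us"
      using card_scalars by (intro power_gt_expt) simp
    also have "\<dots> \<le> card (carrier M)"
      using that card_mono[OF assms lspan_carrier[of us]] by simp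
    finally show ?thesis .
  qed
  moreover have "?P []" by simp
  ultimately obtain us where us: "?P us" and max: "\<And>us'. ?P us' \<Longrightarrow> length us' \<le> length us"
    using ex_has_greatest_nat[of ?P "[]" length "card (carrier M)"] by blast
  have "lspan us = carrier M"
  proof (rule ccontr)
    assume "lspan us \<noteq> carrier M"
    then obtain u where "u \<in> carrier M" "u \<notin> lspan us" using us lspan_carrier[of us] by blast
    then have "?P (u # us)" using us card_lspan_Cons[of us u] by simp
    then show False using max by fastforce
  qed
  then show ?thesis using that[of us] us by metis
qed

end

section \<open>Comparison with the model\<close>

locale coordinates = finite_exterior K M
  for K :: "('k, 'z) ring_scheme" (structure) and M :: "('k, 'm, 'y) module_scheme" +
  fixes n :: nat and \<phi> :: "'m \<Rightarrow> nat \<Rightarrow> 'k"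
  assumes coord_vecs: "x \<in> carrier M \<Longrightarrow> \<phi> x \<in> vecs n"
    and coord_add: "x \<in> carrier M \<Longrightarrow> y \<in> carrier M \<Longrightarrow> \<phi> (x \<oplus>\<^bsub>M\<^esub> y) = (\<lambda>i. \<phi> x i \<oplus> \<phi> y i)"
    and coord_smult: "a \<in> carrier K \<Longrightarrow> x \<in> carrier M \<Longrightarrow> \<phi> (a \<odot>\<^bsub>M\<^esub> x) = (\<lambda>i. a \<otimes> \<phi> x i)"

text \<open>
  This and \<open>class_eval\<close> are defined outside the locale so that they do not depend on the module: the
  same map serves all subspaces of $V$.
\<close>

definition tensor_eval ::
    "('k, 'z) ring_scheme \<Rightarrow> nat \<Rightarrow> ('m \<Rightarrow> nat \<Rightarrow> 'k) \<Rightarrow> ('m list \<Rightarrow> 'k) \<Rightarrow> bool list \<Rightarrow> 'k" where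
  "tensor_eval K n \<phi> c = (\<lambda>l. finsum K (\<lambda>xs. c xs \<otimes>\<^bsub>K\<^esub> finite_field.wedge K n (map \<phi> xs) l)
     {xs. c xs \<noteq> \<zero>\<^bsub>K\<^esub>})"

context finite_field
begin

lemma wedge_update_add:
  "set xs \<subseteq> vecs n \<Longrightarrow> i < length xs \<Longrightarrow> v \<in> vecs n \<Longrightarrow> w \<in> vecs n \<Longrightarrow>
   wedge n (xs[i := (\<lambda>j. v j \<oplus> w j)]) = (\<lambda>l. wedge n (xs[i := v]) l \<oplus> wedge n (xs[i := w]) l)"
proof (induction xs arbitrary: i)
  case (Cons x xs)
  show ?case
  proof (cases i)
    case 0
    then show ?thesis using Cons.prems by (simp add: wed_add_left wedge_ext)
  next
    case (Suc j)
    have "set (xs[j := v]) \<subseteq> vecs n" "set (xs[j := w]) \<subseteq> vecs n"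
      using Cons.prems set_update_subset_insert[of xs j] by fastforce+
    then show ?thesis using Cons Suc by (simp add: wed_add_right wedge_ext)
  qed
qed simp

lemma wedge_update_smult:
  "set xs \<subseteq> vecs n \<Longrightarrow> i < length xs \<Longrightarrow> v \<in> vecs n \<Longrightarrow> a \<in> carrier K \<Longrightarrow>
   wedge n (xs[i := (\<lambda>j. a \<otimes> v j)]) = (\<lambda>l. a \<otimes> wedge n (xs[i := v]) l)"
proof (induction xs arbitrary: i)
  case (Cons x xs)
  show ?case
  proof (cases i)
    case 0
    then show ?thesis using Cons.prems by (simp add: wed_smult_left wedge_ext)
  next
    case (Suc j)
    have "set (xs[j := v]) \<subseteq> vecs n"
      using Cons.prems set_update_subset_insert[of xs j] by fastforce+
    then show ?thesis using Cons Suc by (simp add: wed_smult_right wedge_ext)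
  qed
qed simp

end

context coordinates
begin

abbreviation ev where "ev \<equiv> tensor_eval K n \<phi>"

lemma wedge_tuple: "xs \<in> tuples k (carrier M) \<Longrightarrow> wedge n (map \<phi> xs) \<in> ext_alg n"
  by (rule wedge_ext) (auto simp: tuples_def coord_vecs)

text \<open>Allows two tensors with different supports to be evaluated under one sum, as additivity
  requires.\<close>

lemma ev_superset:
  assumes "c \<in> tensors k" "finite T" "{xs. c xs \<noteq> \<zero>} \<subseteq> T" "T \<subseteq> tuples k (carrier M)"
  shows "ev c = (\<lambda>l. \<Oplus>xs\<in>T. c xs \<otimes> wedge n (map \<phi> xs) l)"
  unfolding tensor_eval_def
proof
  fix l
  show "(\<Oplus>xs\<in>{xs. c xs \<noteq> \<zero>}. c xs \<otimes> wedge n (map \<phi> xs) l) = (\<Oplus>xs\<in>T. c xs \<otimes> wedge n (map \<phi> xs) l)"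
  proof (rule R.finsum_mono_neutral[OF assms(2,3)])
    have "wedge n (map \<phi> xs) l \<in> carrier K" if "xs \<in> T" for xs
      using that assms(4) wedge_tuple[of xs k] by auto
    then show "c xs \<otimes> wedge n (map \<phi> xs) l = \<zero>" if "xs \<in> T - {xs. c xs \<noteq> \<zero>}" for xs
      using that by simp
    show "(\<lambda>xs. c xs \<otimes> wedge n (map \<phi> xs) l) \<in> {xs. c xs \<noteq> \<zero>} \<rightarrow> carrier K"
      using assms(3,4) free_module_val[OF assms(1)] ext_val[OF wedge_tuple[of _ k]] by blast
  qed
qed

lemma support_tensor: "c \<in> tensors k \<Longrightarrow> finite {xs. c xs \<noteq> \<zero>} \<and> {xs. c xs \<noteq> \<zero>} \<subseteq> tuples k (carrier M)"
  by (simp add: free_module_def)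

lemma ev_add:
  assumes "c \<in> tensors k" "d \<in> tensors k"
  shows "ev (\<lambda>x. c x \<oplus> d x) = (\<lambda>l. ev c l \<oplus> ev d l)"
proof
  fix l
  let ?T = "{xs. c xs \<noteq> \<zero>} \<union> {xs. d xs \<noteq> \<zero>}"
  have T: "finite ?T" "?T \<subseteq> tuples k (carrier M)" using support_tensor[OF assms(1)] support_tensor[OF assms(2)] by auto
  have w: "wedge n (map \<phi> xs) l \<in> carrier K" if "xs \<in> ?T" for xs
    using that T(2) wedge_tuple[of xs k] by auto
  have "ev (\<lambda>x. c x \<oplus> d x) l = (\<Oplus>xs\<in>?T. (c xs \<oplus> d xs) \<otimes> wedge n (map \<phi> xs) l)"
    by (subst ev_superset[OF free_module_closed(2)[OF assms] T(1) _ T(2)]) auto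
  also have "\<dots> = (\<Oplus>xs\<in>?T. c xs \<otimes> wedge n (map \<phi> xs) l \<oplus> d xs \<otimes> wedge n (map \<phi> xs) l)"
    using w by (intro R.finsum_cong') (auto simp: l_distr free_module_val[OF assms(1)] free_module_val[OF assms(2)])
  also have "\<dots> = (\<Oplus>xs\<in>?T. c xs \<otimes> wedge n (map \<phi> xs) l) \<oplus> (\<Oplus>xs\<in>?T. d xs \<otimes> wedge n (map \<phi> xs) l)"
    using w by (intro R.finsum_addf) (auto simp: free_module_val[OF assms(1)] free_module_val[OF assms(2)])
  also have "\<dots> = ev c l \<oplus> ev d l"
    using ev_superset[OF assms(1) T(1) _ T(2)] ev_superset[OF assms(2) T(1) _ T(2)] by auto
  finally show "ev (\<lambda>x. c x \<oplus> d x) l = ev c l \<oplus> ev d l" .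
qed

lemma ev_smult:
  assumes "a \<in> carrier K" "d \<in> tensors k"
  shows "ev (\<lambda>x. a \<otimes> d x) = (\<lambda>l. a \<otimes> ev d l)"
proof
  fix l
  let ?T = "{xs. d xs \<noteq> \<zero>}"
  have T: "finite ?T" "?T \<subseteq> tuples k (carrier M)" using support_tensor[OF assms(2)] by auto
  have w: "wedge n (map \<phi> xs) l \<in> carrier K" if "xs \<in> ?T" for xs
    using that T(2) wedge_tuple[of xs k] by auto
  have "ev (\<lambda>x. a \<otimes> d x) l = (\<Oplus>xs\<in>?T. (a \<otimes> d xs) \<otimes> wedge n (map \<phi> xs) l)"
    by (subst ev_superset[OF free_module_closed(3)[OF assms] T(1) _ T(2)]) (use assms in auto)
  also have "\<dots> = (\<Oplus>xs\<in>?T. a \<otimes> (d xs \<otimes> wedge n (map \<phi> xs) l))"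
    using w assms(1) by (intro R.finsum_cong') (auto simp: m_assoc free_module_val[OF assms(2)])
  also have "\<dots> = a \<otimes> (\<Oplus>xs\<in>?T. d xs \<otimes> wedge n (map \<phi> xs) l)"
    using w assms(1) T by (intro R.finsum_rdistr[symmetric]) (auto simp: free_module_val[OF assms(2)])
  finally show "ev (\<lambda>x. a \<otimes> d x) l = a \<otimes> ev d l" by (simp add: tensor_eval_def)
qed

lemma ev_zero: "ev (\<lambda>_. \<zero>) = (\<lambda>_. \<zero>)"
  by (simp add: tensor_eval_def)

lemma ev_gen: "xs \<in> tuples k (carrier M) \<Longrightarrow> ev (free_gen K xs) = wedge n (map \<phi> xs)"
  using wedge_tuple[of xs k]
  by (subst ev_superset[OF gen_tensors, of xs k "{xs}"]) (auto simp: free_gen_def)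

lemma ev_ext: "c \<in> tensors k \<Longrightarrow> ev c \<in> ext_power n (int k) (\<phi> ` carrier M)"
proof (induction rule: free_module_induct)
  case zero
  then show ?case by (simp add: ev_zero ext_power.zero)
next
  case (gen xs)
  then show ?case using wedge_ext_power[of "\<phi> ` carrier M" n "map \<phi> xs"] coord_vecs
    by (auto simp: ev_gen tuples_def image_subset_iff)
next
  case (smult a c)
  then show ?case using coord_vecs by (simp add: ev_smult[OF smult(1,2)] ext_power_smult image_subset_iff)
next
  case (add c d)
  then show ?case using coord_vecs by (simp add: ev_add[OF add(1,2)] ext_power_add image_subset_iff)
qed

lemma ev_image: "ev ` tensors k = ext_power n (int k) (\<phi> ` carrier M)"
proof (intro equalityI subsetI)
  fix \<omega> assume "\<omega> \<in> ext_power n (int k) (\<phi> ` carrier M)"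
  then show "\<omega> \<in> ev ` tensors k"
  proof (induction rule: ext_power.induct)
    case zero
    then show ?case using ev_zero free_module_closed(1) by (intro image_eqI[of _ _ "\<lambda>_. \<zero>"]) auto
  next
    case (step a xs \<omega>)
    then obtain c where c: "c \<in> tensors k" "\<omega> = ev c" by blast
    obtain ys where ys: "ys \<in> tuples k (carrier M)" "xs = map \<phi> ys"
    proof -
      have "xs = map \<phi> (map (inv_into (carrier M) \<phi>) xs)"
        using step(3) by (auto simp: f_inv_into_f subset_iff intro!: map_idI[symmetric])
      moreover have "map (inv_into (carrier M) \<phi>) xs \<in> tuples k (carrier M)"
        using step(2,3) by (auto simp: tuples_def inv_into_into subset_iff)
      ultimately show ?thesis using that by blast
    qed
    have "(\<lambda>l. a \<otimes> wedge n xs l \<oplus> \<omega> l) = ev (\<lambda>x. a \<otimes> free_gen K ys x \<oplus> c x)"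
      using step(1) c ys
      by (simp add: ev_add[of _ k] ev_smult[of _ _ k] ev_gen[of _ k] free_module_closed gen_tensors)
    then show ?case using step(1) c ys by (auto simp: free_module_closed gen_tensors)
  qed
qed (auto simp: ev_ext)

text \<open>The product of the model is multilinear and alternating in its vectors, so each of the
  three kinds of relators evaluates to zero.\<close>

lemma ev_wker: "c \<in> wker k \<Longrightarrow> ev c = (\<lambda>_. \<zero>)"
proof (induction rule: wker_induct)
  case (rel c)
  have neg: "ev (\<lambda>l. c l \<ominus> d l) = (\<lambda>l. ev c l \<ominus> ev d l)" if "c \<in> tensors k" "d \<in> tensors k" for c d
  proof -
    have "(\<lambda>l. c l \<ominus> d l) = (\<lambda>l. c l \<oplus> (\<ominus> \<one>) \<otimes> d l)"
      using that by (simp add: a_minus_def l_minus free_module_val)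
    moreover have "ev d l \<in> carrier K" for l
      using ext_power_ext[OF _ ev_ext[OF that(2)]] coord_vecs by (simp add: image_subset_iff)
    moreover have "ev (\<lambda>l. c l \<oplus> (\<ominus> \<one>) \<otimes> d l) = (\<lambda>l. ev c l \<oplus> (\<ominus> \<one>) \<otimes> ev d l)"
      using that by (subst ev_add[of _ k]) (auto intro!: free_module_closed simp only: ev_smult[of _ _ k] R.a_inv_closed R.one_closed)
    ultimately show ?thesis by (simp add: l_minus a_minus_def)
  qed
  have mu: "map \<phi> (xs[i := x]) = (map \<phi> xs)[i := \<phi> x]" for xs i x by (rule map_update)
  have vec: "set (map \<phi> xs) \<subseteq> vecs n" if "xs \<in> tuples k (carrier M)" for xs
    using that by (auto simp: tuples_def coord_vecs)
  from rel show ?case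
  proof (cases rule: wedge_relators_cases)
    case (add xs i y z)
    note t = tuples_update[OF add(1)]
    have "ev c = (\<lambda>l. wedge n (map \<phi> (xs[i := y \<oplus>\<^bsub>M\<^esub> z])) l \<ominus>
        (wedge n (map \<phi> (xs[i := y])) l \<oplus> wedge n (map \<phi> (xs[i := z])) l))"
      unfolding add(5) using add(3,4) t
      by (subst neg) (simp_all add: gen_tensors free_module_closed ev_add[of _ k] ev_gen[of _ k])
    moreover have "wedge n (map \<phi> (xs[i := y \<oplus>\<^bsub>M\<^esub> z])) =
        (\<lambda>l. wedge n (map \<phi> (xs[i := y])) l \<oplus> wedge n (map \<phi> (xs[i := z])) l)"
      unfolding mu using add vec[OF add(1)]
      by (simp add: coord_add wedge_update_add coord_vecs tuples_def)
    moreover have "wedge n (map \<phi> (xs[i := y])) l \<in> carrier K" "wedge n (map \<phi> (xs[i := z])) l \<in> carrier K" for l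
      using ext_val[OF wedge_tuple[OF t]] add by auto
    ultimately show ?thesis by (simp add: a_minus_def R.r_neg)
  next
    case (smult xs i a y)
    note t = tuples_update[OF smult(1)]
    have "ev c = (\<lambda>l. wedge n (map \<phi> (xs[i := a \<odot>\<^bsub>M\<^esub> y])) l \<ominus> a \<otimes> wedge n (map \<phi> (xs[i := y])) l)"
      unfolding smult(5) using smult(3,4) t
      by (subst neg) (simp_all add: gen_tensors free_module_closed ev_smult[of _ _ k] ev_gen[of _ k])
    moreover have "wedge n (map \<phi> (xs[i := a \<odot>\<^bsub>M\<^esub> y])) = (\<lambda>l. a \<otimes> wedge n (map \<phi> (xs[i := y])) l)"
      unfolding mu using smult vec[OF smult(1)]
      by (simp add: coord_smult wedge_update_smult coord_vecs tuples_def)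
    moreover have "wedge n (map \<phi> (xs[i := y])) l \<in> carrier K" for l
      using ext_val[OF wedge_tuple[OF t]] smult by auto
    ultimately show ?thesis using smult(3) by (simp add: a_minus_def R.r_neg)
  next
    case (alt xs i j)
    then have "map \<phi> xs ! i = map \<phi> xs ! j" "i < length xs" "j < length xs" by (auto simp: tuples_def)
    then have "\<not> distinct (map \<phi> xs)" using alt(2) by (metis length_map less_irrefl nth_eq_iff_index_eq)
    then show ?thesis using alt vec[OF alt(1)] by (simp add: ev_gen[of _ k] wedge_not_distinct)
  qed
next
  case (smult a c)
  then show ?case by (simp add: ev_smult[OF smult(1,2)])
next
  case (add c d)
  then show ?case by (simp add: ev_add[OF add(1,2)])
qed (simp add: ev_zero)

end

definition class_eval ::
    "('k, 'z) ring_scheme \<Rightarrow> nat \<Rightarrow> ('m \<Rightarrow> nat \<Rightarrow> 'k) \<Rightarrow> ('m list \<Rightarrow> 'k) set \<Rightarrow> bool list \<Rightarrow> 'k" where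
  "class_eval K n \<phi> A = tensor_eval K n \<phi> (SOME c. c \<in> A)"

context coordinates
begin

abbreviation cev where "cev \<equiv> class_eval K n \<phi>"

text \<open>Representatives differ by an element of the kernel, which evaluates to zero, so the
  arbitrary choice in \<open>class_eval\<close> is harmless.\<close>

lemma cev_class:
  assumes "c \<in> tensors k"
  shows "cev (wker k +>\<^bsub>free_module K (tuples k (carrier M))\<^esub> c) = ev c"
proof -
  let ?A = "wker k +>\<^bsub>free_module K (tuples k (carrier M))\<^esub> c"
  interpret N: abelian_subgroup "wker k" "free_module K (tuples k (carrier M))"
    by (rule submodule_abelian_subgroup[OF wedge_kernel_submodule[OF module_axioms]])
  have "c \<in> ?A" using assms by (rule N.a_rcos_self)
  then have "(SOME c. c \<in> ?A) \<in> ?A" by (rule someI[of "\<lambda>c. c \<in> ?A"])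
  then obtain d where d: "d \<in> wker k" "(SOME c. c \<in> ?A) = (\<lambda>x. d x \<oplus> c x)"
    by (auto simp: a_r_coset_def' free_module_simps)
  have "\<phi> ` carrier M \<subseteq> vecs n" using coord_vecs by auto
  then have "ev c l \<in> carrier K" for l using ext_power_ext[OF _ ev_ext[OF assms]] by simp
  then have "ev (\<lambda>x. d x \<oplus> c x) = ev c"
    using ev_add[OF wker_sub[OF d(1)] assms] ev_wker[OF d(1)] by simp
  then show ?thesis by (simp add: class_eval_def d(2))
qed

lemma cev_image: "cev ` carrier (exterior_power K k M) = ext_power n (int k) (\<phi> ` carrier M)"
  unfolding exterior_power_def quotient_carrier ev_image[symmetric]
  by (simp add: image_image cev_class cong: image_cong)

lemma cev_add:
  assumes "A \<in> carrier (exterior_power K k M)" "B \<in> carrier (exterior_power K k M)"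
  shows "cev (A \<oplus>\<^bsub>exterior_power K k M\<^esub> B) = (\<lambda>l. cev A l \<oplus> cev B l)"
  using assms quotient_add[OF wedge_kernel_submodule[OF module_axioms]]
  by (auto simp: exterior_power_def quotient_carrier cev_class)
    (simp add: free_module_simps cev_class free_module_closed ev_add[of _ k])

text \<open>The power in the model is an image of the presented one under \<open>cev\<close> and
  inherits its upper bound.\<close>

lemma card_ext_power_le:
  assumes "finite (carrier M)" "card (carrier M) = card (carrier K) ^ m"
  shows "card (carrier (exterior_power K k M)) \<le> card (carrier K) ^ (m choose k)"
    and "card (ext_power n (int k) (\<phi> ` carrier M)) \<le> card (carrier K) ^ (m choose k)"
    and "finite (carrier (exterior_power K k M))"
proof -
  obtain us where us: "set us \<subseteq> carrier M" "lspan us = carrier M" "card (carrier M) = card (carrier K) ^ length us"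
    using exists_lspan[OF assms(1)] .
  have "length us = m" using us(3) assms(2) card_scalars by simp
  then show "card (carrier (exterior_power K k M)) \<le> card (carrier K) ^ (m choose k)"
    and fin: "finite (carrier (exterior_power K k M))"
    using card_exterior_power_le[OF finite_scalars us(1,2)] by auto
  then show "card (ext_power n (int k) (\<phi> ` carrier M)) \<le> card (carrier K) ^ (m choose k)"
    using card_image_le[OF fin, of cev] by (simp add: cev_image)
qed

end

section \<open>Subspaces of $K^n$ and their exterior powers\<close>

context finite_field
begin

lemma carrier_vecs: "carrier (free_module K {..<n}) = vecs n"
proof -
  have "finite {x. v x \<noteq> \<zero>}" if "\<forall>i\<ge>n. v i = \<zero>" for v :: "nat \<Rightarrow> 'k"
    by (rule finite_subset[of _ "{..<n}"]) (use that not_le in auto)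
  then show ?thesis by (auto simp: free_module_def vecs_def not_le[symmetric])
qed

definition subsp :: "nat \<Rightarrow> (nat \<Rightarrow> 'k) set set" where
  "subsp n = {U. U \<subseteq> vecs n \<and> (\<lambda>_. \<zero>) \<in> U \<and> (\<forall>x\<in>U. \<forall>y\<in>U. (\<lambda>i. x i \<oplus> y i) \<in> U) \<and>
     (\<forall>a\<in>carrier K. \<forall>x\<in>U. (\<lambda>i. a \<otimes> x i) \<in> U)}"

definition e1 :: "nat \<Rightarrow> 'k" where
  "e1 = case_nat \<one> (\<lambda>_. \<zero>)"

lemma subspD:
  assumes "U \<in> subsp n"
  shows "U \<subseteq> vecs n" "(\<lambda>_. \<zero>) \<in> U" "x \<in> U \<Longrightarrow> y \<in> U \<Longrightarrow> (\<lambda>i. x i \<oplus> y i) \<in> U"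
    "a \<in> carrier K \<Longrightarrow> x \<in> U \<Longrightarrow> (\<lambda>i. a \<otimes> x i) \<in> U"
  using assms by (auto simp: subsp_def)

lemma subsp_minus:
  assumes "U \<in> subsp n" "x \<in> U" "y \<in> U" shows "(\<lambda>i. x i \<ominus> y i) \<in> U"
proof -
  have "(\<lambda>i. x i \<oplus> (\<ominus> \<one>) \<otimes> y i) \<in> U" using assms by (intro subspD) auto
  moreover have "y i \<in> carrier K" for i using assms subspD(1)[OF assms(1)] vecs_val by blast
  ultimately show ?thesis by (simp add: a_minus_def l_minus)
qed

lemma subsp_submodule: "U \<in> subsp n \<Longrightarrow> submodule K U (free_module K {..<n})"
  by (rule submodule.intro)
    (auto simp: subsp_def carrier_vecs free_module_simps free_module_module[OF is_cring])

lemma finite_subsp: "finite (subsp n)"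
  by (rule finite_subset[of _ "Pow (vecs n)"]) (auto simp: subsp_def finite_vecs)

lemma subsp_finite: "U \<in> subsp n \<Longrightarrow> finite U"
  using finite_subset[OF subspD(1) finite_vecs] by blast

lemma vecs_subsp: "vecs n \<in> subsp n"
  by (auto simp: subsp_def add_vecs smult_vecs)

lemma vtl_subsp: "U \<in> subsp (Suc n) \<Longrightarrow> vtl ` U \<in> subsp n"
proof -
  assume U: "U \<in> subsp (Suc n)"
  show ?thesis unfolding subsp_def
  proof (intro CollectI conjI ballI)
    show "vtl ` U \<subseteq> vecs n" using subspD(1)[OF U] vtl_vecs by blast
    show "(\<lambda>_. \<zero>) \<in> vtl ` U" using subspD(2)[OF U] by (rule image_eqI[rotated]) (simp add: vtl_zero)
    show "(\<lambda>i. x i \<oplus> y i) \<in> vtl ` U" if "x \<in> vtl ` U" "y \<in> vtl ` U" for x y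
      using that subspD(3)[OF U] by (auto simp: vtl_add[symmetric])
    show "(\<lambda>i. a \<otimes> x i) \<in> vtl ` U" if "a \<in> carrier K" "x \<in> vtl ` U" for x a
      using that subspD(4)[OF U] by (auto simp: vtl_smult[symmetric])
  qed
qed

lemma e1_vecs: "e1 \<in> vecs (Suc n)"
  by (simp add: e1_def vecs_cons)

lemma vtl_e1 [simp]: "vtl e1 = (\<lambda>_. \<zero>)"
  by (simp add: e1_def)

lemma smult_e1: "a \<in> carrier K \<Longrightarrow> (\<lambda>i. a \<otimes> e1 i) = case_nat a (\<lambda>_. \<zero>)"
  by (rule HOL.ext) (auto simp: e1_def split: nat.splits)

lemma vtl_eq_zero: "v \<in> vecs (Suc n) \<Longrightarrow> vtl v = (\<lambda>_. \<zero>) \<Longrightarrow> v = (\<lambda>i. v 0 \<otimes> e1 i)"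
  using cons_vtl[of v] by (simp add: smult_e1)

text \<open>The kernel of \<open>vtl\<close> is the line of $e_1$, and a nonzero multiple of $e_1$
  can be scaled back.\<close>

lemma e1_mem_of_kernel:
  assumes U: "U \<in> subsp (Suc n)" and v: "v \<in> U" "vtl v = (\<lambda>_. \<zero>)" "v \<noteq> (\<lambda>_. \<zero>)"
  shows "e1 \<in> U"
proof -
  have vv: "v \<in> vecs (Suc n)" using subspD(1)[OF U] v by blast
  have v0: "v 0 \<in> Units K"
  proof -
    have "v 0 \<noteq> \<zero>"
    proof
      assume "v 0 = \<zero>"
      then have "v = (\<lambda>_. \<zero>)" using vtl_eq_zero[OF vv v(2)] e1_vecs[of n] by (auto simp: fun_eq_iff)
      then show False using v by simp
    qed
    then show ?thesis using vv by (simp add: field_Units)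
  qed
  have "(\<lambda>i. inv (v 0) \<otimes> v i) \<in> U" using v0 v by (intro subspD(4)[OF U]) auto
  moreover have "(\<lambda>i. inv (v 0) \<otimes> v i) = e1"
    using v0 e1_vecs[of n] by (subst vtl_eq_zero[OF vv v(2)]) (simp add: m_assoc[symmetric] Units_closed)
  ultimately show ?thesis by simp
qed

lemma inj_on_vtl:
  assumes U: "U \<in> subsp (Suc n)" and "e1 \<notin> U" shows "inj_on vtl U"
proof (rule inj_onI)
  fix x y assume xy: "x \<in> U" "y \<in> U" "vtl x = vtl y"
  have c: "x i \<in> carrier K" "y i \<in> carrier K" for i using xy subspD(1)[OF U] vecs_val by blast+
  have "vtl (\<lambda>i. x i \<ominus> y i) = (\<lambda>i. vtl x i \<ominus> vtl y i)" by (simp add: vtl_def)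
  also have "\<dots> = (\<lambda>_. \<zero>)" using c by (simp add: xy(3)) (simp add: vtl_def a_minus_def r_neg)
  finally have "(\<lambda>i. x i \<ominus> y i) = (\<lambda>_. \<zero>)"
    using e1_mem_of_kernel[OF U subsp_minus[OF U xy(1,2)]] assms(2) by blast
  then show "x = y" using c by (auto simp: fun_eq_iff)
qed

text \<open>Vectors with equal projection differ by the multiple of $e_1$ with coefficient
  \<open>v 0 \<ominus> u 0\<close>, so a subspace containing $e_1$ is a union of fibres of the
  projection.\<close>

lemma vtl_mem_iff:
  assumes U: "U \<in> subsp (Suc n)" and "e1 \<in> U" and v: "v \<in> vecs (Suc n)"
  shows "v \<in> U \<longleftrightarrow> vtl v \<in> vtl ` U"
proof
  assume "vtl v \<in> vtl ` U"
  then obtain u where u: "u \<in> U" "vtl v = vtl u" by blast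
  have c: "u i \<in> carrier K" for i using u subspD(1)[OF U] vecs_val by blast
  have "(\<lambda>i. u i \<oplus> (v 0 \<ominus> u 0) \<otimes> e1 i) \<in> U"
    using assms u c by (intro subspD(3,4)[OF U]) auto
  moreover have "(\<lambda>i. u i \<oplus> (v 0 \<ominus> u 0) \<otimes> e1 i) = v"
  proof
    fix i
    show "u i \<oplus> (v 0 \<ominus> u 0) \<otimes> e1 i = v i"
    proof (cases i)
      case 0
      have "v 0 \<in> carrier K" using v by simp
      then show ?thesis using 0 c by (simp add: e1_def) algebra
    next
      case (Suc j)
      then show ?thesis using fun_cong[OF u(2), of j] c v by (simp add: e1_def vtl_def)
    qed
  qed
  ultimately show "v \<in> U" by simp
qed blast

lemma card_vtl:
  assumes U: "U \<in> subsp (Suc n)" and "e1 \<in> U"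
  shows "card U = card (carrier K) * card (vtl ` U)"
proof -
  have "inj_on (\<lambda>(a, v). case_nat a v :: nat \<Rightarrow> 'k) (carrier K \<times> vtl ` U)"
  proof (rule inj_onI, clarify)
    fix a a' :: 'k and v v' assume "case_nat a (vtl v) = case_nat a' (vtl v')"
    from fun_cong[OF this, of 0] arg_cong[OF this, of vtl] show "a = a' \<and> vtl v = vtl v'" by simp
  qed
  moreover have "U = (\<lambda>(a, v). case_nat a v) ` (carrier K \<times> vtl ` U)"
  proof (intro equalityI subsetI)
    fix u assume "u \<in> U"
    then show "u \<in> (\<lambda>(a, v). case_nat a v) ` (carrier K \<times> vtl ` U)"
      using subspD(1)[OF U] cons_vtl[of u] by (intro image_eqI[of _ _ "(u 0, vtl u)"]) auto
  next
    fix u assume "u \<in> (\<lambda>(a, v). case_nat a v) ` (carrier K \<times> vtl ` U)"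
    then obtain a v where "a \<in> carrier K" "v \<in> U" "u = case_nat a (vtl v)" by auto
    then show "u \<in> U" using vtl_mem_iff[OF assms, of u] subspD(1)[OF U] vtl_vecs vecs_cons by auto
  qed
  ultimately show ?thesis by (metis card_image card_cartesian_product)
qed

text \<open>The projection restricted to \<open>U\<close> has the line of $e_1$ or zero as its
  kernel, so passing to the image divides the size by $q$ or preserves it.\<close>

lemma card_subsp: "U \<in> subsp n \<Longrightarrow> \<exists>m. card U = card (carrier K) ^ m"
proof (induction n arbitrary: U)
  case 0
  then have "U = {\<lambda>_. \<zero>}" using subspD[OF 0] by (auto simp: vecs_0)
  then show ?case by (intro exI[of _ 0]) simp
next
  case (Suc n)
  obtain m where m: "card (vtl ` U) = card (carrier K) ^ m" using Suc.IH[OF vtl_subsp[OF Suc.prems]] by blast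
  show ?case
  proof (cases "e1 \<in> U")
    case True
    then show ?thesis using card_vtl[OF Suc.prems] m by (intro exI[of _ "Suc m"]) simp
  next
    case False
    then show ?thesis using card_image[OF inj_on_vtl[OF Suc.prems]] m by metis
  qed
qed

lemma part_wedge: "part False (wedge (Suc n) xs) = wedge n (map vtl xs)"
proof (induction xs)
  case Nil
  show ?case by (rule HOL.ext) (auto simp: part_def ext_one_def)
qed simp

lemma part_ext_one: "part True (ext_one (Suc n)) = (\<lambda>_. \<zero>)"
  by (rule HOL.ext) (auto simp: part_def ext_one_def)

text \<open>Taking $\<omega>$ to $\<omega>_0$ is the algebra map induced by the projection, as
  \<open>part_wedge\<close> shows on products.\<close>

lemma part_False_image:
  assumes "U \<subseteq> vecs (Suc n)"
  shows "part False ` ext_power (Suc n) k U = ext_power n k (vtl ` U)"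
proof (intro equalityI subsetI)
  fix \<alpha> assume "\<alpha> \<in> part False ` ext_power (Suc n) k U"
  then obtain \<omega> where "\<omega> \<in> ext_power (Suc n) k U" "\<alpha> = part False \<omega>" by blast
  then show "\<alpha> \<in> ext_power n k (vtl ` U)"
  proof (induction arbitrary: \<alpha> rule: ext_power.induct)
    case zero
    then show ?case by (simp add: part_zero ext_power.zero)
  next
    case (step a xs \<omega>)
    then show ?case
      using ext_power.step[OF step(1), of "map vtl xs" k "vtl ` U"] by (simp add: part_add part_smult part_wedge image_mono)
  qed
next
  fix \<alpha> assume "\<alpha> \<in> ext_power n k (vtl ` U)"
  then show "\<alpha> \<in> part False ` ext_power (Suc n) k U"
  proof (induction rule: ext_power.induct)
    case zero
    then show ?case using part_zero ext_power.zero by (metis imageI)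
  next
    case (step a xs \<omega>)
    then obtain \<omega>' where w: "\<omega>' \<in> ext_power (Suc n) k U" "\<omega> = part False \<omega>'" by blast
    let ?ys = "map (inv_into U vtl) xs"
    have "xs = map vtl ?ys" using step(3) by (auto simp: f_inv_into_f subset_iff intro!: map_idI[symmetric])
    moreover have "(\<lambda>l. a \<otimes> wedge (Suc n) ?ys l \<oplus> \<omega>' l) \<in> ext_power (Suc n) k U"
      using step w by (intro ext_power.step) (auto simp: inv_into_into subset_iff)
    ultimately show ?case using w(2) part_wedge[of n ?ys]
      by (intro image_eqI[of _ _ "\<lambda>l. a \<otimes> wedge (Suc n) ?ys l \<oplus> \<omega>' l"]) (simp_all add: part_add part_smult)
  qed
qed

text \<open>For a product $x \<and> \<omega>$ the second part is $x_1 \<omega>_0 - \<pi>(x) \<and>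
  \<omega>_1$: one vector is used up by its leading coordinate, the others enter through their
  projections. This lowers the degree by one.\<close>

lemma part_True_mem:
  assumes U: "U \<subseteq> vecs (Suc n)" and "\<omega> \<in> ext_power (Suc n) k U"
  shows "part True \<omega> \<in> ext_power n (k - 1) (vtl ` U)"
proof -
  have U': "vtl ` U \<subseteq> vecs n" using U vtl_vecs by blast
  have w: "part True (wedge (Suc n) xs) \<in> ext_power n (int (length xs) - 1) (vtl ` U)" if "set xs \<subseteq> U" for xs
    using that
  proof (induction xs)
    case Nil
    then show ?case by (simp add: part_ext_one ext_power.zero)
  next
    case (Cons x xs)
    have x: "x 0 \<in> carrier K" "vtl x \<in> vtl ` U" using Cons.prems U vecs_val by auto
    have "wedge n (map vtl xs) \<in> ext_power n (int (length xs)) (vtl ` U)"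
      using wedge_ext_power[OF U', of "map vtl xs"] Cons.prems by (simp add: image_mono)
    moreover have "wed n (vtl x) (part True (wedge (Suc n) xs)) \<in> ext_power n (int (length xs)) (vtl ` U)"
      using wed_ext_power[OF U' x(2) Cons.IH] Cons.prems by simp
    ultimately show ?case using x U' by (simp add: part_wedge ext_power_minus ext_power_smult)
  qed
  from assms(2) show ?thesis
  proof (induction rule: ext_power.induct)
    case zero
    then show ?case by (simp add: part_zero ext_power.zero)
  next
    case (step a xs \<omega>)
    then show ?case using w[OF step(3)] U' by (simp add: part_add part_smult ext_power_add ext_power_smult)
  qed
qed

text \<open>As $e_1$ is in \<open>U\<close>, the vectors of the projection, extended by a zero
  leading coordinate, lie in \<open>U\<close>. One part is made from products of such vectors, the
  other from $e_1$ times such products.\<close>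

lemma glue_mem:
  assumes U: "U \<in> subsp (Suc n)" and e: "e1 \<in> U"
    and "\<alpha> \<in> ext_power n k (vtl ` U)" "\<beta> \<in> ext_power n (k - 1) (vtl ` U)"
  shows "glue \<alpha> \<beta> \<in> ext_power (Suc n) k U"
proof -
  note Uv = subspD(1)[OF U]
  have U': "vtl ` U \<subseteq> vecs n" using Uv vtl_vecs by blast
  have lift: "case_nat \<zero> y \<in> U" if "y \<in> vtl ` U" for y
    using vtl_mem_iff[OF U e vecs_cons[of \<zero> y n]] that U' by auto
  have w: "wedge (Suc n) (map (case_nat \<zero>) ys) = glue (wedge n ys) (\<lambda>_. \<zero>)" if "set ys \<subseteq> vecs n" for ys
    using that
  proof (induction ys)
    case Nil
    show ?case by (rule HOL.ext) (auto simp: glue_def ext_one_def split: list.splits)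
  next
    case (Cons y ys)
    then show ?case using ext_val[OF wedge_ext[of ys n]] by (simp add: wed_zero_right a_minus_def)
  qed
  have 0: "glue \<alpha> (\<lambda>_. \<zero>) \<in> ext_power (Suc n) k U" using assms(3)
  proof (induction rule: ext_power.induct)
    case zero
    then show ?case by (simp add: glue_zero ext_power.zero)
  next
    case (step a xs \<omega>)
    have "glue (\<lambda>l. a \<otimes> wedge n xs l \<oplus> \<omega> l) (\<lambda>_. \<zero>) =
       (\<lambda>l. a \<otimes> wedge (Suc n) (map (case_nat \<zero>) xs) l \<oplus> glue \<omega> (\<lambda>_. \<zero>) l)"
      using step(1,3) U' w[of xs] by (intro HOL.ext) (auto simp: glue_def split: list.splits)
    then show ?case using ext_power.step[OF step(1) _ _ step(5), of "map (case_nat \<zero>) xs"] step lift by auto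
  qed
  have 1: "glue (\<lambda>_. \<zero>) \<beta> \<in> ext_power (Suc n) k U" using assms(4)
  proof (induction rule: ext_power.induct)
    case zero
    then show ?case by (simp add: glue_zero ext_power.zero)
  next
    case (step a xs \<omega>)
    have xs: "set xs \<subseteq> vecs n" using step(3) U' by blast
    have "wedge (Suc n) (e1 # map (case_nat \<zero>) xs) = glue (\<lambda>_. \<zero>) (wedge n xs)"
      using w[OF xs] wedge_ext[OF xs] by (simp add: wed_zero_left wed_zero_right a_minus_def) (simp add: e1_def)
    then have "glue (\<lambda>_. \<zero>) (\<lambda>l. a \<otimes> wedge n xs l \<oplus> \<omega> l) =
       (\<lambda>l. a \<otimes> wedge (Suc n) (e1 # map (case_nat \<zero>) xs) l \<oplus> glue (\<lambda>_. \<zero>) \<omega> l)"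
      using step(1) by (intro HOL.ext) (auto simp: glue_def split: list.splits)
    then show ?case
      using ext_power.step[OF step(1) _ _ step(5), of "e1 # map (case_nat \<zero>) xs"] step lift e by auto
  qed
  have "glue \<alpha> \<beta> = (\<lambda>l. glue \<alpha> (\<lambda>_. \<zero>) l \<oplus> glue (\<lambda>_. \<zero>) \<beta> l)"
    using ext_power_ext[OF U' assms(3)] ext_power_ext[OF U' assms(4)] by (simp add: glue_add[symmetric])
  then show ?thesis using ext_power_add[OF Uv 0 1] by simp
qed

lemma ext_power_neg_degree: "k < 0 \<Longrightarrow> ext_power n k U = {\<lambda>_. \<zero>}"
proof -
  assume k: "k < 0"
  have "\<omega> = (\<lambda>_. \<zero>)" if "\<omega> \<in> ext_power n k U" for \<omega>
    using that by cases (use k in auto)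
  then show ?thesis using ext_power.zero by blast
qed

lemma card_glue:
  assumes "A \<subseteq> ext_alg n" "B \<subseteq> ext_alg n"
  shows "card ((\<lambda>(\<alpha>, \<beta>). glue \<alpha> \<beta>) ` (A \<times> B)) = card A * card B"
proof -
  have "inj_on (\<lambda>(\<alpha>, \<beta>). glue \<alpha> \<beta>) (A \<times> B)"
    by (rule inj_onI, clarify) (metis part_glue)
  then show ?thesis by (simp add: card_image card_cartesian_product)
qed

text \<open>Pascal's rule by induction on \<open>n\<close>. If $e_1$ is in \<open>U\<close>, then
  \<open>glue\<close> embeds the pairs of forms of degrees $k$ and $k - 1$ over the projection.
  Otherwise the projection preserves the size of \<open>U\<close>, and \<open>part False\<close>
  maps onto the forms of degree $k$ over the image.\<close>

lemma card_ext_power_ge: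
  "U \<in> subsp n \<Longrightarrow> card U = card (carrier K) ^ m \<Longrightarrow>
    card (ext_power n (int k) U) \<ge> card (carrier K) ^ (m choose k)"
proof (induction n arbitrary: U m k)
  case 0
  \<comment> \<open>Any module would do here: the interpretation provides
    \<open>card_scalars\<close>.\<close>
  interpret finite_exterior K "free_module K {..<0::nat}"
    by (intro finite_exterior.intro exterior_module.intro free_module_module is_cring finite_field_axioms)
  have "U = {\<lambda>_. \<zero>}" using subspD[OF 0(1)] by (auto simp: vecs_0)
  then have m: "m = 0" using 0(2) card_scalars power_eq_1_iff[of m "card (carrier K)"] by (cases m) auto
  have fin: "finite (ext_power 0 (int k) U)" using finite_ext_power subspD(1)[OF 0(1)] by blast
  show ?case
  proof (cases k)
    case k: 0
    let ?f = "\<lambda>a l. a \<otimes> wedge 0 [] l \<oplus> \<zero>"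
    have "?f ` carrier K \<subseteq> ext_power 0 (int k) U"
      using k ext_power.step[of _ "[]" "int k" U, OF _ _ _ ext_power.zero] by (intro image_subsetI) simp
    then have "card (?f ` carrier K) \<le> card (ext_power 0 (int k) U)" by (rule card_mono[OF fin])
    moreover have "inj_on ?f (carrier K)"
    proof (rule inj_onI)
      fix a b assume "a \<in> carrier K" "b \<in> carrier K" "?f a = ?f b"
      then show "a = b" using fun_cong[of "?f a" "?f b" "[]"] by (simp add: ext_one_def)
    qed
    ultimately show ?thesis using m k by (simp add: card_image)
  next
    case (Suc k')
    have "card (ext_power 0 (int k) U) > 0" using fin ext_power.zero card_gt_0_iff by blast
    then show ?thesis using Suc m by simp
  qed
next
  case (Suc n)
  interpret finite_exterior K "free_module K {..<0::nat}"
    by (intro finite_exterior.intro exterior_module.intro free_module_module is_cring finite_field_axioms)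
  note U' = vtl_subsp[OF Suc.prems(1)]
  have fin: "finite (ext_power (Suc n) (int k) U)" using finite_ext_power subspD(1)[OF Suc.prems(1)] by blast
  show ?case
  proof (cases "e1 \<in> U")
    case False
    have "card (vtl ` U) = card (carrier K) ^ m" using card_image[OF inj_on_vtl[OF Suc.prems(1) False]] Suc.prems by simp
    then have "card (ext_power n (int k) (vtl ` U)) \<ge> card (carrier K) ^ (m choose k)" using Suc.IH[OF U'] by blast
    then show ?thesis
      using card_image_le[OF fin, of "part False"] part_False_image[OF subspD(1)[OF Suc.prems(1)], of "int k"] by simp
  next
    case True
    obtain m' where m': "card (vtl ` U) = card (carrier K) ^ m'" using card_subsp[OF U'] by blast
    have "card (carrier K) ^ m = card (carrier K) ^ Suc m'" using card_vtl[OF Suc.prems(1) True] m' Suc.prems by simp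
    then have m: "m = Suc m'" using card_scalars by (simp only: power_inject_exp)
    let ?A = "ext_power n (int k) (vtl ` U)" and ?B = "ext_power n (int k - 1) (vtl ` U)"
    have "card ((\<lambda>(\<alpha>, \<beta>). glue \<alpha> \<beta>) ` (?A \<times> ?B)) \<le> card (ext_power (Suc n) (int k) U)"
      using glue_mem[OF Suc.prems(1) True] by (intro card_mono[OF fin]) auto
    moreover have "card ((\<lambda>(\<alpha>, \<beta>). glue \<alpha> \<beta>) ` (?A \<times> ?B)) = card ?A * card ?B"
      using ext_power_ext[OF subspD(1)[OF U']] by (intro card_glue) auto
    moreover have "card ?A \<ge> card (carrier K) ^ (m' choose k)" using Suc.IH[OF U' m'] .
    moreover have "card ?A * card ?B \<ge> card (carrier K) ^ (m choose k)"
    proof (cases k)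
      case 0
      then show ?thesis using \<open>card ?A \<ge> _\<close> by (simp add: m ext_power_neg_degree)
    next
      case (Suc k')
      then have "card ?B \<ge> card (carrier K) ^ (m' choose k')" using Suc.IH[OF U' m', of k'] by simp
      then have "card (carrier K) ^ (m' choose k) * card (carrier K) ^ (m' choose k') \<le> card ?A * card ?B"
        using \<open>card ?A \<ge> _\<close> by (intro mult_mono) auto
      then show ?thesis using Suc by (simp add: m power_add mult.commute)
    qed
    ultimately show ?thesis by simp
  qed
qed

text \<open>The upper bound brings the presentation into the model: \<open>U\<close> is itself a
  module, with the identity as its coordinate map, and \<open>card_ext_power_le\<close> applies to
  it.\<close>

lemma card_ext_power:
  assumes U: "U \<in> subsp n" and "card U = card (carrier K) ^ m"
  shows "card (ext_power n (int k) U) = card (carrier K) ^ (m choose k)"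
proof (rule antisym[OF _ card_ext_power_ge[OF assms]])
  let ?M = "(free_module K {..<n})\<lparr>carrier := U\<rparr>"
  interpret L: Module.module K "free_module K {..<n}" by (rule free_module_module[OF is_cring])
  have mod: "Module.module K ?M" by (rule L.submodule_is_module[OF subsp_submodule[OF U]])
  interpret coordinates K ?M n "\<lambda>x. x"
    by (intro coordinates.intro finite_exterior.intro exterior_module.intro mod finite_field_axioms coordinates_axioms.intro)
      (use subspD(1)[OF U] in \<open>auto simp: free_module_simps\<close>)
  show "card (ext_power n (int k) U) \<le> card (carrier K) ^ (m choose k)"
    using card_ext_power_le(2)[of m k] assms(2) subsp_finite[OF U] by simp
qed

text \<open>
  If $e_1 \notin U$, then $U \to \pi(U)$ is an isomorphism, so a form over $U$ is determined by $\omega_0$.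
  The proof compares cardinalities.
\<close>

lemma inj_on_part_False:
  assumes U: "U \<in> subsp (Suc n)" and "e1 \<notin> U"
  shows "inj_on (part False) (ext_power (Suc n) k U)"
proof (cases "k < 0")
  case True
  then show ?thesis by (simp add: ext_power_neg_degree)
next
  case False
  obtain m where m: "card U = card (carrier K) ^ m" using card_subsp[OF U] by blast
  have m': "card (vtl ` U) = card (carrier K) ^ m" using card_image[OF inj_on_vtl[OF assms]] m by simp
  obtain k' where k: "k = int k'" using False by (metis not_less zero_le_imp_eq_int)
  show ?thesis
    using card_ext_power[OF U m, of k'] card_ext_power[OF vtl_subsp[OF U] m', of k'] k
    by (intro card_bij_inj[OF finite_ext_power[OF subspD(1)[OF U]] part_False_image[OF subspD(1)[OF U]]]) simp
qed

end

section \<open>Flags of subspaces of $K^n$\<close>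

text \<open>Unlike in \<open>Pi\<^sub>E\<close> the value outside \<open>S\<close> is prescribed.
  With the zero form as default, chains are total functions, and the formula for the boundary makes
  sense at every flag.\<close>

definition ffun :: "'a set \<Rightarrow> ('a \<Rightarrow> 'b set) \<Rightarrow> 'b \<Rightarrow> ('a \<Rightarrow> 'b) set" where
  "ffun S A z = {c. \<forall>x. if x \<in> S then c x \<in> A x else c x = z}"

lemma ffun_bij: "bij_betw (\<lambda>c. restrict c S) (ffun S A z) (Pi\<^sub>E S A)"
proof (rule bij_betw_byWitness[where f' = "\<lambda>f x. if x \<in> S then f x else z"])
  show "\<forall>c\<in>ffun S A z. (\<lambda>x. if x \<in> S then restrict c S x else z) = c"
  proof (intro ballI HOL.ext)
    fix c x assume "c \<in> ffun S A z"
    then have "if x \<in> S then c x \<in> A x else c x = z" by (simp add: ffun_def)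
    then show "(if x \<in> S then restrict c S x else z) = c x" by (simp split: if_splits)
  qed
  show "\<forall>f\<in>Pi\<^sub>E S A. restrict (\<lambda>x. if x \<in> S then f x else z) S = f"
  proof (intro ballI HOL.ext)
    fix f x assume f: "f \<in> Pi\<^sub>E S A"
    show "restrict (\<lambda>x. if x \<in> S then f x else z) S x = f x"
      using PiE_arb[OF f, of x] by (cases "x \<in> S") auto
  qed
  show "(\<lambda>c. restrict c S) ` ffun S A z \<subseteq> Pi\<^sub>E S A"
  proof (rule image_subsetI)
    fix c assume "c \<in> ffun S A z"
    then have "c x \<in> A x" if "x \<in> S" for x using that by (auto simp: ffun_def dest: spec[of _ x])
    then show "restrict c S \<in> Pi\<^sub>E S A" by simp
  qed
  show "(\<lambda>f x. if x \<in> S then f x else z) ` Pi\<^sub>E S A \<subseteq> ffun S A z"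
  proof (rule image_subsetI)
    fix f assume f: "f \<in> Pi\<^sub>E S A"
    show "(\<lambda>x. if x \<in> S then f x else z) \<in> ffun S A z" using PiE_mem[OF f] by (simp add: ffun_def)
  qed
qed

lemma card_ffun: "finite S \<Longrightarrow> card (ffun S A z) = (\<Prod>x\<in>S. card (A x))"
  using bij_betw_same_card[OF ffun_bij[of S A z]] by (simp add: card_PiE)

lemma finite_ffun: "finite S \<Longrightarrow> (\<And>x. x \<in> S \<Longrightarrow> finite (A x)) \<Longrightarrow> finite (ffun S A z)"
  using bij_betw_finite[OF ffun_bij[of S A z]] finite_PiE[of S A] by simp

lemma ffun_mem: "c \<in> ffun S A z \<Longrightarrow> x \<in> S \<Longrightarrow> c x \<in> A x"
  and ffun_out: "c \<in> ffun S A z \<Longrightarrow> x \<notin> S \<Longrightarrow> c x = z"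
  unfolding ffun_def by (metis (mono_tags, lifting) mem_Collect_eq)+

lemma ffunI: "(\<And>x. x \<in> S \<Longrightarrow> c x \<in> A x) \<Longrightarrow> (\<And>x. x \<notin> S \<Longrightarrow> c x = z) \<Longrightarrow> c \<in> ffun S A z"
  by (simp add: ffun_def)

lemma Inter_chain_mem:
  assumes "finite \<sigma>" "\<sigma> \<noteq> {}" "chain\<^sub>\<subseteq> \<sigma>" shows "\<Inter>\<sigma> \<in> \<sigma>"
  using assms
proof (induction rule: finite_ne_induct)
  case (insert x F)
  then have "\<Inter>F \<in> F" by (auto simp: chain_subset_def)
  then have "x \<subseteq> \<Inter>F \<or> \<Inter>F \<subseteq> x" using insert.prems by (auto simp: chain_subset_def)
  then show ?case using \<open>\<Inter>F \<in> F\<close> by (metis Inf_insert inf.absorb1 inf.absorb2 insertCI)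
qed simp

lemma Union_chain_mem:
  assumes "finite \<sigma>" "\<sigma> \<noteq> {}" "chain\<^sub>\<subseteq> \<sigma>" shows "\<Union>\<sigma> \<in> \<sigma>"
  using assms
proof (induction rule: finite_ne_induct)
  case (insert x F)
  then have "\<Union>F \<in> F" by (auto simp: chain_subset_def)
  then have "x \<subseteq> \<Union>F \<or> \<Union>F \<subseteq> x" using insert.prems by (auto simp: chain_subset_def)
  then show ?case using \<open>\<Union>F \<in> F\<close> by (metis Sup_insert sup.absorb1 sup.absorb2 insertCI)
qed simp

context finite_field
begin

text \<open>
  Unlike in the flag complex, the zero subspace is allowed as a member of a flag. For $k \ge 1$ such flags carry zero
  coefficients, and their presence makes the recursion on $n$ uniform.
\<close>

definition psub :: "nat \<Rightarrow> (nat \<Rightarrow> 'k) set set" where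
  "psub n = subsp n - {vecs n}"

definition flags :: "nat \<Rightarrow> (nat \<Rightarrow> 'k) set set set" where
  "flags n = {\<sigma>. \<sigma> \<subseteq> psub n \<and> chain\<^sub>\<subseteq> \<sigma>}"

definition fbot :: "nat \<Rightarrow> (nat \<Rightarrow> 'k) set set \<Rightarrow> (nat \<Rightarrow> 'k) set" where
  "fbot n \<sigma> = (if \<sigma> = {} then vecs n else \<Inter>\<sigma>)"

text \<open>\<open>j\<close> is the number of members of the flags, one more than the simplicial
  dimension. It is an integer, so that the lower end of the complex needs no separate
  treatment.\<close>

definition flag_chains :: "nat \<Rightarrow> int \<Rightarrow> int \<Rightarrow> ((nat \<Rightarrow> 'k) set set \<Rightarrow> bool list \<Rightarrow> 'k) set" where
  "flag_chains n k j = ffun {\<sigma> \<in> flags n. int (card \<sigma>) = j} (\<lambda>\<sigma>. ext_power n k (fbot n \<sigma>)) (\<lambda>_. \<zero>)"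

text \<open>The sign of the face of \<open>insert u \<tau>\<close> opposite to \<open>u\<close>: if
  \<open>u\<close> is its $i$-th member, then $i - 1$ members lie below, and $(-1)^{i-1} =
  (-1)^{i+1}$. On flags, inclusion is all the order that the sign requires.\<close>

definition sg :: "(nat \<Rightarrow> 'k) set set \<Rightarrow> (nat \<Rightarrow> 'k) set \<Rightarrow> 'k \<Rightarrow> 'k" where
  "sg \<tau> u x = (if even (card {t \<in> \<tau>. t \<subset> u}) then x else \<ominus> x)"

definition cofaces :: "nat \<Rightarrow> (nat \<Rightarrow> 'k) set set \<Rightarrow> (nat \<Rightarrow> 'k) set set" where
  "cofaces n \<tau> = {u. u \<notin> \<tau> \<and> insert u \<tau> \<in> flags n}"

definition bd :: "nat \<Rightarrow> ((nat \<Rightarrow> 'k) set set \<Rightarrow> bool list \<Rightarrow> 'k) \<Rightarrow> (nat \<Rightarrow> 'k) set set \<Rightarrow> bool list \<Rightarrow> 'k" where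
  "bd n c = (\<lambda>\<tau> l. \<Oplus>u\<in>cofaces n \<tau>. sg \<tau> u (c (insert u \<tau>) l))"

lemma psub_sub: "psub n \<subseteq> subsp n"
  by (auto simp: psub_def)

lemma finite_psub: "finite (psub n)"
  using finite_subsp by (simp add: psub_def)

lemma finite_flag: "\<sigma> \<in> flags n \<Longrightarrow> finite \<sigma>"
  using finite_subset[OF _ finite_psub] by (auto simp: flags_def)

lemma finite_flags: "finite (flags n)"
  by (rule finite_subset[of _ "Pow (psub n)"]) (auto simp: flags_def finite_psub)

lemma cofaces_psub: "cofaces n \<tau> \<subseteq> psub n"
  by (auto simp: cofaces_def flags_def)

lemma finite_cofaces: "finite (cofaces n \<tau>)"
  by (rule finite_subset[OF cofaces_psub finite_psub])

lemma flags_subset: "\<sigma> \<in> flags n \<Longrightarrow> \<tau> \<subseteq> \<sigma> \<Longrightarrow> \<tau> \<in> flags n"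
  unfolding flags_def chain_subset_def by blast

lemma bot_mem: "\<sigma> \<in> flags n \<Longrightarrow> \<sigma> \<noteq> {} \<Longrightarrow> fbot n \<sigma> \<in> \<sigma>"
  using Inter_chain_mem[OF finite_flag] by (auto simp: fbot_def flags_def)

lemma bot_subsp: "\<sigma> \<in> flags n \<Longrightarrow> fbot n \<sigma> \<in> subsp n"
proof (cases "\<sigma> = {}")
  case False
  moreover assume "\<sigma> \<in> flags n"
  ultimately show ?thesis using bot_mem[of \<sigma> n] psub_sub by (auto simp: flags_def)
qed (simp add: fbot_def vecs_subsp)

lemma bot_antimono: "\<tau> \<in> flags n \<Longrightarrow> \<sigma> \<subseteq> \<tau> \<Longrightarrow> fbot n \<tau> \<subseteq> fbot n \<sigma>"
  using subspD(1)[OF bot_subsp[of \<tau> n]] by (auto simp: fbot_def split: if_splits)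

lemma finite_chains: "finite (flag_chains n k j)"
  unfolding flag_chains_def
  using finite_flags finite_ext_power[OF subspD(1)[OF bot_subsp]] by (intro finite_ffun) auto

lemma chains_mem: "c \<in> flag_chains n k j \<Longrightarrow> \<sigma> \<in> flags n \<Longrightarrow> c \<sigma> \<in> ext_power n k (fbot n \<sigma>)"
  unfolding flag_chains_def using ffun_mem[of c] ffun_out[of c] ext_power.zero
  by (cases "int (card \<sigma>) = j") fastforce+

lemma chains_ext: "c \<in> flag_chains n k j \<Longrightarrow> c \<sigma> \<in> ext_alg n"
proof (cases "\<sigma> \<in> flags n")
  case True
  assume "c \<in> flag_chains n k j"
  then show ?thesis using ext_power_ext[OF subspD(1)[OF bot_subsp[OF True]] chains_mem[OF _ True]] by blast
next
  case False
  assume "c \<in> flag_chains n k j"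
  then show ?thesis using ffun_out[of c _ _ _ \<sigma>] False by (simp add: flag_chains_def)
qed

lemma chains_val: "c \<in> flag_chains n k j \<Longrightarrow> c \<sigma> l \<in> carrier K"
  by (rule ext_val[OF chains_ext])

lemma sg_closed [simp]: "x \<in> carrier K \<Longrightarrow> sg \<tau> u x \<in> carrier K"
  by (simp add: sg_def)

lemma sg_zero [simp]: "sg \<tau> u \<zero> = \<zero>"
  by (simp add: sg_def)

lemma bd_closed: "c \<in> flag_chains n k j \<Longrightarrow> bd n c \<tau> l \<in> carrier K"
  unfolding bd_def by (intro finsum_closed) (simp add: chains_val[of c n k j])

text \<open>
  \<open>vtl\<close> is the projection $\pi$. A full subspace is either all of $K^{n+1}$ or a complement of the line
  spanned by $e_1$, and \<open>Lift n U\<close> identifies the flags of $K^n$ with the flags all of whose members contain $e_1$,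
  respectively with the flags with top $U$.
\<close>

definition full :: "nat \<Rightarrow> (nat \<Rightarrow> 'k) set \<Rightarrow> bool" where
  "full n U \<longleftrightarrow> U \<in> subsp (Suc n) \<and> vtl ` U = vecs n"

definition lift :: "(nat \<Rightarrow> 'k) set \<Rightarrow> (nat \<Rightarrow> 'k) set \<Rightarrow> (nat \<Rightarrow> 'k) set" where
  "lift U W = {v \<in> U. vtl v \<in> W}"

lemma vtl_vecs_image: "vtl ` vecs (Suc n) = vecs n"
proof -
  have "v \<in> vtl ` vecs (Suc n)" if "v \<in> vecs n" for v
    using vecs_cons[OF zero_closed that] by (intro image_eqI[of _ _ "case_nat \<zero> v"]) auto
  then show ?thesis using vtl_vecs by blast
qed

lemma full_vecs: "full n (vecs (Suc n))"
  by (simp add: full_def vecs_subsp vtl_vecs_image)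

lemma full_e1: "full n U \<Longrightarrow> e1 \<in> U \<longleftrightarrow> U = vecs (Suc n)"
proof
  assume U: "full n U" and "e1 \<in> U"
  then have "v \<in> U" if "v \<in> vecs (Suc n)" for v
    using vtl_mem_iff[of U n v] that vtl_vecs by (auto simp: full_def)
  then show "U = vecs (Suc n)" using U subspD(1)[of U "Suc n"] by (auto simp: full_def)
qed (simp add: e1_vecs)

lemma vtl_lift:
  assumes "full n U" "W \<subseteq> vecs n" shows "vtl ` lift U W = W"
proof (intro equalityI subsetI)
  fix w assume w: "w \<in> W"
  then have "w \<in> vtl ` U" using assms by (auto simp: full_def)
  then show "w \<in> vtl ` lift U W" using w by (auto simp: lift_def)
qed (auto simp: lift_def)

lemma lift_subsp:
  assumes "full n U" "W \<in> subsp n" shows "lift U W \<in> subsp (Suc n)"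
proof -
  note U = assms(1)[unfolded full_def, THEN conjunct1]
  show ?thesis unfolding subsp_def lift_def
    using subspD[OF U] subspD[OF assms(2)] by (auto simp: vtl_zero vtl_add vtl_smult)
qed

lemma lift_vtl:
  assumes "full n U" "X \<in> subsp (Suc n)" "X \<subseteq> U" "e1 \<in> U \<Longrightarrow> e1 \<in> X"
  shows "lift U (vtl ` X) = X"
proof (intro equalityI subsetI)
  fix v assume v: "v \<in> lift U (vtl ` X)"
  have U: "U \<in> subsp (Suc n)" using assms(1) by (simp add: full_def)
  show "v \<in> X"
  proof (cases "e1 \<in> U")
    case True
    then show ?thesis using vtl_mem_iff[OF assms(2) assms(4)[OF True], of v] v subspD(1)[OF U]
      by (auto simp: lift_def)
  next
    case False
    then show ?thesis using inj_on_vtl[OF U False] v assms(3) by (auto simp: lift_def dest: inj_onD)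
  qed
qed (use assms(3) in \<open>auto simp: lift_def\<close>)

lemma lift_subset_iff:
  assumes "full n U" "W \<subseteq> vecs n" "W' \<subseteq> vecs n" shows "lift U W \<subseteq> lift U W' \<longleftrightarrow> W \<subseteq> W'"
proof
  assume "lift U W \<subseteq> lift U W'"
  then have "vtl ` lift U W \<subseteq> vtl ` lift U W'" by (rule image_mono)
  then show "W \<subseteq> W'" using vtl_lift[OF assms(1)] assms by simp
qed (auto simp: lift_def)

lemma lift_eq_iff:
  assumes "full n U" "W \<subseteq> vecs n" "W' \<subseteq> vecs n" shows "lift U W = lift U W' \<longleftrightarrow> W = W'"
  using lift_subset_iff[OF assms(1,2,3)] lift_subset_iff[OF assms(1,3,2)] by blast

lemma lift_top: "full n U \<Longrightarrow> lift U (vecs n) = U"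
  unfolding full_def lift_def by auto

lemma lift_le: "lift U W \<subseteq> U"
  by (auto simp: lift_def)

lemma e1_lift: "W \<in> subsp n \<Longrightarrow> e1 \<in> lift U W \<longleftrightarrow> e1 \<in> U"
  using subspD(2) by (auto simp: lift_def)

definition Lift :: "nat \<Rightarrow> (nat \<Rightarrow> 'k) set \<Rightarrow> (nat \<Rightarrow> 'k) set set \<Rightarrow> (nat \<Rightarrow> 'k) set set" where
  "Lift n U \<sigma> = lift U ` \<sigma> \<union> (if U = vecs (Suc n) then {} else {U})"

lemma lift_psub:
  assumes "full n U" "W \<in> psub n" shows "lift U W \<in> psub (Suc n)" "lift U W \<noteq> U"
proof -
  have W: "W \<subseteq> vecs n" "W \<noteq> vecs n" "W \<in> subsp n" using assms(2) subspD(1)[of W n] by (auto simp: psub_def)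
  show ne: "lift U W \<noteq> U" using lift_eq_iff[OF assms(1) W(1) order_refl] lift_top[OF assms(1)] W by auto
  have "lift U W \<noteq> vecs (Suc n)"
  proof
    assume a: "lift U W = vecs (Suc n)"
    have "U \<subseteq> vecs (Suc n)" using assms(1) subspD(1) by (auto simp: full_def)
    then show False using a ne lift_le[of U W] by auto
  qed
  then show "lift U W \<in> psub (Suc n)" using lift_subsp[OF assms(1) W(3)] by (simp add: psub_def)
qed

lemma Lift_flag:
  assumes U: "full n U" and "\<sigma> \<in> flags n" shows "Lift n U \<sigma> \<in> flags (Suc n)"
proof -
  have "Lift n U \<sigma> \<subseteq> psub (Suc n)"
  proof
    fix X assume "X \<in> Lift n U \<sigma>"
    then consider W where "W \<in> \<sigma>" "X = lift U W" | "U \<noteq> vecs (Suc n)" "X = U"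
      by (auto simp: Lift_def split: if_splits)
    then show "X \<in> psub (Suc n)"
      by cases (use assms lift_psub(1)[OF U] in \<open>auto simp: flags_def psub_def[of "Suc n"] full_def\<close>)
  qed
  moreover have "chain\<^sub>\<subseteq> (Lift n U \<sigma>)"
  proof -
    have "lift U a \<subseteq> lift U b \<or> lift U b \<subseteq> lift U a" if "a \<in> \<sigma>" "b \<in> \<sigma>" for a b
      using that assms(2) by (auto simp: flags_def chain_subset_def lift_def)
    then show ?thesis using lift_le by (auto simp: Lift_def chain_subset_def)
  qed
  ultimately show ?thesis by (simp add: flags_def)
qed

lemma flag_vecs: "\<sigma> \<in> flags n \<Longrightarrow> W \<in> \<sigma> \<Longrightarrow> W \<subseteq> vecs n"
  and flag_subsp: "\<sigma> \<in> flags n \<Longrightarrow> W \<in> \<sigma> \<Longrightarrow> W \<in> subsp n"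
  and flag_psub: "\<sigma> \<in> flags n \<Longrightarrow> W \<in> \<sigma> \<Longrightarrow> W \<in> psub n"
  using subspD(1)[of W n] by (auto simp: flags_def psub_def)

lemma inj_on_lift: "full n U \<Longrightarrow> inj_on (lift U) (subsp n)"
  using lift_eq_iff subspD(1) by (auto simp: inj_on_def)

lemma top_notin_lift:
  assumes "full n U" "\<sigma> \<in> flags n" shows "U \<notin> lift U ` \<sigma>"
proof
  assume "U \<in> lift U ` \<sigma>"
  then obtain W where "W \<in> \<sigma>" "U = lift U W" by blast
  then show False using lift_psub(2)[OF assms(1) flag_psub[OF assms(2)]] by metis
qed

lemma card_Lift:
  assumes U: "full n U" and s: "\<sigma> \<in> flags n"
  shows "int (card (Lift n U \<sigma>)) = int (card \<sigma>) + (if U = vecs (Suc n) then 0 else 1)"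
proof -
  have "card (lift U ` \<sigma>) = card \<sigma>"
    using inj_on_subset[OF inj_on_lift[OF U]] flag_subsp[OF s] by (intro card_image) auto
  moreover note top_notin_lift[OF U s]
  ultimately show ?thesis using finite_flag[OF s] by (cases "U = vecs (Suc n)") (auto simp: Lift_def)
qed

lemma bot_Lift:
  assumes U: "full n U" and s: "\<sigma> \<in> flags n"
  shows "fbot (Suc n) (Lift n U \<sigma>) = lift U (fbot n \<sigma>)"
proof (cases "\<sigma> = {}")
  case True
  then show ?thesis using lift_top[OF U] by (simp add: fbot_def Lift_def)
next
  case False
  then have "lift U (\<Inter>\<sigma>) = \<Inter>(lift U ` \<sigma>)" by (auto simp: lift_def)
  moreover have "\<Inter>(lift U ` \<sigma>) \<subseteq> U" using False lift_le by blast
  ultimately show ?thesis using False by (auto simp: fbot_def Lift_def)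
qed

lemma vtl_bot_Lift: "full n U \<Longrightarrow> \<sigma> \<in> flags n \<Longrightarrow> vtl ` fbot (Suc n) (Lift n U \<sigma>) = fbot n \<sigma>"
  using bot_Lift vtl_lift subspD(1)[OF bot_subsp] by simp

lemma Lift_inj:
  assumes U: "full n U" and s: "\<sigma> \<in> flags n" "\<sigma>' \<in> flags n" and eq: "Lift n U \<sigma> = Lift n U \<sigma>'"
  shows "\<sigma> = \<sigma>'"
proof -
  have "lift U ` \<sigma> = lift U ` \<sigma>'"
    using eq insert_ident[OF top_notin_lift[OF U s(1)] top_notin_lift[OF U s(2)]]
    by (cases "U = vecs (Suc n)") (simp_all add: Lift_def)
  moreover have "\<sigma> \<subseteq> subsp n" "\<sigma>' \<subseteq> subsp n" using flag_subsp s by blast+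
  ultimately show ?thesis using inj_on_image_eq_iff[OF inj_on_lift[OF U], of \<sigma> \<sigma>'] by simp
qed

text \<open>A subspace of \<open>U\<close> that has the same intersection with $L$ as
  \<open>U\<close> is recovered from its projection, by \<open>lift_vtl\<close>. For the whole space
  this demands that all members contain $e_1$; for a complement it is automatic.\<close>

lemma Lift_surj:
  assumes U: "full n U" and r: "\<rho> \<in> flags (Suc n)" and le: "\<And>X. X \<in> \<rho> \<Longrightarrow> X \<subseteq> U"
    and e: "\<And>X. X \<in> \<rho> \<Longrightarrow> e1 \<in> U \<Longrightarrow> e1 \<in> X" and top: "U \<noteq> vecs (Suc n) \<Longrightarrow> U \<in> \<rho>"
  obtains \<sigma> where "\<sigma> \<in> flags n" "\<rho> = Lift n U \<sigma>"
proof
  let ?s = "(`) vtl ` (\<rho> - {U})"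
  have lv: "lift U (vtl ` X) = X" if "X \<in> \<rho>" for X
    using that lift_vtl[OF U flag_subsp[OF r that] le[OF that] e[OF that]] by blast
  have "vtl ` X \<in> psub n" if "X \<in> \<rho>" "X \<noteq> U" for X
    using that lv[OF that(1)] lift_top[OF U] vtl_subsp[OF flag_subsp[OF r that(1)]] by (auto simp: psub_def)
  moreover have "chain\<^sub>\<subseteq> ?s"
    unfolding chain_subset_def
  proof (intro ballI)
    fix A B assume "A \<in> ?s" "B \<in> ?s"
    then obtain X Y where XY: "X \<in> \<rho>" "A = vtl ` X" "Y \<in> \<rho>" "B = vtl ` Y" by (elim imageE DiffE)
    then have "X \<subseteq> Y \<or> Y \<subseteq> X" using r by (simp add: flags_def chain_subset_def)
    then show "A \<subseteq> B \<or> B \<subseteq> A" using XY image_mono[of X Y vtl] image_mono[of Y X vtl] by auto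
  qed
  ultimately show "?s \<in> flags n" by (simp add: flags_def image_subset_iff)
  have "lift U ` ?s = (\<lambda>X. X) ` (\<rho> - {U})"
    unfolding image_image by (rule image_cong[OF refl]) (simp add: lv)
  then have "lift U ` ?s = \<rho> - {U}" by simp
  moreover have "U \<in> \<rho> \<longleftrightarrow> U \<noteq> vecs (Suc n)" using top r by (auto simp: flags_def psub_def)
  ultimately show "\<rho> = Lift n U ?s" by (auto simp: Lift_def)
qed

lemma insert_Lift: "insert (lift U w) (Lift n U \<sigma>) = Lift n U (insert w \<sigma>)"
  by (auto simp: Lift_def)

lemma sg_Lift:
  assumes U: "full n U" and s: "\<sigma> \<in> flags n" and w: "w \<in> psub n"
  shows "sg (Lift n U \<sigma>) (lift U w) x = sg \<sigma> w x"
proof -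
  have ww: "w \<subseteq> vecs n" using w subspD(1)[of w n] by (auto simp: psub_def)
  have eq: "{t \<in> Lift n U \<sigma>. t \<subset> lift U w} = lift U ` {t \<in> \<sigma>. t \<subset> w}"
  proof -
    have iff: "lift U t \<subset> lift U w \<longleftrightarrow> t \<subset> w" if "t \<in> \<sigma>" for t
      using lift_subset_iff[OF U flag_vecs[OF s that] ww] lift_eq_iff[OF U flag_vecs[OF s that] ww]
      by (simp add: psubset_eq)
    have "\<not> U \<subset> lift U w" using lift_le[of U w] by blast
    moreover have "t \<in> Lift n U \<sigma> \<Longrightarrow> t = U \<or> t \<in> lift U ` \<sigma>" for t
      unfolding Lift_def by (cases "U = vecs (Suc n)") auto
    moreover have "t \<in> lift U ` \<sigma> \<Longrightarrow> t \<in> Lift n U \<sigma>" for t by (simp add: Lift_def)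
    ultimately have "{t \<in> Lift n U \<sigma>. t \<subset> lift U w} = {t \<in> lift U ` \<sigma>. t \<subset> lift U w}"
      by (intro Collect_cong) metis
    also have "\<dots> = lift U ` {t \<in> \<sigma>. lift U t \<subset> lift U w}" by (rule Compr_image_eq)
    also have "{t \<in> \<sigma>. lift U t \<subset> lift U w} = {t \<in> \<sigma>. t \<subset> w}" using iff by (intro Collect_cong conj_cong refl) (simp only:)
    finally show ?thesis .
  qed
  have "{t \<in> \<sigma>. t \<subset> w} \<subseteq> subsp n" using flag_subsp[OF s] by (simp add: Collect_subset subset_iff)
  then have "card (lift U ` {t \<in> \<sigma>. t \<subset> w}) = card {t \<in> \<sigma>. t \<subset> w}"
    by (intro card_image inj_on_subset[OF inj_on_lift[OF U]])
  then show ?thesis by (simp add: sg_def eq)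
qed

lemma Lift_memI: "W \<in> \<sigma> \<Longrightarrow> lift U W \<in> Lift n U \<sigma>"
  by (simp add: Lift_def)

lemma Lift_memE:
  assumes "X \<in> Lift n U \<sigma>" "X \<noteq> U" obtains W where "W \<in> \<sigma>" "X = lift U W"
  using assms unfolding Lift_def by (cases "U = vecs (Suc n)") auto

text \<open>Separates the terms of the boundary at a lifted flag that come from $K^n$ from the
  foreign ones.\<close>

lemma lift_cofaces:
  assumes U: "full n U" and s: "\<sigma> \<in> flags n"
  shows "lift U ` cofaces n \<sigma> = {u \<in> cofaces (Suc n) (Lift n U \<sigma>). u \<subseteq> U \<and> (e1 \<in> U \<longrightarrow> e1 \<in> u)}"
proof (intro equalityI subsetI)
  fix u assume "u \<in> lift U ` cofaces n \<sigma>"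
  then obtain w where w: "w \<notin> \<sigma>" "insert w \<sigma> \<in> flags n" "u = lift U w" by (auto simp: cofaces_def)
  have wp: "w \<in> psub n" "w \<in> subsp n" using w flag_psub[of "insert w \<sigma>"] flag_subsp[of "insert w \<sigma>"] by auto
  have "u \<notin> lift U ` \<sigma>" using w flag_subsp[OF s] wp inj_on_lift[OF U] by (auto dest: inj_onD)
  then have "u \<notin> Lift n U \<sigma>" using lift_psub(2)[OF U wp(1)] w(3) by (auto simp: Lift_def)
  then show "u \<in> {u \<in> cofaces (Suc n) (Lift n U \<sigma>). u \<subseteq> U \<and> (e1 \<in> U \<longrightarrow> e1 \<in> u)}"
    using w Lift_flag[OF U w(2)] lift_le e1_lift[OF wp(2)] by (simp add: cofaces_def insert_Lift)
next
  fix u assume "u \<in> {u \<in> cofaces (Suc n) (Lift n U \<sigma>). u \<subseteq> U \<and> (e1 \<in> U \<longrightarrow> e1 \<in> u)}"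
  then have u: "u \<notin> Lift n U \<sigma>" "insert u (Lift n U \<sigma>) \<in> flags (Suc n)" "u \<subseteq> U" "e1 \<in> U \<Longrightarrow> e1 \<in> u"
    by (auto simp: cofaces_def)
  have le: "X \<subseteq> U" if "X \<in> insert u (Lift n U \<sigma>)" for X
    using that u(3) lift_le by (auto simp: Lift_def split: if_splits)
  have ee: "e1 \<in> X" if "X \<in> insert u (Lift n U \<sigma>)" "e1 \<in> U" for X
    using that u(4) e1_lift flag_subsp[OF s] by (auto simp: Lift_def split: if_splits)
  have top: "U \<in> insert u (Lift n U \<sigma>)" if "U \<noteq> vecs (Suc n)" using that by (simp add: Lift_def)
  obtain \<sigma>' where s': "\<sigma>' \<in> flags n" "insert u (Lift n U \<sigma>) = Lift n U \<sigma>'"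
    using Lift_surj[OF U u(2) le ee top] by blast
  \<comment> \<open>A complement \<open>U\<close> is already a member of the lifted flag, and the
    whole space is not allowed in a flag.\<close>
  have "u \<noteq> U"
  proof
    assume "u = U"
    then have "vecs (Suc n) \<in> insert u (Lift n U \<sigma>)"
      using u(1) unfolding Lift_def by (cases "U = vecs (Suc n)") auto
    then show False using flag_psub[OF u(2)] by (auto simp: psub_def)
  qed
  moreover have "u \<in> Lift n U \<sigma>'" using s'(2) by (metis insertI1)
  ultimately obtain w where w: "w \<in> \<sigma>'" "u = lift U w" by (metis Lift_memE)
  have sub: "W \<in> \<sigma>'" if W: "W \<in> \<sigma>" for W
  proof -
    have "lift U W \<in> Lift n U \<sigma>'" using s'(2) Lift_memI[OF W] by (metis insertI2)
    moreover have "lift U W \<noteq> U" using lift_psub(2)[OF U flag_psub[OF s W]] .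
    ultimately obtain W' where "W' \<in> \<sigma>'" "lift U W = lift U W'" by (metis Lift_memE)
    then show ?thesis using inj_onD[OF inj_on_lift[OF U]] flag_subsp[OF s W] flag_subsp[OF s'(1)] by metis
  qed
  have "w \<notin> \<sigma>" using w u(1) Lift_memI by metis
  moreover have "insert w \<sigma> \<in> flags n" by (rule flags_subset[OF s'(1)]) (simp add: w(1) sub subset_iff)
  ultimately show "u \<in> lift U ` cofaces n \<sigma>" using w by (auto simp: cofaces_def)
qed

definition trace :: "nat \<Rightarrow> (nat \<Rightarrow> 'k) set \<Rightarrow> bool \<Rightarrow> ((nat \<Rightarrow> 'k) set set \<Rightarrow> bool list \<Rightarrow> 'k) \<Rightarrow>
    (nat \<Rightarrow> 'k) set set \<Rightarrow> bool list \<Rightarrow> 'k" where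
  "trace n U b c = (\<lambda>\<sigma>. if \<sigma> \<in> flags n then part b (c (Lift n U \<sigma>)) else (\<lambda>_. \<zero>))"

lemma bd_trace:
  assumes U: "full n U" and s: "\<sigma> \<in> flags n" and c: "c \<in> flag_chains (Suc n) k j"
  shows "bd n (trace n U b c) \<sigma> l =
    (\<Oplus>u\<in>lift U ` cofaces n \<sigma>. sg (Lift n U \<sigma>) u (c (insert u (Lift n U \<sigma>)) (b # l)))"
proof -
  have "cofaces n \<sigma> \<subseteq> subsp n" using cofaces_psub psub_sub by blast
  then have "inj_on (lift U) (cofaces n \<sigma>)" using inj_on_subset[OF inj_on_lift[OF U]] by blast
  then have "(\<Oplus>u\<in>lift U ` cofaces n \<sigma>. sg (Lift n U \<sigma>) u (c (insert u (Lift n U \<sigma>)) (b # l))) =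
    (\<Oplus>w\<in>cofaces n \<sigma>. sg (Lift n U \<sigma>) (lift U w) (c (insert (lift U w) (Lift n U \<sigma>)) (b # l)))"
    using chains_val[OF c] by (intro finsum_reindex) auto
  also have "\<dots> = (\<Oplus>w\<in>cofaces n \<sigma>. sg \<sigma> w (trace n U b c (insert w \<sigma>) l))"
  proof (rule finsum_cong')
    fix w assume w: "w \<in> cofaces n \<sigma>"
    then have "w \<in> psub n" "insert w \<sigma> \<in> flags n" using cofaces_psub by (auto simp: cofaces_def)
    then show "sg (Lift n U \<sigma>) (lift U w) (c (insert (lift U w) (Lift n U \<sigma>)) (b # l)) =
        sg \<sigma> w (trace n U b c (insert w \<sigma>) l)"
      using sg_Lift[OF U s] by (simp add: insert_Lift trace_def part_def)
  qed (auto simp: trace_def part_def chains_val[OF c])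
  finally show ?thesis by (simp add: bd_def)
qed

text \<open>The comparison step of a filtration argument: where two chains agree on the foreign
  cofaces, these terms cancel from both boundaries, and by \<open>bd_trace\<close> the rest is the
  boundary of the trace in $K^n$.\<close>

lemma bd_trace_eq:
  assumes U: "full n U" and c: "c \<in> flag_chains (Suc n) k j" and d: "d \<in> flag_chains (Suc n) k j"
    and eq: "bd (Suc n) c = bd (Suc n) d"
    and out: "\<And>\<sigma> u l. \<sigma> \<in> flags n \<Longrightarrow> u \<in> cofaces (Suc n) (Lift n U \<sigma>) \<Longrightarrow> \<not> (u \<subseteq> U \<and> (e1 \<in> U \<longrightarrow> e1 \<in> u)) \<Longrightarrow>
       c (insert u (Lift n U \<sigma>)) (b # l) = d (insert u (Lift n U \<sigma>)) (b # l)"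
  shows "bd n (trace n U b c) = bd n (trace n U b d)"
proof (intro HOL.ext)
  fix \<sigma> l
  show "bd n (trace n U b c) \<sigma> l = bd n (trace n U b d) \<sigma> l"
  proof (cases "\<sigma> \<in> flags n")
    case False
    then have "cofaces n \<sigma> = {}" using flags_subset[of "insert _ \<sigma>" n \<sigma>] by (auto simp: cofaces_def)
    then show ?thesis by (simp add: bd_def)
  next
    case True
    let ?A = "cofaces (Suc n) (Lift n U \<sigma>)" and ?B = "lift U ` cofaces n \<sigma>"
    let ?f = "\<lambda>c u. sg (Lift n U \<sigma>) u (c (insert u (Lift n U \<sigma>)) (b # l))"
    have sub: "?B \<subseteq> ?A" using lift_cofaces[OF U True] by blast
    have fc: "?f c \<in> ?A \<rightarrow> carrier K" "?f d \<in> ?A \<rightarrow> carrier K"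
      using chains_val[OF c] chains_val[OF d] by auto
    have "finsum K (?f c) ?A = finsum K (?f d) ?A"
      using fun_cong[OF fun_cong[OF eq], of "Lift n U \<sigma>" "b # l"] by (simp add: bd_def)
    moreover have "finsum K (?f c) (?A - ?B) = finsum K (?f d) (?A - ?B)"
    proof (rule finsum_cong')
      fix u assume "u \<in> ?A - ?B"
      then have "u \<in> ?A" "\<not> (u \<subseteq> U \<and> (e1 \<in> U \<longrightarrow> e1 \<in> u))" using lift_cofaces[OF U True] by auto
      then show "?f c u = ?f d u" using out[OF True] by simp
    qed (use fc in auto)
    ultimately have "finsum K (?f c) ?B \<oplus> finsum K (?f d) (?A - ?B) = finsum K (?f d) ?B \<oplus> finsum K (?f d) (?A - ?B)"
      using finsum_subset_diff[OF finite_cofaces sub fc(1)] finsum_subset_diff[OF finite_cofaces sub fc(2)] by simp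
    moreover have "finsum K (?f c) ?B \<in> carrier K" "finsum K (?f d) ?B \<in> carrier K"
      "finsum K (?f d) (?A - ?B) \<in> carrier K"
      using fc sub by (auto intro!: finsum_closed)
    ultimately have "finsum K (?f c) ?B = finsum K (?f d) ?B" by simp
    then show ?thesis by (simp add: bd_trace[OF U True c] bd_trace[OF U True d])
  qed
qed

text \<open>
  \<open>bad\<close> collects the complements of the line spanned by $e_1$. They are the graphs of the linear forms on $K^n$, so there
  are $q^n$ of them; one of these is \<open>hyp\<close>.
\<close>

definition bad :: "nat \<Rightarrow> (nat \<Rightarrow> 'k) set set" where
  "bad n = {U. full n U \<and> U \<noteq> vecs (Suc n)}"

definition hyp :: "nat \<Rightarrow> (nat \<Rightarrow> 'k) set" where
  "hyp n = {v \<in> vecs (Suc n). v 0 = \<zero>}"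

lemma bad_full: "U \<in> bad n \<Longrightarrow> full n U"
  by (simp add: bad_def)

lemma bad_e1: "U \<in> bad n \<Longrightarrow> e1 \<notin> U"
  using full_e1[of n U] by (simp add: bad_def)

lemma bad_psub: "U \<in> bad n \<Longrightarrow> U \<in> psub (Suc n)"
  by (simp add: bad_def psub_def full_def)

lemma finite_bad: "finite (bad n)"
  by (rule finite_subset[OF _ finite_psub[of "Suc n"]]) (auto simp: bad_psub)

text \<open>With \<open>U\<close> also \<open>X\<close> projects onto $K^n$, and being proper it
  misses $e_1$. The projection is then injective on \<open>X\<close> and already onto from
  \<open>U\<close>, so \<open>X\<close> has no room outside \<open>U\<close>.\<close>

lemma bad_max:
  assumes U: "U \<in> bad n" and X: "X \<in> psub (Suc n)" and le: "U \<subseteq> X"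
  shows "X = U"
proof -
  have Xs: "X \<in> subsp (Suc n)" "X \<noteq> vecs (Suc n)" using X by (auto simp: psub_def)
  have "vtl ` X \<subseteq> vecs n" using subspD(1)[OF Xs(1)] vtl_vecs by blast
  moreover have vU: "vtl ` U = vecs n" using U by (simp add: bad_def full_def)
  ultimately have fX: "full n X" using image_mono[OF le, of vtl] Xs(1) by (simp add: full_def)
  have e: "e1 \<notin> X" using full_e1[OF fX] Xs(2) by simp
  have "x \<in> U" if x: "x \<in> X" for x
  proof -
    have "vtl x \<in> vtl ` U" using x fX vU by (metis full_def imageI)
    then obtain u where u: "u \<in> U" "vtl x = vtl u" by blast
    then have "x = u" using inj_onD[OF inj_on_vtl[OF Xs(1) e]] x le by blast
    then show ?thesis using u by simp
  qed
  then show ?thesis using le by blast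
qed

primrec dot :: "nat \<Rightarrow> (nat \<Rightarrow> 'k) \<Rightarrow> (nat \<Rightarrow> 'k) \<Rightarrow> 'k" where
  "dot 0 a w = \<zero>"
| "dot (Suc n) a w = a 0 \<otimes> w 0 \<oplus> dot n (vtl a) (vtl w)"

lemma dot_closed: "a \<in> vecs n \<Longrightarrow> w \<in> vecs n \<Longrightarrow> dot n a w \<in> carrier K"
proof (induction n arbitrary: a w)
  case (Suc n)
  then show ?case using vtl_vecs[of a n] vtl_vecs[of w n] by (auto intro!: a_closed m_closed intro: vecs_val)
qed simp

lemma dot_add:
  "a \<in> vecs n \<Longrightarrow> v \<in> vecs n \<Longrightarrow> w \<in> vecs n \<Longrightarrow> dot n a (\<lambda>i. v i \<oplus> w i) = dot n a v \<oplus> dot n a w"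
proof (induction n arbitrary: a v w)
  case (Suc n)
  have c: "a 0 \<in> carrier K" "v 0 \<in> carrier K" "w 0 \<in> carrier K" using Suc.prems vecs_val by blast+
  have d: "dot n (vtl a) (vtl v) \<in> carrier K" "dot n (vtl a) (vtl w) \<in> carrier K"
    using Suc.prems vtl_vecs dot_closed by blast+
  show ?case using Suc.IH[OF vtl_vecs[OF Suc.prems(1)] vtl_vecs[OF Suc.prems(2)] vtl_vecs[OF Suc.prems(3)]] c d
    by (simp add: vtl_add r_distr a_ac)
qed simp

lemma dot_smult:
  "a \<in> vecs n \<Longrightarrow> b \<in> carrier K \<Longrightarrow> w \<in> vecs n \<Longrightarrow> dot n a (\<lambda>i. b \<otimes> w i) = b \<otimes> dot n a w"
proof (induction n arbitrary: a w)
  case (Suc n)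
  have c: "a 0 \<in> carrier K" "w 0 \<in> carrier K" using Suc.prems vecs_val by blast+
  have d: "dot n (vtl a) (vtl w) \<in> carrier K"
    using Suc.prems vtl_vecs dot_closed by blast+
  show ?case using Suc.IH[OF vtl_vecs[OF Suc.prems(1)] Suc.prems(2) vtl_vecs[OF Suc.prems(3)]] c d Suc.prems(2)
    by (simp add: vtl_smult r_distr m_lcomm)
qed simp

lemma dot_zero: "a \<in> vecs n \<Longrightarrow> dot n a (\<lambda>_. \<zero>) = \<zero>"
  using dot_smult[of a n \<zero> "\<lambda>_. \<zero>"] dot_closed[of a n "\<lambda>_. \<zero>"] by simp

lemma dot_inj:
  "a \<in> vecs n \<Longrightarrow> b \<in> vecs n \<Longrightarrow> (\<And>w. w \<in> vecs n \<Longrightarrow> dot n a w = dot n b w) \<Longrightarrow> a = b"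
proof (induction n arbitrary: a b)
  case 0
  then show ?case by (simp add: vecs_0)
next
  case (Suc n)
  have c: "a 0 \<in> carrier K" "b 0 \<in> carrier K" using Suc.prems vecs_val by blast+
  have t: "vtl a \<in> vecs n" "vtl b \<in> vecs n" using Suc.prems vtl_vecs by blast+
  have "a 0 = b 0"
    using Suc.prems(3)[OF e1_vecs] c t by (simp add: dot_zero) (simp add: e1_def)
  moreover have "vtl a = vtl b"
  proof (rule Suc.IH[OF t])
    fix w assume w: "w \<in> vecs n"
    show "dot n (vtl a) w = dot n (vtl b) w"
      using Suc.prems(3)[OF vecs_cons[OF zero_closed w]] c t dot_closed[OF _ w] by simp
  qed
  ultimately show ?case by (metis cons_vtl)
qed

text \<open>A linear form is determined by its value at $e_1$ and its restriction to the vectors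
  with zero leading coordinate, to which the induction hypothesis applies.\<close>

lemma dot_repr:
  assumes "\<And>w. w \<in> vecs n \<Longrightarrow> h w \<in> carrier K"
    and "\<And>v w. v \<in> vecs n \<Longrightarrow> w \<in> vecs n \<Longrightarrow> h (\<lambda>i. v i \<oplus> w i) = h v \<oplus> h w"
    and "\<And>a w. a \<in> carrier K \<Longrightarrow> w \<in> vecs n \<Longrightarrow> h (\<lambda>i. a \<otimes> w i) = a \<otimes> h w"
  shows "\<exists>a\<in>vecs n. \<forall>w\<in>vecs n. h w = dot n a w"
  using assms
proof (induction n arbitrary: h)
  case 0
  have "h (\<lambda>_. \<zero>) = \<zero>" using 0(3)[OF zero_closed zero_vecs] 0(1)[OF zero_vecs] by simp
  then show ?case by (simp add: vecs_0)
next
  case (Suc n)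
  let ?g = "\<lambda>w. h (case_nat \<zero> w)"
  have cons: "case_nat \<zero> w \<in> vecs (Suc n)" if "w \<in> vecs n" for w using vecs_cons[OF zero_closed that] .
  have add: "case_nat \<zero> (\<lambda>i. v i \<oplus> w i) = (\<lambda>i. case_nat \<zero> v i \<oplus> case_nat \<zero> w i)" for v w :: "nat \<Rightarrow> 'k"
    by (rule HOL.ext) (simp split: nat.splits)
  have sm: "case_nat \<zero> (\<lambda>i. a \<otimes> w i) = (\<lambda>i. a \<otimes> case_nat \<zero> w i)" if "a \<in> carrier K" for a and w :: "nat \<Rightarrow> 'k"
    by (rule HOL.ext) (simp add: that split: nat.splits)
  have "\<exists>a\<in>vecs n. \<forall>w\<in>vecs n. ?g w = dot n a w"
  proof (rule Suc.IH)
    show "?g w \<in> carrier K" if "w \<in> vecs n" for w using Suc.prems(1)[OF cons[OF that]] .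
    show "?g (\<lambda>i. v i \<oplus> w i) = ?g v \<oplus> ?g w" if "v \<in> vecs n" "w \<in> vecs n" for v w
      unfolding add using Suc.prems(2)[OF cons cons] that by blast
    show "?g (\<lambda>i. a \<otimes> w i) = a \<otimes> ?g w" if "a \<in> carrier K" "w \<in> vecs n" for a w
      unfolding sm[OF that(1)] using Suc.prems(3)[OF that(1) cons[OF that(2)]] .
  qed
  then obtain a where a: "a \<in> vecs n" "\<And>w. w \<in> vecs n \<Longrightarrow> ?g w = dot n a w" by blast
  have e: "h e1 \<in> carrier K" using Suc.prems(1)[OF e1_vecs] .
  show ?case
  proof (intro bexI[of _ "case_nat (h e1) a"] ballI vecs_cons e a(1))
    fix w assume w: "w \<in> vecs (Suc n)"
    have w0: "w 0 \<in> carrier K" using vecs_val[OF w] .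
    have t: "vtl w \<in> vecs n" using vtl_vecs[OF w] .
    have "w = (\<lambda>i. w 0 \<otimes> e1 i \<oplus> case_nat \<zero> (vtl w) i)"
      using w0 vecs_val[OF w] by (intro HOL.ext) (simp add: e1_def vtl_def split: nat.splits)
    then have "h w = w 0 \<otimes> h e1 \<oplus> ?g (vtl w)"
      using Suc.prems(2)[OF smult_vecs[OF w0 e1_vecs] cons[OF t]] Suc.prems(3)[OF w0 e1_vecs] by simp
    also have "\<dots> = h e1 \<otimes> w 0 \<oplus> dot n a (vtl w)" using a(2)[OF t] e w0 by (simp add: m_comm)
    finally show "h w = dot (Suc n) (case_nat (h e1) a) w" by simp
  qed
qed

definition graph :: "nat \<Rightarrow> (nat \<Rightarrow> 'k) \<Rightarrow> (nat \<Rightarrow> 'k) set" where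
  "graph n a = {v \<in> vecs (Suc n). v 0 = dot n a (vtl v)}"

lemma graph_cons: "a \<in> vecs n \<Longrightarrow> w \<in> vecs n \<Longrightarrow> b \<in> carrier K \<Longrightarrow> case_nat b w \<in> graph n a \<longleftrightarrow> b = dot n a w"
  using vecs_cons[of b w n] by (simp add: graph_def)

lemma graph_bad:
  assumes a: "a \<in> vecs n" shows "graph n a \<in> bad n"
proof -
  have "graph n a \<in> subsp (Suc n)"
    unfolding subsp_def graph_def
    by (auto simp: vtl_zero vtl_add vtl_smult dot_zero[OF a] dot_add[OF a vtl_vecs vtl_vecs] dot_smult[OF a _ vtl_vecs]
        add_vecs smult_vecs)
  moreover have "vtl ` graph n a = vecs n"
  proof (intro equalityI subsetI)
    fix w assume w: "w \<in> vecs n"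
    then have "case_nat (dot n a w) w \<in> graph n a" using graph_cons[OF a w dot_closed[OF a w]] by simp
    then show "w \<in> vtl ` graph n a" by (rule image_eqI[rotated]) simp
  qed (auto simp: graph_def vtl_vecs)
  moreover have "e1 \<notin> graph n a" using dot_zero[OF a] by (simp add: graph_def) (simp add: e1_def)
  then have "graph n a \<noteq> vecs (Suc n)" using e1_vecs by metis
  ultimately show ?thesis by (simp add: bad_def full_def)
qed

text \<open>The projection is bijective on a complement, and the leading coordinate of its inverse
  is the linear form sought. The inclusion of \<open>U\<close> in the graph is an equality by
  \<open>bad_max\<close>.\<close>

lemma bad_graph:
  assumes U: "U \<in> bad n" shows "\<exists>a\<in>vecs n. U = graph n a"
proof -
  have Us: "U \<in> subsp (Suc n)" and vU: "vtl ` U = vecs n" using U by (auto simp: bad_def full_def)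
  note inj = inj_on_vtl[OF Us bad_e1[OF U]]
  define s where "s = inv_into U vtl"
  have s: "s w \<in> U" "vtl (s w) = w" if "w \<in> vecs n" for w
    using that vU by (auto simp: s_def inv_into_into f_inv_into_f)
  have su: "s (vtl u) = u" if "u \<in> U" for u using that inj by (simp add: s_def)
  have "\<exists>a\<in>vecs n. \<forall>w\<in>vecs n. s w 0 = dot n a w"
  proof (rule dot_repr)
    show "s w 0 \<in> carrier K" if "w \<in> vecs n" for w
      using s(1)[OF that] subspD(1)[OF Us] vecs_val by blast
    show "s (\<lambda>i. v i \<oplus> w i) 0 = s v 0 \<oplus> s w 0" if "v \<in> vecs n" "w \<in> vecs n" for v w
      using su[OF subspD(3)[OF Us s(1)[OF that(1)] s(1)[OF that(2)]]] s(2) that by (simp add: vtl_add)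
    show "s (\<lambda>i. a \<otimes> w i) 0 = a \<otimes> s w 0" if "a \<in> carrier K" "w \<in> vecs n" for a w
      using su[OF subspD(4)[OF Us that(1) s(1)[OF that(2)]]] s(2) that by (simp add: vtl_smult)
  qed
  then obtain a where a: "a \<in> vecs n" "\<And>w. w \<in> vecs n \<Longrightarrow> s w 0 = dot n a w" by blast
  have "U \<subseteq> graph n a"
  proof
    fix v assume v: "v \<in> U"
    then have vv: "v \<in> vecs (Suc n)" using subspD(1)[OF Us] by blast
    then show "v \<in> graph n a" using su[OF v] a(2)[OF vtl_vecs[OF vv]] by (simp add: graph_def)
  qed
  then have "graph n a = U" using bad_max[OF U bad_psub[OF graph_bad[OF a(1)]]] by simp
  then show ?thesis using a(1) by blast
qed

lemma card_bad: "card (bad n) = card (carrier K) ^ n"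
proof -
  have "inj_on (graph n) (vecs n)"
  proof (rule inj_onI)
    fix a b assume a: "a \<in> vecs n" "b \<in> vecs n" and eq: "graph n a = graph n b"
    show "a = b"
    proof (rule dot_inj[OF a])
      fix w assume w: "w \<in> vecs n"
      show "dot n a w = dot n b w"
        using graph_cons[OF a(1) w dot_closed[OF a(1) w]] graph_cons[OF a(2) w dot_closed[OF a(1) w]] eq by simp
    qed
  qed
  moreover have "graph n ` vecs n = bad n" using graph_bad bad_graph by blast
  ultimately show ?thesis using card_image card_vecs by metis
qed

lemma hyp_bad: "hyp n \<in> bad n"
proof -
  have z: "dot m (\<lambda>_. \<zero>) w = \<zero>" if "w \<in> vecs m" for m w
    using that
  proof (induction m arbitrary: w)
    case (Suc m)
    then show ?case using vtl_vecs[of w m] vecs_val[of w "Suc m"] by (simp add: vtl_zero)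
  qed simp
  have "hyp n = graph n (\<lambda>_. \<zero>)"
    unfolding hyp_def graph_def by (rule Collect_cong) (use z vtl_vecs in auto)
  then show ?thesis using graph_bad[OF zero_vecs] by simp
qed

section \<open>The three pieces of a chain\<close>

definition good :: "nat \<Rightarrow> (nat \<Rightarrow> 'k) set set" where
  "good n = {U \<in> psub (Suc n). U \<notin> bad n \<or> U = hyp n}"

definition gflags :: "nat \<Rightarrow> (nat \<Rightarrow> 'k) set set set" where
  "gflags n = {\<rho> \<in> flags (Suc n). \<rho> \<subseteq> good n}"

lemma gflags_flags: "\<rho> \<in> gflags n \<Longrightarrow> \<rho> \<in> flags (Suc n)"
  by (simp add: gflags_def)

lemma gflags_subset: "\<rho> \<in> gflags n \<Longrightarrow> \<tau> \<subseteq> \<rho> \<Longrightarrow> \<tau> \<in> gflags n"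
  using flags_subset[of \<rho> "Suc n" \<tau>] by (auto simp: gflags_def)

lemma finite_gflags: "finite (gflags n)"
  using finite_flags by (simp add: gflags_def)

lemma flag_cases:
  assumes "\<rho> \<in> flags (Suc n)" "\<rho> \<notin> gflags n"
  obtains U where "U \<in> bad n - {hyp n}" "U \<in> \<rho>"
proof -
  obtain U where "U \<in> \<rho>" "U \<notin> good n" using assms by (auto simp: gflags_def)
  then show ?thesis using that[of U] flag_psub[OF assms(1)] by (simp add: good_def)
qed

lemma bad_top:
  assumes "\<rho> \<in> flags (Suc n)" "U \<in> \<rho>" "U \<in> bad n" "X \<in> \<rho>" shows "X \<subseteq> U"
proof -
  have "X \<subseteq> U \<or> U \<subseteq> X" using assms by (simp add: flags_def chain_subset_def)
  then show ?thesis using bad_max[OF assms(3) flag_psub[OF assms(1,4)]] by auto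
qed

lemma Lift_bad:
  assumes r: "\<rho> \<in> flags (Suc n)" "U \<in> \<rho>" "U \<in> bad n"
  obtains \<sigma> where "\<sigma> \<in> flags n" "\<rho> = Lift n U \<sigma>"
proof (rule Lift_surj[OF bad_full[OF r(3)] r(1)])
  show "X \<subseteq> U" if "X \<in> \<rho>" for X using bad_top[OF r that] .
  show "e1 \<in> X" if "X \<in> \<rho>" "e1 \<in> U" for X using bad_e1[OF r(3)] that by blast
  show "U \<in> \<rho>" by (rule r(2))
qed (rule that)

lemma Lift_line:
  assumes r: "\<rho> \<in> flags (Suc n)" "\<And>X. X \<in> \<rho> \<Longrightarrow> e1 \<in> X"
  obtains \<sigma> where "\<sigma> \<in> flags n" "\<rho> = Lift n (vecs (Suc n)) \<sigma>"
proof (rule Lift_surj[OF full_vecs r(1)])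
  show "X \<subseteq> vecs (Suc n)" if "X \<in> \<rho>" for X using flag_vecs[OF r(1) that] .
  show "e1 \<in> X" if "X \<in> \<rho>" for X using r(2)[OF that] .
qed (auto intro: that)

lemma Lift_line_e1:
  assumes "\<sigma> \<in> flags n" "X \<in> Lift n (vecs (Suc n)) \<sigma>" shows "e1 \<in> X"
proof -
  obtain W where "W \<in> \<sigma>" "X = lift (vecs (Suc n)) W" using assms(2) by (auto simp: Lift_def)
  then show ?thesis using e1_lift[OF flag_subsp[OF assms(1)]] e1_vecs by blast
qed

lemma top_mem_Lift: "U \<in> bad n \<Longrightarrow> U \<in> Lift n U \<sigma>"
  by (simp add: Lift_def bad_def)

lemma not_gflags_bad: "U \<in> bad n - {hyp n} \<Longrightarrow> U \<in> \<rho> \<Longrightarrow> \<rho> \<notin> gflags n"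
  by (auto simp: gflags_def good_def)

lemma bad_unique:
  assumes "\<rho> \<in> flags (Suc n)" "U \<in> \<rho>" "U \<in> bad n" "U' \<in> \<rho>" "U' \<in> bad n" shows "U = U'"
  using bad_top[OF assms(1,2,3,4)] bad_top[OF assms(1,4,5,2)] by (rule antisym[rotated])

lemma e1_bot: "e1 \<in> fbot (Suc n) \<rho> \<longleftrightarrow> (\<forall>X\<in>\<rho>. e1 \<in> X)"
  using e1_vecs by (simp add: fbot_def)

text \<open>If some member misses $e_1$, so does the bottom, and by \<open>inj_on_part_False\<close>
  the part $\<omega>_0$ is sufficient.\<close>

lemma chain_determined:
  assumes c: "c \<in> flag_chains (Suc n) k j" and d: "d \<in> flag_chains (Suc n) k j" and r: "\<rho> \<in> flags (Suc n)"
    and p: "part False (c \<rho>) = part False (d \<rho>)"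
    and p': "\<forall>X\<in>\<rho>. e1 \<in> X \<Longrightarrow> part True (c \<rho>) = part True (d \<rho>)"
  shows "c \<rho> = d \<rho>"
proof (cases "e1 \<in> fbot (Suc n) \<rho>")
  case True
  then show ?thesis using ext_eqI[OF chains_ext[OF c] chains_ext[OF d] p] p' by (simp add: e1_bot)
next
  case False
  show ?thesis
    using inj_onD[OF inj_on_part_False[OF bot_subsp[OF r] False] p chains_mem[OF c r] chains_mem[OF d r]] .
qed

text \<open>Recording $\<omega>_0$ is enough: $\<omega>_1$ carries further information only if all
  members contain $L$, and there the trace at the whole space records it.\<close>

definition gres :: "nat \<Rightarrow> ((nat \<Rightarrow> 'k) set set \<Rightarrow> bool list \<Rightarrow> 'k) \<Rightarrow> (nat \<Rightarrow> 'k) set set \<Rightarrow> bool list \<Rightarrow> 'k" where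
  "gres n c = (\<lambda>\<rho>. if \<rho> \<in> gflags n then part False (c \<rho>) else (\<lambda>_. \<zero>))"

definition gchains :: "nat \<Rightarrow> int \<Rightarrow> int \<Rightarrow> ((nat \<Rightarrow> 'k) set set \<Rightarrow> bool list \<Rightarrow> 'k) set" where
  "gchains n k j = ffun {\<rho> \<in> gflags n. int (card \<rho>) = j} (\<lambda>\<rho>. ext_power n k (vtl ` fbot (Suc n) \<rho>)) (\<lambda>_. \<zero>)"

definition split_chain where
  "split_chain n c = (\<lambda>U\<in>bad n - {hyp n}. trace n U False c, trace n (vecs (Suc n)) True c, gres n c)"

lemma chains_zero: "c \<in> flag_chains n k j \<Longrightarrow> int (card \<sigma>) \<noteq> j \<Longrightarrow> c \<sigma> = (\<lambda>_. \<zero>)"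
  using ffun_out[of c "{\<sigma> \<in> flags n. int (card \<sigma>) = j}"] by (simp add: flag_chains_def)

lemma part_False_mem:
  assumes "c \<in> flag_chains (Suc n) k j" "\<rho> \<in> flags (Suc n)"
  shows "part False (c \<rho>) \<in> ext_power n k (vtl ` fbot (Suc n) \<rho>)"
  using imageI[OF chains_mem[OF assms], of "part False"] part_False_image[OF subspD(1)[OF bot_subsp[OF assms(2)]]]
  by simp

lemma trace_False_mem:
  assumes c: "c \<in> flag_chains (Suc n) k j" and U: "U \<in> bad n"
  shows "trace n U False c \<in> flag_chains n k (j - 1)"
  unfolding flag_chains_def
proof (rule ffunI)
  fix \<sigma> assume "\<sigma> \<in> {\<sigma> \<in> flags n. int (card \<sigma>) = j - 1}"
  then have s: "\<sigma> \<in> flags n" by simp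
  show "trace n U False c \<sigma> \<in> ext_power n k (fbot n \<sigma>)"
    using part_False_mem[OF c Lift_flag[OF bad_full[OF U] s]] vtl_bot_Lift[OF bad_full[OF U] s] s
    by (simp add: trace_def)
next
  fix \<sigma> assume s: "\<sigma> \<notin> {\<sigma> \<in> flags n. int (card \<sigma>) = j - 1}"
  show "trace n U False c \<sigma> = (\<lambda>_. \<zero>)"
  proof (cases "\<sigma> \<in> flags n")
    case True
    then have "int (card (Lift n U \<sigma>)) \<noteq> j" using card_Lift[OF bad_full[OF U] True] s U by (simp add: bad_def)
    then show ?thesis using chains_zero[OF c] True by (simp add: trace_def part_zero)
  qed (simp add: trace_def)
qed

lemma trace_True_mem:
  assumes c: "c \<in> flag_chains (Suc n) k j"
  shows "trace n (vecs (Suc n)) True c \<in> flag_chains n (k - 1) j"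
  unfolding flag_chains_def
proof (rule ffunI)
  fix \<sigma> assume "\<sigma> \<in> {\<sigma> \<in> flags n. int (card \<sigma>) = j}"
  then have s: "\<sigma> \<in> flags n" by simp
  note r = Lift_flag[OF full_vecs s]
  show "trace n (vecs (Suc n)) True c \<sigma> \<in> ext_power n (k - 1) (fbot n \<sigma>)"
    using part_True_mem[OF subspD(1)[OF bot_subsp[OF r]] chains_mem[OF c r]] vtl_bot_Lift[OF full_vecs s] s
    by (simp add: trace_def)
next
  fix \<sigma> assume s: "\<sigma> \<notin> {\<sigma> \<in> flags n. int (card \<sigma>) = j}"
  show "trace n (vecs (Suc n)) True c \<sigma> = (\<lambda>_. \<zero>)"
  proof (cases "\<sigma> \<in> flags n")
    case True
    then have "int (card (Lift n (vecs (Suc n)) \<sigma>)) \<noteq> j" using card_Lift[OF full_vecs True] s by simp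
    then show ?thesis using chains_zero[OF c] True by (simp add: trace_def part_zero)
  qed (simp add: trace_def)
qed

lemma gres_mem:
  assumes c: "c \<in> flag_chains (Suc n) k j" shows "gres n c \<in> gchains n k j"
  unfolding gchains_def
proof (rule ffunI)
  fix \<rho> assume "\<rho> \<in> {\<rho> \<in> gflags n. int (card \<rho>) = j}"
  then show "gres n c \<rho> \<in> ext_power n k (vtl ` fbot (Suc n) \<rho>)"
    using part_False_mem[OF c gflags_flags] by (simp add: gres_def)
next
  fix \<rho> assume "\<rho> \<notin> {\<rho> \<in> gflags n. int (card \<rho>) = j}"
  then show "gres n c \<rho> = (\<lambda>_. \<zero>)" using chains_zero[OF c] by (auto simp: gres_def part_zero)
qed

text \<open>A flag with a complement other than $H$ among its members has it as its top and is seen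
  by the trace at that complement alone, through $\<omega>_0$. Every other flag is seen by
  \<open>gres\<close>, and if all its members contain $L$, also by the trace at the whole space,
  through $\<omega>_1$. So the components can be prescribed independently.\<close>

lemma split_chain_bij:
  "bij_betw (split_chain n) (flag_chains (Suc n) k j)
    ((bad n - {hyp n} \<rightarrow>\<^sub>E flag_chains n k (j - 1)) \<times> flag_chains n (k - 1) j \<times> gchains n k j)"
  unfolding bij_betw_def
proof (intro conjI equalityI)
  show "split_chain n ` flag_chains (Suc n) k j \<subseteq>
     (bad n - {hyp n} \<rightarrow>\<^sub>E flag_chains n k (j - 1)) \<times> flag_chains n (k - 1) j \<times> gchains n k j"
  proof (rule image_subsetI)
    fix c assume c: "c \<in> flag_chains (Suc n) k j"
    have "trace n U False c \<in> flag_chains n k (j - 1)" if "U \<in> bad n - {hyp n}" for U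
      using trace_False_mem[OF c] that by blast
    then show "split_chain n c \<in> (bad n - {hyp n} \<rightarrow>\<^sub>E flag_chains n k (j - 1)) \<times> flag_chains n (k - 1) j \<times> gchains n k j"
      using trace_True_mem[OF c] gres_mem[OF c] by (simp add: split_chain_def)
  qed
  show "inj_on (split_chain n) (flag_chains (Suc n) k j)"
  proof (rule inj_onI, rule HOL.ext)
    fix c d \<rho>
    assume c: "c \<in> flag_chains (Suc n) k j" and d: "d \<in> flag_chains (Suc n) k j" and eq: "split_chain n c = split_chain n d"
    have e: "(\<lambda>U\<in>bad n - {hyp n}. trace n U False c) = (\<lambda>U\<in>bad n - {hyp n}. trace n U False d)"
      using eq by (simp only: split_chain_def prod.inject)
    have t: "trace n U False c = trace n U False d" if "U \<in> bad n - {hyp n}" for U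
      using fun_cong[OF e, of U] that by simp
    have l: "trace n (vecs (Suc n)) True c = trace n (vecs (Suc n)) True d" and g: "gres n c = gres n d"
      using eq by (simp_all add: split_chain_def)
    show "c \<rho> = d \<rho>"
    proof (cases "\<rho> \<in> flags (Suc n)")
      case False
      then show ?thesis using ffun_out[of c _ _ _ \<rho>] ffun_out[of d _ _ _ \<rho>] c d by (simp add: flag_chains_def)
    next
      case r: True
      show ?thesis
      proof (rule chain_determined[OF c d r])
        show "part False (c \<rho>) = part False (d \<rho>)"
        proof (cases "\<rho> \<in> gflags n")
          case True
          then show ?thesis using fun_cong[OF g, of \<rho>] by (simp add: gres_def)
        next
          case False
          obtain U where U: "U \<in> bad n - {hyp n}" "U \<in> \<rho>" using flag_cases[OF r False] .
          obtain \<sigma> where "\<sigma> \<in> flags n" "\<rho> = Lift n U \<sigma>" using Lift_bad[OF r U(2)] U(1) by blast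
          then show ?thesis using fun_cong[OF t[OF U(1)], of \<sigma>] by (simp add: trace_def)
        qed
        assume "\<forall>X\<in>\<rho>. e1 \<in> X"
        then obtain \<sigma> where "\<sigma> \<in> flags n" "\<rho> = Lift n (vecs (Suc n)) \<sigma>" using Lift_line[OF r] by blast
        then show "part True (c \<rho>) = part True (d \<rho>)" using fun_cong[OF l, of \<sigma>] by (simp add: trace_def)
      qed
    qed
  qed
  show "(bad n - {hyp n} \<rightarrow>\<^sub>E flag_chains n k (j - 1)) \<times> flag_chains n (k - 1) j \<times> gchains n k j
     \<subseteq> split_chain n ` flag_chains (Suc n) k j"
  proof (rule subsetI)
    fix x assume "x \<in> (bad n - {hyp n} \<rightarrow>\<^sub>E flag_chains n k (j - 1)) \<times> flag_chains n (k - 1) j \<times> gchains n k j"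
    then obtain g a b where x: "x = (g, a, b)" and g: "g \<in> bad n - {hyp n} \<rightarrow>\<^sub>E flag_chains n k (j - 1)"
      and a: "a \<in> flag_chains n (k - 1) j" and b: "b \<in> gchains n k j" by (elim SigmaE) auto
    let ?S = "{\<rho> \<in> flags (Suc n). int (card \<rho>) = j}"
    \<comment> \<open>All that the three components demand of the value at one flag. The demands are
      compatible because \<open>U\<close> and \<open>\<sigma>\<close> are determined by the flag, by
      \<open>bad_unique\<close> and \<open>Lift_inj\<close>.\<close>
    let ?P = "\<lambda>\<rho> \<omega>. \<omega> \<in> ext_power (Suc n) k (fbot (Suc n) \<rho>) \<and>
       (\<forall>U\<in>bad n - {hyp n}. \<forall>\<sigma>\<in>flags n. \<rho> = Lift n U \<sigma> \<longrightarrow> part False \<omega> = g U \<sigma>) \<and>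
       (\<rho> \<in> gflags n \<longrightarrow> part False \<omega> = b \<rho>) \<and>
       (\<forall>\<sigma>\<in>flags n. \<rho> = Lift n (vecs (Suc n)) \<sigma> \<longrightarrow> part True \<omega> = a \<sigma>)"
    have ex: "\<exists>\<omega>. ?P \<rho> \<omega>" if r: "\<rho> \<in> flags (Suc n)" for \<rho>
    proof (cases "\<rho> \<in> gflags n")
      case False
      obtain U where U: "U \<in> bad n - {hyp n}" "U \<in> \<rho>" using flag_cases[OF r False] .
      then have Ub: "U \<in> bad n" by simp
      obtain \<sigma> where s: "\<sigma> \<in> flags n" "\<rho> = Lift n U \<sigma>" using Lift_bad[OF r U(2) Ub] .
      have gU: "g U \<in> flag_chains n k (j - 1)" using PiE_mem[OF g U(1)] .
      have "g U \<sigma> \<in> part False ` ext_power (Suc n) k (fbot (Suc n) \<rho>)"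
        using chains_mem[OF gU s(1)] vtl_bot_Lift[OF bad_full[OF Ub] s(1)] s(2)
          part_False_image[OF subspD(1)[OF bot_subsp[OF r]]] by simp
      then obtain \<omega> where w: "\<omega> \<in> ext_power (Suc n) k (fbot (Suc n) \<rho>)" "part False \<omega> = g U \<sigma>" by auto
      have 1: "part False \<omega> = g U' \<sigma>'" if "U' \<in> bad n - {hyp n}" "\<sigma>' \<in> flags n" "\<rho> = Lift n U' \<sigma>'" for U' \<sigma>'
      proof -
        have "U' \<in> \<rho>" using that top_mem_Lift by blast
        then have "U' = U" using bad_unique[OF r _ _ U(2) Ub] that by blast
        then show ?thesis using Lift_inj[OF bad_full[OF Ub] s(1) that(2)] s(2) that(3) w(2) by simp
      qed
      have 2: "\<rho> \<noteq> Lift n (vecs (Suc n)) \<sigma>'" if "\<sigma>' \<in> flags n" for \<sigma>'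
        using Lift_line_e1[OF that] U(2) bad_e1[OF Ub] by blast
      show ?thesis using w(1) 1 2 False by blast
    next
      case gf: True
      have 1: "\<rho> \<noteq> Lift n U \<sigma>" if "U \<in> bad n - {hyp n}" for U \<sigma>
        using not_gflags_bad[OF that] top_mem_Lift that gf by blast
      have bm: "b \<rho> \<in> ext_power n k (vtl ` fbot (Suc n) \<rho>)"
      proof (cases "int (card \<rho>) = j")
        case True
        then show ?thesis using ffun_mem[OF b[unfolded gchains_def], of \<rho>] gf by simp
      next
        case False
        then have "b \<rho> = (\<lambda>_. \<zero>)" using ffun_out[of b _ _ _ \<rho>] b by (simp add: gchains_def)
        then show ?thesis by (simp add: ext_power.zero)
      qed
      show ?thesis
      proof (cases "\<forall>X\<in>\<rho>. e1 \<in> X")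
        case True
        then obtain \<sigma> where s: "\<sigma> \<in> flags n" "\<rho> = Lift n (vecs (Suc n)) \<sigma>" using Lift_line[OF r] by blast
        have am: "a \<sigma> \<in> ext_power n (k - 1) (vtl ` fbot (Suc n) \<rho>)"
          using chains_mem[OF a s(1)] vtl_bot_Lift[OF full_vecs s(1)] s(2) by simp
        have "glue (b \<rho>) (a \<sigma>) \<in> ext_power (Suc n) k (fbot (Suc n) \<rho>)"
          using glue_mem[OF bot_subsp[OF r] _ bm am] True by (simp add: e1_bot)
        moreover have "a \<sigma>' = a \<sigma>" if "\<sigma>' \<in> flags n" "\<rho> = Lift n (vecs (Suc n)) \<sigma>'" for \<sigma>'
          using Lift_inj[OF full_vecs s(1) that(1)] s(2) that(2) by simp
        ultimately have "?P \<rho> (glue (b \<rho>) (a \<sigma>))" using 1 by (simp add: part_glue)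
        then show ?thesis by blast
      next
        case False
        have "b \<rho> \<in> part False ` ext_power (Suc n) k (fbot (Suc n) \<rho>)"
          using bm part_False_image[OF subspD(1)[OF bot_subsp[OF r]]] by simp
        then obtain \<omega> where w: "\<omega> \<in> ext_power (Suc n) k (fbot (Suc n) \<rho>)" "part False \<omega> = b \<rho>" by auto
        have "\<rho> \<noteq> Lift n (vecs (Suc n)) \<sigma>'" if "\<sigma>' \<in> flags n" for \<sigma>'
          using Lift_line_e1[OF that] False by blast
        then show ?thesis using w 1 by blast
      qed
    qed
    have "\<exists>f. \<forall>\<rho>\<in>flags (Suc n). ?P \<rho> (f \<rho>)" by (rule bchoice) (use ex in blast)
    then obtain f where f: "\<forall>\<rho>\<in>flags (Suc n). ?P \<rho> (f \<rho>)" by (rule exE)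
    define c where "c = (\<lambda>\<rho>. if \<rho> \<in> ?S then f \<rho> else (\<lambda>_. \<zero>))"
    have cP: "?P \<rho> (c \<rho>)" if "\<rho> \<in> ?S" for \<rho>
    proof -
      have e: "c \<rho> = f \<rho>" using that by (simp only: c_def if_True)
      have "\<rho> \<in> flags (Suc n)" using that by simp
      then show ?thesis unfolding e by (rule bspec[OF f])
    qed
    have cc: "c \<in> flag_chains (Suc n) k j" unfolding flag_chains_def
    proof (rule ffunI)
      show "c \<rho> \<in> ext_power (Suc n) k (fbot (Suc n) \<rho>)" if "\<rho> \<in> ?S" for \<rho> using cP[OF that] by (rule conjunct1)
      show "c \<rho> = (\<lambda>_. \<zero>)" if "\<rho> \<notin> ?S" for \<rho> using that by (simp only: c_def if_False)
    qed
    have tU: "trace n U False c = g U" if U: "U \<in> bad n - {hyp n}" for U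
    proof
      fix \<sigma>
      have Ub: "U \<in> bad n" using U by simp
      have gU: "g U \<in> flag_chains n k (j - 1)" using PiE_mem[OF g U] .
      show "trace n U False c \<sigma> = g U \<sigma>"
      proof (cases "\<sigma> \<in> flags n \<and> int (card \<sigma>) = j - 1")
        case True
        then have "Lift n U \<sigma> \<in> ?S"
          using Lift_flag[OF bad_full[OF Ub]] card_Lift[OF bad_full[OF Ub]] Ub by (simp add: bad_def)
        then show ?thesis using cP[of "Lift n U \<sigma>"] U True by (simp add: trace_def)
      next
        case False
        then have "g U \<sigma> = (\<lambda>_. \<zero>)" "trace n U False c \<sigma> = (\<lambda>_. \<zero>)"
          using ffun_out[of "g U" _ _ _ \<sigma>] gU ffun_out[of "trace n U False c" _ _ _ \<sigma>] trace_False_mem[OF cc Ub]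
          by (simp_all add: flag_chains_def)
        then show ?thesis by simp
      qed
    qed
    have tl: "trace n (vecs (Suc n)) True c = a"
    proof
      fix \<sigma>
      show "trace n (vecs (Suc n)) True c \<sigma> = a \<sigma>"
      proof (cases "\<sigma> \<in> flags n \<and> int (card \<sigma>) = j")
        case True
        then have "Lift n (vecs (Suc n)) \<sigma> \<in> ?S"
          using Lift_flag[OF full_vecs] card_Lift[OF full_vecs] by simp
        then show ?thesis using cP[of "Lift n (vecs (Suc n)) \<sigma>"] True by (simp add: trace_def)
      next
        case False
        then have "a \<sigma> = (\<lambda>_. \<zero>)" "trace n (vecs (Suc n)) True c \<sigma> = (\<lambda>_. \<zero>)"
          using ffun_out[of a _ _ _ \<sigma>] a ffun_out[of "trace n (vecs (Suc n)) True c" _ _ _ \<sigma>] trace_True_mem[OF cc]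
          by (simp_all add: flag_chains_def)
        then show ?thesis by simp
      qed
    qed
    have gr: "gres n c = b"
    proof
      fix \<rho>
      show "gres n c \<rho> = b \<rho>"
      proof (cases "\<rho> \<in> gflags n \<and> int (card \<rho>) = j")
        case True
        then have "\<rho> \<in> ?S" using gflags_flags by simp
        then show ?thesis using cP[of \<rho>] True by (simp add: gres_def)
      next
        case False
        then have "b \<rho> = (\<lambda>_. \<zero>)" "gres n c \<rho> = (\<lambda>_. \<zero>)"
          using ffun_out[of b _ _ _ \<rho>] b ffun_out[of "gres n c" _ _ _ \<rho>] gres_mem[OF cc]
          by (simp_all add: gchains_def)
        then show ?thesis by simp
      qed
    qed
    have "(\<lambda>U\<in>bad n - {hyp n}. trace n U False c) = g"
    proof
      fix U
      show "(\<lambda>U\<in>bad n - {hyp n}. trace n U False c) U = g U"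
        using tU[of U] PiE_arb[OF g, of U] by (cases "U \<in> bad n - {hyp n}") (simp_all only: restrict_apply if_True if_False not_False_eq_True)
    qed
    then have "split_chain n c = x" by (simp add: split_chain_def tl gr x)
    then show "x \<in> split_chain n ` flag_chains (Suc n) k j" using cc by blast
  qed
qed

section \<open>An acyclic matching\<close>

text \<open>A good subspace contains $L$, lies in $H$ or is skew. Without skew members a flag falls
  into a part inside $H$ and a part containing $L$, and $y \<inter> H$ fits in between. With skew
  members, everything above the largest of them, $x$, contains $L$, so $x + L$ fits.\<close>

definition skew :: "nat \<Rightarrow> (nat \<Rightarrow> 'k) set set" where
  "skew n = {U \<in> good n. e1 \<notin> U \<and> \<not> U \<subseteq> hyp n}"

text \<open>
  \<open>toggle\<close> is $x + L$ for the largest skew member $x$ of the flag; if there is none, $y \cap H$ for the smallest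
  member $y$ containing $L$; if there is none either, $H$. The \<open>rank\<close> is constant on matched pairs and
  increases along the other incidences, which makes the matching acyclic.
\<close>

definition toggle :: "nat \<Rightarrow> (nat \<Rightarrow> 'k) set set \<Rightarrow> (nat \<Rightarrow> 'k) set" where
  "toggle n \<rho> = (if \<rho> \<inter> skew n \<noteq> {} then lift (vecs (Suc n)) (vtl ` \<Union>(\<rho> \<inter> skew n))
     else if {y \<in> \<rho>. e1 \<in> y} \<noteq> {} then lift (hyp n) (vtl ` \<Inter>{y \<in> \<rho>. e1 \<in> y}) else hyp n)"

definition rank :: "nat \<Rightarrow> (nat \<Rightarrow> 'k) set set \<Rightarrow> nat" where
  "rank n \<rho> = (if \<rho> \<inter> skew n \<noteq> {} then card (vecs (Suc n)) + 2 + card (\<Union>(\<rho> \<inter> skew n))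
     else if {y \<in> \<rho>. e1 \<in> y} \<noteq> {} then card (vecs (Suc n)) + 1 - card (\<Inter>{y \<in> \<rho>. e1 \<in> y}) else 0)"

lemma good_psub: "U \<in> good n \<Longrightarrow> U \<in> psub (Suc n)"
  by (simp add: good_def)

lemma good_subsp: "U \<in> good n \<Longrightarrow> U \<in> subsp (Suc n)"
  using good_psub psub_sub by blast

lemma good_vtl: "U \<in> good n \<Longrightarrow> U \<noteq> hyp n \<Longrightarrow> vtl ` U \<in> psub n"
  using vtl_subsp[of U n] by (auto simp: good_def psub_def bad_def full_def)

lemma goodI_e1: "U \<in> psub (Suc n) \<Longrightarrow> e1 \<in> U \<Longrightarrow> U \<in> good n"
  using bad_e1 by (auto simp: good_def)

lemma hyp_good: "hyp n \<in> good n"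
  using bad_psub[OF hyp_bad] by (simp add: good_def)

lemma hyp_skew: "hyp n \<notin> skew n" and hyp_e1: "e1 \<notin> hyp n"
  using bad_e1[OF hyp_bad] by (auto simp: skew_def)

text \<open>$x + L$ is the preimage of the projection of $x$. It is proper because $x$ is not a
  complement of $L$: the only good complement is $H$, which is not skew.\<close>

lemma join_line:
  assumes x: "x \<in> skew n"
  shows "lift (vecs (Suc n)) (vtl ` x) \<in> good n" "e1 \<in> lift (vecs (Suc n)) (vtl ` x)"
    "x \<subseteq> lift (vecs (Suc n)) (vtl ` x)" "lift (vecs (Suc n)) (vtl ` x) \<notin> skew n"
    "X \<in> subsp (Suc n) \<Longrightarrow> e1 \<in> X \<Longrightarrow> x \<subseteq> X \<Longrightarrow> lift (vecs (Suc n)) (vtl ` x) \<subseteq> X"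
proof -
  let ?x = "lift (vecs (Suc n)) (vtl ` x)"
  have xg: "x \<in> good n" "x \<noteq> hyp n" using x by (auto simp: skew_def)
  note p = good_vtl[OF xg]
  show e: "e1 \<in> ?x" using e1_lift[of "vtl ` x" n] p e1_vecs psub_sub by blast
  show "?x \<in> good n" by (rule goodI_e1[OF lift_psub(1)[OF full_vecs p] e])
  show "x \<subseteq> ?x" using subspD(1)[OF good_subsp[OF xg(1)]] by (auto simp: lift_def)
  show "?x \<notin> skew n" using e by (simp add: skew_def)
  assume X: "X \<in> subsp (Suc n)" "e1 \<in> X" "x \<subseteq> X"
  show "?x \<subseteq> X"
  proof
    fix v assume "v \<in> ?x"
    then have "v \<in> vecs (Suc n)" "vtl v \<in> vtl ` X" using X(3) by (auto simp: lift_def)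
    then show "v \<in> X" using vtl_mem_iff[OF X(1,2)] by blast
  qed
qed

text \<open>$H$ meets every fibre of the projection exactly once, so lifting the projection of $y$
  to $H$ yields $y \<inter> H$ and preserves the projection. As $y$ is proper and contains $L$, that
  projection is proper, and so $y \<inter> H$ is not a complement.\<close>

lemma meet_hyp:
  assumes y: "y \<in> psub (Suc n)" "e1 \<in> y"
  shows "lift (hyp n) (vtl ` y) \<in> good n" "lift (hyp n) (vtl ` y) = y \<inter> hyp n"
    "vtl ` lift (hyp n) (vtl ` y) = vtl ` y" "e1 \<notin> lift (hyp n) (vtl ` y)" "lift (hyp n) (vtl ` y) \<notin> skew n"
proof -
  let ?y = "lift (hyp n) (vtl ` y)"
  have ys: "y \<in> subsp (Suc n)" "y \<noteq> vecs (Suc n)" using y by (auto simp: psub_def)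
  have vs: "vtl ` y \<in> subsp n" using vtl_subsp[OF ys(1)] .
  have hv: "hyp n \<subseteq> vecs (Suc n)" by (auto simp: hyp_def)
  show eq: "?y = y \<inter> hyp n"
    using vtl_mem_iff[OF ys(1) y(2)] hv by (auto simp: lift_def)
  show v: "vtl ` ?y = vtl ` y" using vtl_lift[OF bad_full[OF hyp_bad] subspD(1)[OF vs]] .
  show "e1 \<notin> ?y" using hyp_e1 lift_le by blast
  show "?y \<notin> skew n" using lift_le by (auto simp: skew_def)
  have "vtl ` y \<noteq> vecs n" using full_e1[of n y] ys y(2) by (auto simp: full_def)
  then have "vtl ` y \<in> psub n" using vs by (simp add: psub_def)
  then have "?y \<in> psub (Suc n)" using lift_psub(1)[OF bad_full[OF hyp_bad]] by blast
  moreover have "?y \<notin> bad n" using v \<open>vtl ` y \<noteq> vecs n\<close> by (auto simp: bad_def full_def)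
  ultimately show "?y \<in> good n" by (simp add: good_def)
qed

lemma gflag_good: "\<rho> \<in> gflags n \<Longrightarrow> X \<in> \<rho> \<Longrightarrow> X \<in> good n"
  by (auto simp: gflags_def)

lemma gflag_chain: "\<rho> \<in> gflags n \<Longrightarrow> X \<in> \<rho> \<Longrightarrow> Y \<in> \<rho> \<Longrightarrow> X \<subseteq> Y \<or> Y \<subseteq> X"
  by (simp add: gflags_def flags_def chain_subset_def)

lemma gflag_finite: "\<rho> \<in> gflags n \<Longrightarrow> finite \<rho>"
  using gflags_flags finite_flag by blast

lemma gflag_insertI:
  assumes "\<rho> \<in> gflags n" "m \<in> good n" "\<And>z. z \<in> \<rho> \<Longrightarrow> z \<subseteq> m \<or> m \<subseteq> z"
  shows "insert m \<rho> \<in> gflags n"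
proof -
  have "chain\<^sub>\<subseteq> (insert m \<rho>)"
    unfolding chain_subset_def
  proof (intro ballI)
    fix A B assume "A \<in> insert m \<rho>" "B \<in> insert m \<rho>"
    then show "A \<subseteq> B \<or> B \<subseteq> A"
      using assms(3) gflag_chain[OF assms(1)] by (metis insertE order_refl)
  qed
  then show ?thesis using assms(1,2) good_psub[OF assms(2)] by (simp add: gflags_def flags_def)
qed

text \<open>A member not inside the largest skew member $x$ contains $x$; hence it is neither skew
  nor inside $H$, and thus contains $L$.\<close>

lemma skew_max:
  assumes r: "\<rho> \<in> gflags n" and ne: "\<rho> \<inter> skew n \<noteq> {}"
  shows "\<Union>(\<rho> \<inter> skew n) \<in> \<rho>" "\<Union>(\<rho> \<inter> skew n) \<in> skew n"
    "z \<in> \<rho> \<Longrightarrow> z \<subseteq> \<Union>(\<rho> \<inter> skew n) \<or> lift (vecs (Suc n)) (vtl ` \<Union>(\<rho> \<inter> skew n)) \<subseteq> z"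
proof -
  let ?x = "\<Union>(\<rho> \<inter> skew n)"
  have "chain\<^sub>\<subseteq> (\<rho> \<inter> skew n)" using gflag_chain[OF r] by (simp add: chain_subset_def)
  then have "?x \<in> \<rho> \<inter> skew n" using Union_chain_mem[of "\<rho> \<inter> skew n"] gflag_finite[OF r] ne by simp
  then show x: "?x \<in> \<rho>" "?x \<in> skew n" by simp_all
  assume z: "z \<in> \<rho>"
  show "z \<subseteq> ?x \<or> lift (vecs (Suc n)) (vtl ` ?x) \<subseteq> z"
  proof (rule disjCI)
    assume a: "\<not> lift (vecs (Suc n)) (vtl ` ?x) \<subseteq> z"
    show "z \<subseteq> ?x"
    proof (rule ccontr)
      assume nz: "\<not> z \<subseteq> ?x"
      then have xz: "?x \<subseteq> z" using gflag_chain[OF r z x(1)] by simp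
      have "z \<notin> skew n" using nz z by blast
      moreover have "\<not> z \<subseteq> hyp n" using x(2) xz by (auto simp: skew_def)
      ultimately have "e1 \<in> z" using gflag_good[OF r z] by (simp add: skew_def)
      then show False using join_line(5)[OF x(2) good_subsp[OF gflag_good[OF r z]]] xz a by simp
    qed
  qed
qed

text \<open>Without skew members, a member that misses $e_1$ lies in $H$, and it cannot contain
  $y$.\<close>

lemma line_min:
  assumes r: "\<rho> \<in> gflags n" and sk: "\<rho> \<inter> skew n = {}" and ne: "{y \<in> \<rho>. e1 \<in> y} \<noteq> {}"
  shows "\<Inter>{y \<in> \<rho>. e1 \<in> y} \<in> \<rho>" "e1 \<in> \<Inter>{y \<in> \<rho>. e1 \<in> y}"
    "z \<in> \<rho> \<Longrightarrow> \<Inter>{y \<in> \<rho>. e1 \<in> y} \<subseteq> z \<or> z \<subseteq> lift (hyp n) (vtl ` \<Inter>{y \<in> \<rho>. e1 \<in> y})"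
proof -
  let ?y = "\<Inter>{y \<in> \<rho>. e1 \<in> y}"
  have "chain\<^sub>\<subseteq> {y \<in> \<rho>. e1 \<in> y}" using gflag_chain[OF r] by (simp add: chain_subset_def)
  then have "?y \<in> {y \<in> \<rho>. e1 \<in> y}" using Inter_chain_mem[of "{y \<in> \<rho>. e1 \<in> y}"] gflag_finite[OF r] ne by simp
  then show y: "?y \<in> \<rho>" "e1 \<in> ?y" by blast+
  assume z: "z \<in> \<rho>"
  show "?y \<subseteq> z \<or> z \<subseteq> lift (hyp n) (vtl ` ?y)"
  proof (cases "e1 \<in> z")
    case True
    then show ?thesis using z by blast
  next
    case False
    then have "z \<subseteq> hyp n" using gflag_good[OF r z] z sk by (auto simp: skew_def)
    then show ?thesis
      using gflag_chain[OF r z y(1)] meet_hyp(2)[OF good_psub[OF gflag_good[OF r y(1)]] y(2)]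
      by (metis le_inf_iff)
  qed
qed

lemma in_hyp:
  assumes r: "\<rho> \<in> gflags n" and sk: "\<rho> \<inter> skew n = {}" and ne: "{y \<in> \<rho>. e1 \<in> y} = {}" and z: "z \<in> \<rho>"
  shows "z \<subseteq> hyp n"
  using gflag_good[OF r z] z sk ne by (auto simp: skew_def)

lemma insert_skew: "m \<notin> skew n \<Longrightarrow> insert m \<rho> \<inter> skew n = \<rho> \<inter> skew n"
  and diff_skew: "m \<notin> skew n \<Longrightarrow> (\<rho> - {m}) \<inter> skew n = \<rho> \<inter> skew n"
  by auto

lemma insert_line: "e1 \<notin> m \<Longrightarrow> {y \<in> insert m \<rho>. e1 \<in> y} = {y \<in> \<rho>. e1 \<in> y}"
  and diff_line: "e1 \<notin> m \<Longrightarrow> {y \<in> \<rho> - {m}. e1 \<in> y} = {y \<in> \<rho>. e1 \<in> y}"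
  by auto

text \<open>The toggled member never enters the data that define it: $x + L$ is not skew, and when
  skew members exist only these are consulted; $y \<inter> H$ and $H$ are not skew and do not
  contain $L$. Inserting it changes the bottom only from $y$ to $y \<inter> H$ or, for the empty
  flag, from the whole space to $H$, both with the same projection.\<close>

lemma toggle_stable:
  assumes r: "\<rho> \<in> gflags n"
  shows "insert (toggle n \<rho>) \<rho> \<in> gflags n"
    and "toggle n (insert (toggle n \<rho>) \<rho>) = toggle n \<rho>" "rank n (insert (toggle n \<rho>) \<rho>) = rank n \<rho>"
    and "toggle n (\<rho> - {toggle n \<rho>}) = toggle n \<rho>" "rank n (\<rho> - {toggle n \<rho>}) = rank n \<rho>"
    and "vtl ` fbot (Suc n) (insert (toggle n \<rho>) \<rho>) = vtl ` fbot (Suc n) \<rho>"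
proof -
  let ?m = "toggle n \<rho>" and ?x = "\<Union>(\<rho> \<inter> skew n)" and ?y = "\<Inter>{y \<in> \<rho>. e1 \<in> y}"
  have "insert ?m \<rho> \<in> gflags n \<and> toggle n (insert ?m \<rho>) = ?m \<and> rank n (insert ?m \<rho>) = rank n \<rho> \<and>
    toggle n (\<rho> - {?m}) = ?m \<and> rank n (\<rho> - {?m}) = rank n \<rho> \<and>
    vtl ` fbot (Suc n) (insert ?m \<rho>) = vtl ` fbot (Suc n) \<rho>"
  proof (cases "\<rho> \<inter> skew n = {}")
    case False
    then have m: "?m = lift (vecs (Suc n)) (vtl ` ?x)" by (simp only: toggle_def if_True not_False_eq_True)
    note x = skew_max[OF r False] and j = join_line[OF skew_max(2)[OF r False]]
    have msk: "?m \<notin> skew n" using j(4) m by simp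
    have tog: "toggle n \<rho>' = ?m" "rank n \<rho>' = rank n \<rho>" if "\<rho>' \<inter> skew n = \<rho> \<inter> skew n" for \<rho>'
      using that False by (simp_all add: toggle_def rank_def)
    have "insert ?m \<rho> \<in> gflags n"
    proof (rule gflag_insertI[OF r])
      show "?m \<in> good n" using j(1) m by simp
      show "z \<subseteq> ?m \<or> ?m \<subseteq> z" if "z \<in> \<rho>" for z using x(3)[OF that] j(3) m by auto
    qed
    moreover have "fbot (Suc n) (insert ?m \<rho>) = fbot (Suc n) \<rho>"
    proof -
      have "\<Inter>\<rho> \<subseteq> ?m" using x(1) j(3) m by blast
      moreover have "\<rho> \<noteq> {}" using False by blast
      ultimately show ?thesis by (simp add: fbot_def inf.absorb2)
    qed
    ultimately show ?thesis
      using tog[OF insert_skew[OF msk]] tog[OF diff_skew[OF msk]] by simp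
  next
    case sk: True
    show ?thesis
    proof (cases "{y \<in> \<rho>. e1 \<in> y} = {}")
      case False
      then have m: "?m = lift (hyp n) (vtl ` ?y)" using sk by (simp only: toggle_def if_True if_False not_False_eq_True simp_thms)
      note y = line_min[OF r sk False]
      note h = meet_hyp[OF good_psub[OF gflag_good[OF r y(1)]] y(2)]
      have msk: "?m \<notin> skew n" and me: "e1 \<notin> ?m" using h(4,5) m by simp_all
      have tog: "toggle n \<rho>' = ?m" "rank n \<rho>' = rank n \<rho>"
        if "\<rho>' \<inter> skew n = \<rho> \<inter> skew n" "{y \<in> \<rho>'. e1 \<in> y} = {y \<in> \<rho>. e1 \<in> y}" for \<rho>'
        unfolding toggle_def rank_def that by simp_all
      have my: "?m \<subseteq> ?y" using h(2) m by simp
      have "insert ?m \<rho> \<in> gflags n"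
      proof (rule gflag_insertI[OF r])
        show "?m \<in> good n" using h(1) m by simp
        show "z \<subseteq> ?m \<or> ?m \<subseteq> z" if "z \<in> \<rho>" for z using y(3)[OF that] my m by (metis order_trans)
      qed
      moreover have "vtl ` fbot (Suc n) (insert ?m \<rho>) = vtl ` fbot (Suc n) \<rho>"
      proof -
        have ne: "\<rho> \<noteq> {}" using False by blast
        then have b: "fbot (Suc n) (insert ?m \<rho>) = ?m \<inter> \<Inter>\<rho>" "fbot (Suc n) \<rho> = \<Inter>\<rho>" by (simp_all add: fbot_def)
        show ?thesis
        proof (cases "\<forall>z\<in>\<rho>. ?y \<subseteq> z")
          case True
          then have "\<Inter>\<rho> = ?y" using y(1) by (intro antisym Inter_lower Inter_greatest) auto
          then show ?thesis using b my h(3) m by (simp add: inf.absorb1)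
        next
          case False
          then obtain z where z: "z \<in> \<rho>" "\<not> ?y \<subseteq> z" by blast
          then have "z \<subseteq> ?m" using y(3)[OF z(1)] m by simp
          then have "\<Inter>\<rho> \<subseteq> ?m" using z(1) by blast
          then show ?thesis using b by (simp add: inf.absorb2)
        qed
      qed
      ultimately show ?thesis
        using tog[OF insert_skew[OF msk] insert_line[OF me]] tog[OF diff_skew[OF msk] diff_line[OF me]] by simp
    next
      case ne: True
      have m: "?m = hyp n" using sk ne by (simp add: toggle_def)
      have msk: "?m \<notin> skew n" and me: "e1 \<notin> ?m" using hyp_skew hyp_e1 m by simp_all
      have tog: "toggle n \<rho>' = ?m" "rank n \<rho>' = rank n \<rho>"
        if "\<rho>' \<inter> skew n = \<rho> \<inter> skew n" "{y \<in> \<rho>'. e1 \<in> y} = {y \<in> \<rho>. e1 \<in> y}" for \<rho>'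
        unfolding toggle_def rank_def that by simp_all
      have "insert ?m \<rho> \<in> gflags n"
        using in_hyp[OF r sk ne] m hyp_good by (intro gflag_insertI[OF r]) auto
      moreover have "vtl ` fbot (Suc n) (insert ?m \<rho>) = vtl ` fbot (Suc n) \<rho>"
      proof (cases "\<rho> = {}")
        case True
        have "vtl ` hyp n = vecs n" using bad_full[OF hyp_bad] by (simp add: full_def)
        then show ?thesis using m True by (simp add: fbot_def vtl_vecs_image)
      next
        case False
        then have "\<Inter>\<rho> \<subseteq> ?m" using in_hyp[OF r sk ne] m by blast
        then show ?thesis using False by (simp add: fbot_def inf.absorb2)
      qed
      ultimately show ?thesis
        using tog[OF insert_skew[OF msk] insert_line[OF me]] tog[OF diff_skew[OF msk] diff_line[OF me]] by simp
    qed
  qed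
  then show "insert (toggle n \<rho>) \<rho> \<in> gflags n"
    and "toggle n (insert (toggle n \<rho>) \<rho>) = toggle n \<rho>" "rank n (insert (toggle n \<rho>) \<rho>) = rank n \<rho>"
    and "toggle n (\<rho> - {toggle n \<rho>}) = toggle n \<rho>" "rank n (\<rho> - {toggle n \<rho>}) = rank n \<rho>"
    and "vtl ` fbot (Suc n) (insert (toggle n \<rho>) \<rho>) = vtl ` fbot (Suc n) \<rho>" by simp_all
qed

text \<open>A new member changes the toggle only if it becomes the largest skew member or, in the
  absence of skew members, the smallest member containing $L$. With $N$ the size of the whole space,
  the rank is at least $N + 2$, between 1 and $N$, or 0 in the three cases of \<open>toggle\<close>.
  So a change within a case raises the rank, and so does the step to a case listed before.\<close>

lemma rank_increase:
  assumes t: "\<tau> \<in> gflags n" and i: "insert u \<tau> \<in> gflags n" and ne: "toggle n (insert u \<tau>) \<noteq> toggle n \<tau>"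
  shows "rank n \<tau> < rank n (insert u \<tau>)"
proof -
  let ?N = "card (vecs (Suc n))"
  have card_lt: "card A < card B" if "A \<subset> B" "B \<in> \<tau> \<or> B = u" for A B
  proof -
    have "B \<in> insert u \<tau>" using that(2) by blast
    then have "finite B" using subsp_finite[OF good_subsp[OF gflag_good[OF i]]] by blast
    then show ?thesis using that(1) by (rule psubset_card_mono)
  qed
  show ?thesis
  proof (cases "u \<in> skew n")
    case u: True
    then have iu: "insert u \<tau> \<inter> skew n = insert u (\<tau> \<inter> skew n)" by blast
    show ?thesis
    proof (cases "\<tau> \<inter> skew n = {}")
      case True
      have "rank n \<tau> \<le> ?N + 1" using True by (simp add: rank_def)
      moreover have "rank n (insert u \<tau>) \<ge> ?N + 2" using iu by (simp add: rank_def)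
      ultimately show ?thesis by simp
    next
      case False
      note x = skew_max[OF t False]
      have un: "\<Union>(insert u \<tau> \<inter> skew n) = u \<union> \<Union>(\<tau> \<inter> skew n)" using iu by simp
      have "\<not> u \<subseteq> \<Union>(\<tau> \<inter> skew n)"
      proof
        assume "u \<subseteq> \<Union>(\<tau> \<inter> skew n)"
        then have "\<Union>(insert u \<tau> \<inter> skew n) = \<Union>(\<tau> \<inter> skew n)" using un by (simp add: sup.absorb2)
        then show False using ne False iu by (simp add: toggle_def)
      qed
      moreover have "u \<subseteq> \<Union>(\<tau> \<inter> skew n) \<or> \<Union>(\<tau> \<inter> skew n) \<subseteq> u"
        using gflag_chain[OF i, of u "\<Union>(\<tau> \<inter> skew n)"] x(1) by simp
      ultimately have "\<Union>(\<tau> \<inter> skew n) \<subset> u" by blast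
      moreover from this have "\<Union>(insert u \<tau> \<inter> skew n) = u" using un by (simp add: sup.absorb1 psubset_imp_subset)
      ultimately show ?thesis using card_lt[of "\<Union>(\<tau> \<inter> skew n)" u] False iu by (simp add: rank_def)
    qed
  next
    case u: False
    note isk = insert_skew[OF u, of \<tau>]
    have sk: "\<tau> \<inter> skew n = {}"
    proof (rule ccontr)
      assume "\<tau> \<inter> skew n \<noteq> {}"
      then show False using ne isk by (simp add: toggle_def)
    qed
    have e: "e1 \<in> u"
    proof (rule ccontr)
      assume "e1 \<notin> u"
      then show False using ne unfolding toggle_def isk insert_line[OF \<open>e1 \<notin> u\<close>] by simp
    qed
    have il: "{y \<in> insert u \<tau>. e1 \<in> y} = insert u {y \<in> \<tau>. e1 \<in> y}" using e by blast
    have uN: "card u \<le> ?N"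
      using subspD(1)[OF good_subsp[OF gflag_good[OF i insertI1]]] by (intro card_mono finite_vecs)
    show ?thesis
    proof (cases "{y \<in> \<tau>. e1 \<in> y} = {}")
      case True
      then have "rank n \<tau> = 0" using sk by (simp add: rank_def)
      moreover have "rank n (insert u \<tau>) = ?N + 1 - card u" unfolding rank_def isk sk il True by simp
      ultimately show ?thesis using uN by simp
    next
      case False
      let ?y = "\<Inter>{y \<in> \<tau>. e1 \<in> y}"
      note y = line_min[OF t sk False]
      have "\<not> ?y \<subseteq> u"
      proof
        assume "?y \<subseteq> u"
        then have "u \<inter> ?y = ?y" by (rule inf.absorb2)
        moreover have "toggle n (insert u \<tau>) = lift (hyp n) (vtl ` (u \<inter> ?y))" unfolding toggle_def isk sk il by simp
        moreover have "toggle n \<tau> = lift (hyp n) (vtl ` ?y)"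
          using False sk by (simp only: toggle_def if_True if_False not_False_eq_True simp_thms)
        ultimately show False using ne by simp
      qed
      moreover have "u \<subseteq> ?y \<or> ?y \<subseteq> u" using gflag_chain[OF i, of u ?y] y(1) by simp
      ultimately have uy: "u \<subset> ?y" by blast
      then have "u \<inter> ?y = u" by (simp add: inf.absorb1 psubset_imp_subset)
      moreover have "rank n (insert u \<tau>) = ?N + 1 - card (u \<inter> ?y)" unfolding rank_def isk sk il by simp
      ultimately have r: "rank n (insert u \<tau>) = ?N + 1 - card u" by simp
      have "card u < card ?y" using card_lt[OF uy] y(1) by simp
      moreover have "card ?y \<le> ?N"
        using subspD(1)[OF good_subsp[OF gflag_good[OF t y(1)]]] by (intro card_mono finite_vecs)
      moreover have "rank n \<tau> = ?N + 1 - card ?y"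
        using False sk by (simp only: rank_def if_True if_False not_False_eq_True simp_thms)
      ultimately show ?thesis using r by simp
    qed
  qed
qed

lemma sg_inj: "x \<in> carrier K \<Longrightarrow> y \<in> carrier K \<Longrightarrow> sg \<tau> u x = sg \<tau> u y \<Longrightarrow> x = y"
  by (metis minus_minus sg_def)

text \<open>
  Downward induction on the rank: the boundary at \<open>\<rho> - {toggle n \<rho>}\<close> involves \<open>\<rho>\<close> and otherwise only
  flags where the chains agree by assumption or that have larger rank.
\<close>

lemma gres_determined:
  assumes c: "c \<in> flag_chains (Suc n) k j" and d: "d \<in> flag_chains (Suc n) k j"
    and eq: "bd (Suc n) c = bd (Suc n) d"
    and out: "\<And>\<rho>. \<rho> \<in> flags (Suc n) \<Longrightarrow> \<rho> \<notin> gflags n \<Longrightarrow> c \<rho> = d \<rho>"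
    and supp: "\<And>\<rho>. \<rho> \<in> gflags n \<Longrightarrow> toggle n \<rho> \<notin> \<rho> \<Longrightarrow> part False (c \<rho>) = part False (d \<rho>)"
    and r: "\<rho> \<in> gflags n"
  shows "part False (c \<rho>) = part False (d \<rho>)"
  using r
proof (induction "2 * card (vecs (Suc n)) + 2 - rank n \<rho>" arbitrary: \<rho> rule: less_induct)
  case less
  show ?case
  proof (cases "toggle n \<rho> \<in> \<rho>")
    case False
    then show ?thesis using supp less.prems by blast
  next
    case m: True
    \<comment> \<open>\<open>?B\<close> bounds the rank: $N + 2$ plus the size of a skew member,
      which is at most $N$. The induction is on the distance to this bound.\<close>
    let ?m = "toggle n \<rho>" and ?B = "2 * card (vecs (Suc n)) + 2"
    define \<tau> where "\<tau> = \<rho> - {?m}"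
    have t: "\<tau> \<in> gflags n" "?m \<notin> \<tau>" "insert ?m \<tau> = \<rho>" using gflags_subset[OF less.prems] m by (auto simp: \<tau>_def)
    have tt: "toggle n \<tau> = ?m" "rank n \<tau> = rank n \<rho>" unfolding \<tau>_def by (rule toggle_stable[OF less.prems])+
    have bound: "rank n \<rho>' \<le> ?B" if "\<rho>' \<in> gflags n" for \<rho>'
    proof -
      have "card (\<Union>(\<rho>' \<inter> skew n)) \<le> card (vecs (Suc n))"
        using subspD(1)[OF good_subsp[OF gflag_good[OF that]]] by (intro card_mono finite_vecs) blast
      then show ?thesis by (auto simp: rank_def intro: order_trans[OF diff_le_self])
    qed
    have other: "c (insert u \<tau>) (False # l) = d (insert u \<tau>) (False # l)"
      if u: "u \<in> cofaces (Suc n) \<tau> - {?m}" for u l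
    proof -
      have uf: "insert u \<tau> \<in> flags (Suc n)" "u \<notin> \<tau>" "u \<noteq> ?m" using u by (auto simp: cofaces_def)
      show ?thesis
      proof (cases "insert u \<tau> \<in> gflags n")
        case False
        then show ?thesis using out[OF uf(1)] by simp
      next
        case g: True
        have "part False (c (insert u \<tau>)) = part False (d (insert u \<tau>))"
        proof (cases "toggle n (insert u \<tau>) \<in> insert u \<tau>")
          case False
          then show ?thesis using supp g by blast
        next
          case True
          \<comment> \<open>Otherwise \<open>?m\<close>, the toggle of \<open>\<tau>\<close>, would
            belong to \<open>insert u \<tau>\<close>, but it is neither in \<open>\<tau>\<close> nor
            equal to \<open>u\<close>.\<close>
          then have "toggle n (insert u \<tau>) \<noteq> toggle n \<tau>" using tt t(2) uf(3) by auto
          then have "rank n \<rho> < rank n (insert u \<tau>)" using rank_increase[OF t(1) g] tt by simp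
          then have "?B - rank n (insert u \<tau>) < ?B - rank n \<rho>" using bound[OF g] by simp
          then show ?thesis using less.hyps g by blast
        qed
        then show ?thesis by (simp add: part_def fun_eq_iff)
      qed
    qed
    have mc: "?m \<in> cofaces (Suc n) \<tau>"
      using t(2,3) gflags_flags[OF less.prems] by (simp add: cofaces_def)
    show ?thesis
    proof (rule HOL.ext)
      fix l
      let ?f = "\<lambda>c u. sg \<tau> u (c (insert u \<tau>) (False # l))" and ?A = "cofaces (Suc n) \<tau>"
      have fc: "?f c \<in> ?A \<rightarrow> carrier K" "?f d \<in> ?A \<rightarrow> carrier K" using chains_val[OF c] chains_val[OF d] by auto
      have "finsum K (?f c) ?A = finsum K (?f d) ?A"
        using fun_cong[OF fun_cong[OF eq], of \<tau> "False # l"] by (simp add: bd_def)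
      moreover have "finsum K (?f c) (?A - {?m}) = finsum K (?f d) (?A - {?m})"
        using other fc by (intro finsum_cong') auto
      moreover have "{?m} \<subseteq> ?A" using mc by simp
      ultimately have "finsum K (?f c) {?m} \<oplus> finsum K (?f d) (?A - {?m}) =
          finsum K (?f d) {?m} \<oplus> finsum K (?f d) (?A - {?m})"
        using finsum_subset_diff[OF finite_cofaces _ fc(1), of "{?m}"] finsum_subset_diff[OF finite_cofaces _ fc(2), of "{?m}"]
        by simp
      moreover have "finsum K (?f d) (?A - {?m}) \<in> carrier K" using fc by (intro finsum_closed) auto
      moreover have "finsum K (?f c) {?m} = ?f c ?m" "finsum K (?f d) {?m} = ?f d ?m"
        using chains_val[OF c] chains_val[OF d] by simp_all
      ultimately have "?f c ?m = ?f d ?m" using chains_val[OF c] chains_val[OF d] by simp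
      then show "part False (c \<rho>) l = part False (d \<rho>) l"
        using sg_inj[OF chains_val[OF c] chains_val[OF d]] t(3) by (simp add: part_def)
    qed
  qed
qed

text \<open>This is $f(n,k)$. For $n = 0$ the empty flag is the only one, and its coefficients, the
  $k$-forms over the zero space, are $K$ for $k = 0$ and zero otherwise. In the step to $n = 1$ the
  factor $q^0 - 1$ vanishes, as $H$ is then the only complement of $L$.\<close>

primrec crit :: "nat \<Rightarrow> int \<Rightarrow> nat" where
  "crit 0 k = (if k = 0 then 1 else 0)"
| "crit (Suc n) k = crit n (k - 1) + (card (carrier K) ^ n - 1) * crit n k"

text \<open>Supported on the larger flags of the matched pairs. Two chains whose third components
  lie here both vanish on the smaller flags, as \<open>gres_determined\<close> requires.\<close>

definition gmatched :: "nat \<Rightarrow> int \<Rightarrow> int \<Rightarrow> ((nat \<Rightarrow> 'k) set set \<Rightarrow> bool list \<Rightarrow> 'k) set" where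
  "gmatched n k j = ffun {\<rho> \<in> gflags n. int (card \<rho>) = j \<and> toggle n \<rho> \<in> \<rho>}
     (\<lambda>\<rho>. ext_power n k (vtl ` fbot (Suc n) \<rho>)) (\<lambda>_. \<zero>)"

lemma gmatched_sub: "gmatched n k j \<subseteq> gchains n k j"
proof
  fix c assume c: "c \<in> gmatched n k j"
  show "c \<in> gchains n k j" unfolding gchains_def
  proof (rule ffunI)
    fix \<rho> assume r: "\<rho> \<in> {\<rho> \<in> gflags n. int (card \<rho>) = j}"
    show "c \<rho> \<in> ext_power n k (vtl ` fbot (Suc n) \<rho>)"
    proof (cases "toggle n \<rho> \<in> \<rho>")
      case True
      then show ?thesis using ffun_mem[OF c[unfolded gmatched_def], of \<rho>] r by simp
    next
      case False
      then show ?thesis using ffun_out[OF c[unfolded gmatched_def], of \<rho>] ext_power.zero by simp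
    qed
  next
    fix \<rho> assume "\<rho> \<notin> {\<rho> \<in> gflags n. int (card \<rho>) = j}"
    then show "c \<rho> = (\<lambda>_. \<zero>)" by (intro ffun_out[OF c[unfolded gmatched_def], of \<rho>]) blast
  qed
qed

text \<open>The two flags of a matched pair have $j$ and $j + 1$ members and, the projection of the
  bottom being the same, equal coefficients. So the smaller flags in degree $j$ contribute as much
  as the larger ones in degree $j + 1$.\<close>

lemma card_gchains: "card (gchains n k j) = card (gmatched n k j) * card (gmatched n k (j + 1))"
proof -
  let ?a = "\<lambda>\<rho>. card (ext_power n k (vtl ` fbot (Suc n) \<rho>))"
  let ?S = "\<lambda>j. {\<rho> \<in> gflags n. int (card \<rho>) = j}"
  let ?T = "\<lambda>j. {\<rho> \<in> gflags n. int (card \<rho>) = j \<and> toggle n \<rho> \<in> \<rho>}"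
  have fin: "finite (?S j)" "finite (?T j)" for j using finite_gflags[of n] by simp_all
  have "?S j = ?T j \<union> (?S j - ?T j)" by blast
  then have "prod ?a (?S j) = prod ?a (?T j) * prod ?a (?S j - ?T j)"
    using prod.subset_diff[of "?T j" "?S j" ?a] fin by (simp add: mult.commute Collect_mono)
  moreover have "prod ?a (?S j - ?T j) = prod ?a (?T (j + 1))"
  proof (rule prod.reindex_bij_witness[where i = "\<lambda>\<rho>. \<rho> - {toggle n \<rho>}" and j = "\<lambda>\<rho>. insert (toggle n \<rho>) \<rho>"])
    fix \<rho> assume "\<rho> \<in> ?S j - ?T j"
    then have r: "\<rho> \<in> gflags n" "int (card \<rho>) = j" "toggle n \<rho> \<notin> \<rho>" by simp_all
    note t = toggle_stable[OF r(1)]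
    show "insert (toggle n \<rho>) \<rho> - {toggle n (insert (toggle n \<rho>) \<rho>)} = \<rho>" using t(2) r(3) by simp
    have "int (card (insert (toggle n \<rho>) \<rho>)) = j + 1" using r gflag_finite[OF r(1)] by simp
    then show "insert (toggle n \<rho>) \<rho> \<in> ?T (j + 1)" using t(1,2) by simp
    show "?a (insert (toggle n \<rho>) \<rho>) = ?a \<rho>" using t(6) by simp
  next
    fix \<rho> assume "\<rho> \<in> ?T (j + 1)"
    then have r: "\<rho> \<in> gflags n" "int (card \<rho>) = j + 1" "toggle n \<rho> \<in> \<rho>" by simp_all
    note t = toggle_stable[OF r(1)]
    show "insert (toggle n (\<rho> - {toggle n \<rho>})) (\<rho> - {toggle n \<rho>}) = \<rho>" using t(4) r(3) by auto
    have "card \<rho> = Suc (card (\<rho> - {toggle n \<rho>}))" using gflag_finite[OF r(1)] r(3) by (rule card.remove)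
    then have "int (card (\<rho> - {toggle n \<rho>})) = j" using r(2) by linarith
    moreover have "\<rho> - {toggle n \<rho>} \<in> gflags n" using gflags_subset[OF r(1)] by blast
    ultimately show "\<rho> - {toggle n \<rho>} \<in> ?S j - ?T j" using t(4) by simp
  qed
  ultimately show ?thesis
    unfolding gchains_def gmatched_def by (simp add: card_ffun fin)
qed

text \<open>Two chains of \<open>M j\<close> with equal boundary are compared in a triangular order.
  At a flag with top \<open>U\<close> in \<open>bad n - {hyp n}\<close> there are no foreign
  cofaces, as \<open>U\<close> is maximal, so the traces at \<open>U\<close> agree. This settles all
  flags outside \<open>gflags n\<close>, whereupon \<open>gres_determined\<close> gives $\<omega>_0$
  on the others. The chains now agree at every flag with a member missing $e_1$, and these are the
  foreign cofaces for the remaining trace, that of $\<omega>_1$. The size of \<open>M j\<close> is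
  that of its image under \<open>split_chain n\<close>.\<close>

lemma matching_step:
  assumes M1: "\<And>j. M1 j \<subseteq> flag_chains n k j" "\<And>j. inj_on (bd n) (M1 j)"
    and M2: "\<And>j. M2 j \<subseteq> flag_chains n (k - 1) j" "\<And>j. inj_on (bd n) (M2 j)"
  defines "M \<equiv> \<lambda>j. {c \<in> flag_chains (Suc n) k j. split_chain n c \<in>
    (bad n - {hyp n} \<rightarrow>\<^sub>E M1 (j - 1)) \<times> M2 j \<times> gmatched n k j}"
  shows "inj_on (bd (Suc n)) (M j)"
    and "card (M j) = card (M1 (j - 1)) ^ (card (carrier K) ^ n - 1) * card (M2 j) * card (gmatched n k j)"
proof -
  let ?T = "(bad n - {hyp n} \<rightarrow>\<^sub>E M1 (j - 1)) \<times> M2 j \<times> gmatched n k j"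
  have sub: "?T \<subseteq> (bad n - {hyp n} \<rightarrow>\<^sub>E flag_chains n k (j - 1)) \<times> flag_chains n (k - 1) j \<times> gchains n k j"
    using PiE_mono[of "bad n - {hyp n}" "\<lambda>_. M1 (j - 1)" "\<lambda>_. flag_chains n k (j - 1)"] M1(1) M2(1) gmatched_sub
    by (intro Sigma_mono) auto
  note bij = split_chain_bij[of n k j]
  have inj: "inj_on (split_chain n) (flag_chains (Suc n) k j)" using bij by (rule bij_betw_imp_inj_on)
  have img: "split_chain n ` flag_chains (Suc n) k j =
    (bad n - {hyp n} \<rightarrow>\<^sub>E flag_chains n k (j - 1)) \<times> flag_chains n (k - 1) j \<times> gchains n k j"
    using bij by (rule bij_betw_imp_surj_on)
  have Msub: "M j \<subseteq> flag_chains (Suc n) k j" unfolding M_def by (rule Collect_restrict)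
  have "split_chain n ` M j = ?T"
  proof (intro equalityI subsetI)
    fix x assume "x \<in> split_chain n ` M j"
    then obtain c where "c \<in> M j" "x = split_chain n c" by blast
    then show "x \<in> ?T" by (simp only: M_def mem_Collect_eq)
  next
    fix x assume x: "x \<in> ?T"
    then have "x \<in> split_chain n ` flag_chains (Suc n) k j" unfolding img by (rule subsetD[OF sub])
    then obtain c where "c \<in> flag_chains (Suc n) k j" "x = split_chain n c" by blast
    then show "x \<in> split_chain n ` M j" using x by (intro image_eqI[of _ _ c]) (simp_all only: M_def mem_Collect_eq simp_thms)
  qed
  moreover have "inj_on (split_chain n) (M j)" by (rule inj_on_subset[OF inj Msub])
  ultimately have "card (M j) = card ?T" using card_image by metis
  moreover have "card (bad n - {hyp n}) = card (carrier K) ^ n - 1"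
    using hyp_bad finite_bad card_bad by simp
  ultimately show "card (M j) = card (M1 (j - 1)) ^ (card (carrier K) ^ n - 1) * card (M2 j) * card (gmatched n k j)"
    using finite_bad by (simp add: card_cartesian_product card_PiE)
  show "inj_on (bd (Suc n)) (M j)"
  proof (rule inj_onI)
    fix c d assume cd: "c \<in> M j" "d \<in> M j" and eq: "bd (Suc n) c = bd (Suc n) d"
    have c: "c \<in> flag_chains (Suc n) k j" and d: "d \<in> flag_chains (Suc n) k j" using cd Msub by blast+
    have mem: "(\<lambda>U\<in>bad n - {hyp n}. trace n U False c) \<in> bad n - {hyp n} \<rightarrow>\<^sub>E M1 (j - 1)"
       "trace n (vecs (Suc n)) True c \<in> M2 j" "gres n c \<in> gmatched n k j"
      if "c \<in> M j" for c
      using that by (simp_all only: M_def split_chain_def mem_Collect_eq mem_Times_iff fst_conv snd_conv simp_thms)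
    have tM: "trace n U False c \<in> M1 (j - 1)" if "c \<in> M j" "U \<in> bad n - {hyp n}" for c U
      using PiE_mem[OF mem(1)[OF that(1)] that(2)] that(2) by simp
    have 1: "trace n U False c = trace n U False d" if U: "U \<in> bad n - {hyp n}" for U
    proof -
      have Ub: "U \<in> bad n" using U by simp
      have "bd n (trace n U False c) = bd n (trace n U False d)"
      proof (rule bd_trace_eq[OF bad_full[OF Ub] c d eq])
        fix \<sigma> u l assume u: "u \<in> cofaces (Suc n) (Lift n U \<sigma>)" and nu: "\<not> (u \<subseteq> U \<and> (e1 \<in> U \<longrightarrow> e1 \<in> u))"
        have "u \<subseteq> U" using bad_top[of "insert u (Lift n U \<sigma>)" n U u] u top_mem_Lift[OF Ub] Ub by (simp add: cofaces_def)
        then have False using nu bad_e1[OF Ub] by simp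
        then show "c (insert u (Lift n U \<sigma>)) (False # l) = d (insert u (Lift n U \<sigma>)) (False # l)" ..
      qed
      then show ?thesis using inj_onD[OF M1(2)] tM[OF cd(1) U] tM[OF cd(2) U] by blast
    qed
    have 2: "c \<rho> = d \<rho>" if r: "\<rho> \<in> flags (Suc n)" "\<rho> \<notin> gflags n" for \<rho>
    proof -
      obtain U where U: "U \<in> bad n - {hyp n}" "U \<in> \<rho>" using flag_cases[OF r] .
      then have Ub: "U \<in> bad n" by simp
      obtain \<sigma> where s: "\<sigma> \<in> flags n" "\<rho> = Lift n U \<sigma>" using Lift_bad[OF r(1) U(2) Ub] .
      show ?thesis
      proof (rule chain_determined[OF c d r(1)])
        show "part False (c \<rho>) = part False (d \<rho>)" using fun_cong[OF 1[OF U(1)], of \<sigma>] s by (simp add: trace_def)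
        assume "\<forall>X\<in>\<rho>. e1 \<in> X"
        then show "part True (c \<rho>) = part True (d \<rho>)" using U(2) bad_e1[OF Ub] by blast
      qed
    qed
    \<comment> \<open>Both chains of \<open>M j\<close> have zero $\<omega>_0$ on the smaller flags
      of the pairs, which gives the hypothesis \<open>supp\<close> of
      \<open>gres_determined\<close>.\<close>
    have z: "part False (c \<rho>) = (\<lambda>_. \<zero>)" if "c \<in> M j" "\<rho> \<in> gflags n" "toggle n \<rho> \<notin> \<rho>" for c \<rho>
      using ffun_out[OF mem(3)[OF that(1), unfolded gmatched_def], of \<rho>] that(2,3) by (simp add: gres_def)
    have 3: "part False (c \<rho>) = part False (d \<rho>)" if "\<rho> \<in> gflags n" for \<rho>
      by (rule gres_determined[OF c d eq 2 _ that]) (simp_all add: z[OF cd(1)] z[OF cd(2)])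
    have 4: "c \<rho> = d \<rho>" if r: "\<rho> \<in> flags (Suc n)" and e: "\<not> (\<forall>X\<in>\<rho>. e1 \<in> X)" for \<rho>
    proof (cases "\<rho> \<in> gflags n")
      case True
      show ?thesis by (rule chain_determined[OF c d r 3[OF True]]) (use e in blast)
    qed (rule 2[OF r])
    have "bd n (trace n (vecs (Suc n)) True c) = bd n (trace n (vecs (Suc n)) True d)"
    proof (rule bd_trace_eq[OF full_vecs c d eq])
      fix \<sigma> u l assume u: "u \<in> cofaces (Suc n) (Lift n (vecs (Suc n)) \<sigma>)"
        and nu: "\<not> (u \<subseteq> vecs (Suc n) \<and> (e1 \<in> vecs (Suc n) \<longrightarrow> e1 \<in> u))"
      let ?r = "insert u (Lift n (vecs (Suc n)) \<sigma>)"
      have f: "?r \<in> flags (Suc n)" using u by (simp add: cofaces_def)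
      have "e1 \<notin> u" using nu flag_vecs[OF f insertI1] by simp
      then have "c ?r = d ?r" by (intro 4[OF f]) simp
      then show "c ?r (True # l) = d ?r (True # l)" by simp
    qed
    then have 5: "trace n (vecs (Suc n)) True c = trace n (vecs (Suc n)) True d"
      using inj_onD[OF M2(2)] mem(2)[OF cd(1)] mem(2)[OF cd(2)] by blast
    have "gres n c = gres n d" using 3 by (intro HOL.ext) (simp add: gres_def)
    moreover have "(\<lambda>U\<in>bad n - {hyp n}. trace n U False c) = (\<lambda>U\<in>bad n - {hyp n}. trace n U False d)"
      using 1 by (rule restrict_ext)
    ultimately have "split_chain n c = split_chain n d" using 5 by (simp only: split_chain_def)
    then show "c = d" using inj_onD[OF inj] c d by blast
  qed
qed

lemma flags_0: "flags 0 = {{}}"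
proof -
  have "subsp 0 \<subseteq> {vecs 0}"
  proof
    fix U assume "U \<in> subsp 0"
    then show "U \<in> {vecs 0}" using subspD(1,2)[of U 0] by (auto simp: vecs_0)
  qed
  then have "psub 0 = {}" by (auto simp: psub_def)
  then show ?thesis by (auto simp: flags_def chain_subset_def)
qed

lemma card_ext_power_0: "card (ext_power 0 k (vecs 0)) = (if k = 0 then card (carrier K) else 1)"
proof (cases "k < 0")
  case True
  then show ?thesis by (simp add: ext_power_neg_degree)
next
  case False
  then obtain m where m: "k = int m" by (metis not_less zero_le_imp_eq_int)
  have "card (vecs 0) = card (carrier K) ^ 0" by (simp add: vecs_0)
  from card_ext_power[OF vecs_subsp this, of m] show ?thesis using m by (cases m) simp_all
qed

text \<open>The critical conditions of the two kinds of smaller complexes, $j - 1 = n - k$ and $j =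
  n - (k - 1)$, both say $j = (n + 1) - k$. So the exceptional factors meet in one degree, where
  their exponents add up by the recursion of \<open>crit\<close>; by \<open>card_gchains\<close> the
  matched flags contribute no such factor. For $n = 0$ the sets consist of the zero chain.\<close>

lemma matching_exists:
  "\<exists>M. \<forall>j. M j \<subseteq> flag_chains n k j \<and> inj_on (bd n) (M j) \<and>
     card (flag_chains n k j) = card (M j) * card (M (j + 1)) *
       (if j = int n - k then card (carrier K) ^ crit n k else 1)"
proof (induction n arbitrary: k)
  case 0
  let ?M = "\<lambda>j :: int. {\<lambda>(\<sigma> :: (nat \<Rightarrow> 'k) set set) (l :: bool list). \<zero>}"
  have "?M j \<subseteq> flag_chains 0 k j" for j
    unfolding flag_chains_def by (auto intro!: ffunI ext_power.zero)
  moreover have "card (flag_chains 0 k j) = (if j = int 0 - k then card (carrier K) ^ crit 0 k else 1)" for j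
  proof (cases "j = 0")
    case True
    have S: "{\<sigma> \<in> flags 0. int (card \<sigma>) = j} = {{}}" unfolding flags_0 True by auto
    have "card (flag_chains 0 k j) = card (ext_power 0 k (vecs 0))"
      unfolding flag_chains_def by (subst card_ffun) (simp_all add: S fbot_def)
    then show ?thesis using True by (simp add: card_ext_power_0)
  next
    case False
    then have S: "{\<sigma> \<in> flags 0. int (card \<sigma>) = j} = {}" unfolding flags_0 by auto
    have "card (flag_chains 0 k j) = 1" unfolding flag_chains_def by (subst card_ffun) (simp_all add: S)
    then show ?thesis using False by simp
  qed
  ultimately show ?case by (intro exI[of _ ?M]) simp
next
  case (Suc n)
  let ?q = "card (carrier K)" and ?N = "card (carrier K) ^ n - 1"
  obtain M1 where M1: "\<And>j. M1 j \<subseteq> flag_chains n k j" "\<And>j. inj_on (bd n) (M1 j)"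
    "\<And>j. card (flag_chains n k j) = card (M1 j) * card (M1 (j + 1)) * (if j = int n - k then ?q ^ crit n k else 1)"
    using Suc.IH[of k] by blast
  obtain M2 where M2: "\<And>j. M2 j \<subseteq> flag_chains n (k - 1) j" "\<And>j. inj_on (bd n) (M2 j)"
    "\<And>j. card (flag_chains n (k - 1) j) = card (M2 j) * card (M2 (j + 1)) * (if j = int n - (k - 1) then ?q ^ crit n (k - 1) else 1)"
    using Suc.IH[of "k - 1"] by blast
  define M where "M = (\<lambda>j. {c \<in> flag_chains (Suc n) k j. split_chain n c \<in>
    (bad n - {hyp n} \<rightarrow>\<^sub>E M1 (j - 1)) \<times> M2 j \<times> gmatched n k j})"
  have sub: "M j \<subseteq> flag_chains (Suc n) k j" for j unfolding M_def by (rule Collect_restrict)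
  have step: "inj_on (bd (Suc n)) (M j)"
    "card (M j) = card (M1 (j - 1)) ^ ?N * card (M2 j) * card (gmatched n k j)" for j
    unfolding M_def by (rule matching_step[OF M1(1,2) M2(1,2)])+
  have "card (flag_chains (Suc n) k j) = card (M j) * card (M (j + 1)) *
      (if j = int (Suc n) - k then ?q ^ crit (Suc n) k else 1)" for j
  proof -
    have "card (flag_chains (Suc n) k j) =
      card (flag_chains n k (j - 1)) ^ ?N * (card (flag_chains n (k - 1) j) * card (gchains n k j))"
      using bij_betw_same_card[OF split_chain_bij[of n k j]] finite_bad[of n] hyp_bad[of n] card_bad[of n]
      by (simp add: card_cartesian_product card_PiE)
    also have "\<dots> = (card (M1 (j - 1)) * card (M1 j) * (if j - 1 = int n - k then ?q ^ crit n k else 1)) ^ ?N *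
       (card (M2 j) * card (M2 (j + 1)) * (if j = int n - (k - 1) then ?q ^ crit n (k - 1) else 1) *
        (card (gmatched n k j) * card (gmatched n k (j + 1))))"
      using M1(3)[of "j - 1"] M2(3)[of j] card_gchains[of n k j] by simp
    also have "\<dots> = card (M j) * card (M (j + 1)) * (if j = int (Suc n) - k then ?q ^ crit (Suc n) k else 1)"
      unfolding step(2)
      by (auto simp: power_mult_distrib power_add power_mult[symmetric] mult.commute mult.left_commute)
    finally show ?thesis .
  qed
  then show ?case using sub step(1) by (intro exI[of _ M]) blast
qed

section \<open>Cycles and boundaries of the model complex\<close>

lemma ext_power_finsum:
  assumes "finite A" "U \<subseteq> vecs n" "\<And>u. u \<in> A \<Longrightarrow> g u \<in> ext_power n k U"
  shows "(\<lambda>l. \<Oplus>u\<in>A. g u l) \<in> ext_power n k U"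
  using assms(1,3)
proof (induction A rule: finite_induct)
  case empty
  then show ?case by (simp add: ext_power.zero)
next
  case (insert a A)
  have v: "g u l \<in> carrier K" if "u \<in> insert a A" for u l
    using ext_val[OF ext_power_ext[OF assms(2) insert.prems[OF that]]] .
  have "(\<lambda>l. \<Oplus>u\<in>insert a A. g u l) = (\<lambda>l. g a l \<oplus> (\<Oplus>u\<in>A. g u l))"
    using insert.hyps v by (intro HOL.ext finsum_insert) auto
  then show ?case using ext_power_add[OF assms(2)] insert by simp
qed

lemma bd_mem:
  assumes c: "c \<in> flag_chains n k j" shows "bd n c \<in> flag_chains n k (j - 1)"
  unfolding flag_chains_def
proof (rule ffunI)
  fix \<tau> assume "\<tau> \<in> {\<sigma> \<in> flags n. int (card \<sigma>) = j - 1}"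
  then have t: "\<tau> \<in> flags n" by simp
  note tv = subspD(1)[OF bot_subsp[OF t]]
  show "bd n c \<tau> \<in> ext_power n k (fbot n \<tau>)"
    unfolding bd_def
  proof (rule ext_power_finsum[OF finite_cofaces tv])
    fix u assume "u \<in> cofaces n \<tau>"
    then have f: "insert u \<tau> \<in> flags n" by (simp add: cofaces_def)
    have "c (insert u \<tau>) \<in> ext_power n k (fbot n \<tau>)"
      using ext_power_mono[OF bot_antimono[OF f subset_insertI]] chains_mem[OF c f] by blast
    then show "(\<lambda>l. sg \<tau> u (c (insert u \<tau>) l)) \<in> ext_power n k (fbot n \<tau>)"
      using ext_power_neg[OF tv] by (cases "even (card {t \<in> \<tau>. t \<subset> u})") (simp_all add: sg_def)
  qed
next
  fix \<tau> assume t: "\<tau> \<notin> {\<sigma> \<in> flags n. int (card \<sigma>) = j - 1}"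
  have "c (insert u \<tau>) = (\<lambda>_. \<zero>)" if "u \<in> cofaces n \<tau>" for u
  proof (rule chains_zero[OF c])
    have u: "insert u \<tau> \<in> flags n" "u \<notin> \<tau>" using that by (simp_all add: cofaces_def)
    have "\<tau> \<in> flags n" using flags_subset[OF u(1) subset_insertI] .
    then show "int (card (insert u \<tau>)) \<noteq> j" using t u(2) finite_flag[of \<tau> n] by simp
  qed
  then have "(\<Oplus>u\<in>cofaces n \<tau>. sg \<tau> u (c (insert u \<tau>) l)) = (\<Oplus>u\<in>cofaces n \<tau>. \<zero>)" for l
    by (intro finsum_cong') simp_all
  then show "bd n c \<tau> = (\<lambda>_. \<zero>)" by (simp add: bd_def)
qed

lemma sg_add: "x \<in> carrier K \<Longrightarrow> y \<in> carrier K \<Longrightarrow> sg \<tau> u (x \<oplus> y) = sg \<tau> u x \<oplus> sg \<tau> u y"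
  by (simp add: sg_def minus_add)

lemma chains_add:
  assumes "c \<in> flag_chains n k j" "d \<in> flag_chains n k j"
  shows "(\<lambda>\<sigma> l. c \<sigma> l \<oplus> d \<sigma> l) \<in> flag_chains n k j"
  unfolding flag_chains_def
proof (rule ffunI)
  fix \<sigma> assume "\<sigma> \<in> {\<sigma> \<in> flags n. int (card \<sigma>) = j}"
  then show "(\<lambda>l. c \<sigma> l \<oplus> d \<sigma> l) \<in> ext_power n k (fbot n \<sigma>)"
    using ext_power_add[OF subspD(1)[OF bot_subsp] chains_mem[OF assms(1)] chains_mem[OF assms(2)]] by simp
next
  fix \<sigma> assume "\<sigma> \<notin> {\<sigma> \<in> flags n. int (card \<sigma>) = j}"
  then have "c \<sigma> = (\<lambda>_. \<zero>)" "d \<sigma> = (\<lambda>_. \<zero>)"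
    using ffun_out[OF assms(1)[unfolded flag_chains_def]] ffun_out[OF assms(2)[unfolded flag_chains_def]] by blast+
  then show "(\<lambda>l. c \<sigma> l \<oplus> d \<sigma> l) = (\<lambda>_. \<zero>)" by simp
qed

lemma chains_neg:
  assumes "c \<in> flag_chains n k j" shows "(\<lambda>\<sigma> l. \<ominus> c \<sigma> l) \<in> flag_chains n k j"
  unfolding flag_chains_def
proof (rule ffunI)
  fix \<sigma> assume "\<sigma> \<in> {\<sigma> \<in> flags n. int (card \<sigma>) = j}"
  then show "(\<lambda>l. \<ominus> c \<sigma> l) \<in> ext_power n k (fbot n \<sigma>)"
    using ext_power_neg[OF subspD(1)[OF bot_subsp] chains_mem[OF assms(1)]] by simp
next
  fix \<sigma> assume "\<sigma> \<notin> {\<sigma> \<in> flags n. int (card \<sigma>) = j}"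
  then have "c \<sigma> = (\<lambda>_. \<zero>)" using ffun_out[OF assms(1)[unfolded flag_chains_def]] by blast
  then show "(\<lambda>l. \<ominus> c \<sigma> l) = (\<lambda>_. \<zero>)" by simp
qed

lemma bd_add:
  assumes c: "c \<in> flag_chains n k j" and d: "d \<in> flag_chains n k j"
  shows "bd n (\<lambda>\<sigma> l. c \<sigma> l \<oplus> d \<sigma> l) = (\<lambda>\<sigma> l. bd n c \<sigma> l \<oplus> bd n d \<sigma> l)"
proof (intro HOL.ext)
  fix \<tau> l
  have "bd n (\<lambda>\<sigma> l. c \<sigma> l \<oplus> d \<sigma> l) \<tau> l =
      (\<Oplus>u\<in>cofaces n \<tau>. sg \<tau> u (c (insert u \<tau>) l) \<oplus> sg \<tau> u (d (insert u \<tau>) l))"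
    unfolding bd_def using chains_val[OF c] chains_val[OF d] by (intro finsum_cong') (simp_all add: sg_add)
  also have "\<dots> = bd n c \<tau> l \<oplus> bd n d \<tau> l"
    unfolding bd_def using chains_val[OF c] chains_val[OF d] by (intro finsum_addf) auto
  finally show "bd n (\<lambda>\<sigma> l. c \<sigma> l \<oplus> d \<sigma> l) \<tau> l = bd n c \<tau> l \<oplus> bd n d \<tau> l" .
qed

lemma finsum_neg:
  assumes "finite A" "f \<in> A \<rightarrow> carrier K" shows "(\<Oplus>x\<in>A. \<ominus> f x) = \<ominus> (\<Oplus>x\<in>A. f x)"
  using assms
proof (induction A rule: finite_induct)
  case (insert a A)
  then show ?case by (simp add: minus_add Pi_iff finsum_closed)
qed simp

text \<open>The terms for $(u, v)$ and $(v, u)$ concern the same flag and have opposite signs: if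
  $v$ lies below $u$, adding $v$ to \<open>\<tau>\<close> raises the number of members below $u$ by
  one, whereas adding $u$ does not affect the number below $v$. \<open>g\<close> and
  \<open>h\<close> separate the two orders of a pair and are extended by zero to all of
  \<open>psub n\<close>, so that the summations can be exchanged.\<close>

lemma bd_bd:
  assumes c: "c \<in> flag_chains n k j" shows "bd n (bd n c) = (\<lambda>_ _. \<zero>)"
proof (intro HOL.ext)
  fix \<tau> l
  let ?P = "psub n" and ?I = "\<lambda>u v. u \<in> cofaces n \<tau> \<and> v \<in> cofaces n (insert u \<tau>)"
  let ?f = "\<lambda>u v. sg \<tau> u (sg (insert u \<tau>) v (c (insert v (insert u \<tau>)) l))"
  define g where "g = (\<lambda>u v. if ?I u v \<and> u \<subset> v then ?f u v else \<zero>)"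
  define h where "h = (\<lambda>u v. if ?I u v \<and> v \<subset> u then ?f u v else \<zero>)"
  have cl: "?f u v \<in> carrier K" for u v using chains_val[OF c] by simp
  have gc: "g u v \<in> carrier K" and hc: "h u v \<in> carrier K" for u v using cl by (simp_all add: g_def h_def)
  have sum_sg: "sg \<tau> u (\<Oplus>v\<in>A. a v) = (\<Oplus>v\<in>A. sg \<tau> u (a v))" if "finite A" "a \<in> A \<rightarrow> carrier K" for u A and a :: "(nat \<Rightarrow> 'k) set \<Rightarrow> 'k"
    using finsum_neg[OF that] by (simp add: sg_def)
  have I_cmp: "u \<subset> v \<or> v \<subset> u" if "?I u v" for u v
  proof -
    have "insert v (insert u \<tau>) \<in> flags n" "u \<noteq> v" using that by (auto simp: cofaces_def)
    then have "u \<subseteq> v \<or> v \<subseteq> u" by (simp add: flags_def chain_subset_def)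
    then show ?thesis using \<open>u \<noteq> v\<close> by blast
  qed
  have inner: "sg \<tau> u (bd n c (insert u \<tau>) l) = (\<Oplus>v\<in>?P. g u v \<oplus> h u v)" if u: "u \<in> cofaces n \<tau>" for u
  proof -
    have "sg \<tau> u (bd n c (insert u \<tau>) l) = (\<Oplus>v\<in>cofaces n (insert u \<tau>). ?f u v)"
      unfolding bd_def using chains_val[OF c] by (intro sum_sg finite_cofaces) simp
    also have "\<dots> = (\<Oplus>v\<in>cofaces n (insert u \<tau>). g u v \<oplus> h u v)"
    proof (rule finsum_cong')
      fix v assume "v \<in> cofaces n (insert u \<tau>)"
      then have I: "?I u v" using u by simp
      show "?f u v = g u v \<oplus> h u v"
      proof (cases "u \<subset> v")
        case True
        then have "\<not> v \<subset> u" by (simp add: less_not_sym)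
        then show ?thesis using True I cl by (simp add: g_def h_def)
      next
        case False
        then have "v \<subset> u" using I_cmp[OF I] by simp
        then show ?thesis using False I cl by (simp add: g_def h_def)
      qed
    qed (use gc hc in auto)
    also have "\<dots> = (\<Oplus>v\<in>?P. g u v \<oplus> h u v)"
    proof (rule finsum_mono_neutral[OF finite_psub cofaces_psub])
      show "(\<lambda>v. g u v \<oplus> h u v) \<in> cofaces n (insert u \<tau>) \<rightarrow> carrier K" using gc hc by simp
      show "g u v \<oplus> h u v = \<zero>" if "v \<in> ?P - cofaces n (insert u \<tau>)" for v
        using that by (simp add: g_def h_def)
    qed
    finally show ?thesis .
  qed
  have "bd n (bd n c) \<tau> l = (\<Oplus>u\<in>cofaces n \<tau>. \<Oplus>v\<in>?P. g u v \<oplus> h u v)"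
    unfolding bd_def[of n "bd n c"] using inner gc hc by (intro finsum_cong') (auto intro!: finsum_closed)
  also have "\<dots> = (\<Oplus>u\<in>?P. \<Oplus>v\<in>?P. g u v \<oplus> h u v)"
  proof (rule finsum_mono_neutral[OF finite_psub cofaces_psub])
    show "(\<lambda>u. \<Oplus>v\<in>?P. g u v \<oplus> h u v) \<in> cofaces n \<tau> \<rightarrow> carrier K"
      using gc hc by (auto intro!: finsum_closed)
    fix u assume "u \<in> ?P - cofaces n \<tau>"
    then have "g u v \<oplus> h u v = \<zero>" for v by (simp add: g_def h_def)
    then show "(\<Oplus>v\<in>?P. g u v \<oplus> h u v) = \<zero>" by simp
  qed
  also have "\<dots> = (\<Oplus>u\<in>?P. (\<Oplus>v\<in>?P. g u v) \<oplus> (\<Oplus>v\<in>?P. h u v))"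
    using gc hc by (intro finsum_cong') (auto intro!: finsum_closed finsum_addf)
  also have "\<dots> = (\<Oplus>u\<in>?P. \<Oplus>v\<in>?P. g u v) \<oplus> (\<Oplus>u\<in>?P. \<Oplus>v\<in>?P. h u v)"
    using gc hc by (intro finsum_addf) (auto intro!: finsum_closed)
  also have "(\<Oplus>u\<in>?P. \<Oplus>v\<in>?P. h u v) = (\<Oplus>u\<in>?P. \<Oplus>v\<in>?P. \<ominus> g v u)"
  proof -
    have "h u v = \<ominus> g v u" for u v
    proof (cases "?I v u \<and> v \<subset> u")
      case True
      then have I: "?I u v" using flags_subset[of "insert u (insert v \<tau>)" n "insert u \<tau>"]
        by (auto simp: cofaces_def insert_commute)
      have fin: "finite {t \<in> \<tau>. t \<subset> u}"
        using True finite_flag[of "insert v \<tau>" n] by (simp add: cofaces_def)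
      have filter: "{t \<in> insert a A. P t} = (if P a then insert a {t \<in> A. P t} else {t \<in> A. P t})"
        for a :: "(nat \<Rightarrow> 'k) set" and A P by auto
      have "{t \<in> insert v \<tau>. t \<subset> u} = insert v {t \<in> \<tau>. t \<subset> u}" using True by (simp only: filter if_True)
      moreover have "v \<notin> {t \<in> \<tau>. t \<subset> u}" using True by (simp add: cofaces_def)
      ultimately have 1: "card {t \<in> insert v \<tau>. t \<subset> u} = Suc (card {t \<in> \<tau>. t \<subset> u})" using fin by simp
      have 2: "{t \<in> insert u \<tau>. t \<subset> v} = {t \<in> \<tau>. t \<subset> v}" using True less_not_sym[of v u] by (simp only: filter if_False)
      have "c (insert v (insert u \<tau>)) l \<in> carrier K" using chains_val[OF c] .
      then show ?thesis using True I unfolding g_def h_def sg_def 1 2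
        by (simp add: insert_commute)
    next
      case False
      have nh: "\<not> (?I u v \<and> v \<subset> u)"
      proof
        assume a: "?I u v \<and> v \<subset> u"
        then have "?I v u" using flags_subset[of "insert v (insert u \<tau>)" n "insert v \<tau>"]
          by (auto simp: cofaces_def insert_commute)
        then show False using False a by blast
      qed
      have "g v u = \<zero>" "h u v = \<zero>" unfolding g_def h_def by (rule if_not_P[OF False], rule if_not_P[OF nh])
      then show ?thesis by simp
    qed
    then show ?thesis by simp
  qed
  also have "\<dots> = \<ominus> (\<Oplus>u\<in>?P. \<Oplus>v\<in>?P. g v u)"
  proof -
    have "(\<Oplus>u\<in>?P. \<Oplus>v\<in>?P. \<ominus> g v u) = (\<Oplus>u\<in>?P. \<ominus> (\<Oplus>v\<in>?P. g v u))"
      using gc by (intro finsum_cong') (auto intro!: finsum_neg finite_psub finsum_closed)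
    also have "\<dots> = \<ominus> (\<Oplus>u\<in>?P. \<Oplus>v\<in>?P. g v u)"
      using gc by (intro finsum_neg finite_psub) (auto intro!: finsum_closed)
    finally show ?thesis .
  qed
  also have "(\<Oplus>u\<in>?P. \<Oplus>v\<in>?P. g v u) = (\<Oplus>u\<in>?P. \<Oplus>v\<in>?P. g u v)"
    using gc by (intro finsum_finsum_swap finite_psub)
  also have "(\<Oplus>u\<in>?P. \<Oplus>v\<in>?P. g u v) \<oplus> \<ominus> (\<Oplus>u\<in>?P. \<Oplus>v\<in>?P. g u v) = \<zero>"
    using gc by (intro r_neg finsum_closed) (auto intro!: finsum_closed)
  finally show "bd n (bd n c) \<tau> l = \<zero>" .
qed

definition flag_cycles :: "nat \<Rightarrow> int \<Rightarrow> int \<Rightarrow> ((nat \<Rightarrow> 'k) set set \<Rightarrow> bool list \<Rightarrow> 'k) set" where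
  "flag_cycles n k j = {c \<in> flag_chains n k j. bd n c = (\<lambda>_ _. \<zero>)}"

text \<open>The fibres of the boundary are translates of the cycles.\<close>

lemma card_chains_image_kernel:
  "card (flag_chains n k j) = card (bd n ` flag_chains n k j) * card (flag_cycles n k j)"
proof -
  let ?C = "flag_chains n k j"
  have fib: "card {c \<in> ?C. bd n c = b} = card (flag_cycles n k j)" if "b \<in> bd n ` ?C" for b
  proof -
    obtain a where a: "a \<in> ?C" "b = bd n a" using \<open>b \<in> bd n ` ?C\<close> by blast
    note na = chains_neg[OF a(1)]
    have v: "a \<sigma> l \<in> carrier K" for \<sigma> l using chains_val[OF a(1)] .
    have "bd n (\<lambda>\<sigma> l. a \<sigma> l \<oplus> \<ominus> a \<sigma> l) = (\<lambda>\<sigma> l. bd n a \<sigma> l \<oplus> bd n (\<lambda>\<sigma> l. \<ominus> a \<sigma> l) \<sigma> l)"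
      by (rule bd_add[OF a(1) na])
    moreover have "bd n (\<lambda>\<sigma> l. a \<sigma> l \<oplus> \<ominus> a \<sigma> l) = (\<lambda>_ _. \<zero>)" using v by (simp add: r_neg bd_def)
    ultimately have bna: "bd n a \<sigma> l \<oplus> bd n (\<lambda>\<sigma> l. \<ominus> a \<sigma> l) \<sigma> l = \<zero>" for \<sigma> l by (metis (no_types, lifting))
    have bij: "bij_betw (\<lambda>z \<sigma> l. z \<sigma> l \<oplus> a \<sigma> l) (flag_cycles n k j) {c \<in> ?C. bd n c = b}"
    proof (rule bij_betw_byWitness[where f' = "\<lambda>z \<sigma> l. z \<sigma> l \<oplus> \<ominus> a \<sigma> l"])
      show "\<forall>z\<in>flag_cycles n k j. (\<lambda>\<sigma> l. (z \<sigma> l \<oplus> a \<sigma> l) \<oplus> \<ominus> a \<sigma> l) = z"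
        using v by (auto simp: flag_cycles_def a_assoc r_neg chains_val)
      show "\<forall>z\<in>{c \<in> ?C. bd n c = b}. (\<lambda>\<sigma> l. (z \<sigma> l \<oplus> \<ominus> a \<sigma> l) \<oplus> a \<sigma> l) = z"
        using v by (auto simp: a_assoc l_neg chains_val)
      show "(\<lambda>z \<sigma> l. z \<sigma> l \<oplus> a \<sigma> l) ` flag_cycles n k j \<subseteq> {c \<in> ?C. bd n c = b}"
      proof (rule image_subsetI)
        fix z assume "z \<in> flag_cycles n k j"
        then have z: "z \<in> ?C" "bd n z = (\<lambda>_ _. \<zero>)" by (simp_all add: flag_cycles_def)
        show "(\<lambda>\<sigma> l. z \<sigma> l \<oplus> a \<sigma> l) \<in> {c \<in> ?C. bd n c = b}"
          using chains_add[OF z(1) a(1)] bd_add[OF z(1) a(1)] z(2) a(2) bd_closed[OF a(1)] by simp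
      qed
      show "(\<lambda>z \<sigma> l. z \<sigma> l \<oplus> \<ominus> a \<sigma> l) ` {c \<in> ?C. bd n c = b} \<subseteq> flag_cycles n k j"
      proof (rule image_subsetI)
        fix z assume "z \<in> {c \<in> ?C. bd n c = b}"
        then have z: "z \<in> ?C" "bd n z = bd n a" using a by simp_all
        show "(\<lambda>\<sigma> l. z \<sigma> l \<oplus> \<ominus> a \<sigma> l) \<in> flag_cycles n k j"
          using chains_add[OF z(1) na] bd_add[OF z(1) na] z(2) bna by (simp add: flag_cycles_def)
      qed
    qed
    show ?thesis by (rule bij_betw_same_card[OF bij, symmetric])
  qed
  have "card ?C = (\<Sum>b\<in>bd n ` ?C. card {c \<in> ?C. bd n c = b})"
    using sum.image_gen[OF finite_chains, of "\<lambda>_. 1 :: nat" n k j "bd n"] by simp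
  then show ?thesis using fib by simp
qed

text \<open>Let $c_i$, $z_i$, $m_i$ be the sizes of the chains, the cycles and \<open>M i\<close> in
  degree $i$, and $r_i$ that of the boundary image of the chains. Then $c_i = r_i z_i$, $m_i \<le>
  r_i$ and, by \<open>bd_bd\<close>, $r_{i+1} \<le> z_i$. For $i \<noteq> j$ also $c_i = m_i
  m_{i+1}$, so $m_i m_{i+1} \<le> r_i r_{i+1} \<le> r_i z_i = m_i m_{i+1}$ forces equality. The
  degrees $j - 1$ and $j + 1$ thus give $r_j = m_j$ and $r_{j+1} = m_{j+1}$, and the exceptional
  factor of $c_j$ is left for the quotient of $z_j$ by $r_{j+1}$.\<close>

theorem card_flag_cycles:
  assumes j: "j = int n - k"
  shows "card (flag_cycles n k j) = card (bd n ` flag_chains n k (j + 1)) * card (carrier K) ^ crit n k"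
proof -
  let ?q = "card (carrier K) ^ crit n k"
  let ?z = "\<lambda>j. card (flag_cycles n k j)" and ?r = "\<lambda>j. card (bd n ` flag_chains n k j)"
  obtain M where M: "\<And>j. M j \<subseteq> flag_chains n k j" "\<And>j. inj_on (bd n) (M j)"
    "\<And>j. card (flag_chains n k j) = card (M j) * card (M (j + 1)) * (if j = int n - k then ?q else 1)"
    using matching_exists[of n k] by blast
  have zero: "(\<lambda>_ _. \<zero>) \<in> flag_chains n k j" for j
    unfolding flag_chains_def by (auto intro!: ffunI ext_power.zero)
  have pos: "card (flag_chains n k j) > 0" for j using zero finite_chains card_gt_0_iff by blast
  have Mpos: "card (M j) > 0" for j using M(3)[of j] pos[of j] by (metis bot_nat_0.not_eq_extremum mult_0)
  have rM: "card (M j) \<le> ?r j" for j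
    using card_mono[OF finite_imageI[OF finite_chains] image_mono[OF M(1)], of "bd n" j] card_image[OF M(2)] by simp
  have rz: "?r j * ?z j = card (flag_chains n k j)" for j using card_chains_image_kernel[of n k j] by simp
  have zr: "?r (j + 1) \<le> ?z j" for j
  proof (rule card_mono)
    show "finite (flag_cycles n k j)" using finite_chains by (simp add: flag_cycles_def)
    show "bd n ` flag_chains n k (j + 1) \<subseteq> flag_cycles n k j"
    proof (rule image_subsetI)
      fix c assume c: "c \<in> flag_chains n k (j + 1)"
      show "bd n c \<in> flag_cycles n k j" using bd_mem[OF c] bd_bd[OF c] by (simp add: flag_cycles_def)
    qed
  qed
  have r1: "?r j \<le> card (M j)"
  proof -
    have "card (M (j - 1)) * ?r j \<le> ?r (j - 1) * ?z (j - 1)"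
      using mult_mono[OF rM zr[of "j - 1"]] by simp
    also have "\<dots> = card (M (j - 1)) * card (M j)" using rz[of "j - 1"] M(3)[of "j - 1"] j by simp
    finally show ?thesis using Mpos[of "j - 1"] by simp
  qed
  have r2: "?r (j + 1) \<le> card (M (j + 1))"
  proof -
    have "?r (j + 1) * card (M (j + 1 + 1)) \<le> ?r (j + 1) * ?r (j + 1 + 1)" by (rule mult_left_mono[OF rM]) simp
    also have "\<dots> \<le> ?r (j + 1) * ?z (j + 1)" by (rule mult_left_mono[OF zr]) simp
    also have "\<dots> = card (M (j + 1)) * card (M (j + 1 + 1))" using rz[of "j + 1"] M(3)[of "j + 1"] j by simp
    finally show ?thesis using Mpos[of "j + 1 + 1"] by simp
  qed
  have "?r j = card (M j)" "?r (j + 1) = card (M (j + 1))" using r1 r2 rM[of j] rM[of "j + 1"] by simp_all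
  then show ?thesis using rz[of j] M(3)[of j] j Mpos[of j] by simp
qed

end

section \<open>Transport to the homology of the flag complex\<close>

lemma (in vectorspace) card_carrier_dim:
  assumes "finite (carrier K)" fin_dim
  shows "card (carrier V) = card (carrier K) ^ dim"
proof -
  obtain A where A: "finite A" "basis A" using finite_basis_exists[OF assms(2)] by blast
  have AV: "A \<subseteq> carrier V" using A(2) by (simp add: basis_def)
  have ex1: "\<exists>!a. a \<in> A \<rightarrow>\<^sub>E carrier K \<and> lincomb a A = v" if "v \<in> carrier V" for v
    using basis_criterion[OF A(1) AV] A(2) that by auto
  have "bij_betw (\<lambda>a. lincomb a A) (A \<rightarrow>\<^sub>E carrier K) (carrier V)"
    unfolding bij_betw_def
  proof (intro conjI inj_onI equalityI subsetI)
    fix a b assume ab: "a \<in> A \<rightarrow>\<^sub>E carrier K" "b \<in> A \<rightarrow>\<^sub>E carrier K" "lincomb a A = lincomb b A"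
    have "lincomb b A \<in> carrier V" using AV ab(2) by (intro lincomb_closed) (auto simp: PiE_def)
    then show "a = b" using ex1[of "lincomb b A"] ab by blast
  next
    fix v assume "v \<in> (\<lambda>a. lincomb a A) ` (A \<rightarrow>\<^sub>E carrier K)"
    then show "v \<in> carrier V" using AV by (auto simp: PiE_def)
  next
    fix v assume "v \<in> carrier V"
    then show "v \<in> (\<lambda>a. lincomb a A) ` (A \<rightarrow>\<^sub>E carrier K)" using ex1[of v] by blast
  qed
  then have "card (carrier V) = card (A \<rightarrow>\<^sub>E carrier K)" by (simp add: bij_betw_same_card)
  then show ?thesis using A dim_basis[OF A] by (simp add: card_PiE)
qed

lemma (in abelian_group) add_pow_minus_one:
  "x \<in> carrier G \<Longrightarrow> add_pow G ((-1 :: int) ^ m) x = (if even m then x else \<ominus> x)"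
  by (cases "even m") (simp_all add: add.int_pow_neg)

section \<open>Chain modules of a local system\<close>

context local_system
begin

lemma simplices_X: "\<sigma> \<in> simplices X p \<Longrightarrow> \<sigma> \<in> X"
  by (simp add: simplices_def)

lemma chain_module_simps:
  "carrier (chain_module X F p) = (\<Pi>\<^sub>E \<sigma>\<in>simplices X p. carrier (F \<sigma>))"
  "\<zero>\<^bsub>chain_module X F p\<^esub> = (\<lambda>\<sigma>\<in>simplices X p. \<zero>\<^bsub>F \<sigma>\<^esub>)"
  "c \<oplus>\<^bsub>chain_module X F p\<^esub> d = (\<lambda>\<sigma>\<in>simplices X p. c \<sigma> \<oplus>\<^bsub>F \<sigma>\<^esub> d \<sigma>)"
  "a \<odot>\<^bsub>chain_module X F p\<^esub> d = (\<lambda>\<sigma>\<in>simplices X p. a \<odot>\<^bsub>F \<sigma>\<^esub> d \<sigma>)"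
  by (simp_all add: chain_module_def)

lemma chain_eqI:
  assumes "c \<in> (\<Pi>\<^sub>E \<sigma>\<in>S. A \<sigma>)" "\<And>\<sigma>. \<sigma> \<in> S \<Longrightarrow> c \<sigma> = d \<sigma>" shows "restrict d S = c"
proof
  fix \<sigma> show "restrict d S \<sigma> = c \<sigma>"
    using assms(2)[of \<sigma>] PiE_arb[OF assms(1), of \<sigma>] by (cases "\<sigma> \<in> S") simp_all
qed

lemma chain_module_module: "Module.module K (chain_module X F p)"
proof -
  interpret E: Module.module K "F {}" by (rule module_coeff[OF empty_simplex])
  let ?S = "simplices X p"
  note M = module_coeff[OF simplices_X]
  note ag = Module.module.axioms(2)[OF M]
  note am = abelian_group.axioms(1)[OF ag]
  have r: "restrict f ?S \<in> (\<Pi>\<^sub>E \<sigma>\<in>?S. carrier (F \<sigma>))" if "\<And>\<sigma>. \<sigma> \<in> ?S \<Longrightarrow> f \<sigma> \<in> carrier (F \<sigma>)" for f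
    using that by simp
  have re: "restrict f ?S = restrict g ?S" if "\<And>\<sigma>. \<sigma> \<in> ?S \<Longrightarrow> f \<sigma> = g \<sigma>" for f g :: "'a set \<Rightarrow> 'm"
    using that by (rule restrict_ext)
  show ?thesis
  proof (intro moduleI abelian_groupI E.R.is_cring, unfold chain_module_simps)
    fix c assume c: "c \<in> (\<Pi>\<^sub>E \<sigma>\<in>?S. carrier (F \<sigma>))"
    note cm = PiE_mem[OF c]
    show "(\<lambda>\<sigma>\<in>?S. (\<lambda>\<sigma>\<in>?S. \<zero>\<^bsub>F \<sigma>\<^esub>) \<sigma> \<oplus>\<^bsub>F \<sigma>\<^esub> c \<sigma>) = c"
      using abelian_monoid.l_zero[OF am cm] by (intro chain_eqI[OF c]) simp
    show "\<exists>d\<in>(\<Pi>\<^sub>E \<sigma>\<in>?S. carrier (F \<sigma>)). (\<lambda>\<sigma>\<in>?S. d \<sigma> \<oplus>\<^bsub>F \<sigma>\<^esub> c \<sigma>) = (\<lambda>\<sigma>\<in>?S. \<zero>\<^bsub>F \<sigma>\<^esub>)"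
      using abelian_group.a_inv_closed[OF ag cm] abelian_group.l_neg[OF ag cm]
      by (intro bexI[of _ "\<lambda>\<sigma>\<in>?S. \<ominus>\<^bsub>F \<sigma>\<^esub> c \<sigma>"] re r) simp_all
    show "(\<lambda>\<sigma>\<in>?S. \<one>\<^bsub>K\<^esub> \<odot>\<^bsub>F \<sigma>\<^esub> c \<sigma>) = c"
      using Module.module.smult_one[OF M cm] by (intro chain_eqI[OF c]) simp
    fix a assume a: "a \<in> carrier K"
    show "(\<lambda>\<sigma>\<in>?S. a \<odot>\<^bsub>F \<sigma>\<^esub> c \<sigma>) \<in> (\<Pi>\<^sub>E \<sigma>\<in>?S. carrier (F \<sigma>))"
      using Module.module.smult_closed[OF M a cm] by (intro r)
    fix b assume b: "b \<in> carrier K"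
    show "(\<lambda>\<sigma>\<in>?S. (a \<oplus>\<^bsub>K\<^esub> b) \<odot>\<^bsub>F \<sigma>\<^esub> c \<sigma>) =
        (\<lambda>\<sigma>\<in>?S. (\<lambda>\<sigma>\<in>?S. a \<odot>\<^bsub>F \<sigma>\<^esub> c \<sigma>) \<sigma> \<oplus>\<^bsub>F \<sigma>\<^esub> (\<lambda>\<sigma>\<in>?S. b \<odot>\<^bsub>F \<sigma>\<^esub> c \<sigma>) \<sigma>)"
      using Module.module.smult_l_distr[OF M a b cm] by (intro re) simp
    show "(\<lambda>\<sigma>\<in>?S. (a \<otimes>\<^bsub>K\<^esub> b) \<odot>\<^bsub>F \<sigma>\<^esub> c \<sigma>) = (\<lambda>\<sigma>\<in>?S. a \<odot>\<^bsub>F \<sigma>\<^esub> (\<lambda>\<sigma>\<in>?S. b \<odot>\<^bsub>F \<sigma>\<^esub> c \<sigma>) \<sigma>)"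
      using Module.module.smult_assoc1[OF M a b cm] by (intro re) simp
  next
    fix c d assume c: "c \<in> (\<Pi>\<^sub>E \<sigma>\<in>?S. carrier (F \<sigma>))" and d: "d \<in> (\<Pi>\<^sub>E \<sigma>\<in>?S. carrier (F \<sigma>))"
    note cm = PiE_mem[OF c] and dm = PiE_mem[OF d]
    show "(\<lambda>\<sigma>\<in>?S. c \<sigma> \<oplus>\<^bsub>F \<sigma>\<^esub> d \<sigma>) \<in> (\<Pi>\<^sub>E \<sigma>\<in>?S. carrier (F \<sigma>))"
      using abelian_monoid.a_closed[OF am cm dm] by (intro r)
    show "(\<lambda>\<sigma>\<in>?S. c \<sigma> \<oplus>\<^bsub>F \<sigma>\<^esub> d \<sigma>) = (\<lambda>\<sigma>\<in>?S. d \<sigma> \<oplus>\<^bsub>F \<sigma>\<^esub> c \<sigma>)"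
      using abelian_monoid.a_comm[OF am cm dm] by (intro re)
    fix a assume a: "a \<in> carrier K"
    show "(\<lambda>\<sigma>\<in>?S. a \<odot>\<^bsub>F \<sigma>\<^esub> (\<lambda>\<sigma>\<in>?S. c \<sigma> \<oplus>\<^bsub>F \<sigma>\<^esub> d \<sigma>) \<sigma>) =
        (\<lambda>\<sigma>\<in>?S. (\<lambda>\<sigma>\<in>?S. a \<odot>\<^bsub>F \<sigma>\<^esub> c \<sigma>) \<sigma> \<oplus>\<^bsub>F \<sigma>\<^esub> (\<lambda>\<sigma>\<in>?S. a \<odot>\<^bsub>F \<sigma>\<^esub> d \<sigma>) \<sigma>)"
      using Module.module.smult_r_distr[OF M a cm dm] by (intro re) simp
  next
    fix c d e assume c: "c \<in> (\<Pi>\<^sub>E \<sigma>\<in>?S. carrier (F \<sigma>))" and d: "d \<in> (\<Pi>\<^sub>E \<sigma>\<in>?S. carrier (F \<sigma>))"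
      and e: "e \<in> (\<Pi>\<^sub>E \<sigma>\<in>?S. carrier (F \<sigma>))"
    note cm = PiE_mem[OF c] and dm = PiE_mem[OF d] and em = PiE_mem[OF e]
    show "(\<lambda>\<sigma>\<in>?S. (\<lambda>\<sigma>\<in>?S. c \<sigma> \<oplus>\<^bsub>F \<sigma>\<^esub> d \<sigma>) \<sigma> \<oplus>\<^bsub>F \<sigma>\<^esub> e \<sigma>) =
        (\<lambda>\<sigma>\<in>?S. c \<sigma> \<oplus>\<^bsub>F \<sigma>\<^esub> (\<lambda>\<sigma>\<in>?S. d \<sigma> \<oplus>\<^bsub>F \<sigma>\<^esub> e \<sigma>) \<sigma>)"
      using abelian_monoid.a_assoc[OF am cm dm em] by (intro re) simp
  next
    show "(\<lambda>\<sigma>\<in>?S. \<zero>\<^bsub>F \<sigma>\<^esub>) \<in> (\<Pi>\<^sub>E \<sigma>\<in>?S. carrier (F \<sigma>))"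
      using abelian_monoid.zero_closed[OF am] by (intro r)
  qed
qed

text \<open>The contribution of the coface \<open>insert s \<tau>\<close> to the boundary at
  \<open>\<tau>\<close>, with the multiplication by a sign resolved. By \<open>boundary_link\<close>
  the boundary is a sum of these over vertices rather than over pairs of a simplex and a
  vertex.\<close>

definition face_term :: "'a rel \<Rightarrow> ('a set \<Rightarrow> 'm) \<Rightarrow> 'a set \<Rightarrow> 'a \<Rightarrow> 'm" where
  "face_term r c \<tau> s = (if even (vertex_index r (insert s \<tau>) s + 1) then \<rho> \<tau> (insert s \<tau>) (c (insert s \<tau>))
     else \<ominus>\<^bsub>F \<tau>\<^esub> \<rho> \<tau> (insert s \<tau>) (c (insert s \<tau>)))"

definition link :: "'a set \<Rightarrow> 'a set" where
  "link \<tau> = {s. s \<notin> \<tau> \<and> insert s \<tau> \<in> X}"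

lemma finite_link: "finite (link \<tau>)"
proof (rule finite_subset)
  show "link \<tau> \<subseteq> \<Union>X" by (auto simp: link_def)
  show "finite (\<Union>X)" using finite_complex finite_simplex by blast
qed

lemma link_simplex: "\<tau> \<in> simplices X (p - 1) \<Longrightarrow> s \<in> link \<tau> \<Longrightarrow> insert s \<tau> \<in> simplices X p"
  using finite_simplex[of \<tau>] by (simp add: simplices_def link_def)

lemma rho_mem:
  assumes "c \<in> carrier (chain_module X F p)" "\<tau> \<in> simplices X (p - 1)" "s \<in> link \<tau>"
  shows "c (insert s \<tau>) \<in> carrier (F (insert s \<tau>))" "\<rho> \<tau> (insert s \<tau>) (c (insert s \<tau>)) \<in> carrier (F \<tau>)"
proof -
  note i = link_simplex[OF assms(2,3)]
  show c: "c (insert s \<tau>) \<in> carrier (F (insert s \<tau>))"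
    using PiE_mem[OF assms(1)[unfolded chain_module_simps] i] .
  show "\<rho> \<tau> (insert s \<tau>) (c (insert s \<tau>)) \<in> carrier (F \<tau>)"
    using LinearCombinations.module_hom_closed[OF hom_coeff[OF simplices_X[OF i] subset_insertI]] c by blast
qed

lemma face_term_mem:
  assumes "c \<in> carrier (chain_module X F p)" "\<tau> \<in> simplices X (p - 1)" "s \<in> link \<tau>"
  shows "face_term r c \<tau> s \<in> carrier (F \<tau>)"
proof -
  interpret T: Module.module K "F \<tau>" by (rule module_coeff[OF simplices_X[OF assms(2)]])
  show ?thesis using rho_mem(2)[OF assms] by (simp add: face_term_def)
qed

lemma boundary_link:
  assumes c: "c \<in> carrier (chain_module X F p)"
  shows "boundary r X F \<rho> p c = (\<lambda>\<tau>\<in>simplices X (p - 1). finsum (F \<tau>) (face_term r c \<tau>) (link \<tau>))"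
  unfolding boundary_def
proof (rule restrict_ext)
  fix \<tau> assume t: "\<tau> \<in> simplices X (p - 1)"
  interpret T: Module.module K "F \<tau>" by (rule module_coeff[OF simplices_X[OF t]])
  let ?g = "\<lambda>(\<sigma>, s). add_pow (F \<tau>) ((-1 :: int) ^ (vertex_index r \<sigma> s + 1)) (\<rho> \<tau> \<sigma> (c \<sigma>))"
  have I: "{(\<sigma>, s). \<sigma> \<in> simplices X p \<and> s \<in> \<sigma> \<and> \<sigma> - {s} = \<tau>} = (\<lambda>s. (insert s \<tau>, s)) ` link \<tau>" (is "?L = ?R")
  proof (intro equalityI subsetI)
    fix x assume "x \<in> ?L"
    then obtain \<sigma> s where x: "x = (\<sigma>, s)" "\<sigma> \<in> simplices X p" "s \<in> \<sigma>" "\<sigma> - {s} = \<tau>" by blast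
    then have "\<sigma> = insert s \<tau>" "s \<notin> \<tau>" by blast+
    then show "x \<in> ?R" using x simplices_X[OF x(2)] by (auto simp: link_def)
  next
    fix x assume "x \<in> ?R"
    then obtain s where "s \<in> link \<tau>" "x = (insert s \<tau>, s)" by blast
    then show "x \<in> ?L" using link_simplex[OF t] by (auto simp: link_def)
  qed
  have gs: "?g (insert s \<tau>, s) = face_term r c \<tau> s" if "s \<in> link \<tau>" for s
    unfolding case_prod_conv face_term_def by (rule T.M.add_pow_minus_one[OF rho_mem(2)[OF c t that]])
  have "finsum (F \<tau>) ?g ?L = finsum (F \<tau>) (\<lambda>s. ?g (insert s \<tau>, s)) (link \<tau>)"
    unfolding I
  proof (rule T.M.finsum_reindex)
    show "?g \<in> (\<lambda>s. (insert s \<tau>, s)) ` link \<tau> \<rightarrow> carrier (F \<tau>)"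
      using gs face_term_mem[OF c t] by auto
    show "inj_on (\<lambda>s. (insert s \<tau>, s)) (link \<tau>)" by (auto simp: inj_on_def)
  qed
  also have "\<dots> = finsum (F \<tau>) (face_term r c \<tau>) (link \<tau>)"
    using gs face_term_mem[OF c t] by (intro T.M.finsum_cong') auto
  finally show "finsum (F \<tau>) ?g ?L = finsum (F \<tau>) (face_term r c \<tau>) (link \<tau>)" .
qed

lemma boundary_hom:
  "boundary r X F \<rho> p \<in> LinearCombinations.module_hom K (chain_module X F p) (chain_module X F (p - 1))"
proof -
  let ?C = "chain_module X F p" and ?D = "chain_module X F (p - 1)" and ?b = "boundary r X F \<rho> p"
  interpret C: Module.module K ?C by (rule chain_module_module)
  have closed: "?b c \<in> carrier ?D" if c: "c \<in> carrier ?C" for c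
  proof -
    have "finsum (F \<tau>) (face_term r c \<tau>) (link \<tau>) \<in> carrier (F \<tau>)" if t: "\<tau> \<in> simplices X (p - 1)" for \<tau>
    proof -
      interpret T: Module.module K "F \<tau>" by (rule module_coeff[OF simplices_X[OF t]])
      show ?thesis using face_term_mem[OF c t] by (intro T.M.finsum_closed) auto
    qed
    then show ?thesis by (simp add: boundary_link[OF c] chain_module_simps)
  qed
  have add: "?b (c \<oplus>\<^bsub>?C\<^esub> d) = ?b c \<oplus>\<^bsub>?D\<^esub> ?b d" if c: "c \<in> carrier ?C" and d: "d \<in> carrier ?C" for c d
  proof -
    have "finsum (F \<tau>) (face_term r (c \<oplus>\<^bsub>?C\<^esub> d) \<tau>) (link \<tau>) =
      finsum (F \<tau>) (face_term r c \<tau>) (link \<tau>) \<oplus>\<^bsub>F \<tau>\<^esub> finsum (F \<tau>) (face_term r d \<tau>) (link \<tau>)"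
      if t: "\<tau> \<in> simplices X (p - 1)" for \<tau>
    proof -
      interpret T: Module.module K "F \<tau>" by (rule module_coeff[OF simplices_X[OF t]])
      have "face_term r (c \<oplus>\<^bsub>?C\<^esub> d) \<tau> s = face_term r c \<tau> s \<oplus>\<^bsub>F \<tau>\<^esub> face_term r d \<tau> s" if s: "s \<in> link \<tau>" for s
      proof -
        note i = link_simplex[OF t s] and h = hom_coeff[OF simplices_X[OF link_simplex[OF t s]] subset_insertI]
        have "\<rho> \<tau> (insert s \<tau>) ((c \<oplus>\<^bsub>?C\<^esub> d) (insert s \<tau>)) =
          \<rho> \<tau> (insert s \<tau>) (c (insert s \<tau>)) \<oplus>\<^bsub>F \<tau>\<^esub> \<rho> \<tau> (insert s \<tau>) (d (insert s \<tau>))"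
          using LinearCombinations.module_hom_add[OF h rho_mem(1)[OF c t s] rho_mem(1)[OF d t s]] i by (simp add: chain_module_simps)
        then show ?thesis using rho_mem(2)[OF c t s] rho_mem(2)[OF d t s] by (simp add: face_term_def T.M.minus_add)
      qed
      then have "finsum (F \<tau>) (face_term r (c \<oplus>\<^bsub>?C\<^esub> d) \<tau>) (link \<tau>) =
          finsum (F \<tau>) (\<lambda>s. face_term r c \<tau> s \<oplus>\<^bsub>F \<tau>\<^esub> face_term r d \<tau> s) (link \<tau>)"
        using face_term_mem[OF c t] face_term_mem[OF d t] by (intro T.M.finsum_cong') auto
      then show ?thesis using face_term_mem[OF c t] face_term_mem[OF d t] by (simp add: T.M.finsum_addf Pi_iff)
    qed
    then show ?thesis
      unfolding boundary_link[OF c] boundary_link[OF d] boundary_link[OF C.M.a_closed[OF c d]] chain_module_simps(3)[where p = "p - 1"]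
      by (intro restrict_ext) simp
  qed
  have smult: "?b (a \<odot>\<^bsub>?C\<^esub> c) = a \<odot>\<^bsub>?D\<^esub> ?b c" if a: "a \<in> carrier K" and c: "c \<in> carrier ?C" for a c
  proof -
    have "finsum (F \<tau>) (face_term r (a \<odot>\<^bsub>?C\<^esub> c) \<tau>) (link \<tau>) = a \<odot>\<^bsub>F \<tau>\<^esub> finsum (F \<tau>) (face_term r c \<tau>) (link \<tau>)"
      if t: "\<tau> \<in> simplices X (p - 1)" for \<tau>
    proof -
      interpret T: Module.module K "F \<tau>" by (rule module_coeff[OF simplices_X[OF t]])
      have "face_term r (a \<odot>\<^bsub>?C\<^esub> c) \<tau> s = a \<odot>\<^bsub>F \<tau>\<^esub> face_term r c \<tau> s" if s: "s \<in> link \<tau>" for s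
      proof -
        note i = link_simplex[OF t s] and h = hom_coeff[OF simplices_X[OF link_simplex[OF t s]] subset_insertI]
        have "\<rho> \<tau> (insert s \<tau>) ((a \<odot>\<^bsub>?C\<^esub> c) (insert s \<tau>)) = a \<odot>\<^bsub>F \<tau>\<^esub> \<rho> \<tau> (insert s \<tau>) (c (insert s \<tau>))"
          using LinearCombinations.module_hom_smult[OF h a rho_mem(1)[OF c t s]] i by (simp add: chain_module_simps)
        then show ?thesis using rho_mem(2)[OF c t s] a by (simp add: face_term_def T.smult_r_minus)
      qed
      then have "finsum (F \<tau>) (face_term r (a \<odot>\<^bsub>?C\<^esub> c) \<tau>) (link \<tau>) =
          finsum (F \<tau>) (\<lambda>s. a \<odot>\<^bsub>F \<tau>\<^esub> face_term r c \<tau> s) (link \<tau>)"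
        using face_term_mem[OF c t] a by (intro T.M.finsum_cong') auto
      then show ?thesis using face_term_mem[OF c t] T.finsum_smult_ldistr[OF finite_link a] by (simp add: Pi_iff)
    qed
    then show ?thesis
      unfolding boundary_link[OF c] boundary_link[OF C.smult_closed[OF a c]] chain_module_simps(4)[where p = "p - 1"]
      by (intro restrict_ext) simp
  qed
  show ?thesis using closed add smult by (simp add: LinearCombinations.module_hom_def Pi_iff)
qed

lemma cycles_submodule: "submodule K (cycles r X F \<rho> p) (chain_module X F p)"
proof -
  interpret mod_hom K "chain_module X F p" "chain_module X F (p - 1)" "boundary r X F \<rho> p"
    by (intro mod_hom.intro mod_hom_axioms.intro chain_module_module boundary_hom)
  show ?thesis using ker_is_submodule by (simp add: ker_def cycles_def)
qed

lemma boundaries_submodule: "submodule K (boundaries r X F \<rho> p) (chain_module X F p)"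
proof -
  interpret mod_hom K "chain_module X F (p + 1)" "chain_module X F (p + 1 - 1)" "boundary r X F \<rho> (p + 1)"
    by (intro mod_hom.intro mod_hom_axioms.intro chain_module_module boundary_hom)
  show ?thesis using im_is_submodule by (simp add: im_def boundaries_def)
qed

end

section \<open>Coordinates on a finite module\<close>

context finite_exterior
begin

primrec comb :: "'m list \<Rightarrow> (nat \<Rightarrow> 'k) \<Rightarrow> 'm" where
  "comb [] v = \<zero>\<^bsub>M\<^esub>"
| "comb (u # us) v = v 0 \<odot>\<^bsub>M\<^esub> u \<oplus>\<^bsub>M\<^esub> comb us (vtl v)"

lemma comb_closed: "set us \<subseteq> carrier M \<Longrightarrow> v \<in> vecs (length us) \<Longrightarrow> comb us v \<in> carrier M"
proof (induction us arbitrary: v)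
  case (Cons u us)
  then show ?case using vtl_vecs[of v "length us"] vecs_val[of v "Suc (length us)" 0] by simp
qed simp

lemma comb_image: "set us \<subseteq> carrier M \<Longrightarrow> comb us ` vecs (length us) = lspan us"
proof (induction us)
  case Nil
  then show ?case by (auto simp: vecs_0)
next
  case (Cons u us)
  then have IH: "comb us ` vecs (length us) = lspan us" by simp
  show ?case
  proof (intro equalityI subsetI)
    fix x assume "x \<in> comb (u # us) ` vecs (length (u # us))"
    then obtain v where v: "v \<in> vecs (Suc (length us))" "x = v 0 \<odot>\<^bsub>M\<^esub> u \<oplus>\<^bsub>M\<^esub> comb us (vtl v)" by auto
    have "comb us (vtl v) \<in> lspan us" using IH vtl_vecs[OF v(1)] by blast
    moreover have "v 0 \<in> carrier K" using vecs_val[OF v(1)] .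
    ultimately show "x \<in> lspan (u # us)" unfolding lspan.simps using v(2) by blast
  next
    fix x assume "x \<in> lspan (u # us)"
    then obtain a w where x: "a \<in> carrier K" "w \<in> lspan us" "x = a \<odot>\<^bsub>M\<^esub> u \<oplus>\<^bsub>M\<^esub> w" by auto
    then obtain v where v: "v \<in> vecs (length us)" "w = comb us v" using IH by auto
    have "comb (u # us) (case_nat a v) = x" using x v by simp
    then show "x \<in> comb (u # us) ` vecs (length (u # us))"
      using vecs_cons[OF x(1) v(1)] by (intro image_eqI[of _ _ "case_nat a v"]) simp_all
  qed
qed

lemma comb_add:
  "set us \<subseteq> carrier M \<Longrightarrow> v \<in> vecs (length us) \<Longrightarrow> w \<in> vecs (length us) \<Longrightarrow>
    comb us (\<lambda>i. v i \<oplus> w i) = comb us v \<oplus>\<^bsub>M\<^esub> comb us w"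
proof (induction us arbitrary: v w)
  case (Cons u us)
  have t: "vtl v \<in> vecs (length us)" "vtl w \<in> vecs (length us)" using Cons.prems vtl_vecs by auto
  have c: "v 0 \<in> carrier K" "w 0 \<in> carrier K" using Cons.prems vecs_val by blast+
  have cl: "comb us (vtl v) \<in> carrier M" "comb us (vtl w) \<in> carrier M" using comb_closed t Cons.prems by auto
  show ?case using Cons.IH[OF _ t] Cons.prems c cl by (simp add: vtl_add smult_l_distr M.add.m_ac)
qed simp

lemma comb_smult:
  "set us \<subseteq> carrier M \<Longrightarrow> a \<in> carrier K \<Longrightarrow> w \<in> vecs (length us) \<Longrightarrow>
    comb us (\<lambda>i. a \<otimes> w i) = a \<odot>\<^bsub>M\<^esub> comb us w"
proof (induction us arbitrary: w)
  case (Cons u us)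
  have t: "vtl w \<in> vecs (length us)" using Cons.prems vtl_vecs by auto
  have c: "w 0 \<in> carrier K" using Cons.prems vecs_val by blast
  have cl: "comb us (vtl w) \<in> carrier M" using comb_closed t Cons.prems by auto
  show ?case using Cons.IH[OF _ _ t] Cons.prems c cl by (simp add: vtl_smult smult_r_distr smult_assoc1)
qed simp

text \<open>Linear combinations map $K^n$ onto the module, and both have size $q^n$; the inverse of
  this bijection is the coordinate map.\<close>

lemma exists_coordinates:
  assumes "finite (carrier M)"
  obtains n \<phi> where "card (carrier M) = card (carrier K) ^ n" "coordinates K M n \<phi>"
    "bij_betw \<phi> (carrier M) (vecs n)"
proof -
  obtain us where us: "set us \<subseteq> carrier M" "lspan us = carrier M"
    "card (carrier M) = card (carrier K) ^ length us" using exists_lspan[OF assms] .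
  let ?n = "length us" and ?\<phi> = "inv_into (vecs (length us)) (comb us)"
  have img: "comb us ` vecs ?n = carrier M" using comb_image[OF us(1)] us(2) by simp
  have inj: "inj_on (comb us) (vecs ?n)"
    by (rule card_bij_inj[OF finite_vecs img]) (simp add: card_vecs us(3))
  have bij: "bij_betw ?\<phi> (carrier M) (vecs ?n)"
    using inj img by (intro bij_betw_inv_into) (simp add: bij_betw_def)
  have v: "?\<phi> x \<in> vecs ?n" "comb us (?\<phi> x) = x" if "x \<in> carrier M" for x
    using that img by (auto simp: inv_into_into f_inv_into_f)
  have eq: "?\<phi> x = w" if "w \<in> vecs ?n" "comb us w = x" for x w
    using that inv_into_f_f[OF inj] by blast
  have "coordinates K M ?n ?\<phi>"
  proof (intro coordinates.intro coordinates_axioms.intro finite_exterior_axioms)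
    show "?\<phi> (x \<oplus>\<^bsub>M\<^esub> y) = (\<lambda>i. ?\<phi> x i \<oplus> ?\<phi> y i)" if "x \<in> carrier M" "y \<in> carrier M" for x y
      using comb_add[OF us(1) v(1)[OF that(1)] v(1)[OF that(2)]] v that
      by (intro eq add_vecs) auto
    show "?\<phi> (a \<odot>\<^bsub>M\<^esub> x) = (\<lambda>i. a \<otimes> ?\<phi> x i)" if "a \<in> carrier K" "x \<in> carrier M" for a x
      using comb_smult[OF us(1) that(1) v(1)[OF that(2)]] v that
      by (intro eq smult_vecs) auto
  qed (rule v(1))
  then show ?thesis using that us(3) bij by blast
qed

end

lemma card_quotient_module:
  assumes "submodule R N M" "finite (carrier M)"
  shows "card (carrier (quotient_module M N)) * card N = card (carrier M)"
proof -
  interpret N: abelian_subgroup N M by (rule submodule_abelian_subgroup[OF assms(1)])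
  have "card (rcosets\<^bsub>add_monoid M\<^esub> N) * card N = order (add_monoid M)"
    by (rule group.lagrange[OF N.a_group N.a_subgroup])
  then show ?thesis by (simp add: quotient_module_def A_RCOSETS_def order_def)
qed

lemma submodule_restrict:
  assumes N: "submodule R N M" and C: "submodule R C M" and "N \<subseteq> C"
  shows "submodule R N (M\<lparr>carrier := C\<rparr>)"
proof -
  interpret N: submodule R N M by fact
  interpret M: Module.module R M by (rule N.module)
  have "Module.module R (M\<lparr>carrier := C\<rparr>)" by (rule M.submodule_is_module[OF C])
  then show ?thesis using assms(3) by (intro submodule.intro) auto
qed

lemma vectorspace_of_module: "field K \<Longrightarrow> Module.module K M \<Longrightarrow> vectorspace K M"
  by (rule vectorspace.intro)

lemma (in vectorspace) fin_dim_of_finite: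
  assumes "finite (carrier V)" shows fin_dim
proof -
  have "span (carrier V) = carrier V"
    using in_own_span[of "carrier V"] span_is_subset2[of "carrier V"] by auto
  then show ?thesis using assms by (auto simp: fin_dim_def)
qed

lemma dim_eq_of_card:
  assumes K: "field K" "finite (carrier K)" and M: "Module.module K M" "finite (carrier M)"
    and card: "card (carrier M) = card (carrier K) ^ d"
  shows "vectorspace.dim K M = d"
proof -
  interpret vectorspace K M by (rule vectorspace_of_module[OF K(1) M(1)])
  from card_carrier_dim[OF K(2) fin_dim_of_finite[OF M(2)]] card have "card (carrier K) ^ dim = card (carrier K) ^ d" by simp
  moreover have "card {\<zero>\<^bsub>K\<^esub>, \<one>\<^bsub>K\<^esub>} \<le> card (carrier K)" using K(2) by (intro card_mono) auto
  ultimately show ?thesis by simp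
qed

section \<open>Flags and exterior powers of $V$ in coordinates\<close>

locale flag_coordinates = coordinates K V n \<phi>
  for K :: "('k, 'z) ring_scheme" (structure) and V :: "('k, 'v, 'y) module_scheme" and n \<phi> +
  assumes bij: "bij_betw \<phi> (carrier V) (vecs n)"
begin

lemma vs: "vectorspace K V"
  by (rule vectorspace_of_module[OF field_axioms module_axioms])

lemma inj: "inj_on \<phi> (carrier V)" and onto: "\<phi> ` carrier V = vecs n"
  using bij by (auto simp: bij_betw_def)

lemma finite_V: "finite (carrier V)"
  using bij finite_vecs bij_betw_finite by blast

lemma coord_zero: "\<phi> \<zero>\<^bsub>V\<^esub> = (\<lambda>_. \<zero>)"
  using coord_smult[of \<zero> "\<zero>\<^bsub>V\<^esub>"] coord_vecs[of "\<zero>\<^bsub>V\<^esub>"] by simp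

definition pre :: "(nat \<Rightarrow> 'k) set \<Rightarrow> 'v set" where
  "pre W = {v \<in> carrier V. \<phi> v \<in> W}"

lemma image_pre: "W \<subseteq> vecs n \<Longrightarrow> \<phi> ` pre W = W"
proof (intro equalityI subsetI)
  fix w assume "W \<subseteq> vecs n" "w \<in> W"
  then have "w \<in> \<phi> ` carrier V" using onto by blast
  then show "w \<in> \<phi> ` pre W" using \<open>w \<in> W\<close> by (auto simp: pre_def)
qed (auto simp: pre_def)

lemma pre_image: "U \<subseteq> carrier V \<Longrightarrow> pre (\<phi> ` U) = U"
  using inj by (auto simp: pre_def dest: inj_onD)

lemma image_subsp:
  assumes "submodule K U V" shows "\<phi> ` U \<in> subsp n"
proof -
  interpret U: submodule K U V by fact
  note c = subsetD[OF U.subset]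
  show ?thesis unfolding subsp_def
  proof (intro CollectI conjI ballI)
    show "\<phi> ` U \<subseteq> vecs n" using coord_vecs c by blast
    show "(\<lambda>_. \<zero>) \<in> \<phi> ` U" using coord_zero U.zero_closed by (metis imageI)
    fix x assume "x \<in> \<phi> ` U"
    then obtain u where u: "u \<in> U" "x = \<phi> u" by blast
    show "(\<lambda>i. a \<otimes> x i) \<in> \<phi> ` U" if "a \<in> carrier K" for a
      using coord_smult[OF that c[OF u(1)]] U.smult_closed[OF that u(1)] u(2) by (metis imageI)
    fix y assume "y \<in> \<phi> ` U"
    then obtain v where v: "v \<in> U" "y = \<phi> v" by blast
    show "(\<lambda>i. x i \<oplus> y i) \<in> \<phi> ` U"
      using coord_add[OF c[OF u(1)] c[OF v(1)]] U.m_closed[OF u(1) v(1)] u(2) v(2) by (metis imageI)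
  qed
qed

lemma pre_submodule:
  assumes "W \<in> subsp n" shows "submodule K (pre W) V"
  by (rule submodule.intro)
    (auto simp: pre_def coord_zero coord_add coord_smult subspD[OF assms] module_axioms)

lemma sub_module: "submodule K U V \<Longrightarrow> Module.module K (V\<lparr>carrier := U\<rparr>)"
  by (rule submodule_is_module)

lemma sub_coordinates:
  assumes U: "submodule K U V" shows "coordinates K (V\<lparr>carrier := U\<rparr>) n \<phi>"
proof -
  note c = subsetD[OF submodule.subset[OF U]]
  show ?thesis
    by (intro coordinates.intro finite_exterior.intro exterior_module.intro sub_module U finite_field_axioms
        coordinates_axioms.intro) (simp_all add: c coord_vecs coord_add coord_smult)
qed

text \<open>Evaluation is onto the power in the model, whose size is exactly the upper bound known
  for the presented power. This is where presentation and model are seen to agree.\<close>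

lemma class_eval_bij:
  assumes U: "submodule K U V"
  shows "bij_betw cev (carrier (exterior_power K k (V\<lparr>carrier := U\<rparr>))) (ext_power n (int k) (\<phi> ` U))"
proof -
  interpret U: coordinates K "V\<lparr>carrier := U\<rparr>" n \<phi> by (rule sub_coordinates[OF U])
  have UV: "U \<subseteq> carrier V" by (rule submodule.subset[OF U])
  have card: "card (\<phi> ` U) = card U" using inj_on_subset[OF inj UV] by (rule card_image)
  obtain m where m: "card (\<phi> ` U) = card (carrier K) ^ m" using card_subsp[OF image_subsp[OF U]] by blast
  have fU: "finite U" using finite_subset[OF UV finite_V] .
  have img: "cev ` carrier (exterior_power K k (V\<lparr>carrier := U\<rparr>)) = ext_power n (int k) (\<phi> ` U)"
    using U.cev_image[of k] by simp
  have "card (carrier (exterior_power K k (V\<lparr>carrier := U\<rparr>))) \<le> card (ext_power n (int k) (\<phi> ` U))"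
    using U.card_ext_power_le(1)[of m k] card_ext_power[OF image_subsp[OF U] m, of k] m card fU by simp
  moreover have "finite (carrier (exterior_power K k (V\<lparr>carrier := U\<rparr>)))"
    using U.card_ext_power_le(3)[of m k] m card fU by simp
  ultimately show ?thesis using card_bij_inj[OF _ img] img by (simp add: bij_betw_def)
qed

text \<open>A tensor has the same value over every subspace that contains its entries, so the
  connecting maps turn into inclusions inside one exterior algebra.\<close>

lemma class_eval_inclusion:
  assumes U: "submodule K U V" and W: "submodule K W V" and UW: "U \<subseteq> W"
    and A: "A \<in> carrier (exterior_power K k (V\<lparr>carrier := U\<rparr>))"
  shows "cev (exterior_inclusion K k (V\<lparr>carrier := W\<rparr>) A) = cev A"
proof -
  interpret U: coordinates K "V\<lparr>carrier := U\<rparr>" n \<phi> by (rule sub_coordinates[OF U])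
  interpret W: coordinates K "V\<lparr>carrier := W\<rparr>" n \<phi> by (rule sub_coordinates[OF W])
  obtain c where c: "c \<in> carrier (free_module K (tuples k U))"
    "A = wedge_kernel K k (V\<lparr>carrier := U\<rparr>) +>\<^bsub>free_module K (tuples k U)\<^esub> c"
    using A by (auto simp: exterior_power_def quotient_carrier)
  have "tuples k U \<subseteq> tuples k W" using UW by (auto simp: tuples_def)
  then have cW: "c \<in> carrier (free_module K (tuples k W))" using c(1) free_module_mono by blast
  show ?thesis
    using exterior_inclusion_class[OF sub_module[OF U] sub_module[OF W] UW c(1)] U.cev_class[of c k] W.cev_class[of c k] c cW
    by simp
qed

abbreviation "X \<equiv> flag_complex K V"

definition zspace :: "(nat \<Rightarrow> 'k) set" where "zspace = {\<lambda>_. \<zero>}"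

text \<open>The flags of $K^n$ that correspond to simplices of the flag complex, whose vertices are
  nonzero subspaces.\<close>

definition zflags :: "(nat \<Rightarrow> 'k) set set set" where "zflags = {\<rho> \<in> flags n. zspace \<notin> \<rho>}"

lemma psp_submodule: "U \<in> proper_subspaces K V \<Longrightarrow> submodule K U V"
  by (auto simp: proper_subspaces_def VectorSpace.subspace_def)

lemma psp_sub: "U \<in> proper_subspaces K V \<Longrightarrow> U \<subseteq> carrier V"
  using submodule.subset[OF psp_submodule] .

lemma image_psp:
  assumes U: "U \<in> proper_subspaces K V" shows "\<phi> ` U \<in> psub n" "\<phi> ` U \<noteq> zspace"
proof -
  note UV = psp_sub[OF U]
  have "\<phi> ` U \<noteq> vecs n"
    using inj_on_image_eq_iff[OF inj UV order_refl] onto U by (auto simp: proper_subspaces_def)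
  then show "\<phi> ` U \<in> psub n" using image_subsp[OF psp_submodule[OF U]] by (simp add: psub_def)
  have "\<phi> ` {\<zero>\<^bsub>V\<^esub>} = zspace" by (simp add: coord_zero zspace_def)
  then show "\<phi> ` U \<noteq> zspace"
    using inj_on_image_eq_iff[OF inj UV, of "{\<zero>\<^bsub>V\<^esub>}"] U by (auto simp: proper_subspaces_def)
qed

lemma pre_psp:
  assumes W: "W \<in> psub n" "W \<noteq> zspace" shows "pre W \<in> proper_subspaces K V"
proof -
  have Ws: "W \<in> subsp n" "W \<noteq> vecs n" using W by (auto simp: psub_def)
  note im = image_pre[OF subspD(1)[OF Ws(1)]]
  have "pre W \<noteq> carrier V" using im onto Ws(2) by auto
  moreover have "pre W \<noteq> {\<zero>\<^bsub>V\<^esub>}" using im W(2) by (auto simp: coord_zero zspace_def)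
  ultimately show ?thesis
    using pre_submodule[OF Ws(1)] vs by (simp add: proper_subspaces_def VectorSpace.subspace_def)
qed

lemma simplex_psp: "\<sigma> \<in> X \<Longrightarrow> U \<in> \<sigma> \<Longrightarrow> U \<in> proper_subspaces K V"
  by (auto simp: flag_complex_def)

definition img :: "'v set set \<Rightarrow> (nat \<Rightarrow> 'k) set set" where "img \<sigma> = (`) \<phi> ` \<sigma>"

definition preimg :: "(nat \<Rightarrow> 'k) set set \<Rightarrow> 'v set set" where "preimg \<rho> = pre ` \<rho>"

lemma image_subset_iff_V: "U \<subseteq> carrier V \<Longrightarrow> W \<subseteq> carrier V \<Longrightarrow> \<phi> ` U \<subseteq> \<phi> ` W \<longleftrightarrow> U \<subseteq> W"
proof
  assume UW: "U \<subseteq> carrier V" "W \<subseteq> carrier V" and le: "\<phi> ` U \<subseteq> \<phi> ` W"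
  show "U \<subseteq> W"
  proof
    fix u assume u: "u \<in> U"
    then obtain w where "w \<in> W" "\<phi> u = \<phi> w" using le by blast
    then show "u \<in> W" using inj_onD[OF inj] u UW by (metis subsetD)
  qed
qed (rule image_mono)

lemma inj_on_image_V: "inj_on ((`) \<phi>) (Pow (carrier V))"
  using inj by (rule inj_on_image_Pow)

lemma img_zflags:
  assumes s: "\<sigma> \<in> X" shows "img \<sigma> \<in> zflags"
proof -
  have "chain\<^sub>\<subseteq> (img \<sigma>)"
    unfolding chain_subset_def
  proof (intro ballI)
    fix A B assume "A \<in> img \<sigma>" "B \<in> img \<sigma>"
    then obtain U W where "U \<in> \<sigma>" "A = \<phi> ` U" "W \<in> \<sigma>" "B = \<phi> ` W" unfolding img_def by (elim imageE)
    moreover from this have "U \<subseteq> W \<or> W \<subseteq> U" using s by (simp add: flag_complex_def chain_subset_def)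
    ultimately show "A \<subseteq> B \<or> B \<subseteq> A" using image_mono[of U W \<phi>] image_mono[of W U \<phi>] by auto
  qed
  moreover have "A \<in> psub n \<and> A \<noteq> zspace" if "A \<in> img \<sigma>" for A
    using that image_psp simplex_psp[OF s] by (auto simp: img_def)
  ultimately show ?thesis by (auto simp: zflags_def flags_def)
qed

lemma preimg_X:
  assumes r: "\<rho> \<in> zflags" shows "preimg \<rho> \<in> X"
proof -
  have f: "\<rho> \<in> flags n" and z: "zspace \<notin> \<rho>" using r by (auto simp: zflags_def)
  have "pre W \<in> proper_subspaces K V" if "W \<in> \<rho>" for W
    using pre_psp[OF flag_psub[OF f that]] that z by blast
  moreover have "chain\<^sub>\<subseteq> (preimg \<rho>)"
    unfolding chain_subset_def
  proof (intro ballI)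
    fix A B assume "A \<in> preimg \<rho>" "B \<in> preimg \<rho>"
    then obtain U W where "U \<in> \<rho>" "A = pre U" "W \<in> \<rho>" "B = pre W" unfolding preimg_def by (elim imageE)
    moreover from this have "U \<subseteq> W \<or> W \<subseteq> U" using f by (simp add: flags_def chain_subset_def)
    ultimately show "A \<subseteq> B \<or> B \<subseteq> A" by (auto simp: pre_def)
  qed
  ultimately show ?thesis using finite_flag[OF f] by (auto simp: flag_complex_def preimg_def)
qed

lemma img_preimg: assumes "\<rho> \<in> zflags" shows "img (preimg \<rho>) = \<rho>"
proof -
  have f: "\<rho> \<in> flags n" using assms by (simp add: zflags_def)
  have "(\<lambda>W. \<phi> ` pre W) ` \<rho> = (\<lambda>W. W) ` \<rho>"
    by (rule image_cong[OF refl]) (simp add: image_pre[OF flag_vecs[OF f]])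
  then show ?thesis by (simp add: img_def preimg_def image_image)
qed

lemma preimg_img: assumes "\<sigma> \<in> X" shows "preimg (img \<sigma>) = \<sigma>"
proof -
  have "(\<lambda>U. pre (\<phi> ` U)) ` \<sigma> = (\<lambda>U. U) ` \<sigma>"
    by (rule image_cong[OF refl]) (simp add: pre_image[OF psp_sub[OF simplex_psp[OF assms]]])
  then show ?thesis by (simp add: img_def preimg_def image_image)
qed

lemma card_img: assumes "\<sigma> \<in> X" shows "card (img \<sigma>) = card \<sigma>"
  unfolding img_def
  using psp_sub[OF simplex_psp[OF assms]] by (intro card_image inj_on_subset[OF inj_on_image_V]) blast

lemma fbot_img: assumes s: "\<sigma> \<in> X" shows "fbot n (img \<sigma>) = \<phi> ` flag_bottom V \<sigma>"
proof (cases "\<sigma> = {}")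
  case True
  then show ?thesis by (simp add: img_def fbot_def flag_bottom_def onto)
next
  case False
  have "\<phi> ` \<Inter>\<sigma> = \<Inter>(img \<sigma>)"
  proof -
    obtain U0 where "U0 \<in> \<sigma>" using False by blast
    then have "\<phi> ` (\<Inter>U\<in>\<sigma>. U) = (\<Inter>U\<in>\<sigma>. \<phi> ` U)"
      using psp_sub[OF simplex_psp[OF s]] by (intro image_INT[OF inj]) auto
    then show ?thesis by (simp add: img_def)
  qed
  then show ?thesis using False by (simp add: img_def fbot_def flag_bottom_def)
qed

lemma bottom_submodule: "\<sigma> \<in> X \<Longrightarrow> submodule K (flag_bottom V \<sigma>) V"
  by (rule flag_bottom_submodule[OF vs])

end

context coordinates
begin

lemma cev_val:
  assumes "A \<in> carrier (exterior_power K k M)" shows "cev A l \<in> carrier K"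
proof -
  have "\<phi> ` carrier M \<subseteq> vecs n" using coord_vecs by blast
  moreover have "cev A \<in> ext_power n (int k) (\<phi> ` carrier M)" using assms cev_image[of k] by blast
  ultimately show ?thesis using ext_val[OF ext_power_ext] by blast
qed

lemma cev_zero: "cev \<zero>\<^bsub>exterior_power K k M\<^esub> = (\<lambda>_. \<zero>)"
proof -
  interpret E: Module.module K "exterior_power K k M" by (rule exterior_power_module[OF module_axioms])
  let ?z = "\<zero>\<^bsub>exterior_power K k M\<^esub>"
  have "cev (?z \<oplus>\<^bsub>exterior_power K k M\<^esub> ?z) = (\<lambda>l. cev ?z l \<oplus> cev ?z l)" by (rule cev_add) simp_all
  then have "cev ?z l = cev ?z l \<oplus> cev ?z l" for l by (simp add: fun_eq_iff)
  then have "cev ?z l = \<zero>" for l using cev_val[OF E.M.zero_closed, of l] R.add.l_cancel_one' by metis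
  then show ?thesis by auto
qed

lemma cev_minus:
  assumes "A \<in> carrier (exterior_power K k M)"
  shows "cev (\<ominus>\<^bsub>exterior_power K k M\<^esub> A) = (\<lambda>l. \<ominus> cev A l)"
proof -
  interpret E: Module.module K "exterior_power K k M" by (rule exterior_power_module[OF module_axioms])
  have "(\<lambda>l. cev (\<ominus>\<^bsub>exterior_power K k M\<^esub> A) l \<oplus> cev A l) = (\<lambda>_. \<zero>)"
    using cev_add[OF E.M.a_inv_closed[OF assms] assms] assms by (simp add: E.M.l_neg cev_zero)
  then have "cev (\<ominus>\<^bsub>exterior_power K k M\<^esub> A) l \<oplus> cev A l = \<zero>" for l by (rule fun_cong)
  then have "\<ominus> cev A l = cev (\<ominus>\<^bsub>exterior_power K k M\<^esub> A) l" for l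
    using cev_val[OF assms] cev_val[OF E.M.a_inv_closed[OF assms]] by (intro R.minus_equality)
  then show ?thesis by auto
qed

lemma cev_finsum:
  assumes "finite S" "\<And>s. s \<in> S \<Longrightarrow> g s \<in> carrier (exterior_power K k M)"
  shows "cev (finsum (exterior_power K k M) g S) l = (\<Oplus>s\<in>S. cev (g s) l)"
  using assms
proof (induction S rule: finite_induct)
  case empty
  interpret E: Module.module K "exterior_power K k M" by (rule exterior_power_module[OF module_axioms])
  show ?case by (simp add: cev_zero)
next
  case (insert a S)
  interpret E: Module.module K "exterior_power K k M" by (rule exterior_power_module[OF module_axioms])
  have "finsum (exterior_power K k M) g (insert a S) = g a \<oplus>\<^bsub>exterior_power K k M\<^esub> finsum (exterior_power K k M) g S"
    using insert by (intro E.M.finsum_insert) auto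
  moreover have "finsum (exterior_power K k M) g S \<in> carrier (exterior_power K k M)"
    using insert.prems by (intro E.M.finsum_closed) auto
  moreover have "(\<Oplus>s\<in>insert a S. cev (g s) l) = cev (g a) l \<oplus> (\<Oplus>s\<in>S. cev (g s) l)"
    using insert by (intro R.finsum_insert) (auto intro: cev_val)
  ultimately show ?case using insert by (simp add: cev_add)
qed

end

section \<open>The isomorphism of chain complexes and the dimension of the homology\<close>

locale wedge_complex = flag_coordinates K V n \<phi>
  for K :: "('k, 'z) ring_scheme" (structure) and V :: "('k, 'v, 'y) module_scheme" and n \<phi> +
  fixes k :: nat and r :: "'v set rel"
  assumes k: "1 \<le> k" and order: "dimension_order K V r"
begin

abbreviation "F \<equiv> wedge_system K V k"
abbreviation "\<mu> \<equiv> wedge_map K V k"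

lemma fin_dim_V: "vectorspace.fin_dim K V"
  by (rule vectorspace.fin_dim_of_finite[OF vs finite_V])

sublocale L: local_system X K F \<mu>
  by (rule wedge_local_system[OF vs finite_scalars fin_dim_V])

text \<open>Simplicial degree \<open>p\<close> becomes \<open>p + 1\<close> members. At flags with
  the zero subspace, which come from no simplex, the value is zero; by \<open>zspace_chain\<close>
  every chain of the model vanishes there.\<close>

definition transport :: "int \<Rightarrow> ('v set set \<Rightarrow> ('v list \<Rightarrow> 'k) set) \<Rightarrow> (nat \<Rightarrow> 'k) set set \<Rightarrow> bool list \<Rightarrow> 'k" where
  "transport p c = (\<lambda>\<rho>. if \<rho> \<in> zflags \<and> int (card \<rho>) = p + 1 then cev (c (preimg \<rho>)) else (\<lambda>_. \<zero>))"

lemma F_bij: "\<sigma> \<in> X \<Longrightarrow> bij_betw cev (carrier (F \<sigma>)) (ext_power n (int k) (fbot n (img \<sigma>)))"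
  unfolding wedge_system_def using class_eval_bij[OF bottom_submodule] fbot_img by simp

lemma F_coordinates: "\<sigma> \<in> X \<Longrightarrow> coordinates K (V\<lparr>carrier := flag_bottom V \<sigma>\<rparr>) n \<phi>"
  by (rule sub_coordinates[OF bottom_submodule])

text \<open>This is where $k \<ge> 1$ enters: the binomial coefficient of 0 over $k$ vanishes, so
  admitting the zero subspace in flags adds no chains.\<close>

lemma zspace_power: "ext_power n (int k) zspace = {\<lambda>_. \<zero>}"
proof -
  have z: "zspace \<in> subsp n" by (simp add: subsp_def zspace_def)
  have "card zspace = card (carrier K) ^ 0" by (simp add: zspace_def)
  from card_ext_power[OF z this, of k] have "card (ext_power n (int k) zspace) = 1" using k by (cases k) simp_all
  then obtain w where "ext_power n (int k) zspace = {w}" by (rule card_1_singletonE)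
  then show ?thesis using ext_power.zero[of n "int k" zspace] by auto
qed

lemma zspace_chain:
  assumes e: "e \<in> flag_chains n (int k) j" and r: "\<rho> \<in> flags n" and z: "zspace \<in> \<rho>"
  shows "e \<rho> = (\<lambda>_. \<zero>)"
proof -
  have "fbot n \<rho> \<subseteq> zspace" using z by (auto simp: fbot_def)
  then have "e \<rho> \<in> ext_power n (int k) zspace" using chains_mem[OF e r] ext_power_mono by blast
  then show ?thesis by (simp add: zspace_power)
qed

lemma simplex_img: "\<sigma> \<in> simplices X p \<Longrightarrow> img \<sigma> \<in> zflags \<and> int (card (img \<sigma>)) = p + 1"
  using img_zflags card_img by (simp add: simplices_def)

lemma preimg_simplex: "\<rho> \<in> zflags \<Longrightarrow> int (card \<rho>) = p + 1 \<Longrightarrow> preimg \<rho> \<in> simplices X p"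
  using preimg_X[of \<rho>] card_img[of "preimg \<rho>"] img_preimg[of \<rho>] by (simp add: simplices_def)

lemma chain_val: "c \<in> carrier (chain_module X F p) \<Longrightarrow> \<sigma> \<in> simplices X p \<Longrightarrow> c \<sigma> \<in> carrier (F \<sigma>)"
  by (auto simp: L.chain_module_simps)

lemma transport_img: "\<sigma> \<in> simplices X p \<Longrightarrow> transport p c (img \<sigma>) = cev (c \<sigma>)"
  using simplex_img[of \<sigma> p] preimg_img[of \<sigma>] by (simp add: transport_def simplices_def)

lemma transport_bij:
  "bij_betw (transport p) (carrier (chain_module X F p)) (flag_chains n (int k) (p + 1))"
  unfolding bij_betw_def
proof (intro conjI equalityI)
  show "inj_on (transport p) (carrier (chain_module X F p))"
  proof (rule inj_onI)
    fix c d assume c: "c \<in> carrier (chain_module X F p)" and d: "d \<in> carrier (chain_module X F p)"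
      and eq: "transport p c = transport p d"
    show "c = d"
    proof (rule PiE_ext[OF c[unfolded L.chain_module_simps] d[unfolded L.chain_module_simps]])
      fix \<sigma> assume s: "\<sigma> \<in> simplices X p"
      have "cev (c \<sigma>) = cev (d \<sigma>)" using fun_cong[OF eq, of "img \<sigma>"] transport_img[OF s] by simp
      then show "c \<sigma> = d \<sigma>"
        using inj_onD[OF bij_betw_imp_inj_on[OF F_bij[OF L.simplices_X[OF s]]]] chain_val[OF c s] chain_val[OF d s] by blast
    qed
  qed
  show "transport p ` carrier (chain_module X F p) \<subseteq> flag_chains n (int k) (p + 1)"
  proof (rule image_subsetI)
    fix c assume c: "c \<in> carrier (chain_module X F p)"
    show "transport p c \<in> flag_chains n (int k) (p + 1)" unfolding flag_chains_def
    proof (rule ffunI)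
      fix \<rho> assume r: "\<rho> \<in> {\<sigma> \<in> flags n. int (card \<sigma>) = p + 1}"
      show "transport p c \<rho> \<in> ext_power n (int k) (fbot n \<rho>)"
      proof (cases "\<rho> \<in> zflags")
        case True
        then have s: "preimg \<rho> \<in> simplices X p" using preimg_simplex r by simp
        have "cev (c (preimg \<rho>)) \<in> ext_power n (int k) (fbot n (img (preimg \<rho>)))"
          using bij_betwE[OF F_bij[OF L.simplices_X[OF s]]] chain_val[OF c s] by blast
        then show ?thesis using True r img_preimg[OF True] by (simp add: transport_def)
      qed (simp add: transport_def ext_power.zero)
    next
      fix \<rho> assume "\<rho> \<notin> {\<sigma> \<in> flags n. int (card \<sigma>) = p + 1}"
      then show "transport p c \<rho> = (\<lambda>_. \<zero>)" by (auto simp: transport_def zflags_def)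
    qed
  qed
  show "flag_chains n (int k) (p + 1) \<subseteq> transport p ` carrier (chain_module X F p)"
  proof
    fix e assume e: "e \<in> flag_chains n (int k) (p + 1)"
    define c where "c = (\<lambda>\<sigma>\<in>simplices X p. inv_into (carrier (F \<sigma>)) cev (e (img \<sigma>)))"
    have inv: "inv_into (carrier (F \<sigma>)) cev (e (img \<sigma>)) \<in> carrier (F \<sigma>)"
      "cev (inv_into (carrier (F \<sigma>)) cev (e (img \<sigma>))) = e (img \<sigma>)" if s: "\<sigma> \<in> simplices X p" for \<sigma>
    proof -
      have "img \<sigma> \<in> flags n" using simplex_img[OF s] by (simp add: zflags_def)
      then have "e (img \<sigma>) \<in> cev ` carrier (F \<sigma>)"
        using chains_mem[OF e] bij_betw_imp_surj_on[OF F_bij[OF L.simplices_X[OF s]]] by simp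
      then show "inv_into (carrier (F \<sigma>)) cev (e (img \<sigma>)) \<in> carrier (F \<sigma>)"
        "cev (inv_into (carrier (F \<sigma>)) cev (e (img \<sigma>))) = e (img \<sigma>)"
        by (rule inv_into_into, rule f_inv_into_f)
    qed
    have c: "c \<in> carrier (chain_module X F p)" using inv(1) by (simp add: c_def L.chain_module_simps)
    have "transport p c \<rho> = e \<rho>" for \<rho>
    proof (cases "\<rho> \<in> zflags \<and> int (card \<rho>) = p + 1")
      case True
      then have s: "preimg \<rho> \<in> simplices X p" using preimg_simplex by simp
      then show ?thesis using True inv(2)[OF s] img_preimg[of \<rho>] by (simp add: transport_def c_def)
    next
      case False
      have "e \<rho> = (\<lambda>_. \<zero>)"
      proof (cases "\<rho> \<in> flags n \<and> int (card \<rho>) = p + 1")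
        case True
        then show ?thesis using False zspace_chain[OF e] by (simp add: zflags_def)
      next
        case False
        then show ?thesis using ffun_out[OF e[unfolded flag_chains_def], of \<rho>] by simp
      qed
      then show ?thesis using False by (simp only: transport_def if_False)
    qed
    then have "e = transport p c" by auto
    then show "e \<in> transport p ` carrier (chain_module X F p)" using c by blast
  qed
qed

lemma dim_less:
  assumes U: "U \<in> proper_subspaces K V" and W: "W \<in> proper_subspaces K V" and UW: "U \<subset> W"
  shows "vectorspace.dim K (V\<lparr>carrier := U\<rparr>) < vectorspace.dim K (V\<lparr>carrier := W\<rparr>)"
proof -
  have card: "card A = card (carrier K) ^ vectorspace.dim K (V\<lparr>carrier := A\<rparr>)"
    if A: "A \<in> proper_subspaces K V" for A
  proof -
    interpret A: vectorspace K "V\<lparr>carrier := A\<rparr>"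
      by (rule vectorspace_of_module[OF field_axioms sub_module[OF psp_submodule[OF A]]])
    have "finite A" using finite_subset[OF psp_sub[OF A] finite_V] .
    then show ?thesis using A.card_carrier_dim[OF finite_scalars A.fin_dim_of_finite] by simp
  qed
  have "card U < card W"
    using psubset_card_mono[OF finite_subset[OF psp_sub[OF W] finite_V] UW] .
  then show ?thesis using card[OF U] card[OF W] card_scalars by simp
qed

text \<open>A flag is totally ordered by inclusion, and strict inclusion raises the dimension, so
  \<open>r\<close> restricts to inclusion. The index counts \<open>s\<close> itself, hence the
  successor.\<close>

lemma vertex_index_flag:
  assumes i: "insert s \<tau> \<in> X" and s: "s \<notin> \<tau>"
  shows "vertex_index r (insert s \<tau>) s = Suc (card {t \<in> \<tau>. t \<subset> s})"
proof -
  let ?P = "proper_subspaces K V"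
  have sP: "s \<in> ?P" and tP: "\<And>t. t \<in> \<tau> \<Longrightarrow> t \<in> ?P" using simplex_psp[OF i] by auto
  have lin: "linear_order_on ?P r" and dim: "\<And>U U'. U \<in> ?P \<Longrightarrow> U' \<in> ?P \<Longrightarrow>
      vectorspace.dim K (V\<lparr>carrier := U\<rparr>) < vectorspace.dim K (V\<lparr>carrier := U'\<rparr>) \<Longrightarrow> (U, U') \<in> r"
    using order unfolding dimension_order_def by blast+
  have refl: "refl_on ?P r" and anti: "antisym r"
    using lin by (auto simp: linear_order_on_def partial_order_on_def preorder_on_def)
  have ss: "(s, s) \<in> r" using refl_onD[OF refl sP] .
  have iff: "(t, s) \<in> r \<longleftrightarrow> t \<subset> s" if t: "t \<in> \<tau>" for t
  proof
    assume ts: "(t, s) \<in> r"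
    have ne: "t \<noteq> s" using t s by blast
    have "t \<subseteq> s \<or> s \<subseteq> t" using i t by (simp add: flag_complex_def chain_subset_def)
    moreover have "\<not> s \<subset> t"
    proof
      assume "s \<subset> t"
      then have "(s, t) \<in> r" using dim[OF sP tP[OF t] dim_less[OF sP tP[OF t]]] by blast
      then show False using antisymD[OF anti ts] ne by blast
    qed
    ultimately show "t \<subset> s" using ne by blast
  next
    assume "t \<subset> s"
    then show "(t, s) \<in> r" using dim[OF tP[OF t] sP dim_less[OF tP[OF t] sP]] by blast
  qed
  have "{t \<in> insert s \<tau>. (t, s) \<in> r} = insert s {t \<in> \<tau>. t \<subset> s}" using iff ss by blast
  moreover have "finite \<tau>" using L.finite_simplex[OF i] by simp
  ultimately show ?thesis using s by (simp add: vertex_index_def)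
qed

text \<open>The index exceeds the number of members below \<open>s\<close> by one, and the exponent
  adds one more, so the parity is that used in \<open>sg\<close>.\<close>

lemma sg_img:
  assumes i: "insert s \<tau> \<in> X" and s: "s \<notin> \<tau>"
  shows "sg (img \<tau>) (\<phi> ` s) x = (if even (vertex_index r (insert s \<tau>) s + 1) then x else \<ominus> x)"
proof -
  have sV: "s \<subseteq> carrier V" and tV: "\<And>t. t \<in> \<tau> \<Longrightarrow> t \<subseteq> carrier V" using psp_sub simplex_psp[OF i] by auto
  have iff: "\<phi> ` t \<subset> \<phi> ` s \<longleftrightarrow> t \<subset> s" if "t \<in> \<tau>" for t
    using image_subset_iff_V[OF tV[OF that] sV] image_subset_iff_V[OF sV tV[OF that]]
    by (simp add: less_le_not_le)
  have "{t \<in> img \<tau>. t \<subset> \<phi> ` s} = (`) \<phi> ` {t \<in> \<tau>. \<phi> ` t \<subset> \<phi> ` s}" unfolding img_def by (rule Compr_image_eq)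
  also have "{t \<in> \<tau>. \<phi> ` t \<subset> \<phi> ` s} = {t \<in> \<tau>. t \<subset> s}" using iff by (intro Collect_cong conj_cong refl) (simp only:)
  finally have "card {t \<in> img \<tau>. t \<subset> \<phi> ` s} = card ((`) \<phi> ` {t \<in> \<tau>. t \<subset> s})" by simp
  also have "\<dots> = card {t \<in> \<tau>. t \<subset> s}"
  proof (rule card_image[OF inj_on_subset[OF inj_on_image_V]])
    show "{t \<in> \<tau>. t \<subset> s} \<subseteq> Pow (carrier V)" by (rule subsetI, rule PowI, rule tV) simp
  qed
  finally show ?thesis by (simp add: sg_def vertex_index_flag[OF assms])
qed

lemma cofaces_img:
  assumes t: "\<tau> \<in> X"
  shows "(`) \<phi> ` L.link \<tau> = cofaces n (img \<tau>) - {zspace}"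
proof (intro equalityI subsetI)
  fix u assume "u \<in> (`) \<phi> ` L.link \<tau>"
  then obtain s where s: "s \<notin> \<tau>" "insert s \<tau> \<in> X" "u = \<phi> ` s" by (auto simp: L.link_def)
  have z: "img (insert s \<tau>) \<in> zflags" using img_zflags[OF s(2)] .
  have im: "img (insert s \<tau>) = insert u (img \<tau>)" using s(3) by (simp add: img_def)
  have "card (insert u (img \<tau>)) = Suc (card \<tau>)"
    using card_img[OF s(2)] im s(1) L.finite_simplex[OF t] by simp
  then have "u \<notin> img \<tau>" using card_img[OF t] by (metis insert_absorb n_not_Suc_n)
  then show "u \<in> cofaces n (img \<tau>) - {zspace}" using z im by (auto simp: zflags_def cofaces_def)
next
  fix u assume "u \<in> cofaces n (img \<tau>) - {zspace}"
  then have u: "u \<notin> img \<tau>" "insert u (img \<tau>) \<in> flags n" "u \<noteq> zspace" by (auto simp: cofaces_def)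
  have z: "insert u (img \<tau>) \<in> zflags" using u img_zflags[OF t] by (auto simp: zflags_def)
  have im: "\<phi> ` pre u = u" using image_pre flag_vecs[OF u(2) insertI1] by blast
  have "preimg (insert u (img \<tau>)) = insert (pre u) \<tau>" using preimg_img[OF t] by (simp add: preimg_def)
  then have "insert (pre u) \<tau> \<in> X" using preimg_X[OF z] by simp
  moreover have "pre u \<notin> \<tau>" using u(1) im by (auto simp: img_def)
  ultimately show "u \<in> (`) \<phi> ` L.link \<tau>" using im by (intro image_eqI[of _ _ "pre u"]) (simp_all add: L.link_def)
qed

text \<open>The sums agree term by term: cofaces correspond by \<open>cofaces_img\<close>, up to the
  zero subspace, where chains vanish; signs correspond by \<open>sg_img\<close>; and connecting maps
  become inclusions by \<open>class_eval_inclusion\<close>.\<close>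

lemma transport_boundary:
  assumes c: "c \<in> carrier (chain_module X F p)"
  shows "transport (p - 1) (boundary r X F \<mu> p c) = bd n (transport p c)"
proof (intro HOL.ext)
  fix \<rho> l
  note T = bij_betwE[OF transport_bij, rule_format, OF c]
  have Tv: "transport p c \<sigma> l \<in> carrier K" for \<sigma> l using chains_val[OF T] .
  show "transport (p - 1) (boundary r X F \<mu> p c) \<rho> l = bd n (transport p c) \<rho> l"
  proof (cases "\<rho> \<in> zflags \<and> int (card \<rho>) = p - 1 + 1")
    case False
    have "bd n (transport p c) \<rho> = (\<lambda>_. \<zero>)"
    proof (cases "\<rho> \<in> flags n \<and> int (card \<rho>) = p")
      case True
      then have "zspace \<in> \<rho>" using False by (simp add: zflags_def)
      then show ?thesis using zspace_chain[OF bd_mem[OF T]] True by simp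
    next
      case False
      then show ?thesis using ffun_out[OF bd_mem[OF T, unfolded flag_chains_def], of \<rho>] by simp
    qed
    then show ?thesis using False by (simp only: transport_def if_False)
  next
    case True
    define \<tau> where "\<tau> = preimg \<rho>"
    have t: "\<tau> \<in> simplices X (p - 1)" and tX: "\<tau> \<in> X" and im: "img \<tau> = \<rho>"
      using preimg_simplex[of \<rho> "p - 1"] preimg_X[of \<rho>] img_preimg[of \<rho>] True by (simp_all add: \<tau>_def)
    interpret T: coordinates K "V\<lparr>carrier := flag_bottom V \<tau>\<rparr>" n \<phi> by (rule F_coordinates[OF tX])
    have Ft: "F \<tau> = exterior_power K k (V\<lparr>carrier := flag_bottom V \<tau>\<rparr>)" by (simp add: wedge_system_def)
    have "transport (p - 1) (boundary r X F \<mu> p c) \<rho> l = cev (finsum (F \<tau>) (L.face_term r c \<tau>) (L.link \<tau>)) l"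
      using transport_img[OF t, of "boundary r X F \<mu> p c"] im t by (simp add: L.boundary_link[OF c])
    also have "\<dots> = (\<Oplus>s\<in>L.link \<tau>. cev (L.face_term r c \<tau> s) l)"
      unfolding Ft using L.face_term_mem[OF c t] by (intro T.cev_finsum L.finite_link) (simp add: Ft)
    also have "\<dots> = (\<Oplus>s\<in>L.link \<tau>. sg \<rho> (\<phi> ` s) (transport p c (insert (\<phi> ` s) \<rho>) l))"
    proof (rule R.finsum_cong'[OF refl])
      show "(\<lambda>s. sg \<rho> (\<phi> ` s) (transport p c (insert (\<phi> ` s) \<rho>) l)) \<in> L.link \<tau> \<rightarrow> carrier K" using Tv by simp
      fix s assume s: "s \<in> L.link \<tau>"
      then have i: "insert s \<tau> \<in> X" "s \<notin> \<tau>" by (simp_all add: L.link_def)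
      note i_simp = L.link_simplex[OF t s]
      let ?x = "\<mu> \<tau> (insert s \<tau>) (c (insert s \<tau>))"
      have "cev ?x = cev (c (insert s \<tau>))"
        unfolding wedge_map_def
        using class_eval_inclusion[OF bottom_submodule[OF i(1)] bottom_submodule[OF tX]
            flag_bottom_antimono[OF vs i(1) subset_insertI]] L.rho_mem(1)[OF c t s]
        by (simp add: wedge_system_def)
      also have "\<dots> = transport p c (img (insert s \<tau>))" using transport_img[OF i_simp] by simp
      also have "img (insert s \<tau>) = insert (\<phi> ` s) \<rho>" using im by (simp add: img_def)
      finally have x: "cev ?x = transport p c (insert (\<phi> ` s) \<rho>)" .
      have "cev (\<ominus>\<^bsub>F \<tau>\<^esub> ?x) = (\<lambda>l. \<ominus> cev ?x l)"
        unfolding Ft using L.rho_mem(2)[OF c t s] by (intro T.cev_minus) (simp add: Ft)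
      then show "cev (L.face_term r c \<tau> s) l = sg \<rho> (\<phi> ` s) (transport p c (insert (\<phi> ` s) \<rho>) l)"
        using x sg_img[OF i, of "cev ?x l"] im by (simp add: L.face_term_def)
    qed
    also have "\<dots> = (\<Oplus>u\<in>(`) \<phi> ` L.link \<tau>. sg \<rho> u (transport p c (insert u \<rho>) l))"
    proof (rule R.finsum_reindex[symmetric])
      show "(\<lambda>u. sg \<rho> u (transport p c (insert u \<rho>) l)) \<in> (`) \<phi> ` L.link \<tau> \<rightarrow> carrier K" using Tv by simp
      show "inj_on ((`) \<phi>) (L.link \<tau>)"
      proof (rule inj_on_subset[OF inj_on_image_V])
        show "L.link \<tau> \<subseteq> Pow (carrier V)" using psp_sub simplex_psp by (auto simp: L.link_def)
      qed
    qed
    also have "\<dots> = (\<Oplus>u\<in>cofaces n \<rho>. sg \<rho> u (transport p c (insert u \<rho>) l))"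
      unfolding cofaces_img[OF tX] im
    proof (rule R.finsum_mono_neutral[OF finite_cofaces Diff_subset])
      show "(\<lambda>u. sg \<rho> u (transport p c (insert u \<rho>) l)) \<in> cofaces n \<rho> - {zspace} \<rightarrow> carrier K" using Tv by simp
      fix u assume "u \<in> cofaces n \<rho> - (cofaces n \<rho> - {zspace})"
      then have "insert u \<rho> \<in> flags n" "zspace \<in> insert u \<rho>" by (auto simp: cofaces_def)
      then show "sg \<rho> u (transport p c (insert u \<rho>) l) = \<zero>" using zspace_chain[OF T] by simp
    qed
    finally show ?thesis by (simp add: bd_def)
  qed
qed

lemma transport_zero: "transport p \<zero>\<^bsub>chain_module X F p\<^esub> = (\<lambda>_ _. \<zero>)"
proof
  fix \<rho>
  show "transport p \<zero>\<^bsub>chain_module X F p\<^esub> \<rho> = (\<lambda>_. \<zero>)"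
  proof (cases "\<rho> \<in> zflags \<and> int (card \<rho>) = p + 1")
    case True
    then have s: "preimg \<rho> \<in> simplices X p" using preimg_simplex by simp
    interpret T: coordinates K "V\<lparr>carrier := flag_bottom V (preimg \<rho>)\<rparr>" n \<phi>
      by (rule F_coordinates[OF L.simplices_X[OF s]])
    show ?thesis using True s T.cev_zero[of k] by (simp add: transport_def L.chain_module_simps wedge_system_def)
  qed (simp only: transport_def if_False)
qed

lemma cycles_transport:
  assumes c: "c \<in> carrier (chain_module X F p)"
  shows "c \<in> cycles r X F \<mu> p \<longleftrightarrow> transport p c \<in> flag_cycles n (int k) (p + 1)"
proof -
  have z: "\<zero>\<^bsub>chain_module X F (p - 1)\<^esub> \<in> carrier (chain_module X F (p - 1))"
  proof -
    interpret C: Module.module K "chain_module X F (p - 1)" by (rule L.chain_module_module)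
    show ?thesis by simp
  qed
  have b: "boundary r X F \<mu> p c \<in> carrier (chain_module X F (p - 1))"
    using LinearCombinations.module_hom_closed[OF L.boundary_hom] c by blast
  have "c \<in> cycles r X F \<mu> p \<longleftrightarrow> boundary r X F \<mu> p c = \<zero>\<^bsub>chain_module X F (p - 1)\<^esub>"
    using c by (simp add: cycles_def)
  also have "\<dots> \<longleftrightarrow> transport (p - 1) (boundary r X F \<mu> p c) = transport (p - 1) \<zero>\<^bsub>chain_module X F (p - 1)\<^esub>"
    using inj_on_eq_iff[OF bij_betw_imp_inj_on[OF transport_bij] b z] by simp
  also have "\<dots> \<longleftrightarrow> bd n (transport p c) = (\<lambda>_ _. \<zero>)"
    by (simp add: transport_boundary[OF c] transport_zero)
  also have "\<dots> \<longleftrightarrow> transport p c \<in> flag_cycles n (int k) (p + 1)"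
    using bij_betwE[OF transport_bij] c by (simp add: flag_cycles_def)
  finally show ?thesis .
qed

lemma card_cycles: "card (cycles r X F \<mu> p) = card (flag_cycles n (int k) (p + 1))"
proof -
  have sub: "cycles r X F \<mu> p \<subseteq> carrier (chain_module X F p)" by (auto simp: cycles_def)
  have "transport p ` cycles r X F \<mu> p = flag_cycles n (int k) (p + 1)"
  proof (intro equalityI subsetI)
    fix e assume e: "e \<in> flag_cycles n (int k) (p + 1)"
    then have "e \<in> flag_chains n (int k) (p + 1)" by (simp add: flag_cycles_def)
    then obtain c where c: "c \<in> carrier (chain_module X F p)" "e = transport p c"
      using bij_betw_imp_surj_on[OF transport_bij, of p] by blast
    then show "e \<in> transport p ` cycles r X F \<mu> p" using cycles_transport[OF c(1)] e by blast
  next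
    fix e assume "e \<in> transport p ` cycles r X F \<mu> p"
    then obtain c where "c \<in> cycles r X F \<mu> p" "e = transport p c" by blast
    then show "e \<in> flag_cycles n (int k) (p + 1)" using cycles_transport sub by blast
  qed
  then show ?thesis using card_image[OF inj_on_subset[OF bij_betw_imp_inj_on[OF transport_bij] sub]] by simp
qed

lemma boundaries_image:
  "transport p ` boundaries r X F \<mu> p = bd n ` flag_chains n (int k) (p + 1 + 1)"
proof -
  have "transport p (boundary r X F \<mu> (p + 1) c) = bd n (transport (p + 1) c)"
    if "c \<in> carrier (chain_module X F (p + 1))" for c
    using transport_boundary[OF that] by simp
  then have "transport p ` boundaries r X F \<mu> p = bd n ` transport (p + 1) ` carrier (chain_module X F (p + 1))"
    unfolding boundaries_def image_image by (rule image_cong[OF refl])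
  then show ?thesis using bij_betw_imp_surj_on[OF transport_bij, of "p + 1"] by simp
qed

lemma boundaries_sub: "boundaries r X F \<mu> p \<subseteq> cycles r X F \<mu> p"
proof
  fix b assume b: "b \<in> boundaries r X F \<mu> p"
  then have bC: "b \<in> carrier (chain_module X F p)"
    using submodule.subset[OF L.boundaries_submodule] by blast
  obtain e where e: "e \<in> flag_chains n (int k) (p + 1 + 1)" "transport p b = bd n e"
    using boundaries_image[of p] b by blast
  have "bd n e \<in> flag_cycles n (int k) (p + 1)"
    using bd_mem[OF e(1)] bd_bd[OF e(1)] by (simp add: flag_cycles_def add.commute)
  then show "b \<in> cycles r X F \<mu> p" using cycles_transport[OF bC] e(2) by simp
qed

lemma card_boundaries: "card (boundaries r X F \<mu> p) = card (bd n ` flag_chains n (int k) (p + 1 + 1))"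
proof -
  have "boundaries r X F \<mu> p \<subseteq> carrier (chain_module X F p)"
    by (rule submodule.subset[OF L.boundaries_submodule])
  then show ?thesis
    using card_image[OF inj_on_subset[OF bij_betw_imp_inj_on[OF transport_bij]]] boundaries_image[of p] by metis
qed

text \<open>Simplices of dimension \<open>p\<close> have $p + 1 = n - k$ vertices, which is the
  critical degree in \<open>card_flag_cycles\<close>. The size of the homology is the quotient of
  the sizes of cycles and boundaries, and its exponent as a power of $q$ is the dimension.\<close>

theorem dim_homology:
  assumes p: "p = int n - int k - 1"
  shows "vectorspace.dim K (reduced_homology r X F \<mu> p) = crit n (int k)"
proof -
  let ?B = "boundaries r X F \<mu> p" and ?Z = "cycles r X F \<mu> p"
  let ?M = "(chain_module X F p)\<lparr>carrier := ?Z\<rparr>"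
  have sub: "submodule K ?B ?M"
    by (rule submodule_restrict[OF L.boundaries_submodule L.cycles_submodule boundaries_sub])
  have fC: "finite (carrier (chain_module X F p))"
    using bij_betw_finite[OF transport_bij[of p]] finite_chains by simp
  have ZC: "?Z \<subseteq> carrier (chain_module X F p)" by (auto simp: cycles_def)
  have fZ: "finite ?Z" by (rule finite_subset[OF ZC fC])
  have "card (carrier (reduced_homology r X F \<mu> p)) * card ?B = card ?Z"
    using card_quotient_module[OF sub] fZ by (simp add: reduced_homology_def)
  also have "card ?Z = card ?B * card (carrier K) ^ crit n (int k)"
    using card_flag_cycles[of "p + 1" n "int k"] p by (simp add: card_cycles card_boundaries)
  finally have card: "card (carrier (reduced_homology r X F \<mu> p)) * card ?B = card (carrier K) ^ crit n (int k) * card ?B"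
    by (simp add: mult.commute)
  have "card ?B > 0"
    using finite_subset[OF boundaries_sub fZ] submodule.zero_closed[OF L.boundaries_submodule] card_gt_0_iff by blast
  then have "card (carrier (reduced_homology r X F \<mu> p)) = card (carrier K) ^ crit n (int k)" using card by simp
  moreover have "Module.module K (reduced_homology r X F \<mu> p)"
    unfolding reduced_homology_def by (rule quotient_module_module[OF sub])
  moreover have "finite (carrier (reduced_homology r X F \<mu> p))"
    using fZ by (simp add: reduced_homology_def quotient_carrier)
  ultimately show ?thesis by (intro dim_eq_of_card[OF field_axioms finite_scalars])
qed

end

section \<open>Elementary symmetric sums\<close>

definition increasing_maps :: "nat \<Rightarrow> nat \<Rightarrow> (nat \<Rightarrow> nat) set" where
  "increasing_maps m N = {\<alpha> \<in> {1..m} \<rightarrow>\<^sub>E {1..N}. strict_mono_on {1..m} \<alpha>}"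

text \<open>The elementary symmetric polynomial of degree \<open>m\<close> in the \<open>N\<close>
  values $q - 1, ..., q^N - 1$, over the integers so that the differences are not truncated.\<close>

definition esum :: "int \<Rightarrow> nat \<Rightarrow> nat \<Rightarrow> int" where
  "esum q m N = (\<Sum>\<alpha>\<in>increasing_maps m N. \<Prod>j = 1..m. (q ^ \<alpha> j - 1))"

lemma finite_increasing_maps: "finite (increasing_maps m N)"
  using finite_PiE[of "{1..m}" "\<lambda>_. {1..N}"] by (simp add: increasing_maps_def)

lemma increasing_mapsD:
  assumes "\<alpha> \<in> increasing_maps m N"
  shows "\<alpha> \<in> {1..m} \<rightarrow>\<^sub>E {1..N}" "1 \<le> i \<Longrightarrow> i < j \<Longrightarrow> j \<le> m \<Longrightarrow> \<alpha> i < \<alpha> j"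
  using assms by (auto simp: increasing_maps_def strict_mono_on_def)

lemma increasing_mapsI:
  assumes "\<And>i. 1 \<le> i \<Longrightarrow> i \<le> m \<Longrightarrow> 1 \<le> \<alpha> i \<and> \<alpha> i \<le> N" "\<And>i. \<not> (1 \<le> i \<and> i \<le> m) \<Longrightarrow> \<alpha> i = undefined"
    "\<And>i j. 1 \<le> i \<Longrightarrow> i < j \<Longrightarrow> j \<le> m \<Longrightarrow> \<alpha> i < \<alpha> j"
  shows "\<alpha> \<in> increasing_maps m N"
proof -
  have "\<alpha> \<in> {1..m} \<rightarrow>\<^sub>E {1..N}" by (rule PiE_I) (use assms in auto)
  moreover have "strict_mono_on {1..m} \<alpha>" using assms(3) by (auto simp: strict_mono_on_def)
  ultimately show ?thesis by (simp add: increasing_maps_def)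
qed

lemma increasing_maps_val: "\<alpha> \<in> increasing_maps m N \<Longrightarrow> 1 \<le> i \<Longrightarrow> i \<le> m \<Longrightarrow> 1 \<le> \<alpha> i \<and> \<alpha> i \<le> N"
  using PiE_mem[OF increasing_mapsD(1), of \<alpha> m N i] by simp

lemma increasing_maps_undef: "\<alpha> \<in> increasing_maps m N \<Longrightarrow> \<not> (1 \<le> i \<and> i \<le> m) \<Longrightarrow> \<alpha> i = undefined"
  using PiE_arb[OF increasing_mapsD(1), of \<alpha> m N i] by simp

text \<open>The value \<open>Suc N\<close> is either not attained, or attained at the last argument,
  which can then be removed.\<close>

lemma increasing_maps_Suc:
  "increasing_maps (Suc m) (Suc N) =
    increasing_maps (Suc m) N \<union> (\<lambda>\<beta>. \<beta>(Suc m := Suc N)) ` increasing_maps m N"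
proof (intro equalityI subsetI)
  fix \<alpha> assume a: "\<alpha> \<in> increasing_maps (Suc m) (Suc N)"
  note v = increasing_maps_val[OF a] and u = increasing_maps_undef[OF a] and s = increasing_mapsD(2)[OF a]
  show "\<alpha> \<in> increasing_maps (Suc m) N \<union> (\<lambda>\<beta>. \<beta>(Suc m := Suc N)) ` increasing_maps m N"
  proof (cases "\<alpha> (Suc m) = Suc N")
    case True
    \<comment> \<open>The value \<open>undefined\<close> makes the map extensional on the smaller
      domain.\<close>
    let ?\<beta> = "\<alpha>(Suc m := undefined)"
    have "?\<beta> \<in> increasing_maps m N"
    proof (rule increasing_mapsI)
      fix i assume i: "1 \<le> i" "i \<le> m"
      then show "1 \<le> ?\<beta> i \<and> ?\<beta> i \<le> N" using v[of i] s[of i "Suc m"] True by simp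
    next
      fix i assume "\<not> (1 \<le> i \<and> i \<le> m)"
      then show "?\<beta> i = undefined" using u[of i] by (cases "i = Suc m") auto
    next
      fix i j assume "1 \<le> i" "i < j" "j \<le> m"
      then show "?\<beta> i < ?\<beta> j" using s[of i j] by simp
    qed
    moreover have "\<alpha> = ?\<beta>(Suc m := Suc N)" using True by auto
    ultimately show ?thesis by blast
  next
    case False
    have "\<alpha> \<in> increasing_maps (Suc m) N"
    proof (rule increasing_mapsI)
      fix i assume i: "1 \<le> i" "i \<le> Suc m"
      then have "\<alpha> i \<le> \<alpha> (Suc m)" using s[of i "Suc m"] by (cases "i = Suc m") auto
      then show "1 \<le> \<alpha> i \<and> \<alpha> i \<le> N" using v[of i] v[of "Suc m"] i False by simp
    qed (use u s in auto)
    then show ?thesis by simp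
  qed
next
  fix \<alpha> assume "\<alpha> \<in> increasing_maps (Suc m) N \<union> (\<lambda>\<beta>. \<beta>(Suc m := Suc N)) ` increasing_maps m N"
  then consider "\<alpha> \<in> increasing_maps (Suc m) N" | \<beta> where "\<beta> \<in> increasing_maps m N" "\<alpha> = \<beta>(Suc m := Suc N)" by blast
  then show "\<alpha> \<in> increasing_maps (Suc m) (Suc N)"
  proof cases
    case 1
    show ?thesis
    proof (rule increasing_mapsI)
      fix i assume "1 \<le> i" "i \<le> Suc m"
      then show "1 \<le> \<alpha> i \<and> \<alpha> i \<le> Suc N" using increasing_maps_val[OF 1, of i] by simp
    qed (use increasing_maps_undef[OF 1] increasing_mapsD(2)[OF 1] in auto)
  next
    case 2
    note v = increasing_maps_val[OF 2(1)] and u = increasing_maps_undef[OF 2(1)] and s = increasing_mapsD(2)[OF 2(1)]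
    show ?thesis
    proof (rule increasing_mapsI)
      fix i assume "1 \<le> i" "i \<le> Suc m"
      then show "1 \<le> \<alpha> i \<and> \<alpha> i \<le> Suc N" using v[of i] 2(2) by (cases "i = Suc m") auto
    next
      fix i assume "\<not> (1 \<le> i \<and> i \<le> Suc m)"
      then show "\<alpha> i = undefined" using u[of i] 2(2) by auto
    next
      fix i j assume "1 \<le> i" "i < j" "j \<le> Suc m"
      then show "\<alpha> i < \<alpha> j" using s[of i j] v[of i] 2(2) by (cases "j = Suc m") auto
    qed
  qed
qed

lemma esum_0: "esum q 0 N = 1"
proof -
  have "increasing_maps 0 N = {\<lambda>_. undefined}"
    by (auto simp: increasing_maps_def strict_mono_on_def)
  then show ?thesis by (simp add: esum_def)
qed

lemma esum_Suc_0: "esum q (Suc m) 0 = 0"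
proof -
  have "increasing_maps (Suc m) 0 = {}"
  proof (rule equals0I)
    fix \<alpha> assume "\<alpha> \<in> increasing_maps (Suc m) 0"
    then show False using increasing_maps_val[of \<alpha> "Suc m" 0 1] by (metis One_nat_def le_add1 le_zero_eq not_one_le_zero plus_1_eq_Suc)
  qed
  then show ?thesis by (simp add: esum_def)
qed

lemma esum_Suc_Suc: "esum q (Suc m) (Suc N) = esum q (Suc m) N + (q ^ Suc N - 1) * esum q m N"
proof -
  let ?f = "\<lambda>\<alpha>. \<Prod>j = 1..Suc m. (q ^ \<alpha> j - 1)" and ?u = "\<lambda>\<beta> :: nat \<Rightarrow> nat. \<beta>(Suc m := Suc N)"
  have disj: "increasing_maps (Suc m) N \<inter> ?u ` increasing_maps m N = {}"
  proof (rule equals0I)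
    fix \<alpha> assume "\<alpha> \<in> increasing_maps (Suc m) N \<inter> ?u ` increasing_maps m N"
    then have "\<alpha> \<in> increasing_maps (Suc m) N" "\<alpha> (Suc m) = Suc N" by auto
    then show False using increasing_maps_val[of \<alpha> "Suc m" N "Suc m"] by simp
  qed
  have inj: "inj_on ?u (increasing_maps m N)"
  proof (rule inj_onI, rule HOL.ext)
    fix \<alpha> \<beta> i assume a: "\<alpha> \<in> increasing_maps m N" "\<beta> \<in> increasing_maps m N" "?u \<alpha> = ?u \<beta>"
    show "\<alpha> i = \<beta> i"
    proof (cases "i = Suc m")
      case True
      then show ?thesis using increasing_maps_undef[OF a(1), of i] increasing_maps_undef[OF a(2), of i] by simp
    next
      case False
      then show ?thesis using fun_cong[OF a(3), of i] by simp
    qed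
  qed
  have "esum q (Suc m) (Suc N) = sum ?f (increasing_maps (Suc m) N) + sum ?f (?u ` increasing_maps m N)"
    unfolding esum_def increasing_maps_Suc using finite_increasing_maps disj by (intro sum.union_disjoint) auto
  also have "sum ?f (?u ` increasing_maps m N) = (\<Sum>\<beta>\<in>increasing_maps m N. ?f (?u \<beta>))"
    using sum.reindex[OF inj, of ?f] by (simp add: o_def)
  also have "\<dots> = (\<Sum>\<beta>\<in>increasing_maps m N. (q ^ Suc N - 1) * (\<Prod>j = 1..m. (q ^ \<beta> j - 1)))"
  proof (rule sum.cong[OF refl])
    fix \<beta>
    have "(\<Prod>j = 1..m. (q ^ ?u \<beta> j - 1)) = (\<Prod>j = 1..m. (q ^ \<beta> j - 1))" by (rule prod.cong) auto
    then show "?f (?u \<beta>) = (q ^ Suc N - 1) * (\<Prod>j = 1..m. (q ^ \<beta> j - 1))"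
      by (simp add: prod.atLeast1_atMost_eq[symmetric] atLeastAtMostSuc_conv)
  qed
  also have "\<dots> = (q ^ Suc N - 1) * esum q m N" by (simp add: esum_def sum_distrib_left)
  finally show ?thesis by (simp add: esum_def)
qed

lemma esum_eq_0: "N < m \<Longrightarrow> esum q m N = 0"
proof (induction N arbitrary: m)
  case 0
  then obtain m' where "m = Suc m'" by (cases m) auto
  then show ?case by (simp add: esum_Suc_0)
next
  case (Suc N)
  then obtain m' where "m = Suc m'" by (cases m) auto
  then show ?case using Suc by (simp add: esum_Suc_Suc)
qed

context finite_field
begin

lemma crit_outside: "k < 0 \<or> int n < k \<Longrightarrow> crit n k = 0"
  by (induction n arbitrary: k) auto

text \<open>Separating the products that contain the last variable $q^n - 1$ from the elementary
  symmetric polynomial of degree $n + 1 - k$ gives the recursion of \<open>crit\<close>. The margins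
  are degree 0, a degree beyond the number of variables, and the initial step, where the factor $q^0
  - 1 = 0$ belongs to no variable and \<open>n - 1\<close> and \<open>Suc n - 1\<close> are both
  0.\<close>

lemma crit_esum:
  "0 \<le> k \<Longrightarrow> k \<le> int n \<Longrightarrow> int (crit n k) = esum (int (card (carrier K))) (nat (int n - k)) (n - 1)"
proof (induction n arbitrary: k)
  case 0
  then show ?case by (simp add: esum_0)
next
  case (Suc n)
  let ?q = "int (card (carrier K))"
  have "card (carrier K) > 0" using finite_scalars card_gt_0_iff by blast
  then have q: "int (card (carrier K) ^ n - 1) = ?q ^ n - 1" by (simp add: of_nat_diff)
  have rec: "int (crit (Suc n) k) = int (crit n (k - 1)) + (?q ^ n - 1) * int (crit n k)" using q by simp
  show ?case
  proof (cases n)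
    case n: 0
    then have "k = 0 \<or> k = 1" using Suc.prems by auto
    then show ?thesis using n by (auto simp: esum_0 esum_Suc_0)
  next
    case n: (Suc n')
    show ?thesis
    proof (cases "k = int (Suc n)")
      case True
      then have "crit n k = 0" by (intro crit_outside) simp
      then show ?thesis using rec Suc.IH[of "k - 1"] True by (simp add: esum_0)
    next
      case False
      then have kn: "k \<le> int n" using Suc.prems by simp
      then have m: "nat (int (Suc n) - k) = Suc (nat (int n - k))" by simp
      have A: "int (crit n (k - 1)) = esum ?q (Suc (nat (int n - k))) n'"
      proof (cases "k = 0")
        case True
        then have "crit n (k - 1) = 0" by (intro crit_outside) simp
        then show ?thesis using True n by (simp add: esum_eq_0)
      next
        case False
        then have "int (crit n (k - 1)) = esum ?q (nat (int n - (k - 1))) (n - 1)"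
          using Suc.IH[of "k - 1"] Suc.prems kn by simp
        moreover have "nat (int n - (k - 1)) = Suc (nat (int n - k))" using kn by simp
        ultimately show ?thesis using n by simp
      qed
      have B: "int (crit n k) = esum ?q (nat (int n - k)) n'" using Suc.IH[of k] Suc.prems kn n by simp
      have "int (crit (Suc n) k) = esum ?q (Suc (nat (int n - k))) n' + (?q ^ Suc n' - 1) * esum ?q (nat (int n - k)) n'"
        using rec A B n by simp
      also have "\<dots> = esum ?q (nat (int (Suc n) - k)) (Suc n - 1)"
        unfolding m using esum_Suc_Suc[of ?q "nat (int n - k)" n'] n by simp
      finally show ?thesis .
    qed
  qed
qed

end

theorem theorem1p5:
  fixes K :: "'k ring" and V :: "('k, 'v) module" and r :: "'v set rel" and q n k :: nat
  assumes "primepow q"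
    and "field K" and "finite (carrier K)" and "card (carrier K) = q"
    and "vectorspace K V" and "vectorspace.fin_dim K V" and "vectorspace.dim K V = n"
    and "dimension_order K V r"
    and "1 \<le> k" and "k \<le> n - 1"
  shows "int (vectorspace.dim K (D_space K V r k)) =
    (\<Sum>\<alpha> | \<alpha> \<in> {1..n - k} \<rightarrow>\<^sub>E {1..n - 1} \<and> strict_mono_on {1..n - k} \<alpha>.
       \<Prod>j = 1..n - k. (int q ^ \<alpha> j - 1))"
proof -
  interpret V: vectorspace K V by fact
  interpret E: finite_exterior K V
    by (intro finite_exterior.intro exterior_module.intro finite_field.intro finite_field_axioms.intro
        V.module_axioms assms(2,3))
  obtain n' \<phi> where phi: "card (carrier V) = card (carrier K) ^ n'" "coordinates K V n' \<phi>"
    "bij_betw \<phi> (carrier V) (E.vecs n')"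
    using E.exists_coordinates[OF finite_vectorspace[OF assms(5,3,6)]] .
  \<comment> \<open>The length of the coordinate vectors is the dimension, since both are exponents
    of the size of \<open>V\<close>.\<close>
  have "card (carrier K) ^ n = card (carrier K) ^ n'"
    using V.card_carrier_dim[OF assms(3,6)] phi(1) assms(7) by simp
  then have n: "n' = n" using E.card_scalars by simp
  interpret W: wedge_complex K V n \<phi> k r
    using phi(2,3) assms(8,9)
    by (intro wedge_complex.intro flag_coordinates.intro wedge_complex_axioms.intro flag_coordinates_axioms.intro)
      (simp_all add: n)
  have "vectorspace.dim K (D_space K V r k) = E.crit n (int k)"
    unfolding D_space_def assms(7) by (rule W.dim_homology) simp
  then have "int (vectorspace.dim K (D_space K V r k)) = esum (int q) (nat (int n - int k)) (n - 1)"
    using E.crit_esum[of "int k" n] assms(4,9,10) by simp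
  also have "nat (int n - int k) = n - k" by simp
  finally show ?thesis by (simp add: esum_def increasing_maps_def)
qed

end
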